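(* The category $\mathit{Omega\_Cat}$, in which an object is a small weak omega category and a morphism is an omega functor, is the category of models of an essentially algebraic theory. It is locally finitely presentable and hence complete and cocomplete.
   Context: A globular set $X$ is a sequence of sets $X_i$ ($i\ge 0$; elements are called $i$-cells) with functions $dom_{i-1}^i,cod_{i-1}^i:X_i\to X_{i-1}$ ($i>0$) satisfying $dom_{i-1}^i dom_i^{i+1}=dom_{i-1}^i cod_i^{i+1}$ and $cod_{i-1}^i dom_i^{i+1}=cod_{i-1}^i cod_i^{i+1}$. For $i<j$, $dom_i^j,cod_i^j:X_j\to X_i$ are the iterated composites. An omega graph is a globular set with functions $id_i^{i-1}:X_{i-1}\to X_i$ ($i>0$) with $dom_{i-1}^i id_i^{i-1}x=x=cod_{i-1}^i id_i^{i-1}x$; $id_j^i$ denotes the iterated composite $X_i\to X_j$. An omega magma is an omega graph with, for all $0\le i<j$, a partial binary operation $a\circ_i^j b$ on $j$-cells, defined exactly when $cod_i^j a=dom_i^j b$, such that: if $i+1=j$, then $dom_i^j(a\circ_i^j b)=dom_i^j a$ and $cod_i^j(a\circ_i^j b)=cod_i^j b$; if $i+1<j$, then $dom_{j-1}^j(a\circ_i^j b)=dom_{j-1}^ja\circ_i^{j-1}dom_{j-1}^jb$ and likewise for $cod_{j-1}^j$. Morphisms of globular sets, omega graphs and omega magmas preserve all the respective structure. A strict omega category is an omega magma in which (whenever the composites are defined) $(a\circ_i^jb)\circ_i^jc=a\circ_i^j(b\circ_i^jc)$; $(a\circ_j^kb)\circ_i^k(c\circ_j^kd)=(a\circ_i^kc)\circ_j^k(b\circ_i^kd)$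 for $i<j<k$; $a=id_j^i(dom_i^ja)\circ_i^ja=a\circ_i^jid_j^i(cod_i^ja)$; and $id_{j+1}^j(a)\circ_i^{j+1}id_{j+1}^j(b)=id_{j+1}^j(a\circ_i^jb)$ for $i<j$. Two $i$-cells $a,b$ are parallel, $a\parallel b$, if they have the same $dom_{i-1}^i$ and the same $cod_{i-1}^i$; any two $0$-cells are parallel. A bridge relation $R$ on an omega graph (or omega magma) $X$ is a sequence $R_i\subseteq X_i\times X_i\times X_{i+1}$ ($i\ge0$) such that: $(a,b,c)\in R_i$ implies $a\parallel b$, $dom_i^{i+1}c=a$, $cod_i^{i+1}c=b$; $(a,a,id_{i+1}^ia)\in R_i$ for all $a\in X_i$; $(a,b,c),(a,b,d)\in R_i$ implies $c=d$. The diagonal bridge relation $R^\Delta$ consists of all triples $(a,a,id_{i+1}^ia)$. A bridge morphism $F:(X,R^X)\to(Y,R^Y)$ is an omega magma morphism with $(a,b,c)\in R_i^X\Rightarrow(Fa,Fb,Fc)\in R_i^Y$. A categorical Penon morphism is a bridge morphism $F:(X,R^X)\to(Y,R^Y)$ such that $Y$ is a strict omega category, $R^Y=R^\Delta$; $(a,b,c)\in R_i^X$ implies $Fa=Fb$ and $Fc=id_{i+1}^i(Fa)$; and if $a,b\in X_i$, $a\parallel b$, $Fa=Fb$, then there is $c$ with $(a,b,c)\in R_i^X$. A weak omega category $\mathbf X$ consists of omega magmas $X_1$ (the underlying magma) and $X_2$, an omega magma morphism $\lambda^X:X_2\to X_1$, a morphism $\rho^X:X_1\to X_2$ of omega graphs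 with $\lambda^X\circ\rho^X=1$ (as omega graph morphisms), a bridge relation $R^X$ on $X_2$, a strict omega category $X_3$, and a categorical Penon morphism $\kappa^X:(X_2,R^X)\to(X_3,R^\Delta)$. An omega functor $\mathbf F:\mathbf X\to\mathbf Y$ is a triple of omega magma morphisms $F_i:X_i\to Y_i$ ($i=1,2,3$) with $F_2$ a bridge morphism $(X_2,R^X)\to(Y_2,R^Y)$, $F_1\lambda^X=\lambda^YF_2$, $F_3\kappa^X=\kappa^YF_2$, and $F_2\rho^X=\rho^YF_1$ (as omega graph morphisms). An essentially algebraic theory is many-sorted, with total operations and partial operations, the domain of each partial operation being defined by equations between total operations, and with equational axioms. Here all operations have finite arity, and each domain condition consists of finitely many equations in finitely many variables. *)

theory Defs
  imports Complex_Main "HOL-Library.FuncSet"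
begin

unbundle cardinal_syntax

section \<open>Size\<close>

text \<open>
  HOL has no type of all sets, so a type \<open>'u\<close> plays the role of a Grothendieck universe: a set of
  any type is small if its cardinality is strictly below that of \<open>'u\<close>, and \<open>'u\<close> is a universe if
  the small sets include an infinite one and are closed under power sets and small unions, that
  is, if the cardinality of \<open>'u\<close> is (uncountable and strongly) inaccessible. Up to bijection, the
  small subsets of \<open>'u\<close> are then all the small sets.
\<close>

definition small :: "'u itself \<Rightarrow> 'a set \<Rightarrow> bool" where
  "small U A \<longleftrightarrow> |A| <o |UNIV :: 'u set|"

definition grothendieck_universe :: "'u itself \<Rightarrow> bool" where
  "grothendieck_universe U \<longleftrightarrow>
     (\<exists>A :: 'u set. infinite A \<and> small U A) \<and>
     (\<forall>A :: 'u set. small U A \<longrightarrow> small U (Pow A)) \<and>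
     (\<forall>(A :: 'u set) (F :: 'u \<Rightarrow> 'u set).
        small U A \<longrightarrow> (\<forall>a\<in>A. small U (F a)) \<longrightarrow> small U (\<Union>a\<in>A. F a))"


section \<open>Categories\<close>

record ('o, 'm) cat =
  Obj :: "'o set"
  Arr :: "'m set"
  Dom :: "'m \<Rightarrow> 'o"
  Cod :: "'m \<Rightarrow> 'o"
  Id  :: "'o \<Rightarrow> 'm"
  Cmp :: "'m \<Rightarrow> 'm \<Rightarrow> 'm"

text \<open>\<open>Cmp C g f\<close> is \<open>g\<close> after \<open>f\<close>; it is only meaningful when \<open>Dom C g = Cod C f\<close>.\<close>

definition hom :: "('o, 'm) cat \<Rightarrow> 'o \<Rightarrow> 'o \<Rightarrow> 'm set" where
  "hom C x y = {f \<in> Arr C. Dom C f = x \<and> Cod C f = y}"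

definition category :: "('o, 'm) cat \<Rightarrow> bool" where
  "category C \<longleftrightarrow>
     (\<forall>f\<in>Arr C. Dom C f \<in> Obj C \<and> Cod C f \<in> Obj C) \<and>
     (\<forall>x\<in>Obj C. Id C x \<in> hom C x x) \<and>
     (\<forall>f\<in>Arr C. \<forall>g\<in>Arr C. Dom C g = Cod C f \<longrightarrow> Cmp C g f \<in> hom C (Dom C f) (Cod C g)) \<and>
     (\<forall>f\<in>Arr C. Cmp C f (Id C (Dom C f)) = f \<and> Cmp C (Id C (Cod C f)) f = f) \<and>
     (\<forall>f\<in>Arr C. \<forall>g\<in>Arr C. \<forall>h\<in>Arr C. Dom C g = Cod C f \<longrightarrow> Dom C h = Cod C g \<longrightarrow>
        Cmp C h (Cmp C g f) = Cmp C (Cmp C h g) f)"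

definition is_functor ::
  "('o1, 'm1) cat \<Rightarrow> ('o2, 'm2) cat \<Rightarrow> ('o1 \<Rightarrow> 'o2) \<Rightarrow> ('m1 \<Rightarrow> 'm2) \<Rightarrow> bool" where
  "is_functor C D Fo Fm \<longleftrightarrow>
     (\<forall>x\<in>Obj C. Fo x \<in> Obj D) \<and>
     (\<forall>f\<in>Arr C. Fm f \<in> hom D (Fo (Dom C f)) (Fo (Cod C f))) \<and>
     (\<forall>x\<in>Obj C. Fm (Id C x) = Id D (Fo x)) \<and>
     (\<forall>f\<in>Arr C. \<forall>g\<in>Arr C. Dom C g = Cod C f \<longrightarrow> Fm (Cmp C g f) = Cmp D (Fm g) (Fm f))"

definition isomorphic_categories :: "('o1, 'm1) cat \<Rightarrow> ('o2, 'm2) cat \<Rightarrow> bool" where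
  "isomorphic_categories C D \<longleftrightarrow> category C \<and> category D \<and>
     (\<exists>Fo Fm Go Gm. is_functor C D Fo Fm \<and> is_functor D C Go Gm \<and>
        (\<forall>x\<in>Obj C. Go (Fo x) = x) \<and> (\<forall>f\<in>Arr C. Gm (Fm f) = f) \<and>
        (\<forall>y\<in>Obj D. Fo (Go y) = y) \<and> (\<forall>g\<in>Arr D. Fm (Gm g) = g))"

definition is_cone ::
  "('i, 'j) cat \<Rightarrow> ('o, 'm) cat \<Rightarrow> ('i \<Rightarrow> 'o) \<Rightarrow> ('j \<Rightarrow> 'm) \<Rightarrow> 'o \<Rightarrow> ('i \<Rightarrow> 'm) \<Rightarrow> bool" where
  "is_cone J C Do Dm c p \<longleftrightarrow> c \<in> Obj C \<and>
     (\<forall>i\<in>Obj J. p i \<in> hom C c (Do i)) \<and>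
     (\<forall>u\<in>Arr J. Cmp C (Dm u) (p (Dom J u)) = p (Cod J u))"

definition is_limit ::
  "('i, 'j) cat \<Rightarrow> ('o, 'm) cat \<Rightarrow> ('i \<Rightarrow> 'o) \<Rightarrow> ('j \<Rightarrow> 'm) \<Rightarrow> 'o \<Rightarrow> ('i \<Rightarrow> 'm) \<Rightarrow> bool" where
  "is_limit J C Do Dm c p \<longleftrightarrow> is_cone J C Do Dm c p \<and>
     (\<forall>d q. is_cone J C Do Dm d q \<longrightarrow>
        (\<exists>!h. h \<in> hom C d c \<and> (\<forall>i\<in>Obj J. Cmp C (p i) h = q i)))"

definition is_cocone ::
  "('i, 'j) cat \<Rightarrow> ('o, 'm) cat \<Rightarrow> ('i \<Rightarrow> 'o) \<Rightarrow> ('j \<Rightarrow> 'm) \<Rightarrow> 'o \<Rightarrow> ('i \<Rightarrow> 'm) \<Rightarrow> bool" where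
  "is_cocone J C Do Dm c p \<longleftrightarrow> c \<in> Obj C \<and>
     (\<forall>i\<in>Obj J. p i \<in> hom C (Do i) c) \<and>
     (\<forall>u\<in>Arr J. Cmp C (p (Cod J u)) (Dm u) = p (Dom J u))"

definition is_colimit ::
  "('i, 'j) cat \<Rightarrow> ('o, 'm) cat \<Rightarrow> ('i \<Rightarrow> 'o) \<Rightarrow> ('j \<Rightarrow> 'm) \<Rightarrow> 'o \<Rightarrow> ('i \<Rightarrow> 'm) \<Rightarrow> bool" where
  "is_colimit J C Do Dm c p \<longleftrightarrow> is_cocone J C Do Dm c p \<and>
     (\<forall>d q. is_cocone J C Do Dm d q \<longrightarrow>
        (\<exists>!h. h \<in> hom C c d \<and> (\<forall>i\<in>Obj J. Cmp C h (p i) = q i)))"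

text \<open>
  Small index categories are taken with objects and arrows in \<open>'u\<close>; every small category is
  isomorphic to one of these.
\<close>

definition small_cat :: "('u, 'u) cat \<Rightarrow> bool" where
  "small_cat J \<longleftrightarrow> category J \<and> small TYPE('u) (Obj J) \<and> small TYPE('u) (Arr J)"

definition complete_category :: "'u itself \<Rightarrow> ('o, 'm) cat \<Rightarrow> bool" where
  "complete_category U C \<longleftrightarrow> category C \<and>
     (\<forall>(J :: ('u, 'u) cat) Do Dm. small_cat J \<longrightarrow> is_functor J C Do Dm \<longrightarrow>
        (\<exists>c p. is_limit J C Do Dm c p))"

definition cocomplete_category :: "'u itself \<Rightarrow> ('o, 'm) cat \<Rightarrow> bool" where
  "cocomplete_category U C \<longleftrightarrow> category C \<and>
     (\<forall>(J :: ('u, 'u) cat) Do Dm. small_cat J \<longrightarrow> is_functor J C Do Dm \<longrightarrow>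
        (\<exists>c p. is_colimit J C Do Dm c p))"


section \<open>Locally finitely presentable categories\<close>

definition directed_poset :: "'i set \<Rightarrow> 'i rel \<Rightarrow> bool" where
  "directed_poset I r \<longleftrightarrow> partial_order_on I r \<and> I \<noteq> {} \<and>
     (\<forall>i\<in>I. \<forall>j\<in>I. \<exists>k\<in>I. (i, k) \<in> r \<and> (j, k) \<in> r)"

definition poset_cat :: "'i set \<Rightarrow> 'i rel \<Rightarrow> ('i, 'i \<times> 'i) cat" where
  "poset_cat I r = \<lparr>Obj = I, Arr = r, Dom = fst, Cod = snd, Id = (\<lambda>i. (i, i)),
     Cmp = (\<lambda>g f. (fst f, snd g))\<rparr>"

text \<open>
  Hom sets are sets of arrows, so the hom functors of a category with arrows in \<open>'m\<close> take values
  in the category of subsets of \<open>'m\<close>.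
\<close>

definition Set_cat :: "('m set, 'm set \<times> ('m \<Rightarrow> 'm) \<times> 'm set) cat" where
  "Set_cat = \<lparr>Obj = UNIV, Arr = {(A, f, B). f \<in> A \<rightarrow>\<^sub>E B}, Dom = fst, Cod = snd \<circ> snd,
     Id = (\<lambda>A. (A, restrict id A, A)),
     Cmp = (\<lambda>(_, g, C) (A, f, _). (A, compose A g f, C))\<rparr>"

definition hom_map ::
  "('o, 'm) cat \<Rightarrow> 'o \<Rightarrow> 'm \<Rightarrow> 'm set \<times> ('m \<Rightarrow> 'm) \<times> 'm set" where
  "hom_map C k f =
     (hom C k (Dom C f), (\<lambda>g\<in>hom C k (Dom C f). Cmp C f g), hom C k (Cod C f))"

definition preserves_directed_colimits ::
  "'u itself \<Rightarrow> ('o1, 'm1) cat \<Rightarrow> ('o2, 'm2) cat \<Rightarrow> ('o1 \<Rightarrow> 'o2) \<Rightarrow> ('m1 \<Rightarrow> 'm2) \<Rightarrow> bool" where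
  "preserves_directed_colimits U C D Fo Fm \<longleftrightarrow>
     (\<forall>(I :: 'u set) r Do Dm c p.
        small U I \<longrightarrow> directed_poset I r \<longrightarrow> is_functor (poset_cat I r) C Do Dm \<longrightarrow>
        is_colimit (poset_cat I r) C Do Dm c p \<longrightarrow>
        is_colimit (poset_cat I r) D (Fo \<circ> Do) (Fm \<circ> Dm) (Fo c) (Fm \<circ> p))"

definition finitely_presentable :: "'u itself \<Rightarrow> ('o, 'm) cat \<Rightarrow> 'o \<Rightarrow> bool" where
  "finitely_presentable U C k \<longleftrightarrow> k \<in> Obj C \<and>
     preserves_directed_colimits U C Set_cat (hom C k) (hom_map C k)"

definition is_directed_colimit_of :: "'u itself \<Rightarrow> ('o, 'm) cat \<Rightarrow> 'o set \<Rightarrow> 'o \<Rightarrow> bool" where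
  "is_directed_colimit_of U C A x \<longleftrightarrow>
     (\<exists>(I :: 'u set) r Do Dm p.
        small U I \<and> directed_poset I r \<and> is_functor (poset_cat I r) C Do Dm \<and>
        Do ` I \<subseteq> A \<and> is_colimit (poset_cat I r) C Do Dm x p)"

definition locally_finitely_presentable :: "'u itself \<Rightarrow> ('o, 'm) cat \<Rightarrow> bool" where
  "locally_finitely_presentable U C \<longleftrightarrow> category C \<and>
     (\<forall>x\<in>Obj C. \<forall>y\<in>Obj C. small U (hom C x y)) \<and>
     cocomplete_category U C \<and>
     (\<exists>A\<subseteq>Obj C. small U A \<and> (\<forall>k\<in>A. finitely_presentable U C k) \<and>
        (\<forall>x\<in>Obj C. is_directed_colimit_of U C A x))"


section \<open>Essentially algebraic theories\<close>

datatype 'f tm = Var nat | Op 'f "'f tm list"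

fun op_symbols :: "'f tm \<Rightarrow> 'f set" where
  "op_symbols (Var n) = {}"
| "op_symbols (Op f ts) = insert f (\<Union>t\<in>set ts. op_symbols t)"

text \<open>
  A context is a list of sorts, the variable \<open>Var n\<close> having the \<open>n\<close>th sort of the list. The
  equations in \<open>dom_eqs T f\<close> are in the context \<open>arity T f\<close>, i.e. in variables standing for the
  arguments of \<open>f\<close>; an axiom consists of a context and the two sides of the equation.
\<close>

record ('s, 'f) ea_theory =
  sorts :: "'s set"
  ops :: "'f set"
  arity :: "'f \<Rightarrow> 's list"
  result :: "'f \<Rightarrow> 's"
  total_ops :: "'f set"
  dom_eqs :: "'f \<Rightarrow> ('f tm \<times> 'f tm) set"
  axioms :: "('s list \<times> 'f tm \<times> 'f tm) set"

inductive has_sort :: "('s, 'f) ea_theory \<Rightarrow> 's list \<Rightarrow> 'f tm \<Rightarrow> 's \<Rightarrow> bool"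
  for T :: "('s, 'f) ea_theory" and \<Gamma> :: "'s list" where
  "n < length \<Gamma> \<Longrightarrow> has_sort T \<Gamma> (Var n) (\<Gamma> ! n)"
| "\<lbrakk>f \<in> ops T; length ts = length (arity T f);
    \<forall>n < length ts. has_sort T \<Gamma> (ts ! n) (arity T f ! n)\<rbrakk>
   \<Longrightarrow> has_sort T \<Gamma> (Op f ts) (result T f)"

definition essentially_algebraic_theory :: "('s, 'f) ea_theory \<Rightarrow> bool" where
  "essentially_algebraic_theory T \<longleftrightarrow>
     (\<forall>f\<in>ops T. set (arity T f) \<subseteq> sorts T \<and> result T f \<in> sorts T) \<and>
     total_ops T \<subseteq> ops T \<and>
     (\<forall>f\<in>ops T - total_ops T. finite (dom_eqs T f) \<and>
        (\<forall>(t, u)\<in>dom_eqs T f.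
           (\<exists>s. has_sort T (arity T f) t s \<and> has_sort T (arity T f) u s) \<and>
           op_symbols t \<subseteq> total_ops T \<and> op_symbols u \<subseteq> total_ops T)) \<and>
     (\<forall>(\<Gamma>, t, u)\<in>axioms T. set \<Gamma> \<subseteq> sorts T \<and>
        (\<exists>s. has_sort T \<Gamma> t s \<and> has_sort T \<Gamma> u s))"

text \<open>
  In models, as in the other structures below, functions take a fixed junk value outside their
  domains and there are no elements of sorts outside the theory, so that equality of models is
  the intended equality.
\<close>

record ('s, 'f, 'u) partial_algebra =
  carrier :: "'s \<Rightarrow> 'u set"
  interp :: "'f \<Rightarrow> 'u list \<Rightarrow> 'u option"

fun eval_tm :: "('s, 'f, 'u) partial_algebra \<Rightarrow> 'u list \<Rightarrow> 'f tm \<Rightarrow> 'u option" where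
  "eval_tm M xs (Var n) = (if n < length xs then Some (xs ! n) else None)"
| "eval_tm M xs (Op f ts) =
     (case those (map (eval_tm M xs) ts) of None \<Rightarrow> None | Some ys \<Rightarrow> interp M f ys)"

definition tuples :: "('s, 'f, 'u) partial_algebra \<Rightarrow> 's list \<Rightarrow> 'u list set" where
  "tuples M \<Gamma> = {xs. list_all2 (\<lambda>x s. x \<in> carrier M s) xs \<Gamma>}"

definition is_model :: "('s, 'f) ea_theory \<Rightarrow> ('s, 'f, 'u) partial_algebra \<Rightarrow> bool" where
  "is_model T M \<longleftrightarrow>
     (\<forall>s. s \<notin> sorts T \<longrightarrow> carrier M s = {}) \<and>
     (\<forall>f xs y. interp M f xs = Some y \<longrightarrow>
        f \<in> ops T \<and> xs \<in> tuples M (arity T f) \<and> y \<in> carrier M (result T f)) \<and>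
     (\<forall>f\<in>total_ops T. \<forall>xs\<in>tuples M (arity T f). interp M f xs \<noteq> None) \<and>
     (\<forall>f\<in>ops T - total_ops T. \<forall>xs\<in>tuples M (arity T f).
        interp M f xs \<noteq> None \<longleftrightarrow> (\<forall>(t, u)\<in>dom_eqs T f. eval_tm M xs t = eval_tm M xs u)) \<and>
     (\<forall>(\<Gamma>, t, u)\<in>axioms T. \<forall>xs\<in>tuples M \<Gamma>.
        eval_tm M xs t \<noteq> None \<longrightarrow> eval_tm M xs u \<noteq> None \<longrightarrow> eval_tm M xs t = eval_tm M xs u)"

definition model_hom ::
  "('s, 'f) ea_theory \<Rightarrow> ('s, 'f, 'u) partial_algebra \<Rightarrow> ('s, 'f, 'u) partial_algebra \<Rightarrow>
   ('s \<Rightarrow> 'u \<Rightarrow> 'u) \<Rightarrow> bool" where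
  "model_hom T M N h \<longleftrightarrow>
     (\<forall>s. h s \<in> carrier M s \<rightarrow>\<^sub>E carrier N s) \<and>
     (\<forall>f\<in>ops T. \<forall>xs y. interp M f xs = Some y \<longrightarrow>
        interp N f (map2 h (arity T f) xs) = Some (h (result T f) y))"

definition Mod ::
  "('s, 'f) ea_theory \<Rightarrow>
   (('s, 'f, 'u) partial_algebra,
    ('s, 'f, 'u) partial_algebra \<times> ('s \<Rightarrow> 'u \<Rightarrow> 'u) \<times> ('s, 'f, 'u) partial_algebra) cat" where
  "Mod T =
     (let models = {M. is_model T M \<and> (\<forall>s. small TYPE('u) (carrier M s))}
      in \<lparr>Obj = models,
          Arr = {(M, h, N). M \<in> models \<and> N \<in> models \<and> model_hom T M N h},
          Dom = fst, Cod = snd \<circ> snd,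
          Id = (\<lambda>M. (M, \<lambda>s. restrict id (carrier M s), M)),
          Cmp = (\<lambda>(_, k, P) (M, h, _). (M, \<lambda>s. compose (carrier M s) (k s) (h s), P))\<rparr>)"


section \<open>Globular sets, omega graphs, omega magmas\<close>

text \<open>
  \<open>src X i\<close> and \<open>tgt X i\<close> are the domain and codomain functions from \<open>(i + 1)\<close>-cells to
  \<open>i\<close>-cells, and \<open>idt X i\<close> goes from \<open>i\<close>-cells to \<open>(i + 1)\<close>-cells.
\<close>

record 'u globular_set =
  cell :: "nat \<Rightarrow> 'u set"
  src :: "nat \<Rightarrow> 'u \<Rightarrow> 'u"
  tgt :: "nat \<Rightarrow> 'u \<Rightarrow> 'u"

record 'u omega_graph = "'u globular_set" +
  idt :: "nat \<Rightarrow> 'u \<Rightarrow> 'u"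

record 'u omega_magma = "'u omega_graph" +
  cmp :: "nat \<Rightarrow> nat \<Rightarrow> 'u \<times> 'u \<Rightarrow> 'u"

definition is_globular_set :: "('u, 'z) globular_set_scheme \<Rightarrow> bool" where
  "is_globular_set X \<longleftrightarrow>
     (\<forall>i. src X i \<in> cell X (Suc i) \<rightarrow>\<^sub>E cell X i) \<and>
     (\<forall>i. tgt X i \<in> cell X (Suc i) \<rightarrow>\<^sub>E cell X i) \<and>
     (\<forall>i. \<forall>a\<in>cell X (Suc (Suc i)).
        src X i (src X (Suc i) a) = src X i (tgt X (Suc i) a) \<and>
        tgt X i (src X (Suc i) a) = tgt X i (tgt X (Suc i) a))"

text \<open>
  Iterated domains, codomains and identities: for \<open>i \<le> j\<close>, \<open>src_it X i j\<close> and \<open>tgt_it X i j\<close> go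
  from \<open>j\<close>-cells to \<open>i\<close>-cells and \<open>idt_it X i j\<close> from \<open>i\<close>-cells to \<open>j\<close>-cells.
\<close>

primrec src_it :: "('u, 'z) globular_set_scheme \<Rightarrow> nat \<Rightarrow> nat \<Rightarrow> 'u \<Rightarrow> 'u" where
  "src_it X i 0 = id"
| "src_it X i (Suc j) = (if i \<le> j then src_it X i j \<circ> src X j else id)"

primrec tgt_it :: "('u, 'z) globular_set_scheme \<Rightarrow> nat \<Rightarrow> nat \<Rightarrow> 'u \<Rightarrow> 'u" where
  "tgt_it X i 0 = id"
| "tgt_it X i (Suc j) = (if i \<le> j then tgt_it X i j \<circ> tgt X j else id)"

primrec idt_it :: "('u, 'z) omega_graph_scheme \<Rightarrow> nat \<Rightarrow> nat \<Rightarrow> 'u \<Rightarrow> 'u" where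
  "idt_it X i 0 = id"
| "idt_it X i (Suc j) = (if i \<le> j then idt X j \<circ> idt_it X i j else id)"

definition is_omega_graph :: "('u, 'z) omega_graph_scheme \<Rightarrow> bool" where
  "is_omega_graph X \<longleftrightarrow> is_globular_set X \<and>
     (\<forall>i. idt X i \<in> cell X i \<rightarrow>\<^sub>E cell X (Suc i)) \<and>
     (\<forall>i. \<forall>a\<in>cell X i. src X i (idt X i a) = a \<and> tgt X i (idt X i a) = a)"

definition composable :: "('u, 'z) globular_set_scheme \<Rightarrow> nat \<Rightarrow> nat \<Rightarrow> ('u \<times> 'u) set" where
  "composable X i j =
     {(a, b). a \<in> cell X j \<and> b \<in> cell X j \<and> tgt_it X i j a = src_it X i j b}"

definition is_omega_magma :: "('u, 'z) omega_magma_scheme \<Rightarrow> bool" where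
  "is_omega_magma X \<longleftrightarrow> is_omega_graph X \<and>
     (\<forall>i j. i < j \<longrightarrow> cmp X i j \<in> composable X i j \<rightarrow>\<^sub>E cell X j) \<and>
     (\<forall>i j. \<not> i < j \<longrightarrow> cmp X i j = (\<lambda>_. undefined)) \<and>
     (\<forall>i. \<forall>(a, b)\<in>composable X i (Suc i).
        src X i (cmp X i (Suc i) (a, b)) = src X i a \<and>
        tgt X i (cmp X i (Suc i) (a, b)) = tgt X i b) \<and>
     (\<forall>i j. i < j \<longrightarrow> (\<forall>(a, b)\<in>composable X i (Suc j).
        src X j (cmp X i (Suc j) (a, b)) = cmp X i j (src X j a, src X j b) \<and>
        tgt X j (cmp X i (Suc j) (a, b)) = cmp X i j (tgt X j a, tgt X j b)))"

definition is_strict_omega_category :: "('u, 'z) omega_magma_scheme \<Rightarrow> bool" where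
  "is_strict_omega_category X \<longleftrightarrow> is_omega_magma X \<and>
     (\<forall>i j a b c. i < j \<longrightarrow>
        (a, b) \<in> composable X i j \<longrightarrow> (cmp X i j (a, b), c) \<in> composable X i j \<longrightarrow>
        (b, c) \<in> composable X i j \<longrightarrow> (a, cmp X i j (b, c)) \<in> composable X i j \<longrightarrow>
        cmp X i j (cmp X i j (a, b), c) = cmp X i j (a, cmp X i j (b, c))) \<and>
     (\<forall>i j k a b c d. i < j \<longrightarrow> j < k \<longrightarrow>
        (a, b) \<in> composable X j k \<longrightarrow> (c, d) \<in> composable X j k \<longrightarrow>
        (cmp X j k (a, b), cmp X j k (c, d)) \<in> composable X i k \<longrightarrow>
        (a, c) \<in> composable X i k \<longrightarrow> (b, d) \<in> composable X i k \<longrightarrow>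
        (cmp X i k (a, c), cmp X i k (b, d)) \<in> composable X j k \<longrightarrow>
        cmp X i k (cmp X j k (a, b), cmp X j k (c, d)) =
        cmp X j k (cmp X i k (a, c), cmp X i k (b, d))) \<and>
     (\<forall>i j. i < j \<longrightarrow> (\<forall>a\<in>cell X j.
        cmp X i j (idt_it X i j (src_it X i j a), a) = a \<and>
        cmp X i j (a, idt_it X i j (tgt_it X i j a)) = a)) \<and>
     (\<forall>i j. i < j \<longrightarrow> (\<forall>(a, b)\<in>composable X i j.
        cmp X i (Suc j) (idt X j a, idt X j b) = idt X j (cmp X i j (a, b))))"

definition globular_morphism ::
  "('u, 'y) globular_set_scheme \<Rightarrow> ('u, 'z) globular_set_scheme \<Rightarrow> (nat \<Rightarrow> 'u \<Rightarrow> 'u) \<Rightarrow> bool" where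
  "globular_morphism X Y F \<longleftrightarrow>
     (\<forall>i. F i \<in> cell X i \<rightarrow>\<^sub>E cell Y i) \<and>
     (\<forall>i. \<forall>a\<in>cell X (Suc i).
        F i (src X i a) = src Y i (F (Suc i) a) \<and> F i (tgt X i a) = tgt Y i (F (Suc i) a))"

definition omega_graph_morphism ::
  "('u, 'y) omega_graph_scheme \<Rightarrow> ('u, 'z) omega_graph_scheme \<Rightarrow> (nat \<Rightarrow> 'u \<Rightarrow> 'u) \<Rightarrow> bool" where
  "omega_graph_morphism X Y F \<longleftrightarrow> globular_morphism X Y F \<and>
     (\<forall>i. \<forall>a\<in>cell X i. F (Suc i) (idt X i a) = idt Y i (F i a))"

definition omega_magma_morphism ::
  "('u, 'y) omega_magma_scheme \<Rightarrow> ('u, 'z) omega_magma_scheme \<Rightarrow> (nat \<Rightarrow> 'u \<Rightarrow> 'u) \<Rightarrow> bool" where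
  "omega_magma_morphism X Y F \<longleftrightarrow> omega_graph_morphism X Y F \<and>
     (\<forall>i j. i < j \<longrightarrow> (\<forall>(a, b)\<in>composable X i j.
        F j (cmp X i j (a, b)) = cmp Y i j (F j a, F j b)))"


section \<open>Bridge relations and categorical Penon morphisms\<close>

type_synonym 'u bridge = "nat \<Rightarrow> ('u \<times> 'u \<times> 'u) set"

definition parallel :: "('u, 'z) globular_set_scheme \<Rightarrow> nat \<Rightarrow> 'u \<Rightarrow> 'u \<Rightarrow> bool" where
  "parallel X i a b \<longleftrightarrow> a \<in> cell X i \<and> b \<in> cell X i \<and>
     (\<forall>k. i = Suc k \<longrightarrow> src X k a = src X k b \<and> tgt X k a = tgt X k b)"

definition bridge_relation :: "('u, 'z) omega_graph_scheme \<Rightarrow> 'u bridge \<Rightarrow> bool" where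
  "bridge_relation X R \<longleftrightarrow>
     (\<forall>i. R i \<subseteq> cell X i \<times> cell X i \<times> cell X (Suc i)) \<and>
     (\<forall>i a b c. (a, b, c) \<in> R i \<longrightarrow> parallel X i a b \<and> src X i c = a \<and> tgt X i c = b) \<and>
     (\<forall>i. \<forall>a\<in>cell X i. (a, a, idt X i a) \<in> R i) \<and>
     (\<forall>i a b c d. (a, b, c) \<in> R i \<longrightarrow> (a, b, d) \<in> R i \<longrightarrow> c = d)"

definition diagonal_bridge :: "('u, 'z) omega_graph_scheme \<Rightarrow> 'u bridge" where
  "diagonal_bridge X i = {(a, a, idt X i a) | a. a \<in> cell X i}"

definition bridge_morphism ::
  "('u, 'y) omega_magma_scheme \<Rightarrow> 'u bridge \<Rightarrow> ('u, 'z) omega_magma_scheme \<Rightarrow> 'u bridge \<Rightarrow>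
   (nat \<Rightarrow> 'u \<Rightarrow> 'u) \<Rightarrow> bool" where
  "bridge_morphism X R Y S F \<longleftrightarrow> omega_magma_morphism X Y F \<and>
     (\<forall>i a b c. (a, b, c) \<in> R i \<longrightarrow> (F i a, F i b, F (Suc i) c) \<in> S i)"

definition categorical_Penon_morphism ::
  "('u, 'y) omega_magma_scheme \<Rightarrow> 'u bridge \<Rightarrow> ('u, 'z) omega_magma_scheme \<Rightarrow> 'u bridge \<Rightarrow>
   (nat \<Rightarrow> 'u \<Rightarrow> 'u) \<Rightarrow> bool" where
  "categorical_Penon_morphism X R Y S F \<longleftrightarrow>
     is_omega_magma X \<and> bridge_relation X R \<and>
     is_strict_omega_category Y \<and> S = diagonal_bridge Y \<and>
     bridge_morphism X R Y S F \<and>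
     (\<forall>i a b c. (a, b, c) \<in> R i \<longrightarrow> F i a = F i b \<and> F (Suc i) c = idt Y i (F i a)) \<and>
     (\<forall>i a b. parallel X i a b \<longrightarrow> F i a = F i b \<longrightarrow> (\<exists>c. (a, b, c) \<in> R i))"


section \<open>Weak omega categories and omega functors\<close>

record 'u weak_omega_category =
  underlying :: "'u omega_magma"
  middle :: "'u omega_magma"
  strictified :: "'u omega_magma"
  lam :: "nat \<Rightarrow> 'u \<Rightarrow> 'u"
  rho :: "nat \<Rightarrow> 'u \<Rightarrow> 'u"
  bridges :: "'u bridge"
  kappa :: "nat \<Rightarrow> 'u \<Rightarrow> 'u"

definition is_weak_omega_category :: "'u weak_omega_category \<Rightarrow> bool" where
  "is_weak_omega_category X \<longleftrightarrow>
     is_omega_magma (underlying X) \<and> is_omega_magma (middle X) \<and>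
     omega_magma_morphism (middle X) (underlying X) (lam X) \<and>
     omega_graph_morphism (underlying X) (middle X) (rho X) \<and>
     (\<forall>i. \<forall>a\<in>cell (underlying X) i. lam X i (rho X i a) = a) \<and>
     bridge_relation (middle X) (bridges X) \<and>
     is_strict_omega_category (strictified X) \<and>
     categorical_Penon_morphism (middle X) (bridges X)
       (strictified X) (diagonal_bridge (strictified X)) (kappa X)"

definition small_weak_omega_category :: "'u weak_omega_category \<Rightarrow> bool" where
  "small_weak_omega_category X \<longleftrightarrow> is_weak_omega_category X \<and>
     (\<forall>i. small TYPE('u) (cell (underlying X) i) \<and> small TYPE('u) (cell (middle X) i) \<and>
          small TYPE('u) (cell (strictified X) i))"

type_synonym 'u functor_data = "(nat \<Rightarrow> 'u \<Rightarrow> 'u) \<times> (nat \<Rightarrow> 'u \<Rightarrow> 'u) \<times> (nat \<Rightarrow> 'u \<Rightarrow> 'u)"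

fun omega_functor ::
  "'u weak_omega_category \<Rightarrow> 'u weak_omega_category \<Rightarrow> 'u functor_data \<Rightarrow> bool" where
  "omega_functor X Y (F1, F2, F3) \<longleftrightarrow>
     omega_magma_morphism (underlying X) (underlying Y) F1 \<and>
     omega_magma_morphism (middle X) (middle Y) F2 \<and>
     omega_magma_morphism (strictified X) (strictified Y) F3 \<and>
     bridge_morphism (middle X) (bridges X) (middle Y) (bridges Y) F2 \<and>
     (\<forall>i. \<forall>a\<in>cell (middle X) i. F1 i (lam X i a) = lam Y i (F2 i a)) \<and>
     (\<forall>i. \<forall>a\<in>cell (middle X) i. F3 i (kappa X i a) = kappa Y i (F2 i a)) \<and>
     (\<forall>i. \<forall>a\<in>cell (underlying X) i. F2 i (rho X i a) = rho Y i (F1 i a))"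

definition identity_map :: "'u omega_magma \<Rightarrow> nat \<Rightarrow> 'u \<Rightarrow> 'u" where
  "identity_map X i = restrict id (cell X i)"

definition compose_maps ::
  "'u omega_magma \<Rightarrow> (nat \<Rightarrow> 'u \<Rightarrow> 'u) \<Rightarrow> (nat \<Rightarrow> 'u \<Rightarrow> 'u) \<Rightarrow> nat \<Rightarrow> 'u \<Rightarrow> 'u" where
  "compose_maps X G F i = compose (cell X i) (G i) (F i)"

definition Omega_Cat ::
  "('u weak_omega_category,
    'u weak_omega_category \<times> 'u functor_data \<times> 'u weak_omega_category) cat" where
  "Omega_Cat =
     \<lparr>Obj = {X. small_weak_omega_category X},
      Arr = {(X, F, Y). small_weak_omega_category X \<and> small_weak_omega_category Y \<and>
                        omega_functor X Y F},
      Dom = fst, Cod = snd \<circ> snd,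
      Id = (\<lambda>X. (X, (identity_map (underlying X), identity_map (middle X),
                     identity_map (strictified X)), X)),
      Cmp = (\<lambda>(_, (G1, G2, G3), Z) (X, (F1, F2, F3), _).
               (X, (compose_maps (underlying X) G1 F1, compose_maps (middle X) G2 F2,
                    compose_maps (strictified X) G3 F3), Z))\<rparr>"

end

theory Submission
  imports Defs "HOL-Library.Countable_Set" "HOL-Library.Countable"
begin

text \<open>
  For any countable essentially algebraic theory, a set of equations between closed terms over
  named generators presents a model: its elements are the provably defined terms up to provable
  equality. Small presentations have small models because a Grothendieck universe is inaccessible.
  A diagram of models has a colimit presented by the operation tables of its members together with
  its transition maps. If the diagram is directed, then a derivation, being finite, already holds
  at some stage; this describes directed colimits by elements, and makes finitely presented models
  finitely presentable. Every model is the directed colimit of the models presented by the finite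
  parts of its operation table. Limits are computed on carriers.

  Weak omega categories are the models of such a theory: the bridge relation of a categorical Penon
  morphism is the graph of a partial operation, defined at \<open>(a, b)\<close> exactly if \<open>a\<close> and \<open>b\<close> are
  parallel and \<open>\<kappa> a = \<kappa> b\<close>, conditions expressed by total operations.
\<close>

section \<open>Closure properties of small sets\<close>

text \<open>Three features of the setting shape the argument. Both sides of a domain equation
  consist of total operations, so they always have values: the equality of options in
  \<open>is_model\<close> is an equality of elements, and an operation defined in a directed colimit
  becomes defined at some stage, where its finitely many domain equations already hold. Next,
  carriers and index sets must consist of elements of the fixed type \<open>'u\<close>. Classes of
  terms, compatible families and finite parts of a table are therefore coded in \<open>'u\<close>
  along injections provided by smallness. The generating objects must moreover form a small set of
  actual models, not of isomorphism classes, which calls for a countable stock of names for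
  generators. Finally, the result is carried from models to weak omega categories by an isomorphism
  of categories, not only an equivalence. This is possible because all functions are extensional, so
  that a structure is recovered exactly from its operation table.\<close>

lemma small_inj:
  assumes "inj_on f A" "f ` A \<subseteq> B" "small U B" shows "small U A"
proof -
  have "|A| \<le>o |B|" using assms(1,2) unfolding card_of_ordLeq[symmetric] by auto
  with assms(3) show ?thesis unfolding small_def by (rule ordLeq_ordLess_trans[rotated])
qed

lemma small_subset: "A \<subseteq> B \<Longrightarrow> small U B \<Longrightarrow> small U A"
  using small_inj[of id A B U] by simp

lemma small_image: "small U A \<Longrightarrow> small U (f ` A)"
  unfolding small_def by (rule ordLeq_ordLess_trans[OF card_of_image])

text \<open>The universe axioms speak of subsets of \<open>'u\<close> only; sets of other types are
  brought under them along such an injection.\<close>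

lemma small_imp_inj:
  assumes "small TYPE('u) A" obtains e :: "'a \<Rightarrow> 'u" where "inj_on e A"
proof -
  have "|A| \<le>o |UNIV :: 'u set|" using assms unfolding small_def by (rule ordLess_imp_ordLeq)
  then show ?thesis using that unfolding card_of_ordLeq[symmetric] by auto
qed

locale universe =
  fixes U :: "'u itself"
  assumes universe: "grothendieck_universe TYPE('u)"
begin

lemma universe_Pow: "small TYPE('u) (Pow A)" if "small TYPE('u) A" for A :: "'u set"
proof -
  have "\<forall>A :: 'u set. small TYPE('u) A \<longrightarrow> small TYPE('u) (Pow A)"
    using universe unfolding grothendieck_universe_def by (elim conjE)
  with that show ?thesis by blast
qed

lemma universe_UN: "small TYPE('u) (\<Union>a\<in>A. F a)"
  if "small TYPE('u) A" "\<forall>a\<in>A. small TYPE('u) (F a)" for A :: "'u set" and F :: "'u \<Rightarrow> 'u set"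
proof -
  have "\<forall>(A :: 'u set) (F :: 'u \<Rightarrow> 'u set). small TYPE('u) A \<longrightarrow>
      (\<forall>a\<in>A. small TYPE('u) (F a)) \<longrightarrow> small TYPE('u) (\<Union>a\<in>A. F a)"
    using universe unfolding grothendieck_universe_def by (elim conjE)
  with that show ?thesis by blast
qed

lemma universe_infinite: "\<exists>A :: 'u set. infinite A \<and> small TYPE('u) A"
  using universe unfolding grothendieck_universe_def by (elim conjE)

lemma small_Pow:
  assumes "small TYPE('u) A" shows "small TYPE('u) (Pow A)"
proof -
  obtain e :: "'a \<Rightarrow> 'u" where e: "inj_on e A" using assms small_imp_inj by blast
  have "small TYPE('u) (Pow (e ` A))"
    by (intro universe_Pow small_image assms)
  moreover have "inj_on (image e) (Pow A)" using e by (rule inj_on_image_Pow)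
  ultimately show ?thesis using small_inj[of "image e" "Pow A" "Pow (e ` A)"] by blast
qed

lemma infinite_universe: "infinite (UNIV :: 'u set)"
  using universe_infinite infinite_super[OF subset_UNIV] by blast

text \<open>An infinite small set contains a copy of the natural numbers.\<close>

lemma small_countable:
  assumes "countable A" shows "small TYPE('u) A"
proof -
  obtain B :: "'u set" where B: "infinite B" "small TYPE('u) B"
    using universe_infinite by blast
  have "|A| \<le>o |UNIV :: nat set|"
    using assms unfolding countable_def card_of_ordLeq[symmetric] by auto
  also have "|UNIV :: nat set| \<le>o |B|" using B(1) infinite_iff_card_of_nat by blast
  finally show ?thesis using B(2) unfolding small_def by (rule ordLeq_ordLess_trans)
qed

text \<open>The axiom covers families of subsets of \<open>'u\<close> indexed by \<open>'u\<close>.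
  In general an element of the union is sent to a pair: the code of one index whose member contains
  it, and its code within that member. These pairs lie in a union of the kind covered.\<close>

lemma small_UN:
  assumes "small TYPE('u) A" "\<And>a. a \<in> A \<Longrightarrow> small TYPE('u) (F a)" shows "small TYPE('u) (\<Union>a\<in>A. F a)"
proof -
  obtain e :: "'a \<Rightarrow> 'u" where e: "inj_on e A" using assms(1) small_imp_inj by blast
  have "\<forall>a\<in>A. \<exists>g :: 'b \<Rightarrow> 'u. inj_on g (F a)" using assms(2) small_imp_inj by metis
  then obtain g :: "'a \<Rightarrow> 'b \<Rightarrow> 'u" where g: "\<And>a. a \<in> A \<Longrightarrow> inj_on (g a) (F a)" by metis
  \<comment> \<open>An infinite set is equinumerous with its square, so pairs over \<open>'u\<close>
    can be coded in \<open>'u\<close>.\<close>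
  obtain p :: "'u \<times> 'u \<Rightarrow> 'u" where p: "inj p"
    using card_of_Times_same_infinite[OF infinite_universe]
      card_of_ordIso[of "UNIV \<times> UNIV :: ('u \<times> 'u) set" "UNIV :: 'u set"]
    unfolding UNIV_Times_UNIV bij_betw_def by auto
  define G where "G x = (let a = inv_into A e x in (\<lambda>b. p (x, g a b)) ` F a)" for x
  have "small TYPE('u) (\<Union>x\<in>e ` A. G x)"
  proof -
    have "\<forall>x\<in>e ` A. small TYPE('u) (G x)" unfolding G_def Let_def using e assms(2) small_image by fastforce
    moreover have "small TYPE('u) (e ` A)" using assms(1) by (rule small_image)
    ultimately show ?thesis using universe_UN by blast
  qed
  \<comment> \<open>The members may overlap; selecting one index for each element makes the coding a
    function.\<close>
  moreover define c where "c b = (SOME a. a \<in> A \<and> b \<in> F a)" for b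
  have c: "c b \<in> A" "b \<in> F (c b)" if "b \<in> (\<Union>a\<in>A. F a)" for b
    using someI_ex[of "\<lambda>a. a \<in> A \<and> b \<in> F a"] that unfolding c_def by auto
  have "inj_on (\<lambda>b. p (e (c b), g (c b) b)) (\<Union>a\<in>A. F a)"
  proof (rule inj_onI)
    fix b b' assume b: "b \<in> (\<Union>a\<in>A. F a)" "b' \<in> (\<Union>a\<in>A. F a)"
      and eq: "p (e (c b), g (c b) b) = p (e (c b'), g (c b') b')"
    then have *: "e (c b) = e (c b')" "g (c b) b = g (c b') b'" using p by (auto dest: injD)
    then have "c b = c b'" using e c b by (meson inj_onD)
    with * show "b = b'" using g c b by (metis inj_onD)
  qed
  moreover have "(\<lambda>b. p (e (c b), g (c b) b)) ` (\<Union>a\<in>A. F a) \<subseteq> (\<Union>x\<in>e ` A. G x)"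
    using c e unfolding G_def Let_def by force
  ultimately show ?thesis by (rule small_inj[rotated 2])
qed

lemma small_Un: "small TYPE('u) A \<Longrightarrow> small TYPE('u) B \<Longrightarrow> small TYPE('u) (A \<union> B)"
proof -
  assume *: "small TYPE('u) A" "small TYPE('u) B"
  have "small TYPE('u) (\<Union>b\<in>{True, False}. if b then A else B)"
    by (rule small_UN) (use * small_countable[of "{True, False}"] in \<open>auto split: if_splits\<close>)
  then show "small TYPE('u) (A \<union> B)" by (simp add: Un_commute)
qed

lemma small_Sigma:
  assumes "small TYPE('u) A" "\<And>a. a \<in> A \<Longrightarrow> small TYPE('u) (B a)" shows "small TYPE('u) (Sigma A B)"
proof -
  have "Sigma A B = (\<Union>a\<in>A. Pair a ` B a)" by auto
  also have "small TYPE('u) \<dots>" by (intro small_UN small_image assms)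
  finally show ?thesis .
qed

text \<open>A function on \<open>I\<close> is determined by its graph, a subset of the dependent
  sum.\<close>

lemma small_PiE:
  assumes "small TYPE('u) I" "\<And>i. i \<in> I \<Longrightarrow> small TYPE('u) (B i)" shows "small TYPE('u) (PiE I B)"
proof (rule small_inj)
  show "small TYPE('u) (Pow (Sigma I B))" using assms by (intro small_Pow small_Sigma)
  show "inj_on (\<lambda>f. (\<lambda>i. (i, f i)) ` I) (PiE I B)"
  proof (rule inj_onI)
    fix f g assume fg: "f \<in> PiE I B" "g \<in> PiE I B" "(\<lambda>i. (i, f i)) ` I = (\<lambda>i. (i, g i)) ` I"
    have "f i = g i" if "i \<in> I" for i
    proof -
      have "(i, f i) \<in> (\<lambda>i. (i, g i)) ` I" using that unfolding fg(3)[symmetric] by blast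
      then show ?thesis by blast
    qed
    then show "f = g" by (rule PiE_ext[OF fg(1,2)])
  qed
  show "(\<lambda>f. (\<lambda>i. (i, f i)) ` I) ` (PiE I B) \<subseteq> Pow (Sigma I B)" by auto
qed

lemma small_lists:
  assumes "small TYPE('u) A" shows "small TYPE('u) (lists A)"
proof -
  have n: "small TYPE('u) {xs. length xs = n \<and> set xs \<subseteq> A}" for n
  proof (induction n)
    case (Suc n)
    have "{xs. length xs = Suc n \<and> set xs \<subseteq> A} \<subseteq>
        (\<lambda>(x, xs). x # xs) ` (A \<times> {xs. length xs = n \<and> set xs \<subseteq> A})"
      by (auto simp: length_Suc_conv image_iff)
    then show ?case by (rule small_subset) (intro small_image small_Sigma assms Suc)
  qed (rule small_subset[of _ "{[]}"], auto intro!: small_countable)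
  have "lists A = (\<Union>n\<in>(UNIV :: nat set). {xs. length xs = n \<and> set xs \<subseteq> A})"
    by (auto simp: lists_eq_set)
  then show ?thesis using small_UN[OF small_countable n, of "UNIV :: nat set"] by simp
qed

end


section \<open>Functors, isomorphisms of categories and limits\<close>

lemma ex1_equality: "\<exists>!x. P x \<Longrightarrow> P a \<Longrightarrow> P b \<Longrightarrow> a = b"
  by blast

lemma compose_eqI:
  "e \<in> A \<rightarrow>\<^sub>E B \<Longrightarrow> (\<And>x. x \<in> A \<Longrightarrow> g (f x) = e x) \<Longrightarrow> compose A g f = e"
  by (rule extensionalityI[of _ A]) (auto simp: compose_eq PiE_def)

lemma in_hom: "f \<in> hom C x y \<longleftrightarrow> f \<in> Arr C \<and> Dom C f = x \<and> Cod C f = y"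
  by (simp add: hom_def)

lemma category_cmp:
  "category C \<Longrightarrow> f \<in> hom C x y \<Longrightarrow> g \<in> hom C y z \<Longrightarrow> Cmp C g f \<in> hom C x z"
  unfolding category_def by (auto simp: in_hom)

lemma category_assoc:
  "category C \<Longrightarrow> f \<in> hom C x y \<Longrightarrow> g \<in> hom C y z \<Longrightarrow> h \<in> hom C z w \<Longrightarrow>
   Cmp C h (Cmp C g f) = Cmp C (Cmp C h g) f"
  unfolding category_def by (auto simp: in_hom)

lemma category_id:
  "category C \<Longrightarrow> x \<in> Obj C \<Longrightarrow> Id C x \<in> hom C x x"
  "category C \<Longrightarrow> f \<in> hom C x y \<Longrightarrow> Cmp C f (Id C x) = f"
  "category C \<Longrightarrow> f \<in> hom C x y \<Longrightarrow> Cmp C (Id C y) f = f"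
  unfolding category_def by (auto simp: in_hom)

lemma category_hom_Obj: "category C \<Longrightarrow> f \<in> hom C x y \<Longrightarrow> x \<in> Obj C \<and> y \<in> Obj C"
  unfolding category_def by (auto simp: in_hom)

lemma functor_obj: "is_functor C D Fo Fm \<Longrightarrow> x \<in> Obj C \<Longrightarrow> Fo x \<in> Obj D"
  unfolding is_functor_def by auto

lemma functor_hom: "is_functor C D Fo Fm \<Longrightarrow> f \<in> hom C x y \<Longrightarrow> Fm f \<in> hom D (Fo x) (Fo y)"
  unfolding is_functor_def by (auto simp: in_hom)

lemma functor_cmp:
  "is_functor C D Fo Fm \<Longrightarrow> f \<in> hom C x y \<Longrightarrow> g \<in> hom C y z \<Longrightarrow> Fm (Cmp C g f) = Cmp D (Fm g) (Fm f)"
  unfolding is_functor_def by (auto simp: in_hom)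

lemma functor_id: "is_functor C D Fo Fm \<Longrightarrow> x \<in> Obj C \<Longrightarrow> Fm (Id C x) = Id D (Fo x)"
  unfolding is_functor_def by auto

lemma functor_Arr:
  "is_functor C D Fo Fm \<Longrightarrow> f \<in> Arr C \<Longrightarrow> Fm f \<in> hom D (Fo (Dom C f)) (Fo (Cod C f))"
  unfolding is_functor_def by auto

lemma functor_compose:
  assumes "is_functor B C Fo Fm" "is_functor C D Go Gm"
  shows "is_functor B D (Go \<circ> Fo) (Gm \<circ> Fm)"
  unfolding is_functor_def
proof (intro conjI ballI impI)
  fix f g assume fg: "f \<in> Arr B" "g \<in> Arr B" "Dom B g = Cod B f"
  then have "Fm f \<in> hom C (Fo (Dom B f)) (Fo (Cod B f))" "Fm g \<in> hom C (Fo (Cod B f)) (Fo (Cod B g))"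
    "Fm (Cmp B g f) = Cmp C (Fm g) (Fm f)"
    using assms(1) unfolding is_functor_def by auto
  then show "(Gm \<circ> Fm) (Cmp B g f) = Cmp D ((Gm \<circ> Fm) g) ((Gm \<circ> Fm) f)"
    using functor_cmp[OF assms(2)] by fastforce
next
  fix f assume "f \<in> Arr B"
  then show "(Gm \<circ> Fm) f \<in> hom D ((Go \<circ> Fo) (Dom B f)) ((Go \<circ> Fo) (Cod B f))"
    using functor_Arr[OF assms(1)] functor_hom[OF assms(2)] by fastforce
qed (use assms in \<open>auto simp: functor_obj functor_id\<close>)

locale category_iso =
  fixes C :: "('o1, 'm1) cat" and D :: "('o2, 'm2) cat" and Fo Fm Go Gm
  assumes cat: "category C" "category D"
    and F: "is_functor C D Fo Fm" and G: "is_functor D C Go Gm"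
    and GF: "\<And>x. x \<in> Obj C \<Longrightarrow> Go (Fo x) = x" "\<And>f. f \<in> Arr C \<Longrightarrow> Gm (Fm f) = f"
    and FG: "\<And>y. y \<in> Obj D \<Longrightarrow> Fo (Go y) = y" "\<And>g. g \<in> Arr D \<Longrightarrow> Fm (Gm g) = g"
begin

lemma inverse_iso: "category_iso D C Go Gm Fo Fm"
  using cat F G GF FG by (simp add: category_iso_def)

lemma hom_GF: "f \<in> hom C x y \<Longrightarrow> Gm (Fm f) = f" and hom_FG: "g \<in> hom D x' y' \<Longrightarrow> Fm (Gm g) = g"
  using GF(2) FG(2) by (auto simp: in_hom)

lemma F_hom_iff:
  assumes "x \<in> Obj C" "y \<in> Obj C" shows "hom D (Fo x) (Fo y) = Fm ` hom C x y"
proof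
  show "hom D (Fo x) (Fo y) \<subseteq> Fm ` hom C x y"
  proof
    fix g assume g: "g \<in> hom D (Fo x) (Fo y)"
    then have "Gm g \<in> hom C x y" using functor_hom[OF G g] GF assms by simp
    then show "g \<in> Fm ` hom C x y" using hom_FG[OF g] by (metis imageI)
  qed
qed (use functor_hom[OF F] in blast)

lemma cone_F:
  assumes "category J" "is_functor J C Do Dm" "is_cone J C Do Dm c p"
  shows "is_cone J D (Fo \<circ> Do) (Fm \<circ> Dm) (Fo c) (Fm \<circ> p)"
  unfolding is_cone_def
proof (intro conjI ballI)
  show "Fo c \<in> Obj D" using assms(3) functor_obj[OF F] unfolding is_cone_def by blast
  fix i assume "i \<in> Obj J"
  then show "(Fm \<circ> p) i \<in> hom D (Fo c) ((Fo \<circ> Do) i)"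
    using assms(3) functor_hom[OF F] unfolding is_cone_def by auto
next
  fix u assume u: "u \<in> Arr J"
  then have "Dom J u \<in> Obj J" using assms(1) unfolding category_def by auto
  then have "p (Dom J u) \<in> hom C c (Do (Dom J u))" "Cmp C (Dm u) (p (Dom J u)) = p (Cod J u)"
    using assms(3) u unfolding is_cone_def by auto
  then show "Cmp D ((Fm \<circ> Dm) u) ((Fm \<circ> p) (Dom J u)) = (Fm \<circ> p) (Cod J u)"
    using functor_cmp[OF F _ functor_Arr[OF assms(2) u]] by (metis comp_apply)
qed

lemma cocone_F:
  assumes "category J" "is_functor J C Do Dm" "is_cocone J C Do Dm c p"
  shows "is_cocone J D (Fo \<circ> Do) (Fm \<circ> Dm) (Fo c) (Fm \<circ> p)"
  unfolding is_cocone_def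
proof (intro conjI ballI)
  show "Fo c \<in> Obj D" using assms(3) functor_obj[OF F] unfolding is_cocone_def by blast
  fix i assume "i \<in> Obj J"
  then show "(Fm \<circ> p) i \<in> hom D ((Fo \<circ> Do) i) (Fo c)"
    using assms(3) functor_hom[OF F] unfolding is_cocone_def by auto
next
  fix u assume u: "u \<in> Arr J"
  then have "Cod J u \<in> Obj J" using assms(1) unfolding category_def by auto
  then have "p (Cod J u) \<in> hom C (Do (Cod J u)) c" "Cmp C (p (Cod J u)) (Dm u) = p (Dom J u)"
    using assms(3) u unfolding is_cocone_def by auto
  then show "Cmp D ((Fm \<circ> p) (Cod J u)) ((Fm \<circ> Dm) u) = (Fm \<circ> p) (Dom J u)"
    using functor_cmp[OF F functor_Arr[OF assms(2) u]] by (metis comp_apply)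
qed

end

text \<open>\<open>Go\<close> undoes \<open>Fo\<close> on objects of \<open>C\<close> only, so a
  diagram moved to \<open>D\<close> and back agrees with the original just on the objects and arrows
  of \<open>J\<close>. Cones see no more than that.\<close>

lemma cone_cong:
  assumes "category J" "\<And>i. i \<in> Obj J \<Longrightarrow> Do i = Do' i" "\<And>u. u \<in> Arr J \<Longrightarrow> Dm u = Dm' u"
  shows "is_cone J C Do Dm c p \<longleftrightarrow> is_cone J C Do' Dm' c p"
    "is_cocone J C Do Dm c p \<longleftrightarrow> is_cocone J C Do' Dm' c p"
  using assms unfolding is_cone_def is_cocone_def category_def by auto

context category_iso
begin

lemma G_diagram:
  assumes "category J" "is_functor J D Do Dm"
  shows "i \<in> Obj J \<Longrightarrow> (Fo \<circ> (Go \<circ> Do)) i = Do i" "u \<in> Arr J \<Longrightarrow> (Fm \<circ> (Gm \<circ> Dm)) u = Dm u"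
  using functor_obj[OF assms(2)] functor_Arr[OF assms(2)] FG by (auto simp: in_hom)

text \<open>A cone \<open>q\<close> in \<open>C\<close> is factored by factoring its image in
  \<open>D\<close> and bringing the result back; uniqueness survives because \<open>Gm\<close>
  undoes \<open>Fm\<close>.\<close>

lemma limit_G:
  assumes J: "category J" and DF: "is_functor J C Do Dm"
    and lim: "is_limit J D (Fo \<circ> Do) (Fm \<circ> Dm) c p"
  shows "is_limit J C Do Dm (Go c) (Gm \<circ> p)"
  unfolding is_limit_def
proof (intro conjI allI impI)
  interpret I: category_iso D C Go Gm Fo Fm by (rule inverse_iso)
  have FD: "is_functor J D (Fo \<circ> Do) (Fm \<circ> Dm)" using DF F by (rule functor_compose)
  have cone: "is_cone J D (Fo \<circ> Do) (Fm \<circ> Dm) c p" using lim by (simp add: is_limit_def)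
  have eqs: "i \<in> Obj J \<Longrightarrow> (Go \<circ> (Fo \<circ> Do)) i = Do i" "u \<in> Arr J \<Longrightarrow> (Gm \<circ> (Fm \<circ> Dm)) u = Dm u" for i u
    using I.G_diagram[OF J DF] by auto
  show Gcone: "is_cone J C Do Dm (Go c) (Gm \<circ> p)"
    using I.cone_F[OF J FD cone] by (subst (asm) cone_cong(1)[OF J eqs])
  fix d q assume q: "is_cone J C Do Dm d q"
  have Fq: "is_cone J D (Fo \<circ> Do) (Fm \<circ> Dm) (Fo d) (Fm \<circ> q)" by (rule cone_F[OF J DF q])
  then have ex1: "\<exists>!h. h \<in> hom D (Fo d) c \<and> (\<forall>i\<in>Obj J. Cmp D (p i) h = (Fm \<circ> q) i)"
    using lim unfolding is_limit_def by blast
  then obtain h where h: "h \<in> hom D (Fo d) c" "\<And>i. i \<in> Obj J \<Longrightarrow> Cmp D (p i) h = Fm (q i)" by auto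
  have d: "d \<in> Obj C" and qi: "\<And>i. i \<in> Obj J \<Longrightarrow> q i \<in> hom C d (Do i)" using q unfolding is_cone_def by auto
  have c: "c \<in> Obj D" and pi: "\<And>i. i \<in> Obj J \<Longrightarrow> p i \<in> hom D c (Fo (Do i))"
    using cone unfolding is_cone_def by auto
  show "\<exists>!h. h \<in> hom C d (Go c) \<and> (\<forall>i\<in>Obj J. Cmp C ((Gm \<circ> p) i) h = q i)"
  proof (rule ex1I[of _ "Gm h"], intro conjI ballI)
    show "Gm h \<in> hom C d (Go c)" using functor_hom[OF G h(1)] GF d by simp
    show "Cmp C ((Gm \<circ> p) i) (Gm h) = q i" if i: "i \<in> Obj J" for i
      using functor_cmp[OF G h(1) pi[OF i]] h(2)[OF i] hom_GF[OF qi[OF i]] by simp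
  next
    fix k assume k: "k \<in> hom C d (Go c) \<and> (\<forall>i\<in>Obj J. Cmp C ((Gm \<circ> p) i) k = q i)"
    have "Fm k \<in> hom D (Fo d) c" using k functor_hom[OF F, of k] FG c by metis
    moreover have "Cmp D (p i) (Fm k) = Fm (q i)" if i: "i \<in> Obj J" for i
    proof -
      have "Gm (p i) \<in> hom C (Go c) (Go (Fo (Do i)))" by (rule functor_hom[OF G pi[OF i]])
      then have "Fm (Cmp C (Gm (p i)) k) = Cmp D (Fm (Gm (p i))) (Fm k)"
        using functor_cmp[OF F] k by blast
      then show ?thesis using k i hom_FG[OF pi[OF i]] by simp
    qed
    ultimately have "Fm k = h" using h by (intro ex1_equality[OF ex1]) auto
    then show "k = Gm h" using hom_GF[of k d "Go c"] k by simp
  qed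
qed

lemma colimit_G:
  assumes J: "category J" and DF: "is_functor J C Do Dm"
    and lim: "is_colimit J D (Fo \<circ> Do) (Fm \<circ> Dm) c p"
  shows "is_colimit J C Do Dm (Go c) (Gm \<circ> p)"
  unfolding is_colimit_def
proof (intro conjI allI impI)
  interpret I: category_iso D C Go Gm Fo Fm by (rule inverse_iso)
  have FD: "is_functor J D (Fo \<circ> Do) (Fm \<circ> Dm)" using DF F by (rule functor_compose)
  have cone: "is_cocone J D (Fo \<circ> Do) (Fm \<circ> Dm) c p" using lim by (simp add: is_colimit_def)
  have eqs: "i \<in> Obj J \<Longrightarrow> (Go \<circ> (Fo \<circ> Do)) i = Do i" "u \<in> Arr J \<Longrightarrow> (Gm \<circ> (Fm \<circ> Dm)) u = Dm u" for i u
    using I.G_diagram[OF J DF] by auto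
  show Gcone: "is_cocone J C Do Dm (Go c) (Gm \<circ> p)"
    using I.cocone_F[OF J FD cone] by (subst (asm) cone_cong(2)[OF J eqs])
  fix d q assume q: "is_cocone J C Do Dm d q"
  have Fq: "is_cocone J D (Fo \<circ> Do) (Fm \<circ> Dm) (Fo d) (Fm \<circ> q)" by (rule cocone_F[OF J DF q])
  then have ex1: "\<exists>!h. h \<in> hom D c (Fo d) \<and> (\<forall>i\<in>Obj J. Cmp D h (p i) = (Fm \<circ> q) i)"
    using lim unfolding is_colimit_def by blast
  then obtain h where h: "h \<in> hom D c (Fo d)" "\<And>i. i \<in> Obj J \<Longrightarrow> Cmp D h (p i) = Fm (q i)" by auto
  have d: "d \<in> Obj C" and qi: "\<And>i. i \<in> Obj J \<Longrightarrow> q i \<in> hom C (Do i) d" using q unfolding is_cocone_def by auto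
  have c: "c \<in> Obj D" and pi: "\<And>i. i \<in> Obj J \<Longrightarrow> p i \<in> hom D (Fo (Do i)) c"
    using cone unfolding is_cocone_def by auto
  show "\<exists>!h. h \<in> hom C (Go c) d \<and> (\<forall>i\<in>Obj J. Cmp C h ((Gm \<circ> p) i) = q i)"
  proof (rule ex1I[of _ "Gm h"], intro conjI ballI)
    show "Gm h \<in> hom C (Go c) d" using functor_hom[OF G h(1)] GF d by simp
    show "Cmp C (Gm h) ((Gm \<circ> p) i) = q i" if i: "i \<in> Obj J" for i
      using functor_cmp[OF G pi[OF i] h(1)] h(2)[OF i] hom_GF[OF qi[OF i]] by simp
  next
    fix k assume k: "k \<in> hom C (Go c) d \<and> (\<forall>i\<in>Obj J. Cmp C k ((Gm \<circ> p) i) = q i)"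
    have "Fm k \<in> hom D c (Fo d)" using k functor_hom[OF F, of k] FG c by metis
    moreover have "Cmp D (Fm k) (p i) = Fm (q i)" if i: "i \<in> Obj J" for i
    proof -
      have "Gm (p i) \<in> hom C (Go (Fo (Do i))) (Go c)" by (rule functor_hom[OF G pi[OF i]])
      then have "Fm (Cmp C k (Gm (p i))) = Cmp D (Fm k) (Fm (Gm (p i)))"
        using functor_cmp[OF F] k by blast
      then show ?thesis using k i hom_FG[OF pi[OF i]] by simp
    qed
    ultimately have "Fm k = h" using h by (intro ex1_equality[OF ex1]) auto
    then show "k = Gm h" using hom_GF[of k "Go c" d] k by simp
  qed
qed

text \<open>Preservation is \<open>colimit_G\<close> for the inverse isomorphism, applied to the
  image diagram.\<close>

lemma colimit_F:
  assumes J: "category J" and DF: "is_functor J C Do Dm" and lim: "is_colimit J C Do Dm c p"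
  shows "is_colimit J D (Fo \<circ> Do) (Fm \<circ> Dm) (Fo c) (Fm \<circ> p)"
proof -
  interpret I: category_iso D C Go Gm Fo Fm by (rule inverse_iso)
  have FD: "is_functor J D (Fo \<circ> Do) (Fm \<circ> Dm)" using DF F by (rule functor_compose)
  have eqs: "i \<in> Obj J \<Longrightarrow> (Go \<circ> (Fo \<circ> Do)) i = Do i" "u \<in> Arr J \<Longrightarrow> (Gm \<circ> (Fm \<circ> Dm)) u = Dm u" for i u
    using I.G_diagram[OF J DF] by auto
  have "is_cocone J C (Go \<circ> (Fo \<circ> Do)) (Gm \<circ> (Fm \<circ> Dm)) d q = is_cocone J C Do Dm d q" for d q
    by (rule cone_cong(2)[OF J eqs])
  then have "is_colimit J C (Go \<circ> (Fo \<circ> Do)) (Gm \<circ> (Fm \<circ> Dm)) c p"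
    using lim by (simp add: is_colimit_def)
  then show ?thesis by (rule I.colimit_G[OF J FD])
qed

lemma complete_transfer:
  assumes "complete_category U D" shows "complete_category U C"
  unfolding complete_category_def
proof (intro conjI allI impI)
  fix J :: "('a, 'a) cat" and Do Dm
  assume J: "small_cat J" "is_functor J C Do Dm"
  then have "is_functor J D (Fo \<circ> Do) (Fm \<circ> Dm)" by (intro functor_compose[OF _ F])
  then obtain c p where "is_limit J D (Fo \<circ> Do) (Fm \<circ> Dm) c p"
    using assms J(1) unfolding complete_category_def by blast
  moreover have "category J" using J(1) unfolding small_cat_def by blast
  ultimately show "\<exists>c p. is_limit J C Do Dm c p" using limit_G J(2) by blast
qed (rule cat(1))

lemma cocomplete_transfer:
  assumes "cocomplete_category U D" shows "cocomplete_category U C"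
  unfolding cocomplete_category_def
proof (intro conjI allI impI)
  fix J :: "('a, 'a) cat" and Do Dm
  assume J: "small_cat J" "is_functor J C Do Dm"
  then have "is_functor J D (Fo \<circ> Do) (Fm \<circ> Dm)" by (intro functor_compose[OF _ F])
  then obtain c p where "is_colimit J D (Fo \<circ> Do) (Fm \<circ> Dm) c p"
    using assms J(1) unfolding cocomplete_category_def by blast
  moreover have "category J" using J(1) unfolding small_cat_def by blast
  ultimately show "\<exists>c p. is_colimit J C Do Dm c p" using colimit_G J(2) by blast
qed (rule cat(1))

end


section \<open>Finite presentability\<close>

lemma poset_cat_simps [simp]:
  "Obj (poset_cat I r) = I" "Arr (poset_cat I r) = r" "Dom (poset_cat I r) = fst"
  "Cod (poset_cat I r) = snd" "Id (poset_cat I r) i = (i, i)" "Cmp (poset_cat I r) g f = (fst f, snd g)"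
  by (simp_all add: poset_cat_def)

lemma poset_category: "directed_poset I r \<Longrightarrow> category (poset_cat I r)"
  unfolding directed_poset_def partial_order_on_def preorder_on_def category_def refl_on_def
  by (auto simp: in_hom dest: transD)

text \<open>
  That \<open>hom(k, -)\<close> preserves directed colimits, spelled out on elements. Unlike
  \<open>preserves_directed_colimits\<close> it makes no reference to \<open>Set_cat\<close>, whose test objects
  depend on the type of arrows, so it is visibly invariant under isomorphism of categories.
\<close>

definition finitely_presentable_elementwise :: "'u itself \<Rightarrow> ('o, 'm) cat \<Rightarrow> 'o \<Rightarrow> bool" where
  "finitely_presentable_elementwise U C k \<longleftrightarrow> k \<in> Obj C \<and>
     (\<forall>(I :: 'u set) r Do Dm c p.
        small U I \<longrightarrow> directed_poset I r \<longrightarrow> is_functor (poset_cat I r) C Do Dm \<longrightarrow>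
        is_colimit (poset_cat I r) C Do Dm c p \<longrightarrow>
        (\<forall>g\<in>hom C k c. \<exists>i\<in>I. \<exists>g'\<in>hom C k (Do i). g = Cmp C (p i) g') \<and>
        (\<forall>i\<in>I. \<forall>g\<in>hom C k (Do i). \<forall>g'\<in>hom C k (Do i). Cmp C (p i) g = Cmp C (p i) g' \<longrightarrow>
           (\<exists>j. (i, j) \<in> r \<and> Cmp C (Dm (i, j)) g = Cmp C (Dm (i, j)) g')))"

context
  fixes U :: "'u itself" and C :: "('o, 'm) cat" and k :: 'o and I :: "'u set" and r Do Dm c p
  assumes fp: "finitely_presentable_elementwise U C k"
    and diag: "small U I" "directed_poset I r" "is_functor (poset_cat I r) C Do Dm"
    and colim: "is_colimit (poset_cat I r) C Do Dm c p"
begin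

lemma finitely_presentable_surj:
  "g \<in> hom C k c \<Longrightarrow> \<exists>i\<in>I. \<exists>g'\<in>hom C k (Do i). g = Cmp C (p i) g'"
  using fp diag colim unfolding finitely_presentable_elementwise_def by blast

lemma finitely_presentable_inj:
  "i \<in> I \<Longrightarrow> g \<in> hom C k (Do i) \<Longrightarrow> g' \<in> hom C k (Do i) \<Longrightarrow> Cmp C (p i) g = Cmp C (p i) g' \<Longrightarrow>
    \<exists>j. (i, j) \<in> r \<and> Cmp C (Dm (i, j)) g = Cmp C (Dm (i, j)) g'"
  using fp diag colim unfolding finitely_presentable_elementwise_def by blast

end

text \<open>A test diagram in \<open>D\<close> and its colimit are moved to \<open>C\<close> by the
  inverse functor, where both conditions are available for \<open>k\<close>.\<close>

lemma (in category_iso) finitely_presentable_transfer: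
  assumes "finitely_presentable_elementwise U C k"
  shows "finitely_presentable_elementwise U D (Fo k)"
  unfolding finitely_presentable_elementwise_def
proof (intro conjI allI impI)
  interpret I: category_iso D C Go Gm Fo Fm by (rule inverse_iso)
  have k: "k \<in> Obj C" using assms unfolding finitely_presentable_elementwise_def by blast
  then show "Fo k \<in> Obj D" by (rule functor_obj[OF F])
  fix I :: "'a set" and r Do Dm c p
  assume sI: "small U I" and dp: "directed_poset I r" and DF: "is_functor (poset_cat I r) D Do Dm"
    and col: "is_colimit (poset_cat I r) D Do Dm c p"
  have J: "category (poset_cat I r)" using dp by (rule poset_category)
  have GD: "is_functor (poset_cat I r) C (Go \<circ> Do) (Gm \<circ> Dm)" by (rule functor_compose[OF DF G])
  have Gcol: "is_colimit (poset_cat I r) C (Go \<circ> Do) (Gm \<circ> Dm) (Go c) (Gm \<circ> p)"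
    by (rule I.colimit_F[OF J DF col])
  note surj = finitely_presentable_surj[OF assms sI dp GD Gcol, unfolded comp_def]
    and inj = finitely_presentable_inj[OF assms sI dp GD Gcol, unfolded comp_def]
  have c: "c \<in> Obj D" and pi: "\<And>i. i \<in> I \<Longrightarrow> p i \<in> hom D (Do i) c"
    using col unfolding is_colimit_def is_cocone_def by auto
  have Dij: "Dm (i, j) \<in> hom D (Do i) (Do j)" if "(i, j) \<in> r" for i j
    using functor_Arr[OF DF, of "(i, j)"] that by simp
  show "\<forall>g\<in>hom D (Fo k) c. \<exists>i\<in>I. \<exists>g'\<in>hom D (Fo k) (Do i). g = Cmp D (p i) g'"
  proof
    fix g assume g: "g \<in> hom D (Fo k) c"
    then have "Gm g \<in> hom C k (Go c)" using functor_hom[OF G g] GF k by simp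
    then obtain i g' where i: "i \<in> I" "g' \<in> hom C k (Go (Do i))" "Gm g = Cmp C (Gm (p i)) g'"
      using surj by blast
    have "Fm g' \<in> hom D (Fo k) (Do i)"
      using functor_hom[OF F i(2)] FG category_hom_Obj[OF cat(2) pi[OF i(1)]] by simp
    moreover have "g = Cmp D (p i) (Fm g')"
      using functor_cmp[OF F i(2) functor_hom[OF G pi[OF i(1)]]] i(3) hom_FG[OF g] hom_FG[OF pi[OF i(1)]]
      by simp
    ultimately show "\<exists>i\<in>I. \<exists>g'\<in>hom D (Fo k) (Do i). g = Cmp D (p i) g'" using i by blast
  qed
  show "\<forall>i\<in>I. \<forall>g\<in>hom D (Fo k) (Do i). \<forall>g'\<in>hom D (Fo k) (Do i). Cmp D (p i) g = Cmp D (p i) g' \<longrightarrow>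
           (\<exists>j. (i, j) \<in> r \<and> Cmp D (Dm (i, j)) g = Cmp D (Dm (i, j)) g')"
  proof (intro ballI impI)
    fix i g g' assume i: "i \<in> I" and g: "g \<in> hom D (Fo k) (Do i)" and g': "g' \<in> hom D (Fo k) (Do i)"
      and eq: "Cmp D (p i) g = Cmp D (p i) g'"
    have hg: "Gm g \<in> hom C k (Go (Do i))" "Gm g' \<in> hom C k (Go (Do i))"
      using functor_hom[OF G g] functor_hom[OF G g'] GF k by simp_all
    have "Cmp C (Gm (p i)) (Gm g) = Cmp C (Gm (p i)) (Gm g')"
      using functor_cmp[OF G g pi[OF i]] functor_cmp[OF G g' pi[OF i]] eq by simp
    then obtain j where j: "(i, j) \<in> r" "Cmp C (Gm (Dm (i, j))) (Gm g) = Cmp C (Gm (Dm (i, j))) (Gm g')"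
      using inj[OF i hg] by blast
    have "Cmp D (Dm (i, j)) x \<in> hom D (Fo k) (Do j)" if "x \<in> hom D (Fo k) (Do i)" for x
      using category_cmp[OF cat(2) that Dij[OF j(1)]] .
    then have "Cmp D (Dm (i, j)) g = Cmp D (Dm (i, j)) g'"
      using j(2) functor_cmp[OF G g Dij[OF j(1)]] functor_cmp[OF G g' Dij[OF j(1)]] g g' hom_FG by metis
    then show "\<exists>j. (i, j) \<in> r \<and> Cmp D (Dm (i, j)) g = Cmp D (Dm (i, j)) g'" using j by blast
  qed
qed

lemma Set_cat_simps [simp]:
  "Obj Set_cat = UNIV" "Dom Set_cat x = fst x" "Cod Set_cat x = snd (snd x)"
  "(A, f, B) \<in> Arr Set_cat \<longleftrightarrow> f \<in> A \<rightarrow>\<^sub>E B"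
  "Cmp Set_cat (B', g, C) (A, f, B) = (A, compose A g f, C)"
  by (simp_all add: Set_cat_def)

lemma Set_cat_hom: "x \<in> hom Set_cat A B \<longleftrightarrow> (\<exists>f \<in> A \<rightarrow>\<^sub>E B. x = (A, f, B))"
  by (cases x) (auto simp: in_hom)

text \<open>The usual recognition of directed colimits of sets: the legs are jointly surjective, and
  elements that a leg identifies are already identified at a later stage.\<close>

lemma Set_cat_directed_colimit:
  assumes dp: "directed_poset I r"
    and D: "\<And>i j. (i, j) \<in> r \<Longrightarrow> E (i, j) = (S i, d i j, S j) \<and> d i j \<in> S i \<rightarrow>\<^sub>E S j"
    and q: "\<And>i. i \<in> I \<Longrightarrow> q i = (S i, e i, X) \<and> e i \<in> S i \<rightarrow>\<^sub>E X"
    and comm: "\<And>i j x. (i, j) \<in> r \<Longrightarrow> x \<in> S i \<Longrightarrow> e j (d i j x) = e i x"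
    and surj: "\<And>x. x \<in> X \<Longrightarrow> \<exists>i\<in>I. \<exists>y\<in>S i. x = e i y"
    and inj: "\<And>i x y. i \<in> I \<Longrightarrow> x \<in> S i \<Longrightarrow> y \<in> S i \<Longrightarrow> e i x = e i y \<Longrightarrow> \<exists>j. (i, j) \<in> r \<and> d i j x = d i j y"
  shows "is_colimit (poset_cat I r) Set_cat S E X q"
  unfolding is_colimit_def
proof (intro conjI allI impI)
  have rI: "i \<in> I" "j \<in> I" if "(i, j) \<in> r" for i j
    using that dp unfolding directed_poset_def partial_order_on_def preorder_on_def by auto
  show "is_cocone (poset_cat I r) Set_cat S E X q"
    unfolding is_cocone_def
  proof (intro conjI ballI)
    fix u assume "u \<in> Arr (poset_cat I r)"
    then obtain i j where u: "u = (i, j)" "(i, j) \<in> r" by (cases u) auto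
    have "compose (S i) (e j) (d i j) = e i"
      using comm[OF u(2)] q[OF rI(1)[OF u(2)]] by (intro compose_eqI) blast+
    then show "Cmp Set_cat (q (Cod (poset_cat I r) u)) (E u) = q (Dom (poset_cat I r) u)"
      using u D q rI by simp
  qed (use q in \<open>auto simp: Set_cat_hom\<close>)
  fix Y q' assume "is_cocone (poset_cat I r) Set_cat S E Y q'"
  then have q': "\<And>i. i \<in> I \<Longrightarrow> q' i \<in> hom Set_cat (S i) Y"
    "\<And>i j. (i, j) \<in> r \<Longrightarrow> Cmp Set_cat (q' j) (E (i, j)) = q' i"
    unfolding is_cocone_def by auto
  then have "\<forall>i\<in>I. \<exists>f \<in> S i \<rightarrow>\<^sub>E Y. q' i = (S i, f, Y)" by (simp add: Set_cat_hom)
  then obtain f where f: "\<And>i. i \<in> I \<Longrightarrow> f i \<in> S i \<rightarrow>\<^sub>E Y" "\<And>i. i \<in> I \<Longrightarrow> q' i = (S i, f i, Y)"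
    by metis
  have fc: "f j (d i j x) = f i x" if "(i, j) \<in> r" "x \<in> S i" for i j x
  proof -
    have "compose (S i) (f j) (d i j) = f i" using q'(2)[OF that(1)] f(2) rI[OF that(1)] D[OF that(1)] by simp
    then show ?thesis using that(2) by (metis compose_eq)
  qed
  \<comment> \<open>\<open>inj\<close> compares elements of a single stage, so \<open>x\<close> and
    \<open>y\<close> are first moved to an upper bound \<open>k\<close> and then on to a stage
    \<open>l\<close> where they coincide.\<close>
  have wd: "f i x = f j y" if ij: "i \<in> I" "j \<in> I" "x \<in> S i" "y \<in> S j" "e i x = e j y" for i j x y
  proof -
    obtain k where k: "k \<in> I" "(i, k) \<in> r" "(j, k) \<in> r" using dp ij unfolding directed_poset_def by blast
    have m: "d i k x \<in> S k" "d j k y \<in> S k" using D k ij by auto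
    have "e k (d i k x) = e k (d j k y)" using comm k ij by simp
    then obtain l where l: "(k, l) \<in> r" "d k l (d i k x) = d k l (d j k y)" using inj[OF k(1) m] by blast
    have "f i x = f l (d k l (d i k x))" using fc[OF k(2)] fc[OF l(1)] ij m by simp
    also have "\<dots> = f j y" unfolding l(2) using fc[OF k(3)] fc[OF l(1)] ij m by simp
    finally show ?thesis .
  qed
  define h where "h = (\<lambda>x\<in>X. let (i, y) = SOME (i, y). i \<in> I \<and> y \<in> S i \<and> x = e i y in f i y)"
  have h: "h (e i y) = f i y" if "i \<in> I" "y \<in> S i" for i y
  proof -
    have eX: "e i y \<in> X" using q that by auto
    obtain j z where jz: "(SOME (j, z). j \<in> I \<and> z \<in> S j \<and> e i y = e j z) = (j, z)" by fastforce
    have "case (j, z) of (j, z) \<Rightarrow> j \<in> I \<and> z \<in> S j \<and> e i y = e j z"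
      unfolding jz[symmetric] by (rule someI[of _ "(i, y)"]) (use that in auto)
    then show ?thesis using wd[of j i z y] that eX jz by (simp add: h_def)
  qed
  have hY: "h \<in> X \<rightarrow>\<^sub>E Y"
  proof (rule PiE_I)
    show "h x \<in> Y" if "x \<in> X" for x using surj[OF that] h f by (metis PiE_mem)
  qed (simp add: h_def)
  show "\<exists>!h. h \<in> hom Set_cat X Y \<and> (\<forall>i\<in>Obj (poset_cat I r). Cmp Set_cat h (q i) = q' i)"
  proof (rule ex1I[of _ "(X, h, Y)"], intro conjI ballI)
    show "(X, h, Y) \<in> hom Set_cat X Y" using hY by (simp add: Set_cat_hom)
    fix i assume "i \<in> Obj (poset_cat I r)"
    then have i: "i \<in> I" by simp
    have "compose (S i) h (e i) = f i"
      using h[OF i] f(1)[OF i] by (intro compose_eqI) blast+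
    then show "Cmp Set_cat (X, h, Y) (q i) = q' i" using i q f by simp
  next
    fix k assume k: "k \<in> hom Set_cat X Y \<and> (\<forall>i\<in>Obj (poset_cat I r). Cmp Set_cat k (q i) = q' i)"
    then obtain g where g: "g \<in> X \<rightarrow>\<^sub>E Y" "k = (X, g, Y)" by (auto simp: Set_cat_hom)
    have "g (e i y) = h (e i y)" if "i \<in> I" "y \<in> S i" for i y
    proof -
      have "compose (S i) g (e i) = f i" using k g that q f by auto
      then show ?thesis using h that by (metis compose_eq)
    qed
    then have "g x = h x" if "x \<in> X" for x using surj[OF that] by auto
    then have "g = h" using g(1) hY by (auto intro: PiE_ext)
    then show "k = (X, h, Y)" using g by simp
  qed
qed

text \<open>The two elementwise conditions are joint surjectivity and eventual equality for the sets
  \<open>hom C k (Do i)\<close>, as the criterion for colimits in \<open>Set_cat\<close>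
  demands.\<close>

lemma finitely_presentable_elementwiseD:
  fixes U :: "'u itself" and C :: "('o, 'm) cat"
  assumes C: "category C" and fp: "finitely_presentable_elementwise U C k"
  shows "finitely_presentable U C k"
  unfolding finitely_presentable_def preserves_directed_colimits_def
proof (intro conjI allI impI)
  show "k \<in> Obj C" using fp unfolding finitely_presentable_elementwise_def by blast
  fix I :: "'u set" and r Do Dm c p
  assume sI: "small U I" and dp: "directed_poset I r" and DF: "is_functor (poset_cat I r) C Do Dm"
    and col: "is_colimit (poset_cat I r) C Do Dm c p"
  have pi: "p i \<in> hom C (Do i) c" if "i \<in> I" for i
    using col that unfolding is_colimit_def is_cocone_def by auto
  have pij: "Cmp C (p j) (Dm (i, j)) = p i" if "(i, j) \<in> r" for i j
    using col that unfolding is_colimit_def is_cocone_def by force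
  have Dij: "Dm (i, j) \<in> hom C (Do i) (Do j)" if "(i, j) \<in> r" for i j
    using functor_Arr[OF DF, of "(i, j)"] that by simp
  have rI: "i \<in> I" "j \<in> I" if "(i, j) \<in> r" for i j
    using that dp unfolding directed_poset_def partial_order_on_def preorder_on_def by auto
  have hm: "hom_map C k f = (hom C k x, \<lambda>g\<in>hom C k x. Cmp C f g, hom C k y)" if "f \<in> hom C x y" for f x y
    using that by (simp add: hom_map_def in_hom)
  show "is_colimit (poset_cat I r) Set_cat (hom C k \<circ> Do) (hom_map C k \<circ> Dm) (hom C k c) (hom_map C k \<circ> p)"
  proof (rule Set_cat_directed_colimit[OF dp, where d = "\<lambda>i j. \<lambda>g\<in>hom C k (Do i). Cmp C (Dm (i, j)) g"
        and e = "\<lambda>i. \<lambda>g\<in>hom C k (Do i). Cmp C (p i) g"])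
    fix i j assume "(i, j) \<in> r"
    then show "(hom_map C k \<circ> Dm) (i, j) = ((hom C k \<circ> Do) i, \<lambda>g\<in>hom C k (Do i). Cmp C (Dm (i, j)) g,
        (hom C k \<circ> Do) j) \<and> (\<lambda>g\<in>hom C k (Do i). Cmp C (Dm (i, j)) g) \<in> (hom C k \<circ> Do) i \<rightarrow>\<^sub>E (hom C k \<circ> Do) j"
      using hm[OF Dij] category_cmp[OF C _ Dij] by auto
  next
    fix i assume i: "i \<in> I"
    then show "(hom_map C k \<circ> p) i = ((hom C k \<circ> Do) i, \<lambda>g\<in>hom C k (Do i). Cmp C (p i) g, hom C k c) \<and>
        (\<lambda>g\<in>hom C k (Do i). Cmp C (p i) g) \<in> (hom C k \<circ> Do) i \<rightarrow>\<^sub>E hom C k c"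
      using hm[OF pi] category_cmp[OF C _ pi] by auto
  next
    fix i j g assume ij: "(i, j) \<in> r" and g: "g \<in> (hom C k \<circ> Do) i"
    then have "Cmp C (p j) (Cmp C (Dm (i, j)) g) = Cmp C (p i) g"
      using category_assoc[OF C _ Dij[OF ij] pi[OF rI(2)[OF ij]], of g k] pij[OF ij] by simp
    then show "(\<lambda>g\<in>hom C k (Do j). Cmp C (p j) g) ((\<lambda>g\<in>hom C k (Do i). Cmp C (Dm (i, j)) g) g) =
        (\<lambda>g\<in>hom C k (Do i). Cmp C (p i) g) g"
      using g category_cmp[OF C _ Dij[OF ij], of g k] by simp
  next
    fix g assume "g \<in> hom C k c"
    then show "\<exists>i\<in>I. \<exists>y\<in>(hom C k \<circ> Do) i. g = (\<lambda>g\<in>hom C k (Do i). Cmp C (p i) g) y"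
      using finitely_presentable_surj[OF fp sI dp DF col] by fastforce
  next
    fix i g g' assume i: "i \<in> I" "g \<in> (hom C k \<circ> Do) i" "g' \<in> (hom C k \<circ> Do) i"
      "(\<lambda>g\<in>hom C k (Do i). Cmp C (p i) g) g = (\<lambda>g\<in>hom C k (Do i). Cmp C (p i) g) g'"
    then have g: "g \<in> hom C k (Do i)" "g' \<in> hom C k (Do i)" "Cmp C (p i) g = Cmp C (p i) g'" by simp_all
    then have "\<exists>j. (i, j) \<in> r \<and> Cmp C (Dm (i, j)) g = Cmp C (Dm (i, j)) g'"
      using finitely_presentable_inj[OF fp sI dp DF col] i(1) by blast
    then show "\<exists>j. (i, j) \<in> r \<and> (\<lambda>g\<in>hom C k (Do i). Cmp C (Dm (i, j)) g) g =
        (\<lambda>g\<in>hom C k (Do i). Cmp C (Dm (i, j)) g) g'" using g by auto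
  qed
qed

text \<open>Presentability is assumed in its elementwise form in \<open>D\<close>, moved in that
  form, and converted to the form with \<open>Set_cat\<close> only in \<open>C\<close>, where the
  type of arrows is the right one.\<close>

lemma (in category_iso) lfp_transfer:
  assumes homs: "\<And>x y. x \<in> Obj D \<Longrightarrow> y \<in> Obj D \<Longrightarrow> small U (hom D x y)"
    and cocomplete: "cocomplete_category U D"
    and A: "A \<subseteq> Obj D" "small U A" "\<And>k. k \<in> A \<Longrightarrow> finitely_presentable_elementwise U D k"
    and gen: "\<And>x. x \<in> Obj D \<Longrightarrow> is_directed_colimit_of U D A x"
  shows "locally_finitely_presentable U C"
  unfolding locally_finitely_presentable_def
proof (intro conjI ballI exI[of _ "Go ` A"])
  interpret I: category_iso D C Go Gm Fo Fm by (rule inverse_iso)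
  show "category C" by (rule cat(1))
  show "cocomplete_category U C" using cocomplete by (rule cocomplete_transfer)
  show "Go ` A \<subseteq> Obj C" using A(1) functor_obj[OF G] by blast
  show "small U (Go ` A)" using A(2) by (rule small_image)
  show "finitely_presentable U C k" if "k \<in> Go ` A" for k
    using that A(3) I.finitely_presentable_transfer finitely_presentable_elementwiseD[OF cat(1)] by blast
  show "small U (hom C x y)" if xy: "x \<in> Obj C" "y \<in> Obj C" for x y
  proof (rule small_inj[of Fm])
    show "inj_on Fm (hom C x y)" by (rule inj_on_inverseI[of _ Gm]) (rule hom_GF)
    show "Fm ` hom C x y \<subseteq> hom D (Fo x) (Fo y)" using F_hom_iff[OF xy] by simp
    show "small U (hom D (Fo x) (Fo y))" using homs xy functor_obj[OF F] by simp
  qed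
  fix x assume x: "x \<in> Obj C"
  then have "is_directed_colimit_of U D A (Fo x)" using gen functor_obj[OF F] by blast
  then obtain I :: "'a set" and r Do Dm p where *: "small U I" "directed_poset I r"
    "is_functor (poset_cat I r) D Do Dm" "Do ` I \<subseteq> A" "is_colimit (poset_cat I r) D Do Dm (Fo x) p"
    unfolding is_directed_colimit_of_def by blast
  have "is_colimit (poset_cat I r) C (Go \<circ> Do) (Gm \<circ> Dm) (Go (Fo x)) (Gm \<circ> p)"
    using poset_category * I.colimit_F by blast
  then have "is_colimit (poset_cat I r) C (Go \<circ> Do) (Gm \<circ> Dm) x (Gm \<circ> p)" using GF x by simp
  moreover have "is_functor (poset_cat I r) C (Go \<circ> Do) (Gm \<circ> Dm)" by (rule functor_compose[OF *(3) G])
  moreover have "(Go \<circ> Do) ` I \<subseteq> Go ` A" using *(4) by auto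
  ultimately show "is_directed_colimit_of U C (Go ` A) x"
    using *(1,2) unfolding is_directed_colimit_of_def by blast
qed

section \<open>Partial algebras presented by generators and relations\<close>

text \<open>Wherever sorts matter, a generator is a pair of a name and a sort.\<close>

datatype ('f, 'g) ct = Gen 'g | App 'f "('f, 'g) ct list"

instance ct :: (countable, countable) countable
  by countable_datatype

primrec inst :: "('f, 'g) ct list \<Rightarrow> 'f tm \<Rightarrow> ('f, 'g) ct" where
  "inst ts (Var n) = ts ! n"
| "inst ts (Op f ps) = App f (map (inst ts) ps)"

primrec gens :: "('f, 'g) ct \<Rightarrow> 'g set" where
  "gens (Gen g) = {g}"
| "gens (App f ts) = \<Union> (set (map gens ts))"

definition Gens :: "(('f, 'g) ct \<times> ('f, 'g) ct) set \<Rightarrow> 'g set" where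
  "Gens R = (\<Union>(t, u)\<in>R. gens t \<union> gens u)"

text \<open>Valuations are partial because a presentation gives values only to the generators that
  it mentions; a term containing a generator without value is undefined.\<close>

primrec ev :: "('s, 'f, 'u) partial_algebra \<Rightarrow> ('g \<rightharpoonup> 'u) \<Rightarrow> ('f, 'g) ct \<Rightarrow> 'u option" where
  "ev M h (Gen g) = h g"
| "ev M h (App f ts) = (case those (map (ev M h) ts) of None \<Rightarrow> None | Some ys \<Rightarrow> interp M f ys)"

text \<open>Existential equality: the equation includes the definedness of both sides, and
  \<open>holds M h t t\<close> says that \<open>t\<close> is defined.\<close>

definition holds ::
  "('s, 'f, 'u) partial_algebra \<Rightarrow> ('g \<rightharpoonup> 'u) \<Rightarrow> ('f, 'g) ct \<Rightarrow> ('f, 'g) ct \<Rightarrow> bool" where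
  "holds M h t u \<longleftrightarrow> (\<exists>y. ev M h t = Some y \<and> ev M h u = Some y)"

definition valuation :: "('s, 'f, 'u) partial_algebra \<Rightarrow> ('a \<times> 's \<rightharpoonup> 'u) \<Rightarrow> bool" where
  "valuation M h \<longleftrightarrow> (\<forall>g x. h g = Some x \<longrightarrow> x \<in> carrier M (snd g))"

definition hmap :: "('s \<Rightarrow> 'u \<Rightarrow> 'v) \<Rightarrow> ('a \<times> 's \<rightharpoonup> 'u) \<Rightarrow> ('a \<times> 's \<rightharpoonup> 'v)" where
  "hmap k h g = map_option (k (snd g)) (h g)"

lemma those_eq_Some: "those (map g ts) = Some ys \<longleftrightarrow> list_all2 (\<lambda>t y. g t = Some y) ts ys"
  by (induction ts arbitrary: ys) (auto simp: list_all2_Cons1 split: option.splits)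

lemma ev_App:
  "ev M h (App f ts) = Some z \<longleftrightarrow>
     (\<exists>ys. list_all2 (\<lambda>t y. ev M h t = Some y) ts ys \<and> interp M f ys = Some z)"
  by (auto simp: those_eq_Some[symmetric] split: option.splits)

lemma eval_Op:
  "eval_tm M xs (Op f ps) = Some z \<longleftrightarrow>
     (\<exists>ys. list_all2 (\<lambda>p y. eval_tm M xs p = Some y) ps ys \<and> interp M f ys = Some z)"
  by (auto simp: those_eq_Some[symmetric] split: option.splits)

lemma list_all2_Some_determ:
  "list_all2 (\<lambda>t y. g t = Some y) ts ys \<Longrightarrow> list_all2 (\<lambda>t y. g t = Some y) ts zs \<Longrightarrow> ys = zs"
  by (metis option.inject those_eq_Some)

lemma ev_mono: "h \<subseteq>\<^sub>m h' \<Longrightarrow> ev M h t = Some y \<Longrightarrow> ev M h' t = Some y"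
proof (induction t arbitrary: y)
  case (App f ts)
  then obtain ys where "list_all2 (\<lambda>t y. ev M h t = Some y) ts ys" "interp M f ys = Some y"
    unfolding ev_App by blast
  then show ?case unfolding ev_App
    by (intro exI[of _ ys]) (use App in \<open>auto intro: list.rel_mono_strong\<close>)
next
  case (Gen g)
  then have "g \<in> dom h" by (simp add: domI)
  with Gen show ?case by (simp add: map_le_def)
qed

lemma holds_mono: "h \<subseteq>\<^sub>m h' \<Longrightarrow> holds M h t u \<Longrightarrow> holds M h' t u"
  unfolding holds_def by (elim exE conjE) (intro exI conjI; erule ev_mono)

lemma ev_cong: "(\<And>g. g \<in> gens t \<Longrightarrow> h g = h' g) \<Longrightarrow> ev M h t = ev M h' t"
proof (induction t)
  case (App f ts)
  then have "map (ev M h) ts = map (ev M h') ts" by auto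
  then show ?case by (simp only: ev.simps)
qed simp

lemma ev_gens: "ev M h t = Some y \<Longrightarrow> g \<in> gens t \<Longrightarrow> h g \<noteq> None"
proof (induction t arbitrary: y)
  case (App f ts)
  then obtain ys where ys: "list_all2 (\<lambda>t y. ev M h t = Some y) ts ys" unfolding ev_App by blast
  obtain t where t: "t \<in> set ts" "g \<in> gens t" using App.prems by auto
  then obtain y where "ev M h t = Some y" using ys by (auto simp: list_all2_conv_all_nth in_set_conv_nth)
  then show ?case using App.IH t by blast
qed simp

lemma holds_gens: "holds M h t u \<Longrightarrow> g \<in> gens t \<union> gens u \<Longrightarrow> h g \<noteq> None"
  unfolding holds_def by (elim exE conjE UnE) (rule ev_gens; assumption)+

lemma finite_gens: "finite (gens t)"
  by (induction t) auto

lemma finite_Gens: "finite R \<Longrightarrow> finite (Gens R)"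
  unfolding Gens_def by (auto simp: finite_gens)

lemma ev_rename: "ev M h (map_ct (\<lambda>x. x) r t) = ev M (h \<circ> r) t"
proof (induction t)
  case (App f ts)
  then have "map (ev M h) (map (map_ct (\<lambda>x. x) r) ts) = map (ev M (h \<circ> r)) ts"
    unfolding map_map by (intro map_cong[OF refl], subst comp_apply) (rule App)
  then show ?case by (simp only: ev.simps ct.map)
qed simp

lemma gens_rename: "gens (map_ct (\<lambda>x. x) r t) = r ` gens t"
  by (induction t) auto

lemma hmap_le_iff: "hmap k h \<subseteq>\<^sub>m h' \<longleftrightarrow> (\<forall>g x. h g = Some x \<longrightarrow> h' g = Some (k (snd g) x))"
  unfolding map_le_def hmap_def by (auto simp: dom_def) (metis option.simps(9))

lemma (in universe) small_terms:
  assumes "small TYPE('u) G" shows "small TYPE('u) {t :: ('f :: countable, 'g) ct. gens t \<subseteq> G}"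
proof -
  \<comment> \<open>\<open>S n\<close> consists of the terms over \<open>G\<close> of height at most
    \<open>n\<close>. Operations have finitely many arguments, so countably many stages exhaust the
    terms.\<close>
  define S where "S n = ((\<lambda>X. Gen ` G \<union> case_prod App ` ((UNIV :: 'f set) \<times> lists X)) ^^ n) {}" for n
  have Suc_eq: "S (Suc n) = Gen ` G \<union> case_prod App ` ((UNIV :: 'f set) \<times> lists (S n))" for n by (simp add: S_def)
  have small_S: "small TYPE('u) (S n)" for n
  proof (induction n)
    case (Suc n)
    show ?case unfolding Suc_eq
      by (intro small_Un small_image small_Sigma small_lists assms Suc) (rule small_countable, simp)
  qed (simp add: S_def small_countable)
  have mono: "S n \<subseteq> S (Suc n)" for n
  proof (induction n)
    case (Suc n)
    then have "lists (S n) \<subseteq> lists (S (Suc n))" by (rule lists_mono)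
    then show ?case unfolding Suc_eq[of n] Suc_eq[of "Suc n"] by (intro Un_mono image_mono Sigma_mono) auto
  qed (simp add: S_def)
  have "gens t \<subseteq> G \<Longrightarrow> \<exists>n. t \<in> S n" for t
  proof (induction t)
    case (Gen g)
    then show ?case by (intro exI[of _ 1]) (simp add: S_def)
  next
    case (App f ts)
    then have "\<forall>t\<in>set ts. \<exists>n. t \<in> S n" by auto
    then obtain n where n: "\<And>t. t \<in> set ts \<Longrightarrow> t \<in> S (n t)" by metis
    define m where "m = Max (insert 0 (n ` set ts))"
    have "t \<in> S m" if "t \<in> set ts" for t
    proof -
      have "n t \<le> m" unfolding m_def by (rule Max_ge) (use that in auto)
      then show ?thesis using n[OF that] lift_Suc_mono_le[of S, OF mono] by blast
    qed
    then have "App f ts \<in> S (Suc m)" unfolding Suc_eq by (auto intro!: image_eqI[of _ _ "(f, ts)"])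
    then show ?case by blast
  qed
  then have "{t. gens t \<subseteq> G} \<subseteq> (\<Union>n. S n)" by blast
  then show ?thesis by (rule small_subset) (intro small_UN small_S small_countable countableI_type)
qed


section \<open>Sorted terms, provable equality and its soundness\<close>

locale ea =
  fixes T :: "('s, 'f) ea_theory"
  assumes ea: "essentially_algebraic_theory T"
begin

text \<open>\<open>dom_eqs\<close> is junk on total operations.\<close>

definition dq :: "'f \<Rightarrow> ('f tm \<times> 'f tm) set" where
  "dq f = (if f \<in> total_ops T then {} else dom_eqs T f)"

lemma op_sorts: "f \<in> ops T \<Longrightarrow> set (arity T f) \<subseteq> sorts T" "f \<in> ops T \<Longrightarrow> result T f \<in> sorts T"
  using ea unfolding essentially_algebraic_theory_def by blast+

lemma total_op: "f \<in> total_ops T \<Longrightarrow> f \<in> ops T \<and> dq f = {}"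
  using ea unfolding essentially_algebraic_theory_def dq_def by auto

lemma dq_finite: "f \<in> ops T \<Longrightarrow> finite (dq f)"
  using ea unfolding essentially_algebraic_theory_def dq_def by auto

lemma dq_sort:
  assumes "f \<in> ops T" "(p, q) \<in> dq f"
  shows "\<exists>s. has_sort T (arity T f) p s \<and> has_sort T (arity T f) q s"
    "op_symbols p \<subseteq> total_ops T" "op_symbols q \<subseteq> total_ops T"
proof -
  have "f \<in> ops T - total_ops T" "(p, q) \<in> dom_eqs T f" using assms unfolding dq_def by (auto split: if_splits)
  then show "\<exists>s. has_sort T (arity T f) p s \<and> has_sort T (arity T f) q s"
    "op_symbols p \<subseteq> total_ops T" "op_symbols q \<subseteq> total_ops T"
    using ea unfolding essentially_algebraic_theory_def by fast+
qed

lemma axiom_sort: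
  assumes "(\<Gamma>, p, q) \<in> axioms T"
  shows "set \<Gamma> \<subseteq> sorts T" "\<exists>s. has_sort T \<Gamma> p s \<and> has_sort T \<Gamma> q s"
  using ea assms unfolding essentially_algebraic_theory_def by fast+

text \<open>Since \<open>dq\<close> is empty on total operations, total and partial operations obey
  one definedness rule and need no separate treatment later.\<close>

lemma model_iff:
  "is_model T M \<longleftrightarrow>
     (\<forall>s. s \<notin> sorts T \<longrightarrow> carrier M s = {}) \<and>
     (\<forall>f xs y. interp M f xs = Some y \<longrightarrow>
        f \<in> ops T \<and> xs \<in> tuples M (arity T f) \<and> y \<in> carrier M (result T f)) \<and>
     (\<forall>f\<in>ops T. \<forall>xs\<in>tuples M (arity T f).
        interp M f xs \<noteq> None \<longleftrightarrow> (\<forall>p q. (p, q) \<in> dq f \<longrightarrow> eval_tm M xs p = eval_tm M xs q)) \<and>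
     (\<forall>\<Gamma> p q. (\<Gamma>, p, q) \<in> axioms T \<longrightarrow> (\<forall>xs\<in>tuples M \<Gamma>.
        eval_tm M xs p \<noteq> None \<longrightarrow> eval_tm M xs q \<noteq> None \<longrightarrow> eval_tm M xs p = eval_tm M xs q))"
proof -
  have "(\<forall>f\<in>total_ops T. \<forall>xs\<in>tuples M (arity T f). interp M f xs \<noteq> None) \<and>
     (\<forall>f\<in>ops T - total_ops T. \<forall>xs\<in>tuples M (arity T f).
        interp M f xs \<noteq> None \<longleftrightarrow> (\<forall>(t, u)\<in>dom_eqs T f. eval_tm M xs t = eval_tm M xs u)) \<longleftrightarrow>
     (\<forall>f\<in>ops T. \<forall>xs\<in>tuples M (arity T f).
        interp M f xs \<noteq> None \<longleftrightarrow> (\<forall>p q. (p, q) \<in> dq f \<longrightarrow> eval_tm M xs p = eval_tm M xs q))"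
    (is "?A \<longleftrightarrow> ?B")
  proof
    assume A: ?A
    show ?B
    proof (intro ballI)
      fix f xs assume f: "f \<in> ops T" "xs \<in> tuples M (arity T f)"
      show "interp M f xs \<noteq> None \<longleftrightarrow> (\<forall>p q. (p, q) \<in> dq f \<longrightarrow> eval_tm M xs p = eval_tm M xs q)"
      proof (cases "f \<in> total_ops T")
        case True then show ?thesis using A f total_op by simp
      next
        case False
        then have "f \<in> ops T - total_ops T" using f by blast
        then have "interp M f xs \<noteq> None \<longleftrightarrow> (\<forall>(t, u)\<in>dom_eqs T f. eval_tm M xs t = eval_tm M xs u)"
          using A f(2) by blast
        then show ?thesis using False by (auto simp: dq_def)
      qed
    qed
  next
    assume B: ?B
    show ?A
    proof (intro conjI ballI)
      fix f xs assume "f \<in> total_ops T" "xs \<in> tuples M (arity T f)"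
      then show "interp M f xs \<noteq> None" using B total_op by simp
    next
      fix f xs assume f: "f \<in> ops T - total_ops T" "xs \<in> tuples M (arity T f)"
      then have "interp M f xs \<noteq> None \<longleftrightarrow> (\<forall>p q. (p, q) \<in> dq f \<longrightarrow> eval_tm M xs p = eval_tm M xs q)"
        using B by blast
      then show "interp M f xs \<noteq> None \<longleftrightarrow> (\<forall>(t, u)\<in>dom_eqs T f. eval_tm M xs t = eval_tm M xs u)"
        using f by (auto simp: dq_def)
    qed
  qed
  moreover have "(\<forall>(\<Gamma>, p, q)\<in>axioms T. \<forall>xs\<in>tuples M \<Gamma>.
      eval_tm M xs p \<noteq> None \<longrightarrow> eval_tm M xs q \<noteq> None \<longrightarrow> eval_tm M xs p = eval_tm M xs q) \<longleftrightarrow>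
    (\<forall>\<Gamma> p q. (\<Gamma>, p, q) \<in> axioms T \<longrightarrow> (\<forall>xs\<in>tuples M \<Gamma>.
      eval_tm M xs p \<noteq> None \<longrightarrow> eval_tm M xs q \<noteq> None \<longrightarrow> eval_tm M xs p = eval_tm M xs q))"
    by (simp add: Ball_def)
  ultimately show ?thesis unfolding is_model_def by (simp only: conj_assoc[symmetric])
qed

lemma model_carrier: "is_model T M \<Longrightarrow> x \<in> carrier M s \<Longrightarrow> s \<in> sorts T"
  unfolding is_model_def by blast

lemma model_interp:
  assumes "is_model T M" "interp M f xs = Some y"
  shows "f \<in> ops T" "xs \<in> tuples M (arity T f)" "y \<in> carrier M (result T f)"
  using assms unfolding is_model_def by blast+

lemma model_defined:
  "is_model T M \<Longrightarrow> f \<in> ops T \<Longrightarrow> xs \<in> tuples M (arity T f) \<Longrightarrow>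
     interp M f xs \<noteq> None \<longleftrightarrow> (\<forall>p q. (p, q) \<in> dq f \<longrightarrow> eval_tm M xs p = eval_tm M xs q)"
  unfolding model_iff by blast

lemma model_axiom:
  "is_model T M \<Longrightarrow> (\<Gamma>, p, q) \<in> axioms T \<Longrightarrow> xs \<in> tuples M \<Gamma> \<Longrightarrow>
     eval_tm M xs p \<noteq> None \<Longrightarrow> eval_tm M xs q \<noteq> None \<Longrightarrow> eval_tm M xs p = eval_tm M xs q"
  unfolding model_iff by blast

text \<open>Applied to the two sides of a domain equation, this excludes that they agree merely by
  both being undefined.\<close>

lemma eval_total:
  assumes M: "is_model T M" and "has_sort T \<Gamma> p s" "op_symbols p \<subseteq> total_ops T" "xs \<in> tuples M \<Gamma>"
  shows "\<exists>y\<in>carrier M s. eval_tm M xs p = Some y"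
  using assms(2-)
proof (induction rule: has_sort.induct)
  case (1 n)
  then show ?case by (auto simp: tuples_def list_all2_conv_all_nth)
next
  case (2 f ts)
  then have f: "f \<in> total_ops T" by simp
  have "\<forall>n<length ts. \<exists>y\<in>carrier M (arity T f ! n). eval_tm M xs (ts ! n) = Some y"
    using 2 by (simp add: UN_subset_iff)
  then obtain Y where Y: "\<And>n. n < length ts \<Longrightarrow> Y n \<in> carrier M (arity T f ! n)"
    "\<And>n. n < length ts \<Longrightarrow> eval_tm M xs (ts ! n) = Some (Y n)" by metis
  define ys where "ys = map Y [0..<length ts]"
  have ys: "list_all2 (\<lambda>p y. eval_tm M xs p = Some y) ts ys" "ys \<in> tuples M (arity T f)"
    using Y 2(2) by (auto simp: ys_def list_all2_conv_all_nth tuples_def)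
  moreover have "interp M f ys \<noteq> None"
    using M ys(2) f unfolding is_model_def by blast
  ultimately have "\<exists>z. eval_tm M xs (Op f ts) = Some z \<and> z \<in> carrier M (result T f)"
    using model_interp(3)[OF M] by (auto simp only: eval_Op)
  then show ?case by blast
qed

primrec csort :: "('f, 'a \<times> 's) ct \<Rightarrow> 's" where
  "csort (Gen g) = snd g"
| "csort (App f ts) = result T f"

primrec wft :: "('f, 'a \<times> 's) ct \<Rightarrow> bool" where
  "wft (Gen g) \<longleftrightarrow> snd g \<in> sorts T"
| "wft (App f ts) \<longleftrightarrow> f \<in> ops T \<and> list_all wft ts \<and> map csort ts = arity T f"

definition wfR :: "(('f, 'a \<times> 's) ct \<times> ('f, 'a \<times> 's) ct) set \<Rightarrow> bool" where
  "wfR R \<longleftrightarrow> (\<forall>(t, u)\<in>R. wft t \<and> wft u \<and> csort t = csort u)"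

lemma wft_sort: "wft t \<Longrightarrow> csort t \<in> sorts T"
  by (cases t) (auto simp: op_sorts)

lemma wft_inst:
  assumes "has_sort T \<Gamma> p s" "map csort ts = \<Gamma>" "\<forall>t\<in>set ts. wft t"
  shows "wft (inst ts p) \<and> csort (inst ts p) = s"
  using assms
proof (induction rule: has_sort.induct)
  case (2 f ps)
  then have "\<forall>p\<in>set ps. wft (inst ts p)" by (auto simp: in_set_conv_nth)
  moreover have "map csort (map (inst ts) ps) = arity T f" using 2 by (auto intro!: nth_equalityI)
  ultimately show ?case using 2(1) by (simp add: list_all_iff)
qed auto

lemma gens_inst:
  assumes "has_sort T \<Gamma> p s" "length ts = length \<Gamma>"
  shows "gens (inst ts p) \<subseteq> \<Union> (gens ` set ts)"
  using assms
proof (induction rule: has_sort.induct)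
  case (2 f ps)
  then show ?case by (fastforce simp: in_set_conv_nth)
next
  case (1 n)
  then have "ts ! n \<in> set ts" by simp
  then show ?case by auto
qed

lemma ev_inst:
  assumes "has_sort T \<Gamma> p s" "list_all2 (\<lambda>t y. ev M h t = Some y) ts ys" "length ts = length \<Gamma>"
  shows "ev M h (inst ts p) = eval_tm M ys p"
  using assms
proof (induction rule: has_sort.induct)
  case (2 f ps)
  then have "\<forall>p\<in>set ps. ev M h (inst ts p) = eval_tm M ys p" by (auto simp: in_set_conv_nth)
  then have "map (ev M h) (map (inst ts) ps) = map (eval_tm M ys) ps" by simp
  then show ?case by (simp only: inst.simps ev.simps eval_tm.simps)
qed (auto simp: list_all2_conv_all_nth)

lemma ev_carrier:
  "is_model T M \<Longrightarrow> valuation M h \<Longrightarrow> ev M h t = Some y \<Longrightarrow> y \<in> carrier M (csort t)"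
  by (cases t) (auto simp: valuation_def simp del: ev.simps(2) simp: ev_App dest: model_interp)

lemma ev_tuple:
  assumes "is_model T M" "valuation M h" "list_all2 (\<lambda>t y. ev M h t = Some y) ts ys"
  shows "ys \<in> tuples M (map csort ts)"
  using assms ev_carrier by (fastforce simp: tuples_def list_all2_conv_all_nth)

lemma hom_carrier: "model_hom T M N k \<Longrightarrow> x \<in> carrier M s \<Longrightarrow> k s x \<in> carrier N s"
  using PiE_mem[of "k s" "carrier M s" "\<lambda>_. carrier N s"] by (simp add: model_hom_def)

lemma hom_interp:
  "is_model T M \<Longrightarrow> model_hom T M N k \<Longrightarrow> interp M f xs = Some y \<Longrightarrow>
     interp N f (map2 k (arity T f) xs) = Some (k (result T f) y)"
  using model_interp(1)[of M f xs y] unfolding model_hom_def by simp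

text \<open>Homomorphisms preserve definedness without having to reflect it, whence the hypothesis
  that \<open>t\<close> has a value in \<open>M\<close>.\<close>

lemma ev_hom:
  assumes M: "is_model T M" and k: "model_hom T M N k"
  shows "wft t \<Longrightarrow> ev M h t = Some y \<Longrightarrow> ev N (hmap k h) t = Some (k (csort t) y)"
proof (induction t arbitrary: y)
  case (App f ts)
  then obtain ys where ys: "list_all2 (\<lambda>t y. ev M h t = Some y) ts ys" "interp M f ys = Some y"
    unfolding ev_App by blast
  have *: "\<And>t y. t \<in> set ts \<Longrightarrow> ev M h t = Some y \<Longrightarrow> ev N (hmap k h) t = Some (k (csort t) y)"
    using App by (auto simp: list_all_iff)
  have "list_all2 (\<lambda>t y. ev N (hmap k h) t = Some y) ts (map2 k (map csort ts) ys)"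
    using ys(1) * by (simp add: list_all2_conv_all_nth)
  moreover have "interp N f (map2 k (map csort ts) ys) = Some (k (result T f) y)"
    using hom_interp[OF M k ys(2)] App.prems by simp
  ultimately show ?case unfolding ev_App csort.simps by blast
qed (simp add: hmap_def)

lemma holds_hom:
  assumes "is_model T M" "model_hom T M N k" "wft t" "wft u" "csort t = csort u" "holds M h t u"
  shows "holds N (hmap k h) t u"
  using assms(6) ev_hom[OF assms(1,2) assms(3)] ev_hom[OF assms(1,2) assms(4)] assms(5)
  unfolding holds_def by auto

lemma valuation_hmap: "model_hom T M N k \<Longrightarrow> valuation M h \<Longrightarrow> valuation N (hmap k h)"
  unfolding valuation_def hmap_def by (auto dest!: hom_carrier)

text \<open>
  Provable equality of closed terms from the relations \<open>R\<close>. As operations are partial this is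
  only a partial equivalence relation; \<open>eqv R t t\<close> says that \<open>t\<close> is provably defined.
\<close>

inductive eqv :: "(('f, 'a \<times> 's) ct \<times> ('f, 'a \<times> 's) ct) set \<Rightarrow> ('f, 'a \<times> 's) ct \<Rightarrow> ('f, 'a \<times> 's) ct \<Rightarrow> bool"
  for R where
  rel: "(t, u) \<in> R \<Longrightarrow> eqv R t u"
| sym: "eqv R t u \<Longrightarrow> eqv R u t"
| trans: "eqv R t u \<Longrightarrow> eqv R u v \<Longrightarrow> eqv R t v"
| arg: "eqv R (App f ts) (App f ts) \<Longrightarrow> t \<in> set ts \<Longrightarrow> eqv R t t"
| congr: "eqv R (App f ts) (App f ts) \<Longrightarrow> list_all2 (eqv R) ts us \<Longrightarrow> eqv R (App f ts) (App f us)"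
| defined: "f \<in> ops T \<Longrightarrow> map csort ts = arity T f \<Longrightarrow> \<forall>t\<in>set ts. eqv R t t \<Longrightarrow>
    \<forall>p q. (p, q) \<in> dq f \<longrightarrow> eqv R (inst ts p) (inst ts q) \<Longrightarrow> eqv R (App f ts) (App f ts)"
| dom_eq: "eqv R (App f ts) (App f ts) \<Longrightarrow> (p, q) \<in> dq f \<Longrightarrow> eqv R (inst ts p) (inst ts q)"
| axm: "(map csort ts, p, q) \<in> axioms T \<Longrightarrow> \<forall>t\<in>set ts. eqv R t t \<Longrightarrow>
    eqv R (inst ts p) (inst ts p) \<Longrightarrow> eqv R (inst ts q) (inst ts q) \<Longrightarrow> eqv R (inst ts p) (inst ts q)"

lemma eqv_refl: "eqv R t u \<Longrightarrow> eqv R t t" "eqv R t u \<Longrightarrow> eqv R u u"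
  using eqv.sym eqv.trans by blast+

text \<open>The rules \<open>dom_eq\<close> and \<open>axm\<close> bring in instances of open terms;
  their sorts come from the sorting conditions that the theory puts on domain equations and
  axioms.\<close>

lemma eqv_wft:
  assumes "wfR R" "eqv R t u" shows "wft t \<and> wft u \<and> csort t = csort u"
  using assms(2)
proof induction
  case (rel t u)
  then show ?case using assms(1) by (auto simp: wfR_def)
next
  case (congr f ts us)
  then have "list_all2 (\<lambda>t u. wft u \<and> csort t = csort u) ts us" by (auto elim: list.rel_mono_strong)
  then have "list_all wft us \<and> map csort us = map csort ts" by (induction rule: list_all2_induct) auto
  then show ?case using congr by auto
next
  case (dom_eq f ts p q)
  then have f: "f \<in> ops T" "map csort ts = arity T f" "\<forall>t\<in>set ts. wft t" by (auto simp: list_all_iff)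
  then obtain s where s: "has_sort T (arity T f) p s" "has_sort T (arity T f) q s" using dq_sort dom_eq by blast
  show ?case using wft_inst[OF s(1) f(2,3)] wft_inst[OF s(2) f(2,3)] by simp
next
  case (axm ts p q)
  then obtain s where s: "has_sort T (map csort ts) p s" "has_sort T (map csort ts) q s"
    using axiom_sort by blast
  show ?case using wft_inst[OF s(1) refl] wft_inst[OF s(2) refl] axm by simp
qed (auto simp: list_all_iff)

text \<open>No rule invents generators. This bounds the set of provably defined terms and so makes
  presented models small.\<close>

lemma eqv_gens:
  assumes "wfR R" "eqv R t u" shows "gens t \<union> gens u \<subseteq> Gens R"
  using assms(2)
proof induction
  case (rel t u)
  then show ?case by (auto simp: Gens_def)
next
  case (congr f ts us)
  then have "list_all2 (\<lambda>t u. gens u \<subseteq> Gens R) ts us" by (auto elim: list.rel_mono_strong)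
  then have "\<Union> (gens ` set us) \<subseteq> Gens R" by (induction rule: list_all2_induct) auto
  then show ?case using congr by auto
next
  case (dom_eq f ts p q)
  have f: "f \<in> ops T" "length ts = length (arity T f)"
    using eqv_wft[OF assms(1) dom_eq(1)] by (auto dest: arg_cong[of _ _ length])
  then obtain s where s: "has_sort T (arity T f) p s" "has_sort T (arity T f) q s" using dq_sort dom_eq by blast
  show ?case using gens_inst[OF s(1) f(2)] gens_inst[OF s(2) f(2)] dom_eq by auto
qed auto

text \<open>
  Soundness, for a directed family of models at once: whatever is provable from relations each
  of which holds from some stage on, holds from some stage on. A constant family gives soundness
  in a single model, and the stages of a directed diagram give the description of its colimit.
\<close>

lemma eqv_sound_directed:
  assumes R: "wfR R" "\<And>t u. (t, u) \<in> R \<Longrightarrow> \<exists>i\<in>I. holds (N i) (h i) t u"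
    and I: "I \<noteq> {}" "\<And>i j. i \<in> I \<Longrightarrow> j \<in> I \<Longrightarrow> \<exists>k\<in>I. le i k \<and> le j k"
    and mono: "\<And>i j t u. i \<in> I \<Longrightarrow> j \<in> I \<Longrightarrow> le i j \<Longrightarrow> wft t \<Longrightarrow> wft u \<Longrightarrow> csort t = csort u \<Longrightarrow>
      holds (N i) (h i) t u \<Longrightarrow> holds (N j) (h j) t u"
    and N: "\<And>i. i \<in> I \<Longrightarrow> is_model T (N i)" "\<And>i. i \<in> I \<Longrightarrow> valuation (N i) (h i)"
  shows "eqv R t u \<Longrightarrow> \<exists>i\<in>I. holds (N i) (h i) t u"
proof -
  \<comment> \<open>Sorting is carried along with validity, because \<open>mono\<close> moves only
    well sorted equations to later stages.\<close>
  define H where "H i t u \<longleftrightarrow> wft t \<and> wft u \<and> csort t = csort u \<and> holds (N i) (h i) t u" for i t u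
  \<comment> \<open>Every rule has finitely many premises, and directedness provides one stage at
    which all of them hold.\<close>
  have finH: "\<exists>i\<in>I. \<forall>(t, u)\<in>S. H i t u" if "finite S" "\<forall>(t, u)\<in>S. \<exists>i\<in>I. H i t u" for S
    using that
  proof induction
    case (insert x S)
    obtain t u where x: "x = (t, u)" by (cases x)
    obtain i where i: "i \<in> I" "\<forall>(t, u)\<in>S. H i t u" using insert by auto
    obtain j where j: "j \<in> I" "H j t u" using insert x by auto
    obtain k where k: "k \<in> I" "le i k" "le j k" using I(2)[OF i(1) j(1)] by blast
    have "\<forall>(t, u)\<in>insert x S. H k t u"
      using i j k mono[OF i(1) k(1,2)] mono[OF j(1) k(1,3)] unfolding H_def x by auto
    then show ?case using k(1) by blast
  qed (use I in auto)
  have vals: "\<exists>ys. list_all2 (\<lambda>t y. ev (N i) (h i) t = Some y) ts ys" if "\<forall>t\<in>set ts. H i t t" for i ts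
    using that
  proof (induction ts)
    case (Cons t ts)
    then obtain y ys where "ev (N i) (h i) t = Some y" "list_all2 (\<lambda>t y. ev (N i) (h i) t = Some y) ts ys"
      by (auto simp: H_def holds_def)
    then have "list_all2 (\<lambda>t y. ev (N i) (h i) t = Some y) (t # ts) (y # ys)" by simp
    then show ?case by blast
  qed (blast intro: list.rel_intros)
  have "\<exists>i\<in>I. H i t u" if "eqv R t u"
    using that
  proof induction
    case (rel t u)
    then show ?case using R(2)[OF rel] eqv_wft[OF R(1) eqv.rel[OF rel]] by (simp add: H_def)
  next
    case (sym t u)
    then show ?case unfolding H_def holds_def by metis
  next
    case (trans t u v)
    then obtain i where "i \<in> I" "\<forall>(t, u)\<in>{(t, u), (u, v)}. H i t u" using finH[of "{(t, u), (u, v)}"] by auto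
    then show ?case by (intro bexI[of _ i]) (auto simp: H_def holds_def)
  next
    case (arg f ts t)
    then obtain i where i: "i \<in> I" "H i (App f ts) (App f ts)" by blast
    then obtain ys where ys: "list_all2 (\<lambda>t y. ev (N i) (h i) t = Some y) ts ys"
      unfolding H_def holds_def ev_App by blast
    then have "\<exists>y. ev (N i) (h i) t = Some y"
      using arg(2) by (auto simp: list_all2_conv_all_nth in_set_conv_nth)
    then show ?case using i arg(2) by (intro bexI[of _ i]) (auto simp: H_def holds_def list_all_iff)
  next
    case (congr f ts us)
    have "\<forall>(t, u)\<in>set (zip ts us). \<exists>i\<in>I. H i t u" using congr(3) by (auto simp: list_all2_iff)
    then obtain i where i: "i \<in> I" "H i (App f ts) (App f ts)" "\<forall>(t, u)\<in>set (zip ts us). H i t u"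
      using finH[of "insert (App f ts, App f ts) (set (zip ts us))"] congr(2) by auto
    have l2: "list_all2 (H i) ts us" using i(3) list_all2_lengthD[OF congr(3)] by (auto simp: list_all2_iff)
    obtain ys z where ys: "list_all2 (\<lambda>t y. ev (N i) (h i) t = Some y) ts ys" "interp (N i) f ys = Some z"
      using i(2) unfolding H_def holds_def ev_App by blast
    have "list_all2 (\<lambda>t y. ev (N i) (h i) t = Some y) us ys"
      using ys(1) l2 by (fastforce simp: list_all2_conv_all_nth H_def holds_def)
    then have "holds (N i) (h i) (App f ts) (App f us)" using ys unfolding holds_def ev_App by blast
    moreover have "wft (App f us)"
    proof -
      have "list_all wft us \<and> map csort us = map csort ts"
        using l2 by (induction rule: list_all2_induct) (auto simp: H_def)
      then show ?thesis using i(2) by (auto simp: H_def)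
    qed
    ultimately show ?case using i by (intro bexI[of _ i]) (auto simp: H_def)
  next
    case (defined f ts)
    \<comment> \<open>The premises to be met at one stage: definedness of the arguments and the
      domain equations, finite in number by \<open>dq_finite\<close>.\<close>
    let ?S = "(\<lambda>t. (t, t)) ` set ts \<union> (\<lambda>(p, q). (inst ts p, inst ts q)) ` dq f"
    have "finite ?S" using dq_finite defined(1) by simp
    moreover have "\<forall>(t, u)\<in>?S. \<exists>i\<in>I. H i t u" using defined(3,4) by auto
    ultimately have "\<exists>i\<in>I. \<forall>(t, u)\<in>?S. H i t u" by (rule finH)
    then obtain i where i: "i \<in> I" "\<forall>(t, u)\<in>?S. H i t u" by blast
    then have "\<forall>t\<in>set ts. H i t t" by auto
    then obtain ys where ys: "list_all2 (\<lambda>t y. ev (N i) (h i) t = Some y) ts ys" using vals by blast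
    then have tup: "ys \<in> tuples (N i) (arity T f)" using ev_tuple[OF N[OF i(1)] ys] defined(2) by simp
    have "eval_tm (N i) ys p = eval_tm (N i) ys q" if pq: "(p, q) \<in> dq f" for p q
    proof -
      obtain s where s: "has_sort T (arity T f) p s" "has_sort T (arity T f) q s"
        using dq_sort[OF defined(1) pq] by blast
      have "H i (inst ts p) (inst ts q)" using i(2) pq by auto
      then have "ev (N i) (h i) (inst ts p) = ev (N i) (h i) (inst ts q)" by (auto simp: H_def holds_def)
      moreover have "length ts = length (arity T f)" using defined(2) by (metis length_map)
      ultimately show ?thesis using ev_inst[OF s(1) ys] ev_inst[OF s(2) ys] by simp
    qed
    then have "interp (N i) f ys \<noteq> None" using model_defined[OF N(1)[OF i(1)] defined(1) tup] by blast
    then have "holds (N i) (h i) (App f ts) (App f ts)" using ys unfolding holds_def ev_App by blast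
    moreover have "wft (App f ts)" using defined \<open>\<forall>t\<in>set ts. H i t t\<close> by (auto simp: H_def list_all_iff)
    ultimately show ?case using i(1) by (auto simp: H_def simp del: wft.simps)
  next
    case (dom_eq f ts p q)
    then obtain i where i: "i \<in> I" "H i (App f ts) (App f ts)" by blast
    then obtain ys z where ys: "list_all2 (\<lambda>t y. ev (N i) (h i) t = Some y) ts ys" "interp (N i) f ys = Some z"
      unfolding H_def holds_def ev_App by blast
    note f = model_interp[OF N(1)[OF i(1)] ys(2)]
    have sorts: "map csort ts = arity T f" "\<forall>t\<in>set ts. wft t" using i(2) by (auto simp: H_def list_all_iff)
    then have len: "length ts = length (arity T f)" by (metis length_map)
    obtain s where s: "has_sort T (arity T f) p s" "has_sort T (arity T f) q s"
      using dq_sort[OF f(1) dom_eq(2)] by blast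
    \<comment> \<open>Definedness of the application says only that the two sides evaluate alike;
      that they have a value is due to their total operations.\<close>
    obtain y where "eval_tm (N i) ys p = Some y"
      using eval_total[OF N(1)[OF i(1)] s(1) dq_sort(2)[OF f(1) dom_eq(2)] f(2)] by blast
    moreover have "eval_tm (N i) ys p = eval_tm (N i) ys q"
      using model_defined[OF N(1)[OF i(1)] f(1,2)] ys(2) dom_eq(2) by auto
    ultimately have "holds (N i) (h i) (inst ts p) (inst ts q)"
      using ev_inst[OF s(1) ys(1) len] ev_inst[OF s(2) ys(1) len] by (simp add: holds_def)
    then show ?case using i(1) wft_inst[OF s(1) sorts] wft_inst[OF s(2) sorts] by (auto simp: H_def)
  next
    case (axm ts p q)
    let ?S = "(\<lambda>t. (t, t)) ` (insert (inst ts p) (insert (inst ts q) (set ts)))"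
    have "\<forall>(t, u)\<in>?S. \<exists>i\<in>I. H i t u" using axm by auto
    then obtain i where i: "i \<in> I" "\<forall>(t, u)\<in>?S. H i t u" using finH[of ?S] by auto
    then have ts: "\<forall>t\<in>set ts. H i t t" by auto
    then obtain ys where ys: "list_all2 (\<lambda>t y. ev (N i) (h i) t = Some y) ts ys" using vals by blast
    note tup = ev_tuple[OF N[OF i(1)] ys]
    obtain s where s: "has_sort T (map csort ts) p s" "has_sort T (map csort ts) q s"
      using axiom_sort axm(1) by blast
    have e: "ev (N i) (h i) (inst ts p) = eval_tm (N i) ys p" "ev (N i) (h i) (inst ts q) = eval_tm (N i) ys q"
      using ev_inst[OF s(1) ys] ev_inst[OF s(2) ys] by simp_all
    have "H i (inst ts p) (inst ts p)" "H i (inst ts q) (inst ts q)" using i(2) by auto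
    then have "eval_tm (N i) ys p \<noteq> None" "eval_tm (N i) ys q \<noteq> None" using e by (auto simp: H_def holds_def)
    then have "holds (N i) (h i) (inst ts p) (inst ts q)"
      using model_axiom[OF N(1)[OF i(1)] axm(1) tup] e by (auto simp: holds_def)
    then show ?case using i(1) wft_inst[OF s(1) refl] wft_inst[OF s(2) refl] ts by (auto simp: H_def)
  qed
  then show "eqv R t u \<Longrightarrow> \<exists>i\<in>I. holds (N i) (h i) t u" unfolding H_def by blast
qed

lemma eqv_sound:
  assumes "wfR R" "is_model T M" "valuation M h" "\<forall>(t, u)\<in>R. holds M h t u" "eqv R t u"
  shows "holds M h t u"
proof -
  have "\<exists>i\<in>{()}. holds M h t u"
    by (rule eqv_sound_directed[where I = "{()}" and N = "\<lambda>_. M" and h = "\<lambda>_. h" and R = R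
          and le = "\<lambda>_ _. True"]) (use assms in auto)
  then show ?thesis by simp
qed

end

section \<open>The model presented by generators and relations\<close>

context ea
begin

text \<open>
  Such a \<open>c\<close> codes the classes of provably defined terms by elements of \<open>'u\<close>, so that the
  presented model has its carriers in \<open>'u\<close> as \<open>Mod\<close> requires.
\<close>

definition separates :: "(('f, 'a \<times> 's) ct \<times> ('f, 'a \<times> 's) ct) set \<Rightarrow> (('f, 'a \<times> 's) ct \<Rightarrow> 'u) \<Rightarrow> bool" where
  "separates R c \<longleftrightarrow> (\<forall>t u. eqv R t t \<longrightarrow> eqv R u u \<longrightarrow> (c t = c u \<longleftrightarrow> eqv R t u))"

definition pres ::
  "(('f, 'a \<times> 's) ct \<times> ('f, 'a \<times> 's) ct) set \<Rightarrow> (('f, 'a \<times> 's) ct \<Rightarrow> 'u) \<Rightarrow> ('s, 'f, 'u) partial_algebra" where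
  "pres R c = \<lparr>carrier = (\<lambda>s. {c t | t. eqv R t t \<and> csort t = s}),
     interp = (\<lambda>f xs. if \<exists>ts. map c ts = xs \<and> eqv R (App f ts) (App f ts)
       then Some (c (App f (SOME ts. map c ts = xs \<and> eqv R (App f ts) (App f ts)))) else None)\<rparr>"

text \<open>A generator foreign to \<open>R\<close> is not provably defined and must not be given a
  value.\<close>

definition generic ::
  "(('f, 'a \<times> 's) ct \<times> ('f, 'a \<times> 's) ct) set \<Rightarrow> (('f, 'a \<times> 's) ct \<Rightarrow> 'u) \<Rightarrow> 'a \<times> 's \<rightharpoonup> 'u" where
  "generic R c g = (if eqv R (Gen g) (Gen g) then Some (c (Gen g)) else None)"

text \<open>\<open>e\<close> gives the values of the generators in \<open>M\<close>. The
  factorization is expressed by inclusion of maps, since \<open>h\<close> may also value generators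
  foreign to \<open>R\<close>, on which \<open>e\<close> is undefined.\<close>

definition presents ::
  "('s, 'f, 'u) partial_algebra \<Rightarrow> ('a \<times> 's \<rightharpoonup> 'u) \<Rightarrow> (('f, 'a \<times> 's) ct \<times> ('f, 'a \<times> 's) ct) set \<Rightarrow> bool" where
  "presents M e R \<longleftrightarrow> is_model T M \<and> valuation M e \<and> dom e \<subseteq> Gens R \<and> (\<forall>(t, u)\<in>R. holds M e t u) \<and>
     (\<forall>N h. is_model T N \<longrightarrow> valuation N h \<longrightarrow> (\<forall>(t, u)\<in>R. holds N h t u) \<longrightarrow>
        (\<exists>!k. model_hom T M N k \<and> hmap k e \<subseteq>\<^sub>m h))"

context
  fixes R :: "(('f, 'a \<times> 's) ct \<times> ('f, 'a \<times> 's) ct) set" and c :: "('f, 'a \<times> 's) ct \<Rightarrow> 'u"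
  assumes R: "wfR R" and c: "separates R c"
begin

lemma code_eq: "eqv R t t \<Longrightarrow> eqv R u u \<Longrightarrow> c t = c u \<longleftrightarrow> eqv R t u"
  using c unfolding separates_def by blast

text \<open>Independence of representatives: arguments with equal codes are provably equal, and
  \<open>congr\<close> passes this on to the applications.\<close>

lemma interp_pres:
  assumes ts: "\<forall>t\<in>set ts. eqv R t t"
  shows "interp (pres R c) f (map c ts) = (if eqv R (App f ts) (App f ts) then Some (c (App f ts)) else None)"
proof -
  have *: "eqv R (App f ts') (App f ts)" if "map c ts' = map c ts" "eqv R (App f ts') (App f ts')" for ts'
  proof (rule eqv.congr[OF that(2)])
    have len: "length ts' = length ts" using that(1) by (metis length_map)
    show "list_all2 (eqv R) ts' ts"
    proof (rule list_all2_all_nthI[OF len])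
      fix n assume n: "n < length ts'"
      then have "eqv R (ts' ! n) (ts' ! n)" "eqv R (ts ! n) (ts ! n)"
        using eqv.arg[OF that(2)] ts len by simp_all
      moreover have "c (ts' ! n) = c (ts ! n)" using that(1) n len by (metis nth_map)
      ultimately show "eqv R (ts' ! n) (ts ! n)" using code_eq by blast
    qed
  qed
  show ?thesis
  proof (cases "eqv R (App f ts) (App f ts)")
    case True
    define ts' where "ts' = (SOME ts'. map c ts' = map c ts \<and> eqv R (App f ts') (App f ts'))"
    have ts': "map c ts' = map c ts \<and> eqv R (App f ts') (App f ts')"
      unfolding ts'_def by (rule someI[of _ ts]) (use True in auto)
    then have "c (App f ts') = c (App f ts)" using * code_eq True by blast
    then show ?thesis using ts' True unfolding pres_def ts'_def by auto
  next
    case False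
    then have "\<not> (\<exists>ts'. map c ts' = map c ts \<and> eqv R (App f ts') (App f ts'))"
      using * eqv_refl(2) by blast
    then show ?thesis using False by (simp add: pres_def)
  qed
qed

lemma interp_pres_Some:
  assumes "interp (pres R c) f xs = Some y"
  shows "\<exists>ts. xs = map c ts \<and> eqv R (App f ts) (App f ts) \<and> (\<forall>t\<in>set ts. eqv R t t) \<and> y = c (App f ts)"
proof -
  obtain ts where ts: "xs = map c ts" "eqv R (App f ts) (App f ts)"
    using assms by (auto simp: pres_def split: if_splits)
  then have "\<forall>t\<in>set ts. eqv R t t" using eqv.arg by blast
  then show ?thesis using interp_pres[of ts f] ts assms by auto
qed

text \<open>The basic property of a term model: definedness in the model is provable definedness,
  and a term denotes its own class.\<close>

lemma ev_pres: "ev (pres R c) (generic R c) t = (if eqv R t t then Some (c t) else None)"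
proof (induction t)
  case (App f ts)
  show ?case
  proof (cases "\<forall>t\<in>set ts. eqv R t t")
    case True
    then have "list_all2 (\<lambda>t y. ev (pres R c) (generic R c) t = Some y) ts (map c ts)"
      using App by (simp add: list_all2_conv_all_nth)
    then have "ev (pres R c) (generic R c) (App f ts) = interp (pres R c) f (map c ts)"
      by (simp add: those_eq_Some[symmetric])
    then show ?thesis using interp_pres[OF True] by simp
  next
    case False
    then have "\<not> eqv R (App f ts) (App f ts)" using eqv.arg by blast
    moreover have "ev (pres R c) (generic R c) (App f ts) = None"
    proof (rule ccontr)
      assume "ev (pres R c) (generic R c) (App f ts) \<noteq> None"
      then obtain y where "ev (pres R c) (generic R c) (App f ts) = Some y" by blast
      then obtain ys where ys: "list_all2 (\<lambda>t y. ev (pres R c) (generic R c) t = Some y) ts ys"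
        unfolding ev_App by blast
      have "eqv R t t" if t: "t \<in> set ts" for t
      proof (rule ccontr)
        assume "\<not> eqv R t t"
        then have "ev (pres R c) (generic R c) t = None" using App.IH[OF t] by simp
        then show False using ys t by (auto simp: list_all2_conv_all_nth in_set_conv_nth)
      qed
      then show False using False by blast
    qed
    ultimately show ?thesis by simp
  qed
qed (simp add: generic_def)

lemma tuples_pres:
  "xs \<in> tuples (pres R c) \<Gamma> \<longleftrightarrow> (\<exists>ts. xs = map c ts \<and> (\<forall>t\<in>set ts. eqv R t t) \<and> map csort ts = \<Gamma>)"
proof
  assume "xs \<in> tuples (pres R c) \<Gamma>"
  then have "list_all2 (\<lambda>x s. \<exists>t. x = c t \<and> eqv R t t \<and> csort t = s) xs \<Gamma>"
    by (simp add: tuples_def pres_def)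
  then show "\<exists>ts. xs = map c ts \<and> (\<forall>t\<in>set ts. eqv R t t) \<and> map csort ts = \<Gamma>"
  proof (induction rule: list_all2_induct)
    case (Cons x xs s \<Gamma>)
    then obtain t ts where "x = c t" "eqv R t t" "csort t = s" "xs = map c ts" "\<forall>t\<in>set ts. eqv R t t"
      "map csort ts = \<Gamma>" by blast
    then show ?case by (intro exI[of _ "t # ts"]) simp
  qed simp
next
  assume "\<exists>ts. xs = map c ts \<and> (\<forall>t\<in>set ts. eqv R t t) \<and> map csort ts = \<Gamma>"
  then show "xs \<in> tuples (pres R c) \<Gamma>"
    by (auto simp: tuples_def pres_def list_all2_conv_all_nth)
qed

lemma eval_pres:
  assumes "has_sort T (map csort ts) p s" "\<forall>t\<in>set ts. eqv R t t"
  shows "eval_tm (pres R c) (map c ts) p = (if eqv R (inst ts p) (inst ts p) then Some (c (inst ts p)) else None)"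
proof -
  have "list_all2 (\<lambda>t y. ev (pres R c) (generic R c) t = Some y) ts (map c ts)"
    using assms(2) ev_pres by (simp add: list_all2_conv_all_nth)
  then show ?thesis using ev_inst[OF assms(1), of "pres R c" "generic R c" ts "map c ts"] ev_pres by simp
qed

text \<open>The syntactic counterpart of \<open>eval_total\<close>, by repeated use of the rule
  \<open>defined\<close> with no domain equations to check.\<close>

lemma inst_total:
  assumes "has_sort T \<Gamma> p s" "op_symbols p \<subseteq> total_ops T" "map csort ts = \<Gamma>" "\<forall>t\<in>set ts. eqv R t t"
  shows "eqv R (inst ts p) (inst ts p)"
  using assms
proof (induction rule: has_sort.induct)
  case (1 n)
  then show ?case by auto
next
  case (2 f ps)
  have ps: "\<forall>p\<in>set ps. eqv R (inst ts p) (inst ts p)" using 2 by (fastforce simp: in_set_conv_nth)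
  have wf: "\<forall>t\<in>set ts. wft t" using 2 eqv_wft[OF R] by blast
  have "map csort (map (inst ts) ps) = arity T f"
  proof (rule nth_equalityI)
    fix n assume "n < length (map csort (map (inst ts) ps))"
    then have n: "n < length ps" by simp
    then have "has_sort T \<Gamma> (ps ! n) (arity T f ! n)" using 2 by blast
    then have "csort (inst ts (ps ! n)) = arity T f ! n" using wft_inst[OF _ 2(5) wf] by blast
    then show "map csort (map (inst ts) ps) ! n = arity T f ! n" using n by simp
  qed (use 2 in simp)
  moreover have "dq f = {}" using 2 total_op by auto
  ultimately show ?case using eqv.defined[OF 2(1), of "map (inst ts) ps"] ps by simp
qed

lemma pres_model: "is_model T (pres R c)"
  unfolding model_iff
proof (intro conjI allI impI ballI)
  fix s assume "s \<notin> sorts T"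
  then have "csort t \<noteq> s" if "eqv R t t" for t using eqv_wft[OF R that] wft_sort by blast
  then show "carrier (pres R c) s = {}" by (auto simp: pres_def)
next
  fix f xs y assume "interp (pres R c) f xs = Some y"
  then obtain ts where ts: "xs = map c ts" "eqv R (App f ts) (App f ts)" "\<forall>t\<in>set ts. eqv R t t" "y = c (App f ts)"
    using interp_pres_Some by blast
  have "wft (App f ts)" using eqv_wft[OF R ts(2)] by blast
  then show "f \<in> ops T" "xs \<in> tuples (pres R c) (arity T f)" using ts tuples_pres by auto
  have "csort (App f ts) = result T f" by simp
  then show "y \<in> carrier (pres R c) (result T f)" using ts unfolding pres_def by fastforce
next
  fix f xs assume f: "f \<in> ops T" and "xs \<in> tuples (pres R c) (arity T f)"
  then obtain ts where ts: "xs = map c ts" "\<forall>t\<in>set ts. eqv R t t" "map csort ts = arity T f"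
    using tuples_pres by blast
  have e: "eval_tm (pres R c) xs p = eval_tm (pres R c) xs q \<longleftrightarrow> eqv R (inst ts p) (inst ts q)"
    if pq: "(p, q) \<in> dq f" for p q
  proof -
    obtain s where s: "has_sort T (map csort ts) p s" "has_sort T (map csort ts) q s"
      using dq_sort(1)[OF f pq] ts(3) by auto
    have "eqv R (inst ts p) (inst ts p)" "eqv R (inst ts q) (inst ts q)"
      using inst_total[OF s(1) dq_sort(2)[OF f pq] refl ts(2)]
        inst_total[OF s(2) dq_sort(3)[OF f pq] refl ts(2)] by blast+
    then show ?thesis using eval_pres[OF s(1) ts(2)] eval_pres[OF s(2) ts(2)] code_eq ts(1) by simp
  qed
  have "interp (pres R c) f xs \<noteq> None \<longleftrightarrow> eqv R (App f ts) (App f ts)"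
    using interp_pres[OF ts(2)] ts(1) by simp
  \<comment> \<open>The rules \<open>dom_eq\<close> and \<open>defined\<close> are the two
    directions of the definedness condition for models.\<close>
  also have "\<dots> \<longleftrightarrow> (\<forall>p q. (p, q) \<in> dq f \<longrightarrow> eqv R (inst ts p) (inst ts q))"
    using eqv.dom_eq[of R f ts] eqv.defined[OF f ts(3,2)] by blast
  finally show "interp (pres R c) f xs \<noteq> None \<longleftrightarrow>
      (\<forall>p q. (p, q) \<in> dq f \<longrightarrow> eval_tm (pres R c) xs p = eval_tm (pres R c) xs q)" using e by blast
next
  fix \<Gamma> p q xs assume ax: "(\<Gamma>, p, q) \<in> axioms T" and xs: "xs \<in> tuples (pres R c) \<Gamma>"
    and d: "eval_tm (pres R c) xs p \<noteq> None" "eval_tm (pres R c) xs q \<noteq> None"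
  obtain ts where ts: "xs = map c ts" "\<forall>t\<in>set ts. eqv R t t" "map csort ts = \<Gamma>"
    using tuples_pres xs by blast
  obtain s where s: "has_sort T (map csort ts) p s" "has_sort T (map csort ts) q s"
    using axiom_sort(2)[OF ax] ts(3) by auto
  note ep = eval_pres[OF s(1) ts(2)] and eq = eval_pres[OF s(2) ts(2)]
  have i: "eqv R (inst ts p) (inst ts p)" "eqv R (inst ts q) (inst ts q)"
    using d ep eq ts(1) by (auto split: if_splits)
  have "eqv R (inst ts p) (inst ts q)" using eqv.axm[of ts p q R] ax ts i by blast
  then show "eval_tm (pres R c) xs p = eval_tm (pres R c) xs q" using ep eq i code_eq ts(1) by simp
qed

text \<open>The homomorphism sends the code of \<open>t\<close> to the value of \<open>t\<close>
  under \<open>h\<close>; soundness makes this defined and independent of \<open>t\<close>. It is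
  the only one because every element is denoted by a closed term, whose value homomorphisms
  preserve.\<close>

lemma pres_presents: "presents (pres R c) (generic R c) R"
  unfolding presents_def
proof (intro conjI allI impI)
  show "is_model T (pres R c)" by (rule pres_model)
  show val: "valuation (pres R c) (generic R c)"
    unfolding valuation_def
  proof (intro allI impI)
    fix g x assume "generic R c g = Some x"
    then have "eqv R (Gen g) (Gen g)" "x = c (Gen g)" by (auto simp: generic_def split: if_splits)
    moreover have "csort (Gen g) = snd g" by simp
    ultimately show "x \<in> carrier (pres R c) (snd g)" unfolding pres_def by fastforce
  qed
  show "dom (generic R c) \<subseteq> Gens R"
  proof
    fix g assume "g \<in> dom (generic R c)"
    then have "eqv R (Gen g) (Gen g)" by (auto simp: generic_def split: if_splits)
    then show "g \<in> Gens R" using eqv_gens[OF R] by fastforce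
  qed
  show "\<forall>(t, u)\<in>R. holds (pres R c) (generic R c) t u"
  proof (clarify)
    fix t u assume "(t, u) \<in> R"
    then have "eqv R t u" by (rule eqv.rel)
    then show "holds (pres R c) (generic R c) t u"
      using ev_pres code_eq eqv_refl unfolding holds_def by auto
  qed
  fix N :: "('s, 'f, 'u) partial_algebra" and h
  assume N: "is_model T N" and h: "valuation N h" "\<forall>(t, u)\<in>R. holds N h t u"
  have sound: "holds N h t u" if "eqv R t u" for t u by (rule eqv_sound[OF R N h that])
  define k where "k s = (\<lambda>x\<in>carrier (pres R c) s. the (ev N h (SOME t. eqv R t t \<and> c t = x)))" for s
  have k: "ev N h t = Some (k (csort t) (c t))" if t: "eqv R t t" for t
  proof -
    define u where "u = (SOME u. eqv R u u \<and> c u = c t)"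
    have u: "eqv R u u \<and> c u = c t" unfolding u_def by (rule someI[of _ t]) (use t in auto)
    then have "holds N h t u" using sound code_eq t by metis
    then have *: "ev N h t = Some (the (ev N h u))" by (auto simp: holds_def)
    have "c t \<in> carrier (pres R c) (csort t)" using t by (auto simp: pres_def)
    then have "k (csort t) (c t) = the (ev N h u)" by (simp add: k_def u_def)
    then show ?thesis using * by simp
  qed
  have hom: "model_hom T (pres R c) N k"
    unfolding model_hom_def
  proof (intro conjI allI ballI impI)
    show "k s \<in> carrier (pres R c) s \<rightarrow>\<^sub>E carrier N s" for s
    proof (rule PiE_I)
      fix x assume "x \<in> carrier (pres R c) s"
      then obtain t where t: "x = c t" "eqv R t t" "csort t = s" by (auto simp: pres_def)
      then show "k s x \<in> carrier N s" using ev_carrier[OF N h(1) k[OF t(2)]] by simp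
    qed (simp add: k_def)
    fix f xs y assume "interp (pres R c) f xs = Some y"
    then obtain ts where ts: "xs = map c ts" "eqv R (App f ts) (App f ts)" "\<forall>t\<in>set ts. eqv R t t" "y = c (App f ts)"
      using interp_pres_Some by blast
    have ar: "map csort ts = arity T f" using eqv_wft[OF R ts(2)] by simp
    have "ev N h (App f ts) = Some (k (result T f) y)" using k[OF ts(2)] ts(4) by simp
    then obtain ys where ys: "list_all2 (\<lambda>t y. ev N h t = Some y) ts ys" "interp N f ys = Some (k (result T f) y)"
      unfolding ev_App by blast
    moreover have "list_all2 (\<lambda>t y. ev N h t = Some y) ts (map2 k (arity T f) xs)"
      using ts k unfolding ar[symmetric] by (simp add: list_all2_conv_all_nth)
    ultimately show "interp N f (map2 k (arity T f) xs) = Some (k (result T f) y)"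
      using list_all2_Some_determ by metis
  qed
  show "\<exists>!k. model_hom T (pres R c) N k \<and> hmap k (generic R c) \<subseteq>\<^sub>m h"
  proof (rule ex1I[of _ k], rule conjI[OF hom])
    show "hmap k (generic R c) \<subseteq>\<^sub>m h"
      unfolding hmap_le_iff using k[of "Gen _"] by (auto simp: generic_def split: if_splits)
  next
    fix k' assume k': "model_hom T (pres R c) N k' \<and> hmap k' (generic R c) \<subseteq>\<^sub>m h"
    show "k' = k"
    proof (rule ext)
      fix s show "k' s = k s"
      proof (rule PiE_ext[of _ "carrier (pres R c) s" "\<lambda>_. carrier N s"])
        fix x assume "x \<in> carrier (pres R c) s"
        then obtain t where t: "x = c t" "eqv R t t" "csort t = s" by (auto simp: pres_def)
        have "ev (pres R c) (generic R c) t = Some (c t)" using ev_pres t by simp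
        then have "ev N (hmap k' (generic R c)) t = Some (k' (csort t) (c t))"
          using eqv_wft[OF R t(2)] by (intro ev_hom[OF pres_model conjunct1[OF k']]) simp_all
        then have "ev N h t = Some (k' (csort t) (c t))" by (rule ev_mono[OF conjunct2[OF k']])
        then show "k' s x = k s x" using k[OF t(2)] t by simp
      qed (use hom k' in \<open>auto simp: model_hom_def\<close>)
    qed
  qed
qed

end

lemma presents_unique:
  assumes "presents M e R" "is_model T N" "valuation N h" "\<forall>(t, u)\<in>R. holds N h t u"
    and "model_hom T M N k" "hmap k e \<subseteq>\<^sub>m h" "model_hom T M N k'" "hmap k' e \<subseteq>\<^sub>m h"
  shows "k = k'"
  by (rule ex1_equality[of "\<lambda>k. model_hom T M N k \<and> hmap k e \<subseteq>\<^sub>m h"])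
    (use assms in \<open>auto simp: presents_def\<close>)

lemma presents_hom:
  assumes "presents M e R" "is_model T N" "valuation N h" "\<forall>(t, u)\<in>R. holds N h t u"
  obtains k where "model_hom T M N k" "hmap k e \<subseteq>\<^sub>m h"
proof -
  have "\<exists>!k. model_hom T M N k \<and> hmap k e \<subseteq>\<^sub>m h"
    using assms unfolding presents_def by auto
  then show ?thesis using that by blast
qed

lemma presentsD:
  assumes "presents M e R"
  shows "is_model T M" "valuation M e" "dom e \<subseteq> Gens R" "\<forall>(t, u)\<in>R. holds M e t u"
  using assms unfolding presents_def by auto

lemma presents_gens: "presents M e R \<Longrightarrow> g \<in> Gens R \<Longrightarrow> e g \<noteq> None"
  using presentsD(4)[of M e R] holds_gens[of M e] unfolding Gens_def by fast

text \<open>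
  Renaming generators to natural numbers brings all finite presentations, up to isomorphism, into
  one countable set.
\<close>

lemma presents_rename:
  fixes r :: "'a \<times> 's \<Rightarrow> 'b \<times> 's" and M :: "('s, 'f, 'u) partial_algebra"
  assumes r: "inj_on r (Gens R)" "\<And>g. snd (r g) = snd g"
    and M: "presents M e (map_prod (map_ct (\<lambda>x. x) r) (map_ct (\<lambda>x. x) r) ` R)"
  shows "presents M (\<lambda>g. if g \<in> Gens R then e (r g) else None) R"
proof -
  define R' where "R' = map_prod (map_ct (\<lambda>x. x) r) (map_ct (\<lambda>x. x) r) ` R"
  define d where "d g = (if g \<in> Gens R then e (r g) else None)" for g
  have GR: "Gens R' = r ` Gens R" unfolding Gens_def R'_def by (simp add: gens_rename case_prod_unfold image_UN image_Un)
  have hR: "(\<forall>(t, u)\<in>R'. holds N h' t u) \<longleftrightarrow> (\<forall>(t, u)\<in>R. holds N h t u)"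
    if h'h: "\<And>g. g \<in> Gens R \<Longrightarrow> h' (r g) = h g" for h' h and N :: "('s, 'f, 'u) partial_algebra"
  proof -
    have "holds N h' (map_ct (\<lambda>x. x) r t) (map_ct (\<lambda>x. x) r u) \<longleftrightarrow> holds N h t u" if tu: "(t, u) \<in> R" for t u
    proof -
      have "gens t \<subseteq> Gens R" "gens u \<subseteq> Gens R" using tu unfolding Gens_def by auto
      then have "\<forall>g\<in>gens t \<union> gens u. (h' \<circ> r) g = h g" using h'h by auto
      then have "ev N (h' \<circ> r) t = ev N h t" "ev N (h' \<circ> r) u = ev N h u"
        by (intro ev_cong; blast)+
      then show ?thesis unfolding holds_def ev_rename by simp
    qed
    then have "\<forall>x\<in>R. holds N h' (map_ct (\<lambda>x. x) r (fst x)) (map_ct (\<lambda>x. x) r (snd x)) \<longleftrightarrow>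
        holds N h (fst x) (snd x)" by auto
    then show ?thesis unfolding R'_def by (simp add: case_prod_unfold)
  qed
  note M' = presentsD[OF M[folded R'_def]]
  show ?thesis
    unfolding d_def[symmetric] presents_def
  proof (intro conjI allI impI)
    show "is_model T M" by (rule M'(1))
    show "valuation M d" unfolding valuation_def
    proof (intro allI impI)
      fix g x assume "d g = Some x"
      then have "e (r g) = Some x" by (auto simp: d_def split: if_splits)
      then show "x \<in> carrier M (snd g)" using M'(2) r(2)[of g] unfolding valuation_def by metis
    qed
    show "dom d \<subseteq> Gens R" by (auto simp: d_def dom_def)
    show "\<forall>(t, u)\<in>R. holds M d t u" using M'(4) hR[of e d M] by (simp add: d_def)
    fix N :: "('s, 'f, 'u) partial_algebra" and h assume N: "is_model T N" and h: "valuation N h" "\<forall>(t, u)\<in>R. holds N h t u"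
    \<comment> \<open>\<open>h\<close> is moved along the inverse of \<open>r\<close>. Off the image
      of \<open>r\<close> it stays undefined, in keeping with the domain of \<open>e\<close>, which
      lies within that image.\<close>
    define h' where "h' g' = (if g' \<in> r ` Gens R then h (inv_into (Gens R) r g') else None)" for g'
    have h'r: "h' (r g) = h g" if "g \<in> Gens R" for g using that r(1) by (simp add: h'_def)
    have "valuation N h'" unfolding valuation_def
    proof (intro allI impI)
      fix g' x assume g': "h' g' = Some x"
      then obtain g where g: "g \<in> Gens R" "g' = r g" by (auto simp: h'_def split: if_splits)
      then show "x \<in> carrier N (snd g')" using h(1) h'r[OF g(1)] g' r(2)[of g] unfolding valuation_def by metis
    qed
    moreover have "\<forall>(t, u)\<in>R'. holds N h' t u" using hR[of h' h N] h'r h(2) by blast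
    ultimately have ex: "\<exists>!k. model_hom T M N k \<and> hmap k e \<subseteq>\<^sub>m h'"
      using M[folded R'_def] N unfolding presents_def by blast
    have "hmap k e \<subseteq>\<^sub>m h' \<longleftrightarrow> hmap k d \<subseteq>\<^sub>m h" for k
    proof -
      have "hmap k e \<subseteq>\<^sub>m h' \<longleftrightarrow> (\<forall>g\<in>Gens R. \<forall>x. e (r g) = Some x \<longrightarrow> h' (r g) = Some (k (snd (r g)) x))"
        unfolding hmap_le_iff using M'(3) unfolding GR dom_def by blast
      also have "\<dots> \<longleftrightarrow> (\<forall>g\<in>Gens R. \<forall>x. e (r g) = Some x \<longrightarrow> h g = Some (k (snd g) x))"
        using h'r r(2) by simp
      also have "\<dots> \<longleftrightarrow> hmap k d \<subseteq>\<^sub>m h" unfolding hmap_le_iff d_def by auto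
      finally show ?thesis .
    qed
    then show "\<exists>!k. model_hom T M N k \<and> hmap k d \<subseteq>\<^sub>m h" using ex by simp
  qed
qed

lemma wfR_rename:
  assumes "\<And>g. snd (r g) = snd g" "wfR R"
  shows "wfR (map_prod (map_ct (\<lambda>x. x) r) (map_ct (\<lambda>x. x) r) ` R)"
proof -
  have "csort (map_ct (\<lambda>x. x) r t) = csort t" for t using assms(1) by (cases t) auto
  moreover from this have "wft (map_ct (\<lambda>x. x) r t) = wft t" for t
    by (induction t) (auto simp: assms(1) list_all_iff comp_def)
  ultimately show ?thesis using assms(2) by (fastforce simp: wfR_def)
qed

subsection \<open>The category of models\<close>

lemma hom_compose:
  assumes "is_model T M" "model_hom T M N h" "model_hom T N P k"
  shows "model_hom T M P (\<lambda>s. compose (carrier M s) (k s) (h s))"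
  unfolding model_hom_def
proof (intro conjI allI ballI impI)
  show "compose (carrier M s) (k s) (h s) \<in> carrier M s \<rightarrow>\<^sub>E carrier P s" for s
    using hom_carrier[OF assms(2)] hom_carrier[OF assms(3)] by (auto simp: compose_def)
  fix f xs y assume f: "f \<in> ops T" and y: "interp M f xs = Some y"
  note t = model_interp[OF assms(1) y]
  have "interp N f (map2 h (arity T f) xs) = Some (h (result T f) y)"
    using assms(2) f y unfolding model_hom_def by blast
  then have "interp P f (map2 k (arity T f) (map2 h (arity T f) xs)) = Some (k (result T f) (h (result T f) y))"
    using assms(3) f unfolding model_hom_def by blast
  moreover have "map2 k (arity T f) (map2 h (arity T f) xs) =
      map2 (\<lambda>s. compose (carrier M s) (k s) (h s)) (arity T f) xs"
    using t(2) unfolding tuples_def by (auto simp: list_all2_conv_all_nth compose_eq intro!: nth_equalityI)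
  ultimately show "interp P f (map2 (\<lambda>s. compose (carrier M s) (k s) (h s)) (arity T f) xs) =
      Some (compose (carrier M (result T f)) (k (result T f)) (h (result T f)) y)"
    using t(3) by (simp add: compose_eq)
qed

lemma hom_ident:
  assumes "is_model T M" shows "model_hom T M M (\<lambda>s. restrict id (carrier M s))"
  unfolding model_hom_def
proof (intro conjI allI ballI impI)
  fix f xs y assume "interp M f xs = Some y"
  note t = model_interp[OF assms this]
  have "map2 (\<lambda>s. restrict id (carrier M s)) (arity T f) xs = xs"
    using t(2) unfolding tuples_def by (auto simp: list_all2_conv_all_nth intro!: nth_equalityI)
  then show "interp M f (map2 (\<lambda>s. restrict id (carrier M s)) (arity T f) xs) =
      Some (restrict id (carrier M (result T f)) y)" using t \<open>interp M f xs = Some y\<close> by simp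
qed auto

lemma Mod_Obj: "M \<in> Obj (Mod T) \<longleftrightarrow> is_model T M \<and> (\<forall>s. small TYPE('u) (carrier M s))"
  for M :: "('s, 'f, 'u) partial_algebra"
  by (simp add: Mod_def Let_def)

lemma Mod_hom: "x \<in> hom (Mod T) M N \<longleftrightarrow>
    M \<in> Obj (Mod T) \<and> N \<in> Obj (Mod T) \<and> (\<exists>h. x = (M, h, N) \<and> model_hom T M N h)"
  by (cases x) (auto simp: in_hom Mod_def Let_def)

lemma Mod_Arr: "x \<in> Arr (Mod T) \<Longrightarrow> x \<in> hom (Mod T) (fst x) (snd (snd x))"
  by (cases x) (auto simp: in_hom Mod_def Let_def)

lemma Mod_simps [simp]:
  "Dom (Mod T) x = fst x" "Cod (Mod T) x = snd (snd x)"
  "Id (Mod T) M = (M, \<lambda>s. restrict id (carrier M s), M)"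
  "Cmp (Mod T) (N', k, P) (M, h, N) = (M, \<lambda>s. compose (carrier M s) (k s) (h s), P)"
  by (simp_all add: Mod_def Let_def)

lemma model_hom_ext:
  assumes "model_hom T M N h" "model_hom T M N k" "\<And>s x. x \<in> carrier M s \<Longrightarrow> h s x = k s x"
  shows "h = k"
proof
  fix s show "h s = k s"
    by (rule PiE_ext[of _ "carrier M s" "\<lambda>_. carrier N s"]) (use assms in \<open>auto simp: model_hom_def\<close>)
qed

lemma Mod_category: "category (Mod T)"
  unfolding category_def
proof (intro conjI ballI impI)
  fix f assume f: "f \<in> Arr (Mod T)"
  obtain M h N where F: "f = (M, h, N)" by (cases f)
  have H: "M \<in> Obj (Mod T)" "N \<in> Obj (Mod T)" "model_hom T M N h" using Mod_Arr[OF f] F by (auto simp: Mod_hom)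
  show "Dom (Mod T) f \<in> Obj (Mod T)" "Cod (Mod T) f \<in> Obj (Mod T)" using H F by auto
  have M: "is_model T M" "is_model T N" using H Mod_Obj by blast+
  have "(\<lambda>s. compose (carrier M s) (h s) (restrict id (carrier M s))) = h"
    by (rule model_hom_ext[OF hom_compose[OF M(1) hom_ident[OF M(1)] H(3)] H(3)]) (simp add: compose_eq)
  then show "Cmp (Mod T) f (Id (Mod T) (Dom (Mod T) f)) = f" using F by simp
  have "(\<lambda>s. compose (carrier M s) (restrict id (carrier N s)) (h s)) = h"
    by (rule model_hom_ext[OF hom_compose[OF M(1) H(3) hom_ident[OF M(2)]] H(3)])
      (use hom_carrier[OF H(3)] in \<open>simp add: compose_eq\<close>)
  then show "Cmp (Mod T) (Id (Mod T) (Cod (Mod T) f)) f = f" using F by simp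
next
  fix M assume "M \<in> Obj (Mod T)"
  then show "Id (Mod T) M \<in> hom (Mod T) M M" using hom_ident Mod_Obj by (auto simp: Mod_hom)
next
  fix f g assume fg: "f \<in> Arr (Mod T)" "g \<in> Arr (Mod T)" "Dom (Mod T) g = Cod (Mod T) f"
  obtain M h N where F: "f = (M, h, N)" by (cases f)
  then obtain k P where G: "g = (N, k, P)" using fg by (cases g) auto
  have "M \<in> Obj (Mod T)" "model_hom T M N h" "model_hom T N P k" "P \<in> Obj (Mod T)"
    using Mod_Arr[OF fg(1)] Mod_Arr[OF fg(2)] F G by (auto simp: Mod_hom)
  moreover from this have "is_model T M" using Mod_Obj by blast
  ultimately show "Cmp (Mod T) g f \<in> hom (Mod T) (Dom (Mod T) f) (Cod (Mod T) g)"
    using F G hom_compose[of M N h P k] by (auto simp: Mod_hom)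
next
  fix f g h assume fg: "f \<in> Arr (Mod T)" "g \<in> Arr (Mod T)" "h \<in> Arr (Mod T)"
    "Dom (Mod T) g = Cod (Mod T) f" "Dom (Mod T) h = Cod (Mod T) g"
  obtain M u N where F: "f = (M, u, N)" by (cases f)
  then obtain v P where G: "g = (N, v, P)" using fg by (cases g) auto
  then obtain w Q where H: "h = (P, w, Q)" using fg by (cases h) auto
  have "model_hom T M N u" using Mod_Arr[OF fg(1)] F by (auto simp: Mod_hom)
  then show "Cmp (Mod T) h (Cmp (Mod T) g f) = Cmp (Mod T) (Cmp (Mod T) h g) f"
    using F G H hom_carrier[of M N u] by (auto simp: compose_def fun_eq_iff)
qed

end

subsection \<open>The diagram of a model\<close>

context ea
begin

text \<open>The positive diagram of model theory. The tag \<open>i\<close> keeps the elements of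
  different models apart; the reflexive pairs turn every element into a defined generator, even if
  it occurs in no entry of an operation table.\<close>

definition diag :: "'i \<Rightarrow> ('s, 'f, 'u) partial_algebra \<Rightarrow>
    (('f, ('i \<times> 'u) \<times> 's) ct \<times> ('f, ('i \<times> 'u) \<times> 's) ct) set" where
  "diag i M = {(App f (map2 (\<lambda>s x. Gen ((i, x), s)) (arity T f) xs), Gen ((i, y), result T f)) | f xs y.
       interp M f xs = Some y} \<union> {(Gen ((i, x), s), Gen ((i, x), s)) | x s. x \<in> carrier M s}"

lemma diag_op:
  "interp M f xs = Some y \<Longrightarrow>
    (App f (map2 (\<lambda>s x. Gen ((i, x), s)) (arity T f) xs), Gen ((i, y), result T f)) \<in> diag i M"
  unfolding diag_def by blast

lemma diag_elem: "x \<in> carrier M s \<Longrightarrow> (Gen ((i, x), s), Gen ((i, x), s)) \<in> diag i M"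
  unfolding diag_def by blast

lemma diag_cases:
  assumes "(t, u) \<in> diag i M"
  obtains f xs y where "t = App f (map2 (\<lambda>s x. Gen ((i, x), s)) (arity T f) xs)"
    "u = Gen ((i, y), result T f)" "interp M f xs = Some y"
  | x s where "t = Gen ((i, x), s)" "u = t" "x \<in> carrier M s"
  using assms unfolding diag_def by blast

lemma diag_wfR:
  assumes M: "is_model T M" shows "wfR (diag i M)"
  unfolding wfR_def
proof (clarify)
  fix t u assume "(t, u) \<in> diag i M"
  then show "wft t \<and> wft u \<and> csort t = csort u"
  proof (cases rule: diag_cases)
    case (1 f xs y)
    note f = model_interp[OF M 1(3)]
    have len: "length xs = length (arity T f)" using f(2) by (auto simp: tuples_def dest: list_all2_lengthD)
    have "list_all wft (map2 (\<lambda>s x. Gen ((i, x), s)) (arity T f) xs)"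
      using op_sorts(1)[OF f(1)] len by (auto simp: list_all_length subset_iff)
    moreover have "map csort (map2 (\<lambda>s x. Gen ((i, x), s)) (arity T f) xs) = arity T f"
      using len by (intro nth_equalityI) auto
    ultimately show ?thesis using 1 f(1) op_sorts(2)[OF f(1)] by simp
  next
    case (2 x s)
    then show ?thesis using model_carrier[OF M] by simp
  qed
qed

lemma Gens_diag:
  assumes M: "is_model T M" shows "Gens (diag i M) = {((i, x), s) | x s. x \<in> carrier M s}"
proof
  show "{((i, x), s) | x s. x \<in> carrier M s} \<subseteq> Gens (diag i M)"
    using diag_elem[of _ M _ i] unfolding Gens_def by fastforce
  have "gens t \<union> gens u \<subseteq> {((i, x), s) | x s. x \<in> carrier M s}" if "(t, u) \<in> diag i M" for t u
    using that
  proof (cases rule: diag_cases)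
    case (1 f xs y)
    note f = model_interp[OF M 1(3)]
    show ?thesis using 1 f(2,3) by (auto simp: tuples_def list_all2_conv_all_nth in_set_conv_nth)
  qed auto
  then show "Gens (diag i M) \<subseteq> {((i, x), s) | x s. x \<in> carrier M s}" unfolding Gens_def by blast
qed

lemma diag_args:
  assumes "xs \<in> tuples M \<Gamma>" "\<And>s x. x \<in> carrier M s \<Longrightarrow> h ((i, x), s) = Some (q s x)"
  shows "list_all2 (\<lambda>t y. ev N h t = Some y) (map2 (\<lambda>s x. Gen ((i, x), s)) \<Gamma> xs) (map2 q \<Gamma> xs)"
  using assms by (auto simp: list_all2_conv_all_nth tuples_def)

text \<open>The method of diagrams: valuations that satisfy the table of \<open>M\<close> are
  homomorphisms out of \<open>M\<close>. The converse is \<open>diag_holds\<close>.\<close>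

lemma diag_hom:
  assumes M: "is_model T M" and h: "valuation N h" "\<And>t u. (t, u) \<in> diag i M \<Longrightarrow> holds N h t u"
  defines "q \<equiv> \<lambda>s. \<lambda>x\<in>carrier M s. the (h ((i, x), s))"
  shows "model_hom T M N q" "\<And>s x. x \<in> carrier M s \<Longrightarrow> h ((i, x), s) = Some (q s x)"
proof -
  show q: "h ((i, x), s) = Some (q s x)" if "x \<in> carrier M s" for s x
    using h(2)[OF diag_elem[OF that]] that unfolding q_def by (auto simp: holds_def)
  show "model_hom T M N q"
    unfolding model_hom_def
  proof (intro conjI allI ballI impI)
    show "q s \<in> carrier M s \<rightarrow>\<^sub>E carrier N s" for s
    proof (rule PiE_I)
      show "q s x \<in> carrier N s" if "x \<in> carrier M s" for x
        using q[OF that] h(1) unfolding valuation_def by fastforce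
    qed (simp add: q_def)
    fix f xs y assume y: "interp M f xs = Some y"
    note f = model_interp[OF M y]
    have "holds N h (App f (map2 (\<lambda>s x. Gen ((i, x), s)) (arity T f) xs)) (Gen ((i, y), result T f))"
      by (rule h(2)[OF diag_op[OF y]])
    then have "ev N h (App f (map2 (\<lambda>s x. Gen ((i, x), s)) (arity T f) xs)) = Some (q (result T f) y)"
      using q[OF f(3)] by (simp add: holds_def del: ev.simps(2))
    then obtain ys where "list_all2 (\<lambda>t y. ev N h t = Some y) (map2 (\<lambda>s x. Gen ((i, x), s)) (arity T f) xs) ys"
      "interp N f ys = Some (q (result T f) y)" unfolding ev_App by blast
    then show "interp N f (map2 q (arity T f) xs) = Some (q (result T f) y)"
      using list_all2_Some_determ[OF _ diag_args[of xs M "arity T f" h i q N, OF f(2) q]] by blast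
  qed
qed

lemma diag_holds:
  assumes M: "is_model T M" and q: "model_hom T M N q" "\<And>s x. x \<in> carrier M s \<Longrightarrow> h ((i, x), s) = Some (q s x)"
    and tu: "(t, u) \<in> diag i M"
  shows "holds N h t u"
  using tu
proof (cases rule: diag_cases)
  case (1 f xs y)
  note f = model_interp[OF M 1(3)]
  have "interp N f (map2 q (arity T f) xs) = Some (q (result T f) y)" by (rule hom_interp[OF M q(1) 1(3)])
  then have "ev N h t = Some (q (result T f) y)"
    using diag_args[of xs M "arity T f" h i q N, OF f(2) q(2)]
    unfolding 1(1) ev_App by blast
  then show ?thesis using q(2)[OF f(3)] unfolding holds_def 1(2) by simp
next
  case (2 x s)
  then show ?thesis using q(2) by (simp add: holds_def)
qed

end


locale small_ea = universe U + ea T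
  for U :: "'u itself" and T :: "('s :: countable, 'f :: countable) ea_theory"
begin

text \<open>Fixing the coding by choice makes the model a function of \<open>R\<close>, so that a
  family of presented models is no larger than the family of its relations.\<close>

definition Pres :: "(('f, 'a \<times> 's) ct \<times> ('f, 'a \<times> 's) ct) set \<Rightarrow> ('s, 'f, 'u) partial_algebra" where
  "Pres R = pres R (SOME c. separates R c)"

text \<open>Besides the universal property it records two facts about the construction: every
  element is denoted by a provably defined term, and generators with equal values are provably
  equal. From these the elements of a directed colimit are determined.\<close>

lemma Pres:
  fixes R :: "(('f, 'a \<times> 's) ct \<times> ('f, 'a \<times> 's) ct) set"
  assumes R: "wfR R" and small: "small TYPE('u) (Gens R)"
  obtains e where "presents (Pres R) e R" "Pres R \<in> Obj (Mod T)"
    "\<And>x s. x \<in> carrier (Pres R) s \<Longrightarrow> \<exists>t. eqv R t t \<and> csort t = s \<and> ev (Pres R) e t = Some x"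
    "\<And>g g' x. e g = Some x \<Longrightarrow> e g' = Some x \<Longrightarrow> eqv R (Gen g) (Gen g')"
proof -
  have "{t. eqv R t t} \<subseteq> {t. gens t \<subseteq> Gens R}" using eqv_gens[OF R] by auto
  then have sm: "small TYPE('u) {t. eqv R t t}" using small_terms[OF small] by (rule small_subset)
  then obtain j :: "('f, 'a \<times> 's) ct \<Rightarrow> 'u" where j: "inj_on j {t. eqv R t t}" by (rule small_imp_inj)
  \<comment> \<open>The representative depends on the class alone: for provably equal
    \<open>t\<close> and \<open>u\<close> the predicates \<open>eqv R t\<close> and
    \<open>eqv R u\<close> coincide.\<close>
  define c where "c t = j (SOME u. eqv R t u)" for t
  have "separates R c"
    unfolding separates_def
  proof (intro allI impI)
    fix t u assume tu: "eqv R t t" "eqv R u u"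
    have rep: "eqv R t (SOME u. eqv R t u)" if "eqv R t t" for t using that by (rule someI)
    show "c t = c u \<longleftrightarrow> eqv R t u"
    proof
      assume "c t = c u"
      then have "(SOME v. eqv R t v) = (SOME v. eqv R u v)"
        unfolding c_def by (rule inj_onD[OF j]) (use rep tu eqv_refl in blast)+
      then show "eqv R t u" using rep[OF tu(1)] rep[OF tu(2)] eqv.sym eqv.trans by metis
    next
      assume "eqv R t u"
      then have "eqv R t = eqv R u" using eqv.sym eqv.trans by (intro ext iffI) blast+
      then show "c t = c u" unfolding c_def by simp
    qed
  qed
  then have c: "separates R (SOME c :: _ \<Rightarrow> 'u. separates R c)" by (rule someI[of "separates R"])
  define c where "c = (SOME c :: _ \<Rightarrow> 'u. separates R c)"
  have P: "Pres R = pres R c" by (simp add: Pres_def c_def)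
  note c = c[folded c_def]
  show ?thesis
  proof (rule that[of "generic R c"])
    show "presents (Pres R) (generic R c) R" unfolding P by (rule pres_presents[OF R c])
    have "carrier (Pres R) s \<subseteq> c ` {t. eqv R t t}" for s unfolding P by (auto simp: pres_def)
    then have "small TYPE('u) (carrier (Pres R) s)" for s by (rule small_subset) (intro small_image sm)
    then show "Pres R \<in> Obj (Mod T)" using pres_model[OF R c] unfolding Mod_Obj P by blast
    show "\<exists>t. eqv R t t \<and> csort t = s \<and> ev (Pres R) (generic R c) t = Some x"
      if x: "x \<in> carrier (Pres R) s" for x s
    proof -
      obtain t where "x = c t" "eqv R t t" "csort t = s" using x unfolding P by (auto simp: pres_def)
      then show ?thesis using ev_pres[OF R c, of t] unfolding P by auto
    qed
    show "eqv R (Gen g) (Gen g')" if "generic R c g = Some x" "generic R c g' = Some x" for g g' x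
      using that code_eq[OF R c, of "Gen g" "Gen g'"] by (auto simp: generic_def split: if_splits)
  qed
qed

end

text \<open>Arrows of \<open>Mod T\<close> are triples of a domain, a family of maps, and a codomain.\<close>

abbreviation maps :: "'a \<times> 'b \<times> 'c \<Rightarrow> 'b" where "maps x \<equiv> fst (snd x)"

section \<open>Colimits of arbitrary small diagrams of models\<close>

locale model_diagram = small_ea U T
  for U :: "'u itself" and T :: "('s :: countable, 'f :: countable) ea_theory" +
  fixes J :: "('i, 'j) cat" and Do :: "'i \<Rightarrow> ('s, 'f, 'u) partial_algebra" and Dm
  assumes J: "category J" and D: "is_functor J (Mod T) Do Dm"
begin

lemma diagram_obj: "i \<in> Obj J \<Longrightarrow> Do i \<in> Obj (Mod T)" "i \<in> Obj J \<Longrightarrow> is_model T (Do i)"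
  "i \<in> Obj J \<Longrightarrow> small TYPE('u) (carrier (Do i) s)"
  using functor_obj[OF D] by (auto simp: Mod_Obj)

lemma J_Arr: "u \<in> Arr J \<Longrightarrow> Dom J u \<in> Obj J" "u \<in> Arr J \<Longrightarrow> Cod J u \<in> Obj J"
  using J unfolding category_def by auto

lemma diagram_arr:
  assumes "u \<in> Arr J"
  shows "Dm u = (Do (Dom J u), maps (Dm u), Do (Cod J u))"
    "model_hom T (Do (Dom J u)) (Do (Cod J u)) (maps (Dm u))"
  using functor_Arr[OF D assms] by (auto simp: Mod_hom)

lemma cocone_iff:
  "is_cocone J (Mod T) Do Dm N q \<longleftrightarrow> N \<in> Obj (Mod T) \<and>
     (\<forall>i\<in>Obj J. q i = (Do i, maps (q i), N) \<and> model_hom T (Do i) N (maps (q i))) \<and>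
     (\<forall>u\<in>Arr J. \<forall>s. \<forall>x\<in>carrier (Do (Dom J u)) s.
        maps (q (Cod J u)) s (maps (Dm u) s x) = maps (q (Dom J u)) s x)" (is "?L \<longleftrightarrow> ?R")
proof -
  have 1: "(\<forall>i\<in>Obj J. q i \<in> hom (Mod T) (Do i) N) \<longleftrightarrow>
      (\<forall>i\<in>Obj J. q i = (Do i, maps (q i), N) \<and> model_hom T (Do i) N (maps (q i)))"
    if "N \<in> Obj (Mod T)" using that diagram_obj(1) unfolding Mod_hom by (metis fst_conv snd_conv)
  have 2: "Cmp (Mod T) (q (Cod J u)) (Dm u) = q (Dom J u) \<longleftrightarrow>
      (\<forall>s. \<forall>x\<in>carrier (Do (Dom J u)) s. maps (q (Cod J u)) s (maps (Dm u) s x) = maps (q (Dom J u)) s x)"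
    if u: "u \<in> Arr J" and q: "\<forall>i\<in>Obj J. q i = (Do i, maps (q i), N) \<and> model_hom T (Do i) N (maps (q i))" for u
  proof -
    define M where "M = Do (Dom J u)"
    define P where "P = Do (Cod J u)"
    obtain a where a: "Dm u = (M, a, P)" "model_hom T M P a"
      using diagram_arr[OF u] unfolding M_def P_def by metis
    obtain b where b: "q (Cod J u) = (P, b, N)" "model_hom T P N b" using q J_Arr[OF u] unfolding P_def by metis
    obtain c where c: "q (Dom J u) = (M, c, N)" "model_hom T M N c" using q J_Arr[OF u] unfolding M_def by metis
    have M: "is_model T M" using diagram_obj J_Arr u unfolding M_def by blast
    have "(\<lambda>s. compose (carrier M s) (b s) (a s)) = c \<longleftrightarrow> (\<forall>s. \<forall>x\<in>carrier M s. b s (a s x) = c s x)"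
    proof
      assume e: "(\<lambda>s. compose (carrier M s) (b s) (a s)) = c"
      show "\<forall>s. \<forall>x\<in>carrier M s. b s (a s x) = c s x" unfolding e[symmetric] by (simp add: compose_eq)
    next
      assume "\<forall>s. \<forall>x\<in>carrier M s. b s (a s x) = c s x"
      then show "(\<lambda>s. compose (carrier M s) (b s) (a s)) = c"
        by (intro model_hom_ext[OF hom_compose[OF M a(2) b(2)] c(2)]) (simp add: compose_eq)
    qed
    then show ?thesis unfolding M_def[symmetric] by (simp add: a b c)
  qed
  show ?thesis
  proof (cases "N \<in> Obj (Mod T) \<and>
      (\<forall>i\<in>Obj J. q i = (Do i, maps (q i), N) \<and> model_hom T (Do i) N (maps (q i)))")
    case True
    then have "(\<forall>i\<in>Obj J. q i \<in> hom (Mod T) (Do i) N)" using 1 by blast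
    then show ?thesis unfolding is_cocone_def using True 2 by blast
  next
    case False
    then show ?thesis unfolding is_cocone_def using 1 by blast
  qed
qed

definition diagram_relations :: "(('f, ('i \<times> 'u) \<times> 's) ct \<times> ('f, ('i \<times> 'u) \<times> 's) ct) set" where
  "diagram_relations = (\<Union>i\<in>Obj J. diag i (Do i)) \<union>
     {(Gen ((Dom J u, x), s), Gen ((Cod J u, maps (Dm u) s x), s)) | u x s.
        u \<in> Arr J \<and> x \<in> carrier (Do (Dom J u)) s}"

lemma diagram_relations_cases:
  assumes "(t, u) \<in> diagram_relations"
  obtains i where "i \<in> Obj J" "(t, u) \<in> diag i (Do i)"
  | v x s where "v \<in> Arr J" "x \<in> carrier (Do (Dom J v)) s"
      "t = Gen ((Dom J v, x), s)" "u = Gen ((Cod J v, maps (Dm v) s x), s)"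
  using assms unfolding diagram_relations_def by blast

lemma diagram_relations_wfR: "wfR diagram_relations"
  unfolding wfR_def
proof (clarify)
  fix t u assume "(t, u) \<in> diagram_relations"
  then show "wft t \<and> wft u \<and> csort t = csort u"
  proof (cases rule: diagram_relations_cases)
    case (1 i)
    then show ?thesis using diag_wfR[OF diagram_obj(2)[OF 1(1)], of i] unfolding wfR_def by auto
  next
    case (2 v x s)
    have "s \<in> sorts T" using model_carrier[OF diagram_obj(2)[OF J_Arr(1)[OF 2(1)]] 2(2)] .
    then show ?thesis using 2 by simp
  qed
qed

lemma diagram_relations_Gens: "Gens diagram_relations = {((i, x), s) | i x s. i \<in> Obj J \<and> x \<in> carrier (Do i) s}"
proof
  show "{((i, x), s) | i x s. i \<in> Obj J \<and> x \<in> carrier (Do i) s} \<subseteq> Gens diagram_relations"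
  proof (clarify)
    fix i x s assume i: "i \<in> Obj J" "x \<in> carrier (Do i) s"
    then have "(Gen ((i, x), s), Gen ((i, x), s)) \<in> diagram_relations"
      unfolding diagram_relations_def using diag_elem[of x "Do i" s i] by blast
    then show "((i, x), s) \<in> Gens diagram_relations" unfolding Gens_def by fastforce
  qed
  have "gens t \<union> gens u \<subseteq> {((i, x), s) | i x s. i \<in> Obj J \<and> x \<in> carrier (Do i) s}"
    if "(t, u) \<in> diagram_relations" for t u
    using that
  proof (cases rule: diagram_relations_cases)
    case (1 i)
    then have "gens t \<union> gens u \<subseteq> Gens (diag i (Do i))" unfolding Gens_def by blast
    then show ?thesis using 1 Gens_diag[OF diagram_obj(2)[OF 1(1)], of i] by auto
  next
    case (2 v x s)
    then show ?thesis using J_Arr hom_carrier[OF diagram_arr(2)] by auto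
  qed
  then show "Gens diagram_relations \<subseteq> {((i, x), s) | i x s. i \<in> Obj J \<and> x \<in> carrier (Do i) s}"
    unfolding Gens_def by blast
qed

lemma diagram_relations_small:
  assumes "small TYPE('u) (Obj J)" shows "small TYPE('u) (Gens diagram_relations)"
proof -
  have "Gens diagram_relations = (\<Union>i\<in>Obj J. \<Union>s. (\<lambda>x. ((i, x), s)) ` carrier (Do i) s)"
    unfolding diagram_relations_Gens by auto
  also have "small TYPE('u) \<dots>"
    by (intro small_UN assms small_image small_countable countableI_type diagram_obj(3))
  finally show ?thesis .
qed

definition cocone_val :: "('i \<Rightarrow> 'a \<times> ('s \<Rightarrow> 'u \<Rightarrow> 'u) \<times> 'b) \<Rightarrow> ('i \<times> 'u) \<times> 's \<rightharpoonup> 'u" where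
  "cocone_val q = (\<lambda>((i, x), s). if i \<in> Obj J \<and> x \<in> carrier (Do i) s then Some (maps (q i) s x) else None)"

text \<open>Satisfying the tables says that the legs are homomorphisms, satisfying the transition
  relations says that they commute with the diagram.\<close>

lemma cocone_val:
  assumes "is_cocone J (Mod T) Do Dm N q"
  shows "valuation N (cocone_val q)" "\<forall>(t, u)\<in>diagram_relations. holds N (cocone_val q) t u"
proof -
  note q = assms[unfolded cocone_iff]
  show "valuation N (cocone_val q)"
    unfolding valuation_def
  proof (intro allI impI)
    fix g y assume "cocone_val q g = Some y"
    then obtain i x s where "g = ((i, x), s)" "i \<in> Obj J" "x \<in> carrier (Do i) s" "y = maps (q i) s x"
      by (auto simp: cocone_val_def split: prod.splits if_splits)
    then show "y \<in> carrier N (snd g)" using q hom_carrier[of "Do i" N] by auto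
  qed
  show "\<forall>(t, u)\<in>diagram_relations. holds N (cocone_val q) t u"
  proof (clarify)
    fix t u assume "(t, u) \<in> diagram_relations"
    then show "holds N (cocone_val q) t u"
    proof (cases rule: diagram_relations_cases)
      case (1 i)
      have "model_hom T (Do i) N (maps (q i))" using q 1(1) by blast
      then show ?thesis
        by (rule diag_holds[OF diagram_obj(2)[OF 1(1)] _ _ 1(2)]) (use 1 in \<open>simp add: cocone_val_def\<close>)
    next
      case (2 v x s)
      then have "maps (Dm v) s x \<in> carrier (Do (Cod J v)) s" using hom_carrier[OF diagram_arr(2)] by blast
      then show ?thesis using q 2 J_Arr by (simp add: cocone_val_def holds_def)
    qed
  qed
qed

lemma colimit_val:
  assumes "presents M e diagram_relations" "i \<in> Obj J"
  defines "k \<equiv> \<lambda>s. \<lambda>x\<in>carrier (Do i) s. the (e ((i, x), s))"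
  shows "model_hom T (Do i) M k" "x \<in> carrier (Do i) s \<Longrightarrow> e ((i, x), s) = Some (k s x)"
proof -
  have "holds M e t u" if "(t, u) \<in> diag i (Do i)" for t u
    using presentsD(4)[OF assms(1)] that assms(2) unfolding diagram_relations_def by blast
  then show "model_hom T (Do i) M k" "x \<in> carrier (Do i) s \<Longrightarrow> e ((i, x), s) = Some (k s x)"
    using diag_hom[OF diagram_obj(2)[OF assms(2)] presentsD(2)[OF assms(1)]] unfolding k_def by blast+
qed

text \<open>Cocones are valuations satisfying \<open>diagram_relations\<close>, and a homomorphism
  extends such a valuation exactly if it factors the cocone. The two universal properties thus
  coincide.\<close>

lemma colimit_presents:
  assumes M: "M \<in> Obj (Mod T)" and e: "presents M e diagram_relations"
  shows "is_colimit J (Mod T) Do Dm M (\<lambda>i. (Do i, \<lambda>s. \<lambda>x\<in>carrier (Do i) s. the (e ((i, x), s)), M))"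
    (is "is_colimit _ _ _ _ _ ?p")
  unfolding is_colimit_def
proof (intro conjI allI impI)
  note M' = presentsD[OF e]
  have p: "model_hom T (Do i) M (maps (?p i))"
    "\<And>s x. x \<in> carrier (Do i) s \<Longrightarrow> e ((i, x), s) = Some (maps (?p i) s x)" if "i \<in> Obj J" for i
    using colimit_val[OF e that] by (simp_all only: fst_conv snd_conv)
  show "is_cocone J (Mod T) Do Dm M ?p"
    unfolding cocone_iff
  proof (intro conjI ballI allI)
    fix v s x assume v: "v \<in> Arr J" "x \<in> carrier (Do (Dom J v)) s"
    then have "(Gen ((Dom J v, x), s), Gen ((Cod J v, maps (Dm v) s x), s)) \<in> diagram_relations"
      unfolding diagram_relations_def by blast
    then have "e ((Dom J v, x), s) = e ((Cod J v, maps (Dm v) s x), s)"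
      using M'(4) by (fastforce simp: holds_def)
    then show "maps (?p (Cod J v)) s (maps (Dm v) s x) = maps (?p (Dom J v)) s x"
      using p(2)[OF J_Arr(1)[OF v(1)] v(2)]
        p(2)[OF J_Arr(2)[OF v(1)] hom_carrier[OF diagram_arr(2)[OF v(1)] v(2)]] by simp
  qed (use M p in auto)
  fix N q assume q: "is_cocone J (Mod T) Do Dm N q"
  note q' = q[unfolded cocone_iff]
  have N: "N \<in> Obj (Mod T)" "is_model T N" using q' Mod_Obj by blast+
  \<comment> \<open>The generators mentioned by the relations are the elements of the
    \<open>Do i\<close>, so extending the valuation is commuting with the legs, element by
    element.\<close>
  have iff: "hmap k e \<subseteq>\<^sub>m cocone_val q \<longleftrightarrow> (\<forall>i\<in>Obj J. Cmp (Mod T) (M, k, N) (?p i) = q i)"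
    if k: "model_hom T M N k" for k
  proof -
    have "hmap k e \<subseteq>\<^sub>m cocone_val q \<longleftrightarrow>
        (\<forall>g\<in>Gens diagram_relations. \<forall>y. e g = Some y \<longrightarrow> cocone_val q g = Some (k (snd g) y))"
      unfolding hmap_le_iff using M'(3) by (auto simp: dom_def)
    also have "\<dots> \<longleftrightarrow> (\<forall>i\<in>Obj J. \<forall>s. \<forall>x\<in>carrier (Do i) s. maps (q i) s x = k s (maps (?p i) s x))"
      unfolding diagram_relations_Gens using p(2) by (force simp: cocone_val_def)
    also have "\<dots> \<longleftrightarrow> (\<forall>i\<in>Obj J. Cmp (Mod T) (M, k, N) (?p i) = q i)"
    proof (intro ball_cong refl)
      fix i assume i: "i \<in> Obj J"
      then obtain a where a: "q i = (Do i, a, N)" "model_hom T (Do i) N a" using q' by metis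
      have "(\<lambda>s. compose (carrier (Do i) s) (k s) (maps (?p i) s)) = a \<longleftrightarrow>
          (\<forall>s. \<forall>x\<in>carrier (Do i) s. a s x = k s (maps (?p i) s x))"
      proof
        assume e: "(\<lambda>s. compose (carrier (Do i) s) (k s) (maps (?p i) s)) = a"
        show "\<forall>s. \<forall>x\<in>carrier (Do i) s. a s x = k s (maps (?p i) s x)"
          unfolding e[symmetric] by (simp add: compose_eq)
      next
        assume "\<forall>s. \<forall>x\<in>carrier (Do i) s. a s x = k s (maps (?p i) s x)"
        then show "(\<lambda>s. compose (carrier (Do i) s) (k s) (maps (?p i) s)) = a"
          by (intro model_hom_ext[OF hom_compose[OF diagram_obj(2)[OF i] p(1)[OF i] k] a(2)])
            (simp add: compose_eq)
      qed
      then show "(\<forall>s. \<forall>x\<in>carrier (Do i) s. maps (q i) s x = k s (maps (?p i) s x)) \<longleftrightarrow>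
          Cmp (Mod T) (M, k, N) (?p i) = q i" by (simp add: a)
    qed
    finally show ?thesis .
  qed
  have ex: "\<exists>!k. model_hom T M N k \<and> hmap k e \<subseteq>\<^sub>m cocone_val q"
    using e N(2) cocone_val[OF q] unfolding presents_def by blast
  then obtain k where k: "model_hom T M N k" "hmap k e \<subseteq>\<^sub>m cocone_val q" by blast
  show "\<exists>!h. h \<in> hom (Mod T) M N \<and> (\<forall>i\<in>Obj J. Cmp (Mod T) h (?p i) = q i)"
  proof (rule ex1I[of _ "(M, k, N)"])
    show "(M, k, N) \<in> hom (Mod T) M N \<and> (\<forall>i\<in>Obj J. Cmp (Mod T) (M, k, N) (?p i) = q i)"
      using iff[OF k(1)] k M N(1) by (auto simp: Mod_hom)
  next
    fix h assume h: "h \<in> hom (Mod T) M N \<and> (\<forall>i\<in>Obj J. Cmp (Mod T) h (?p i) = q i)"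
    then obtain k' where k': "h = (M, k', N)" "model_hom T M N k'" by (auto simp: Mod_hom)
    then have "hmap k' e \<subseteq>\<^sub>m cocone_val q" using iff[OF k'(2)] h by blast
    then have "k' = k" using ex k k'(2) by blast
    then show "h = (M, k, N)" using k' by simp
  qed
qed

end

context small_ea
begin

theorem Mod_cocomplete: "cocomplete_category TYPE('u) (Mod T :: (('s, 'f, 'u) partial_algebra, _) cat)"
  unfolding cocomplete_category_def
proof (intro conjI allI impI)
  show "category (Mod T :: (('s, 'f, 'u) partial_algebra, _) cat)" by (rule Mod_category)
  fix J :: "('u, 'u) cat" and Do :: "'u \<Rightarrow> ('s, 'f, 'u) partial_algebra" and Dm
  assume J: "small_cat J" and D: "is_functor J (Mod T) Do Dm"
  interpret model_diagram U T J Do Dm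
    by unfold_locales (use J D in \<open>auto simp: small_cat_def\<close>)
  have "small TYPE('u) (Obj J)" using \<open>small_cat J\<close> by (simp add: small_cat_def)
  then obtain e where "presents (Pres diagram_relations) e diagram_relations" "Pres diagram_relations \<in> Obj (Mod T)"
    using Pres[OF diagram_relations_wfR diagram_relations_small] by metis
  then show "\<exists>c p. is_colimit J (Mod T) Do Dm c p" using colimit_presents by blast
qed

end

subsection \<open>Directed colimits of models\<close>

lemma directed_upper_bound:
  assumes "directed_poset I r" "finite S" "S \<subseteq> I"
  shows "\<exists>k\<in>I. \<forall>j\<in>S. (j, k) \<in> r"
  using assms(2,3)
proof induction
  case empty
  then show ?case using assms(1) unfolding directed_poset_def by blast
next
  case (insert x S)
  then obtain k where k: "k \<in> I" "\<forall>j\<in>S. (j, k) \<in> r" by auto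
  obtain l where l: "l \<in> I" "(k, l) \<in> r" "(x, l) \<in> r"
    using assms(1) k(1) insert.prems unfolding directed_poset_def by blast
  have "trans r" using assms(1) unfolding directed_poset_def partial_order_on_def preorder_on_def by blast
  then show ?case using k l by (auto dest: transD)
qed

locale directed_diagram = small_ea U T
  for U :: "'u itself" and T :: "('s :: countable, 'f :: countable) ea_theory" +
  fixes I :: "'i set" and r and Do :: "'i \<Rightarrow> ('s, 'f, 'u) partial_algebra" and Dm
  assumes dp: "directed_poset I r" and D: "is_functor (poset_cat I r) (Mod T) Do Dm"
begin

sublocale model_diagram U T "poset_cat I r" Do Dm
  by unfold_locales (use dp D in \<open>auto intro: poset_category\<close>)

abbreviation tr :: "'i \<Rightarrow> 'i \<Rightarrow> 's \<Rightarrow> 'u \<Rightarrow> 'u" where "tr i j \<equiv> maps (Dm (i, j))"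

lemma r_I: "(i, j) \<in> r \<Longrightarrow> i \<in> I" "(i, j) \<in> r \<Longrightarrow> j \<in> I"
  and r_refl: "i \<in> I \<Longrightarrow> (i, i) \<in> r"
  and r_trans: "(i, j) \<in> r \<Longrightarrow> (j, k) \<in> r \<Longrightarrow> (i, k) \<in> r"
  using dp unfolding directed_poset_def partial_order_on_def preorder_on_def refl_on_def
  by (auto dest: transD)

lemma Do_model: "i \<in> I \<Longrightarrow> is_model T (Do i)"
  using diagram_obj(2) by simp

lemma tr_hom: "(i, j) \<in> r \<Longrightarrow> model_hom T (Do i) (Do j) (tr i j)"
  using diagram_arr(2)[of "(i, j)"] by simp

lemma tr_carrier: "(i, j) \<in> r \<Longrightarrow> x \<in> carrier (Do i) s \<Longrightarrow> tr i j s x \<in> carrier (Do j) s"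
  using hom_carrier[OF tr_hom] .

lemma tr_id: "i \<in> I \<Longrightarrow> x \<in> carrier (Do i) s \<Longrightarrow> tr i i s x = x"
  using functor_id[OF D, of i] by simp

lemma tr_tr:
  assumes "(i, j) \<in> r" "(j, k) \<in> r" "x \<in> carrier (Do i) s"
  shows "tr j k s (tr i j s x) = tr i k s x"
proof -
  obtain a b where ab: "Dm (i, j) = (Do i, a, Do j)" "Dm (j, k) = (Do j, b, Do k)"
    using diagram_arr(1)[of "(i, j)"] diagram_arr(1)[of "(j, k)"] assms by (metis fst_conv snd_conv poset_cat_simps(2-4))
  have "Dm (Cmp (poset_cat I r) (j, k) (i, j)) = Cmp (Mod T) (Dm (j, k)) (Dm (i, j))"
    by (rule functor_cmp[OF D, of _ i j _ k]) (use assms in \<open>auto simp: in_hom\<close>)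
  then show ?thesis using assms(3) by (simp add: ab compose_eq)
qed

text \<open>At stage \<open>j\<close> only the elements of earlier stages have a value, namely their
  image in \<open>Do j\<close>. If \<open>stage j\<close> values a generator from index
  \<open>i\<close>, then \<open>j\<close> lies above \<open>i\<close>.\<close>

definition stage :: "'i \<Rightarrow> ('i \<times> 'u) \<times> 's \<rightharpoonup> 'u" where
  "stage j = (\<lambda>((i, x), s). if (i, j) \<in> r \<and> x \<in> carrier (Do i) s then Some (tr i j s x) else None)"

lemma stage_val: "valuation (Do j) (stage j)"
  unfolding valuation_def stage_def using tr_carrier by (auto split: if_splits)

lemma stage_mono: "(j, k) \<in> r \<Longrightarrow> hmap (tr j k) (stage j) \<subseteq>\<^sub>m stage k"
  unfolding hmap_le_iff stage_def using tr_tr r_trans by (auto split: if_splits)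

text \<open>A table entry of \<open>Do i\<close> holds at stage \<open>i\<close>, and a transition
  relation from \<open>i\<close> to \<open>j\<close> holds at stage \<open>j\<close>; directed
  soundness extends this to all consequences.\<close>

lemma stage_sound:
  assumes "eqv diagram_relations t u" shows "\<exists>j\<in>I. holds (Do j) (stage j) t u"
proof (rule eqv_sound_directed[where I = I and N = Do and h = stage and R = diagram_relations
      and le = "\<lambda>i j. (i, j) \<in> r", OF diagram_relations_wfR])
  fix t u assume "(t, u) \<in> diagram_relations"
  then show "\<exists>i\<in>I. holds (Do i) (stage i) t u"
  proof (cases rule: diagram_relations_cases)
    case (1 i)
    then have i: "i \<in> I" by simp
    have "holds (Do i) (stage i) t u"
      by (rule diag_holds[OF Do_model[OF i] tr_hom[OF r_refl[OF i]] _ 1(2)])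
        (use i r_refl in \<open>simp add: stage_def\<close>)
    then show ?thesis using i by blast
  next
    case (2 v x s)
    obtain i j where v: "v = (i, j)" by (cases v)
    have ij: "(i, j) \<in> r" "i \<in> I" "j \<in> I" using 2 v r_I by auto
    have x: "x \<in> carrier (Do i) s" using 2 v by simp
    have "holds (Do j) (stage j) t u"
      using ij x r_refl tr_carrier[OF ij(1) x] tr_id by (simp add: 2 v stage_def holds_def)
    then show ?thesis using ij by blast
  qed
next
  show "I \<noteq> {}" "\<And>i j. i \<in> I \<Longrightarrow> j \<in> I \<Longrightarrow> \<exists>k\<in>I. (i, k) \<in> r \<and> (j, k) \<in> r"
    using dp unfolding directed_poset_def by blast+
  fix i j :: 'i and t u :: "('f, ('i \<times> 'u) \<times> 's) ct"
  assume "i \<in> I" "(i, j) \<in> r" "wft t" "wft u" "csort t = csort u" "holds (Do i) (stage i) t u"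
  then show "holds (Do j) (stage j) t u"
    using holds_hom[OF Do_model tr_hom] holds_mono[OF stage_mono] by blast
qed (use Do_model stage_val assms in auto)

context
  fixes c p
  assumes small_I: "small TYPE('u) I"
    and colim: "is_colimit (poset_cat I r) (Mod T) Do Dm c p"
begin

lemma cocone: "is_cocone (poset_cat I r) (Mod T) Do Dm c p"
  using colim unfolding is_colimit_def by blast

lemma leg_hom: "i \<in> I \<Longrightarrow> model_hom T (Do i) c (maps (p i))"
  and leg_tr: "(i, j) \<in> r \<Longrightarrow> x \<in> carrier (Do i) s \<Longrightarrow> maps (p j) s (tr i j s x) = maps (p i) s x"
  and leg_eq: "i \<in> I \<Longrightarrow> p i = (Do i, maps (p i), c)"
  and c_Obj: "c \<in> Obj (Mod T)"
  using cocone unfolding cocone_iff by (simp_all, fastforce)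

lemma c_model: "is_model T c"
  using c_Obj by (simp add: Mod_Obj)

text \<open>Both facts are read off from the colimit presented by \<open>diagram_relations\<close>.\<close>

lemma
  shows colimit_surj: "x \<in> carrier c s \<Longrightarrow> \<exists>i\<in>I. \<exists>y\<in>carrier (Do i) s. x = maps (p i) s y" (is "_ \<Longrightarrow> ?S x")
    and colimit_inj: "i \<in> I \<Longrightarrow> y \<in> carrier (Do i) s \<Longrightarrow> y' \<in> carrier (Do i) s \<Longrightarrow>
      maps (p i) s y = maps (p i) s y' \<Longrightarrow> \<exists>j. (i, j) \<in> r \<and> tr i j s y = tr i j s y'"
proof -
  have "small TYPE('u) (Obj (poset_cat I r))" using small_I by simp
  then obtain e where e: "presents (Pres diagram_relations) e diagram_relations"
    and P_Obj: "Pres diagram_relations \<in> Obj (Mod T)"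
    and elem: "\<And>x s. x \<in> carrier (Pres diagram_relations) s \<Longrightarrow>
      \<exists>t. eqv diagram_relations t t \<and> csort t = s \<and> ev (Pres diagram_relations) e t = Some x"
    and same: "\<And>g g' x. e g = Some x \<Longrightarrow> e g' = Some x \<Longrightarrow> eqv diagram_relations (Gen g) (Gen g')"
    using Pres[OF diagram_relations_wfR diagram_relations_small] by metis
  define P where "P = Pres diagram_relations"
  note e = e[folded P_def] and P_Obj = P_Obj[folded P_def] and elem = elem[folded P_def]
  define q where "q i = (\<lambda>s. \<lambda>x\<in>carrier (Do i) s. the (e ((i, x), s)))" for i
  have q: "model_hom T (Do i) P (q i)" "\<And>x s. x \<in> carrier (Do i) s \<Longrightarrow> e ((i, x), s) = Some (q i s x)" if "i \<in> I" for i
    using colimit_val[OF e, of i] that unfolding q_def by simp_all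
  have Pcol: "is_colimit (poset_cat I r) (Mod T) Do Dm P (\<lambda>i. (Do i, q i, P))"
    using colimit_presents[OF P_Obj e] unfolding q_def .
  then have Pcone: "is_cocone (poset_cat I r) (Mod T) Do Dm P (\<lambda>i. (Do i, q i, P))"
    unfolding is_colimit_def by blast
  then have q_tr: "q j s (tr i j s x) = q i s x" if "(i, j) \<in> r" "x \<in> carrier (Do i) s" for i j s x
    using that unfolding cocone_iff by fastforce
  \<comment> \<open>\<open>c\<close> is an arbitrary colimit. Comparison homomorphisms in both
    directions carry the description of the presented colimit \<open>P\<close> over to it.\<close>
  obtain H where H: "H \<in> hom (Mod T) P c" "\<forall>i\<in>I. Cmp (Mod T) H (Do i, q i, P) = p i"
    using Pcol cocone unfolding is_colimit_def poset_cat_simps by blast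
  obtain H' where H': "H' \<in> hom (Mod T) c P" "\<forall>i\<in>I. Cmp (Mod T) H' (p i) = (Do i, q i, P)"
    using colim Pcone unfolding is_colimit_def poset_cat_simps by blast
  obtain h where h: "H = (P, h, c)" "model_hom T P c h" using H(1) by (auto simp: Mod_hom)
  obtain h' where h': "H' = (c, h', P)" "model_hom T c P h'" using H'(1) by (auto simp: Mod_hom)
  have hq: "h s (q i s y) = maps (p i) s y" if "i \<in> I" "y \<in> carrier (Do i) s" for i s y
  proof -
    have "p i = (Do i, \<lambda>s. compose (carrier (Do i) s) (h s) (q i s), c)" using H(2) that(1) h by auto
    then show ?thesis using that(2) by (simp add: compose_eq)
  qed
  have h'p: "h' s (maps (p i) s y) = q i s y" if i: "i \<in> I" "y \<in> carrier (Do i) s" for i s y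
  proof -
    obtain k where k: "p i = (Do i, k, c)" using leg_eq[OF i(1)] by metis
    have "q i = (\<lambda>s. compose (carrier (Do i) s) (h' s) (k s))" using H'(2) i(1) h' k by auto
    then show ?thesis using i(2) k by (simp add: compose_eq)
  qed
  have hp: "p i \<in> hom (Mod T) (Do i) c" if "i \<in> I" for i
    using cocone that unfolding is_cocone_def by simp
  \<comment> \<open>Both are endomorphisms of \<open>c\<close> compatible with the legs.\<close>
  have "Cmp (Mod T) H H' = Id (Mod T) c"
  proof (rule ex1_equality)
    show "\<exists>!h. h \<in> hom (Mod T) c c \<and> (\<forall>i\<in>I. Cmp (Mod T) h (p i) = p i)"
      using colim cocone unfolding is_colimit_def poset_cat_simps by blast
    show "Cmp (Mod T) H H' \<in> hom (Mod T) c c \<and> (\<forall>i\<in>I. Cmp (Mod T) (Cmp (Mod T) H H') (p i) = p i)"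
      using category_cmp[OF Mod_category H'(1) H(1)] category_assoc[OF Mod_category hp H'(1) H(1)] H(2) H'(2)
      by auto
    show "Id (Mod T) c \<in> hom (Mod T) c c \<and> (\<forall>i\<in>I. Cmp (Mod T) (Id (Mod T) c) (p i) = p i)"
      using category_id[OF Mod_category] c_Obj hp by blast
  qed
  then have hh: "(\<lambda>s. compose (carrier c s) (h s) (h' s)) = (\<lambda>s. restrict id (carrier c s))"
    by (simp add: h(1) h'(1))
  have hh': "h s (h' s x) = x" if "x \<in> carrier c s" for s x
    using fun_cong[OF fun_cong[OF hh, of s], of x] that by (simp add: compose_eq)
  show "?S x" if x: "x \<in> carrier c s"
  proof -
    \<comment> \<open>A term denotes the image of \<open>x\<close> in \<open>P\<close>. By soundness
      it is defined at some stage \<open>j\<close>, and its value there is the required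
      preimage.\<close>
    obtain t where t: "eqv diagram_relations t t" "csort t = s" "ev P e t = Some (h' s x)"
      using elem[OF hom_carrier[OF h'(2) x]] by blast
    obtain j y where j: "j \<in> I" "ev (Do j) (stage j) t = Some y"
      using stage_sound[OF t(1)] unfolding holds_def by blast
    have y: "y \<in> carrier (Do j) s" using ev_carrier[OF Do_model[OF j(1)] stage_val j(2)] t(2) by simp
    have "hmap (q j) (stage j) \<subseteq>\<^sub>m e"
      unfolding hmap_le_iff
    proof (intro allI impI)
      fix g x assume "stage j g = Some x"
      then obtain i z s where "g = ((i, z), s)" "(i, j) \<in> r" "z \<in> carrier (Do i) s" "x = tr i j s z"
        by (auto simp: stage_def split: prod.splits if_splits)
      then show "e g = Some (q j (snd g) x)" using q(2)[OF r_I(1)] q_tr by simp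
    qed
    moreover have "wft t" using eqv_wft[OF diagram_relations_wfR t(1)] by blast
    then have "ev P (hmap (q j) (stage j)) t = Some (q j s y)"
      using ev_hom[OF Do_model[OF j(1)] q(1)[OF j(1)] _ j(2)] t(2) by simp
    ultimately have "ev P e t = Some (q j s y)" by (rule ev_mono)
    then have "h' s x = q j s y" using t(3) by simp
    then have "x = maps (p j) s y" using hh'[OF x] hq[OF j(1) y] by simp
    then show ?thesis using j(1) y by blast
  qed
  show "\<exists>j. (i, j) \<in> r \<and> tr i j s y = tr i j s y'"
    if i: "i \<in> I" and y: "y \<in> carrier (Do i) s" "y' \<in> carrier (Do i) s" and eq: "maps (p i) s y = maps (p i) s y'"
  proof -
    have "q i s y = q i s y'" using h'p[OF i y(1)] h'p[OF i y(2)] eq by simp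
    \<comment> \<open>Equal values in \<open>P\<close> mean provable equality of the generators,
      which holds at some stage; that both have values there also shows the stage to lie above
      \<open>i\<close>.\<close>
    then have "eqv diagram_relations (Gen ((i, y), s)) (Gen ((i, y'), s))"
      using same q(2)[OF i y(1)] q(2)[OF i y(2)] by simp
    then obtain j where "holds (Do j) (stage j) (Gen ((i, y), s)) (Gen ((i, y'), s))" using stage_sound by blast
    then show ?thesis by (auto simp: holds_def stage_def split: if_splits)
  qed
qed

section \<open>Equations valid in a directed colimit are valid at some stage\<close>

context
  fixes i v
  assumes i: "i \<in> I" and v: "valuation (Do i) v"
begin

lemma push_val: "(i, j) \<in> r \<Longrightarrow> valuation (Do j) (hmap (tr i j) v)"
  using valuation_hmap[OF tr_hom v] .

lemma push_push: "(i, j) \<in> r \<Longrightarrow> (j, k) \<in> r \<Longrightarrow> hmap (tr j k) (hmap (tr i j) v) = hmap (tr i k) v"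
  unfolding hmap_def fun_eq_iff using v tr_tr by (auto simp: option.map_comp valuation_def intro!: map_option_cong)

lemma push_leg: "(i, j) \<in> r \<Longrightarrow> hmap (maps (p j)) (hmap (tr i j) v) = hmap (maps (p i)) v"
  unfolding hmap_def fun_eq_iff using v leg_tr by (auto simp: option.map_comp valuation_def intro!: map_option_cong)

lemma push_holds:
  assumes "(i, j) \<in> r" "(j, k) \<in> r" "wft t" "wft u" "csort t = csort u" "holds (Do j) (hmap (tr i j) v) t u"
  shows "holds (Do k) (hmap (tr i k) v) t u"
  using holds_hom[OF Do_model[OF r_I(1)[OF assms(2)]] tr_hom[OF assms(2)] assms(3-6)]
  unfolding push_push[OF assms(1,2)] .

text \<open>Both terms already have values \<open>a\<close> and \<open>b\<close> at stage
  \<open>j\<close>. As these agree in the colimit, \<open>colimit_inj\<close> makes them agree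
  later.\<close>

lemma holds_later:
  assumes j: "(i, j) \<in> r" and tu: "wft t" "wft u" "csort t = csort u"
    and def: "ev (Do j) (hmap (tr i j) v) t = Some a" "ev (Do j) (hmap (tr i j) v) u = Some b"
    and holds: "holds c (hmap (maps (p i)) v) t u"
  shows "\<exists>k. (j, k) \<in> r \<and> holds (Do k) (hmap (tr i k) v) t u"
proof -
  note jI = r_I(2)[OF j]
  have "ev c (hmap (maps (p i)) v) t = Some (maps (p j) (csort t) a)"
    "ev c (hmap (maps (p i)) v) u = Some (maps (p j) (csort t) b)"
    using ev_hom[OF Do_model[OF jI] leg_hom[OF jI] tu(1) def(1)]
      ev_hom[OF Do_model[OF jI] leg_hom[OF jI] tu(2) def(2)] push_leg[OF j] tu(3) by simp_all
  then have "maps (p j) (csort t) a = maps (p j) (csort t) b" using holds by (simp add: holds_def)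
  moreover have "a \<in> carrier (Do j) (csort t)" "b \<in> carrier (Do j) (csort t)"
    using ev_carrier[OF Do_model[OF jI] push_val[OF j]] def tu(3) by force+
  ultimately obtain k where k: "(j, k) \<in> r" "tr j k (csort t) a = tr j k (csort t) b"
    using colimit_inj[OF jI] by blast
  have "ev (Do k) (hmap (tr i k) v) t = Some (tr j k (csort t) a)"
    "ev (Do k) (hmap (tr i k) v) u = Some (tr j k (csort t) b)"
    using ev_hom[OF Do_model[OF jI] tr_hom[OF k(1)] tu(1) def(1)]
      ev_hom[OF Do_model[OF jI] tr_hom[OF k(1)] tu(2) def(2)] push_push[OF j k(1)] tu(3) by simp_all
  then show ?thesis using k by (auto simp: holds_def)
qed

text \<open>Validity persists along transition maps, so an upper bound of the finitely many stages
  serves all equations.\<close>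

lemma common_stage:
  assumes "finite S" "\<And>t u. (t, u) \<in> S \<Longrightarrow> wft t \<and> wft u \<and> csort t = csort u"
    "\<And>t u. (t, u) \<in> S \<Longrightarrow> \<exists>j. (i, j) \<in> r \<and> holds (Do j) (hmap (tr i j) v) t u"
  shows "\<exists>j. (i, j) \<in> r \<and> (\<forall>(t, u)\<in>S. holds (Do j) (hmap (tr i j) v) t u)"
proof -
  have "\<forall>x\<in>S. \<exists>j. (i, j) \<in> r \<and> holds (Do j) (hmap (tr i j) v) (fst x) (snd x)" using assms(3) by simp
  then obtain J where J: "\<And>x. x \<in> S \<Longrightarrow> (i, J x) \<in> r \<and> holds (Do (J x)) (hmap (tr i (J x)) v) (fst x) (snd x)"
    by metis
  have "insert i (J ` S) \<subseteq> I" using J r_I i by blast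
  then obtain k where k: "k \<in> I" "\<forall>j\<in>insert i (J ` S). (j, k) \<in> r"
    using directed_upper_bound[OF dp, of "insert i (J ` S)"] assms(1) by blast
  have "holds (Do k) (hmap (tr i k) v) t u" if tu: "(t, u) \<in> S" for t u
    using push_holds[of "J (t, u)" k t u] J[OF tu] k(2) assms(2)[OF tu] tu by auto
  then show ?thesis using k by blast
qed

text \<open>Once the arguments of \<open>f\<close> have values at a stage, so have both sides of its
  domain equations, being built from total operations. These equations hold in the colimit, hence
  later on, and as they are finite in number one stage satisfies them all. There \<open>f\<close> is
  defined. Here the finiteness of the domain conditions is essential.\<close>

lemma defined_later:
  "wft t \<Longrightarrow> ev c (hmap (maps (p i)) v) t = Some z \<Longrightarrow>
    \<exists>j. (i, j) \<in> r \<and> holds (Do j) (hmap (tr i j) v) t t"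
proof (induction t arbitrary: z)
  case (Gen g)
  then obtain x where "v g = Some x" by (auto simp: hmap_def)
  then show ?case using r_refl[OF i] by (auto simp: holds_def hmap_def)
next
  case (App f ts)
  have f: "f \<in> ops T" "list_all wft ts" "map csort ts = arity T f" using App.prems by auto
  then have len: "length ts = length (arity T f)" by (metis length_map)
  obtain zs where zs: "list_all2 (\<lambda>t y. ev c (hmap (maps (p i)) v) t = Some y) ts zs" "interp c f zs = Some z"
    using App.prems(2) unfolding ev_App by blast
  have "\<exists>j. (i, j) \<in> r \<and> (\<forall>(t, u)\<in>(\<lambda>t. (t, t)) ` set ts. holds (Do j) (hmap (tr i j) v) t u)"
  proof (rule common_stage)
    fix t u assume "(t, u) \<in> (\<lambda>t. (t, t)) ` set ts"
    then have tu: "u = t" "t \<in> set ts" by auto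
    obtain y where "ev c (hmap (maps (p i)) v) t = Some y"
      using zs(1) tu(2) by (auto simp: list_all2_conv_all_nth in_set_conv_nth)
    then show "\<exists>j. (i, j) \<in> r \<and> holds (Do j) (hmap (tr i j) v) t u" using App.IH f(2) tu by (auto simp: list_all_iff)
  qed (use f(2) in \<open>auto simp: list_all_iff\<close>)
  then obtain j where j: "(i, j) \<in> r" "\<forall>t\<in>set ts. holds (Do j) (hmap (tr i j) v) t t" by auto
  have insts: "\<exists>k. (i, k) \<in> r \<and> holds (Do k) (hmap (tr i k) v) (inst ts a) (inst ts b)"
    and inst_wf: "wft (inst ts a) \<and> wft (inst ts b) \<and> csort (inst ts a) = csort (inst ts b)"
    if ab: "(a, b) \<in> dq f" for a b
  proof -
    obtain s where s: "has_sort T (arity T f) a s" "has_sort T (arity T f) b s" using dq_sort(1)[OF f(1) ab] by blast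
    have wf: "wft (inst ts a) \<and> csort (inst ts a) = s" "wft (inst ts b) \<and> csort (inst ts b) = s"
      using wft_inst[OF s(1) f(3)] wft_inst[OF s(2) f(3)] f(2) by (auto simp: list_all_iff)
    then show "wft (inst ts a) \<and> wft (inst ts b) \<and> csort (inst ts a) = csort (inst ts b)" by simp
    have "\<forall>t\<in>set ts. \<exists>y. ev (Do j) (hmap (tr i j) v) t = Some y" using j(2) by (auto simp: holds_def)
    then obtain Y where Y: "\<And>t. t \<in> set ts \<Longrightarrow> ev (Do j) (hmap (tr i j) v) t = Some (Y t)" by metis
    then have ys: "list_all2 (\<lambda>t y. ev (Do j) (hmap (tr i j) v) t = Some y) ts (map Y ts)"
      by (simp add: list_all2_conv_all_nth)
    note jI = r_I(2)[OF j(1)]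
    have tup: "map Y ts \<in> tuples (Do j) (arity T f)" using ev_tuple[OF Do_model[OF jI] push_val[OF j(1)] ys] f(3) by simp
    obtain x where x: "ev (Do j) (hmap (tr i j) v) (inst ts a) = Some x"
      using ev_inst[OF s(1) ys len] eval_total[OF Do_model[OF jI] s(1) dq_sort(2)[OF f(1) ab] tup] by auto
    obtain y where y: "ev (Do j) (hmap (tr i j) v) (inst ts b) = Some y"
      using ev_inst[OF s(2) ys len] eval_total[OF Do_model[OF jI] s(2) dq_sort(3)[OF f(1) ab] tup] by auto
    \<comment> \<open>In the colimit the application is defined, so the domain equation holds
      between the values \<open>zs\<close> of the arguments.\<close>
    have ctup: "zs \<in> tuples c (arity T f)" using model_interp[OF c_model zs(2)] by blast
    obtain w where "eval_tm c zs a = Some w" using eval_total[OF c_model s(1) dq_sort(2)[OF f(1) ab] ctup] by blast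
    moreover have "eval_tm c zs a = eval_tm c zs b"
      using model_defined[OF c_model f(1) ctup] zs(2) ab by auto
    ultimately have "holds c (hmap (maps (p i)) v) (inst ts a) (inst ts b)"
      using ev_inst[OF s(1) zs(1) len] ev_inst[OF s(2) zs(1) len] by (simp add: holds_def)
    then obtain k where k: "(j, k) \<in> r" "holds (Do k) (hmap (tr i k) v) (inst ts a) (inst ts b)"
      using holds_later[OF j(1) _ _ _ x y] wf by auto
    then show "\<exists>k. (i, k) \<in> r \<and> holds (Do k) (hmap (tr i k) v) (inst ts a) (inst ts b)"
      using r_trans[OF j(1)] by blast
  qed
  let ?S = "(\<lambda>t. (t, t)) ` set ts \<union> (\<lambda>(a, b). (inst ts a, inst ts b)) ` dq f"
  have "\<exists>k. (i, k) \<in> r \<and> (\<forall>(t, u)\<in>?S. holds (Do k) (hmap (tr i k) v) t u)"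
  proof (rule common_stage)
    show "finite ?S" using dq_finite[OF f(1)] by simp
    fix t u assume tu: "(t, u) \<in> ?S"
    show "wft t \<and> wft u \<and> csort t = csort u" using tu inst_wf f(2) by (auto simp: list_all_iff)
    show "\<exists>j. (i, j) \<in> r \<and> holds (Do j) (hmap (tr i j) v) t u" using tu insts j by auto
  qed
  then obtain k where k1: "(i, k) \<in> r" "\<forall>(t, u)\<in>?S. holds (Do k) (hmap (tr i k) v) t u" by blast
  have k: "(i, k) \<in> r" "\<forall>t\<in>set ts. holds (Do k) (hmap (tr i k) v) t t"
    "\<forall>a b. (a, b) \<in> dq f \<longrightarrow> holds (Do k) (hmap (tr i k) v) (inst ts a) (inst ts b)"
  proof -
    show "\<forall>t\<in>set ts. holds (Do k) (hmap (tr i k) v) t t" using k1(2) by auto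
    show "\<forall>a b. (a, b) \<in> dq f \<longrightarrow> holds (Do k) (hmap (tr i k) v) (inst ts a) (inst ts b)"
    proof (intro allI impI)
      fix a b assume "(a, b) \<in> dq f"
      then have "(inst ts a, inst ts b) \<in> ?S" by (intro UnI2 image_eqI[of _ _ "(a, b)"]) auto
      then show "holds (Do k) (hmap (tr i k) v) (inst ts a) (inst ts b)" using k1(2) by blast
    qed
  qed (rule k1(1))
  have "\<forall>t\<in>set ts. \<exists>y. ev (Do k) (hmap (tr i k) v) t = Some y" using k(2) by (auto simp: holds_def)
  then obtain Y where Y: "\<And>t. t \<in> set ts \<Longrightarrow> ev (Do k) (hmap (tr i k) v) t = Some (Y t)" by metis
  then have ys: "list_all2 (\<lambda>t y. ev (Do k) (hmap (tr i k) v) t = Some y) ts (map Y ts)"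
    by (simp add: list_all2_conv_all_nth)
  note kI = r_I(2)[OF k(1)]
  have tup: "map Y ts \<in> tuples (Do k) (arity T f)" using ev_tuple[OF Do_model[OF kI] push_val[OF k(1)] ys] f(3) by simp
  have "eval_tm (Do k) (map Y ts) a = eval_tm (Do k) (map Y ts) b" if ab: "(a, b) \<in> dq f" for a b
  proof -
    obtain s where s: "has_sort T (arity T f) a s" "has_sort T (arity T f) b s" using dq_sort(1)[OF f(1) ab] by blast
    show ?thesis using k(3)[rule_format, OF ab] ev_inst[OF s(1) ys len] ev_inst[OF s(2) ys len] by (auto simp: holds_def)
  qed
  then have "interp (Do k) f (map Y ts) \<noteq> None" using model_defined[OF Do_model[OF kI] f(1) tup] by blast
  then have "holds (Do k) (hmap (tr i k) v) (App f ts) (App f ts)" using ys unfolding holds_def ev_App by blast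
  then show ?case using k(1) by blast
qed

lemma holds_eventually:
  assumes tu: "wft t" "wft u" "csort t = csort u" "holds c (hmap (maps (p i)) v) t u"
  shows "\<exists>j. (i, j) \<in> r \<and> holds (Do j) (hmap (tr i j) v) t u"
proof -
  obtain z where "ev c (hmap (maps (p i)) v) t = Some z" "ev c (hmap (maps (p i)) v) u = Some z"
    using tu(4) unfolding holds_def by blast
  then have "\<exists>j. (i, j) \<in> r \<and> (\<forall>(t, u)\<in>{(t, t), (u, u)}. holds (Do j) (hmap (tr i j) v) t u)"
    by (intro common_stage) (use defined_later tu in auto)
  then obtain j a b where j: "(i, j) \<in> r" "ev (Do j) (hmap (tr i j) v) t = Some a"
    "ev (Do j) (hmap (tr i j) v) u = Some b" by (auto simp: holds_def)
  then show ?thesis using holds_later[OF j(1) tu(1-3) j(2,3) tu(4)] r_trans[OF j(1)] by blast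
qed

end

end

end

section \<open>Finitely presented models are finitely presentable\<close>

context small_ea
begin

text \<open>A homomorphism out of \<open>M\<close> is a choice of values for finitely many
  generators subject to finitely many relations. The values lift to a common stage, and the
  relations hold at a later one. Two homomorphisms that agree in the colimit agree on each generator
  at some later stage, hence on all of them at a common one.\<close>

lemma presented_finitely_presentable:
  fixes M :: "('s, 'f, 'u) partial_algebra" and R :: "(('f, 'a \<times> 's) ct \<times> ('f, 'a \<times> 's) ct) set"
  assumes M: "M \<in> Obj (Mod T)" and e: "presents M e R" and R: "wfR R" "finite R"
  shows "finitely_presentable_elementwise TYPE('u) (Mod T) M"
  unfolding finitely_presentable_elementwise_def
proof (intro conjI allI impI)
  show "M \<in> Obj (Mod T)" by (rule M)
  fix I :: "'u set" and r and Do :: "'u \<Rightarrow> ('s, 'f, 'u) partial_algebra" and Dm c p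
  assume sI: "small TYPE('u) I" and dp: "directed_poset I r" and D: "is_functor (poset_cat I r) (Mod T) Do Dm"
    and col: "is_colimit (poset_cat I r) (Mod T) Do Dm c p"
  interpret directed_diagram U T I r Do Dm by unfold_locales (use dp D in auto)
  note leg_hom = leg_hom[OF sI col] and leg_tr = leg_tr[OF sI col] and leg_eq = leg_eq[OF sI col]
    and c_Obj = c_Obj[OF sI col] and c_model = c_model[OF sI col]
  note M' = presentsD[OF e]
  have fin: "finite (dom e)" using M'(3) finite_Gens[OF R(2)] by (rule finite_subset)
  have comp: "model_hom T M c (\<lambda>s. compose (carrier M s) (maps (p j) s) (k s))"
    if "j \<in> I" "model_hom T M (Do j) k" for j k
    using hom_compose[OF M'(1) that(2) leg_hom[OF that(1)]] .
  have eM: "x \<in> carrier M (snd g)" if "e g = Some x" for g x using M'(2) that unfolding valuation_def by blast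
  show "\<forall>g\<in>hom (Mod T) M c. \<exists>i\<in>I. \<exists>g'\<in>hom (Mod T) M (Do i). g = Cmp (Mod T) (p i) g'"
  proof
    fix G assume "G \<in> hom (Mod T) M c"
    then obtain k where k: "G = (M, k, c)" "model_hom T M c k" by (auto simp: Mod_hom)
    \<comment> \<open>The value of each generator is lifted separately; finiteness of
      \<open>dom e\<close> then yields a common stage.\<close>
    have "\<forall>g\<in>dom e. \<exists>i y. i \<in> I \<and> y \<in> carrier (Do i) (snd g) \<and> k (snd g) (the (e g)) = maps (p i) (snd g) y"
    proof
      fix g assume "g \<in> dom e"
      then obtain x where x: "e g = Some x" by blast
      have "k (snd g) x \<in> carrier c (snd g)" using hom_carrier[OF k(2) eM[OF x]] .
      then show "\<exists>i y. i \<in> I \<and> y \<in> carrier (Do i) (snd g) \<and> k (snd g) (the (e g)) = maps (p i) (snd g) y"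
        using colimit_surj[OF sI col] x by fastforce
    qed
    then obtain a y where ay: "\<And>g. g \<in> dom e \<Longrightarrow> a g \<in> I" "\<And>g. g \<in> dom e \<Longrightarrow> y g \<in> carrier (Do (a g)) (snd g)"
      "\<And>g. g \<in> dom e \<Longrightarrow> k (snd g) (the (e g)) = maps (p (a g)) (snd g) (y g)" by metis
    obtain i where i: "i \<in> I" "\<forall>j\<in>a ` dom e. (j, i) \<in> r"
      using directed_upper_bound[OF dp, of "a ` dom e"] fin ay(1) by blast
    define v where "v g = (if g \<in> dom e then Some (tr (a g) i (snd g) (y g)) else None)" for g
    have v: "valuation (Do i) v"
      unfolding valuation_def
    proof (intro allI impI)
      fix g x assume "v g = Some x"
      then have g: "g \<in> dom e" "x = tr (a g) i (snd g) (y g)" by (simp_all add: v_def split: if_splits)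
      then show "x \<in> carrier (Do i) (snd g)" using tr_carrier ay(2) i(2) by blast
    qed
    \<comment> \<open>Through the leg at \<open>i\<close>, the lifted values become those prescribed
      by \<open>k\<close>, so the relations of \<open>R\<close> hold for them in the
      colimit.\<close>
    have pv: "hmap (maps (p i)) v = hmap k e"
    proof
      fix g show "hmap (maps (p i)) v g = hmap k e g"
      proof (cases "g \<in> dom e")
        case True
        then have "(a g, i) \<in> r" using i(2) by blast
        then have "maps (p i) (snd g) (tr (a g) i (snd g) (y g)) = k (snd g) (the (e g))"
          using leg_tr[OF _ ay(2)[OF True]] ay(3)[OF True] by simp
        then show ?thesis using True by (auto simp: hmap_def v_def)
      qed (simp add: hmap_def v_def domIff)
    qed
    have "\<exists>j. (i, j) \<in> r \<and> (\<forall>(t, u)\<in>R. holds (Do j) (hmap (tr i j) v) t u)"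
    proof (rule common_stage[OF sI col i(1) v R(2)])
      fix t u assume tu: "(t, u) \<in> R"
      show wf: "wft t \<and> wft u \<and> csort t = csort u" using R(1) tu unfolding wfR_def by blast
      have "holds M e t u" using M'(4) tu by blast
      then have "holds c (hmap (maps (p i)) v) t u"
        unfolding pv using holds_hom[OF M'(1) k(2)] wf by blast
      then show "\<exists>j. (i, j) \<in> r \<and> holds (Do j) (hmap (tr i j) v) t u"
        using holds_eventually[OF sI col i(1) v] wf by blast
    qed
    then obtain j where j: "(i, j) \<in> r" "\<forall>(t, u)\<in>R. holds (Do j) (hmap (tr i j) v) t u" by blast
    note jI = r_I(2)[OF j(1)]
    obtain k' where k': "model_hom T M (Do j) k'" "hmap k' e \<subseteq>\<^sub>m hmap (tr i j) v"
      using presents_hom[OF e Do_model[OF jI] push_val[OF sI col i(1) v j(1)] j(2)] by blast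
    \<comment> \<open>Both homomorphisms agree on the generators of \<open>M\<close>.\<close>
    have "(\<lambda>s. compose (carrier M s) (maps (p j) s) (k' s)) = k"
    proof (rule presents_unique[OF e c_model])
      show "valuation c (hmap k e)" using valuation_hmap[OF k(2) M'(2)] .
      show "\<forall>(t, u)\<in>R. holds c (hmap k e) t u"
        using holds_hom[OF M'(1) k(2)] R(1) M'(4) unfolding wfR_def by fast
      show "model_hom T M c (\<lambda>s. compose (carrier M s) (maps (p j) s) (k' s))" using comp[OF jI k'(1)] .
      show "model_hom T M c k" "hmap k e \<subseteq>\<^sub>m hmap k e" using k by simp_all
      show "hmap (\<lambda>s. compose (carrier M s) (maps (p j) s) (k' s)) e \<subseteq>\<^sub>m hmap k e"
        unfolding hmap_le_iff
      proof (intro allI impI)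
        fix g x assume x: "e g = Some x"
        have "hmap (tr i j) v g = Some (k' (snd g) x)" using k'(2) x unfolding hmap_le_iff by blast
        then have "hmap (maps (p j)) (hmap (tr i j) v) g = Some (maps (p j) (snd g) (k' (snd g) x))"
          by (simp add: hmap_def[of "maps (p j)"])
        then show "hmap k e g = Some (compose (carrier M (snd g)) (maps (p j) (snd g)) (k' (snd g)) x)"
          using push_leg[OF sI col i(1) v j(1)] pv eM[OF x] by (simp add: compose_eq)
      qed
    qed
    moreover obtain b where b: "p j = (Do j, b, c)" using leg_eq[OF jI] by metis
    ultimately have "G = Cmp (Mod T) (p j) (M, k', Do j)" using k(1) by simp
    moreover have "(M, k', Do j) \<in> hom (Mod T) M (Do j)" using k'(1) M diagram_obj(1) jI by (simp add: Mod_hom)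
    ultimately show "\<exists>i\<in>I. \<exists>g'\<in>hom (Mod T) M (Do i). G = Cmp (Mod T) (p i) g'" using jI by blast
  qed
  show "\<forall>i\<in>I. \<forall>g\<in>hom (Mod T) M (Do i). \<forall>g'\<in>hom (Mod T) M (Do i). Cmp (Mod T) (p i) g = Cmp (Mod T) (p i) g' \<longrightarrow>
      (\<exists>j. (i, j) \<in> r \<and> Cmp (Mod T) (Dm (i, j)) g = Cmp (Mod T) (Dm (i, j)) g')"
  proof (intro ballI impI)
    fix i G G' assume i: "i \<in> I" and GG': "G \<in> hom (Mod T) M (Do i)" "G' \<in> hom (Mod T) M (Do i)"
      and eq: "Cmp (Mod T) (p i) G = Cmp (Mod T) (p i) G'"
    obtain k where k: "G = (M, k, Do i)" "model_hom T M (Do i) k" using GG'(1) by (auto simp: Mod_hom)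
    obtain k' where k': "G' = (M, k', Do i)" "model_hom T M (Do i) k'" using GG'(2) by (auto simp: Mod_hom)
    obtain b where b: "p i = (Do i, b, c)" using leg_eq[OF i] by metis
    have bk: "(\<lambda>s. compose (carrier M s) (b s) (k s)) = (\<lambda>s. compose (carrier M s) (b s) (k' s))"
      using eq unfolding k k' b by simp
    have pk: "b s (k s x) = b s (k' s x)" if "x \<in> carrier M s" for s x
      using fun_cong[OF fun_cong[OF bk, of s], of x] that by (simp add: compose_eq)
    have "\<forall>g\<in>dom e. \<exists>j. (i, j) \<in> r \<and> tr i j (snd g) (k (snd g) (the (e g))) = tr i j (snd g) (k' (snd g) (the (e g)))"
    proof
      fix g assume "g \<in> dom e"
      then obtain x where x: "e g = Some x" by blast
      note xM = eM[OF x]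
      show "\<exists>j. (i, j) \<in> r \<and> tr i j (snd g) (k (snd g) (the (e g))) = tr i j (snd g) (k' (snd g) (the (e g)))"
        using colimit_inj[OF sI col i hom_carrier[OF k(2) xM] hom_carrier[OF k'(2) xM]] pk[OF xM] x b by simp
    qed
    then obtain a where a: "\<And>g. g \<in> dom e \<Longrightarrow> (i, a g) \<in> r"
      "\<And>g. g \<in> dom e \<Longrightarrow> tr i (a g) (snd g) (k (snd g) (the (e g))) = tr i (a g) (snd g) (k' (snd g) (the (e g)))"
      by metis
    have "insert i (a ` dom e) \<subseteq> I" using a r_I i by blast
    then obtain j where j: "j \<in> I" "\<forall>l\<in>insert i (a ` dom e). (l, j) \<in> r"
      using directed_upper_bound[OF dp, of "insert i (a ` dom e)"] fin by blast
    have ij: "(i, j) \<in> r" using j by blast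
    have same: "tr i j (snd g) (k (snd g) x) = tr i j (snd g) (k' (snd g) x)" if x: "e g = Some x" for g x
    proof -
      have g: "g \<in> dom e" using x by blast
      have "tr (a g) j (snd g) (tr i (a g) (snd g) (k (snd g) x)) =
          tr (a g) j (snd g) (tr i (a g) (snd g) (k' (snd g) x))" using a(2)[OF g] x by simp
      moreover have "(a g, j) \<in> r" using j(2) g by blast
      ultimately show ?thesis
        using tr_tr[OF a(1)[OF g]] hom_carrier[OF k(2) eM[OF x]] hom_carrier[OF k'(2) eM[OF x]] by simp
    qed
    define w where "w = (\<lambda>s. compose (carrier M s) (tr i j s) (k s))"
    define w' where "w' = (\<lambda>s. compose (carrier M s) (tr i j s) (k' s))"
    have ww: "model_hom T M (Do j) w" "model_hom T M (Do j) w'"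
      unfolding w_def w'_def using hom_compose[OF M'(1) _ tr_hom[OF ij]] k(2) k'(2) by blast+
    have "w = w'"
    proof (rule presents_unique[OF e Do_model[OF j(1)]])
      show "valuation (Do j) (hmap w e)" using valuation_hmap[OF ww(1) M'(2)] .
      show "\<forall>(t, u)\<in>R. holds (Do j) (hmap w e) t u"
        using holds_hom[OF M'(1) ww(1)] R(1) M'(4) unfolding wfR_def by fast
      show "hmap w' e \<subseteq>\<^sub>m hmap w e" unfolding hmap_le_iff
        using same eM by (auto simp: hmap_def w_def w'_def compose_eq)
    qed (use ww in auto)
    moreover obtain d where "Dm (i, j) = (Do i, d, Do j)" using diagram_arr(1)[of "(i, j)"] ij by (metis fst_conv snd_conv poset_cat_simps(2-4))
    ultimately have "Cmp (Mod T) (Dm (i, j)) G = Cmp (Mod T) (Dm (i, j)) G'"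
      unfolding k k' w_def w'_def by simp
    then show "\<exists>j. (i, j) \<in> r \<and> Cmp (Mod T) (Dm (i, j)) G = Cmp (Mod T) (Dm (i, j)) G'" using ij by blast
  qed
qed

end

context ea
begin

text \<open>By the method of diagrams, each element being its own name.\<close>

lemma diag_presents:
  fixes M :: "('s, 'f, 'u) partial_algebra" and i :: 'i
  assumes M: "is_model T M"
  shows "presents M (\<lambda>((j, x), s). if j = i \<and> x \<in> carrier M s then Some x else None) (diag i M)"
    (is "presents M ?e _")
  unfolding presents_def
proof (intro conjI allI impI)
  show "is_model T M" by (rule M)
  show val: "valuation M ?e" unfolding valuation_def by (auto split: if_splits)
  show "dom ?e \<subseteq> Gens (diag i M)" unfolding Gens_diag[OF M] by (auto split: if_splits)
  show "\<forall>(t, u)\<in>diag i M. holds M ?e t u"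
    using diag_holds[OF M hom_ident[OF M], of ?e i] by auto
  fix N :: "('s, 'f, 'u) partial_algebra" and h
  assume N: "is_model T N" and h: "valuation N h" "\<forall>(t, u)\<in>diag i M. holds N h t u"
  define q where "q = (\<lambda>s. \<lambda>x\<in>carrier M s. the (h ((i, x), s)))"
  have q: "model_hom T M N q" "\<And>s x. x \<in> carrier M s \<Longrightarrow> h ((i, x), s) = Some (q s x)"
    using diag_hom[OF M h(1), of i] h(2) unfolding q_def by blast+
  show "\<exists>!k. model_hom T M N k \<and> hmap k ?e \<subseteq>\<^sub>m h"
  proof (rule ex1I[of _ q], rule conjI[OF q(1)])
    show "hmap q ?e \<subseteq>\<^sub>m h" unfolding hmap_le_iff using q(2) by (auto split: if_splits)
    fix k assume k: "model_hom T M N k \<and> hmap k ?e \<subseteq>\<^sub>m h"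
    then have le: "hmap k ?e \<subseteq>\<^sub>m h" by blast
    show "k = q"
    proof (rule model_hom_ext[OF _ q(1)])
      fix s x assume x: "x \<in> carrier M s"
      then have "h ((i, x), s) = Some (k s x)" using le unfolding hmap_le_iff by fastforce
      then show "k s x = q s x" using q(2)[OF x] by simp
    qed (use k in blast)
  qed
qed

end

section \<open>Models as directed colimits of finitely presented models\<close>

context small_ea
begin

text \<open>Satisfying \<open>R\<close> is satisfying every \<open>Q i\<close>. The legs of a cocone
  therefore glue to one valuation satisfying \<open>R\<close>, and the homomorphism that it induces
  on \<open>M\<close> is the factorization. Transition maps exist because relations only increase
  along \<open>r\<close>.\<close>

lemma directed_union:
  fixes M :: "('s, 'f, 'u) partial_algebra" and R :: "(('f, 'a \<times> 's) ct \<times> ('f, 'a \<times> 's) ct) set"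
    and P :: "'i \<Rightarrow> ('s, 'f, 'u) partial_algebra"
  assumes M: "M \<in> Obj (Mod T)" "presents M e R" and R: "wfR R"
    and dp: "directed_poset I r"
    and Q: "\<And>i j. (i, j) \<in> r \<Longrightarrow> Q i \<subseteq> Q j" "(\<Union>i\<in>I. Q i) = R"
    and P: "\<And>i. i \<in> I \<Longrightarrow> P i \<in> Obj (Mod T)" "\<And>i. i \<in> I \<Longrightarrow> presents (P i) (a i) (Q i)"
  shows "\<exists>Dm p. is_functor (poset_cat I r) (Mod T) P Dm \<and> is_colimit (poset_cat I r) (Mod T) P Dm M p"
proof -
  have rI: "(i, j) \<in> r \<Longrightarrow> i \<in> I" "(i, j) \<in> r \<Longrightarrow> j \<in> I" and refl: "i \<in> I \<Longrightarrow> (i, i) \<in> r"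
    and tran: "(i, j) \<in> r \<Longrightarrow> (j, k) \<in> r \<Longrightarrow> (i, k) \<in> r" for i j k
    using dp unfolding directed_poset_def partial_order_on_def preorder_on_def refl_on_def
    by (auto dest: transD)
  note Ma = presentsD[OF M(2)]
  have Pm: "is_model T (P i)" "valuation (P i) (a i)" "dom (a i) \<subseteq> Gens (Q i)" "\<forall>(t, u)\<in>Q i. holds (P i) (a i) t u"
    if "i \<in> I" for i
    using presentsD[OF P(2)[OF that]] by blast+
  have PQ: "\<forall>(t, u)\<in>Q i. holds (P j) (a j) t u" if "(i, j) \<in> r" for i j
    using Pm(4)[OF rI(2)[OF that]] Q(1)[OF that] by blast
  have MQ: "\<forall>(t, u)\<in>Q i. holds M e t u" if "i \<in> I" for i
    using Ma(4) Q(2) that by blast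
  have "\<forall>x\<in>r. \<exists>k. model_hom T (P (fst x)) (P (snd x)) k \<and> hmap k (a (fst x)) \<subseteq>\<^sub>m a (snd x)"
  proof
    fix x assume "x \<in> r"
    then obtain i j where x: "x = (i, j)" "(i, j) \<in> r" by (cases x) auto
    show "\<exists>k. model_hom T (P (fst x)) (P (snd x)) k \<and> hmap k (a (fst x)) \<subseteq>\<^sub>m a (snd x)"
      using presents_hom[OF P(2)[OF rI(1)[OF x(2)]] Pm(1,2)[OF rI(2)[OF x(2)]] PQ[OF x(2)]] x by auto
  qed
  then obtain d where d0: "\<And>x. x \<in> r \<Longrightarrow> model_hom T (P (fst x)) (P (snd x)) (d x) \<and> hmap (d x) (a (fst x)) \<subseteq>\<^sub>m a (snd x)"
    by metis
  then have d: "model_hom T (P i) (P j) (d (i, j))" "hmap (d (i, j)) (a i) \<subseteq>\<^sub>m a j" if "(i, j) \<in> r" for i j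
    using d0[OF that] by simp_all
  have "\<forall>i\<in>I. \<exists>k. model_hom T (P i) M k \<and> hmap k (a i) \<subseteq>\<^sub>m e"
    using presents_hom[OF P(2) Ma(1,2) MQ] by metis
  then obtain b where b: "\<And>i. i \<in> I \<Longrightarrow> model_hom T (P i) M (b i)" "\<And>i. i \<in> I \<Longrightarrow> hmap (b i) (a i) \<subseteq>\<^sub>m e"
    by metis
  define Dm where "Dm = (\<lambda>(i, j). (P i, d (i, j), P j))"
  define p where "p i = (P i, b i, M)" for i
  have aP: "x \<in> carrier (P i) (snd g)" if "i \<in> I" "a i g = Some x" for i g x
    using Pm(2)[OF that(1)] that(2) unfolding valuation_def by blast
  have cmp_le: "hmap (\<lambda>s. compose (carrier (P i) s) (k s) (d (i, j) s)) (a i) \<subseteq>\<^sub>m h"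
    if "(i, j) \<in> r" "hmap k (a j) \<subseteq>\<^sub>m h" for i j k h
    using d(2)[OF that(1)] that(2) aP[OF rI(1)[OF that(1)]] unfolding hmap_le_iff by (simp add: compose_eq)
  have cmp_hom: "model_hom T (P i) N (\<lambda>s. compose (carrier (P i) s) (k s) (d (i, j) s))"
    if "(i, j) \<in> r" "model_hom T (P j) N k" for i j k N
    using hom_compose[OF Pm(1)[OF rI(1)[OF that(1)]] d(1)[OF that(1)] that(2)] .
  have D: "is_functor (poset_cat I r) (Mod T) P Dm"
    unfolding is_functor_def poset_cat_simps
  proof (intro conjI ballI impI)
    show "Dm f \<in> hom (Mod T) (P (fst f)) (P (snd f))" if "f \<in> r" for f
      using that d rI P(1) by (cases f) (auto simp: Dm_def Mod_hom)
    show "Dm (x, x) = Id (Mod T) (P x)" if x: "x \<in> I" for x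
    proof -
      have "d (x, x) = (\<lambda>s. restrict id (carrier (P x) s))"
      proof (rule presents_unique[OF P(2)[OF x] Pm(1,2)[OF x] PQ[OF refl[OF x]]])
        show "hmap (\<lambda>s. restrict id (carrier (P x) s)) (a x) \<subseteq>\<^sub>m a x"
          unfolding hmap_le_iff using aP[OF x] by simp
      qed (use d refl[OF x] hom_ident[OF Pm(1)[OF x]] in auto)
      then show ?thesis by (simp add: Dm_def)
    qed
    show "Dm (fst f, snd g) = Cmp (Mod T) (Dm g) (Dm f)" if fg: "f \<in> r" "g \<in> r" "fst g = snd f" for f g
    proof -
      obtain i j k where fg': "f = (i, j)" "g = (j, k)" using fg(3) by (cases f; cases g) auto
      have ij: "(i, j) \<in> r" "(j, k) \<in> r" using fg fg' by auto
      have ik: "(i, k) \<in> r" by (rule tran[OF ij])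
      \<comment> \<open>Both sides take the generators valued by \<open>a i\<close> to their values
        under \<open>a k\<close>, so the presentation of \<open>P i\<close> forces equality.\<close>
      have "d (i, k) = (\<lambda>s. compose (carrier (P i) s) (d (j, k) s) (d (i, j) s))"
        by (rule presents_unique[OF P(2)[OF rI(1)[OF ik]] Pm(1,2)[OF rI(2)[OF ik]] PQ[OF ik]
              d(1)[OF ik] d(2)[OF ik] cmp_hom[OF ij(1) d(1)[OF ij(2)]] cmp_le[OF ij(1) d(2)[OF ij(2)]]])
      then show ?thesis by (simp add: Dm_def fg')
    qed
  qed (use P in auto)
  interpret model_diagram U T "poset_cat I r" P Dm
    by unfold_locales (use D poset_category[OF dp] in auto)
  have cone: "is_cocone (poset_cat I r) (Mod T) P Dm N q \<longleftrightarrow> N \<in> Obj (Mod T) \<and>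
     (\<forall>i\<in>I. q i = (P i, maps (q i), N) \<and> model_hom T (P i) N (maps (q i))) \<and>
     (\<forall>(i, j)\<in>r. \<forall>s. \<forall>x\<in>carrier (P i) s. maps (q j) s (d (i, j) s x) = maps (q i) s x)" for N q
    unfolding cocone_iff by (auto simp: Dm_def)
  have a_gens: "g \<in> Gens R \<Longrightarrow> \<exists>i\<in>I. \<exists>x. a i g = Some x" for g
  proof -
    assume "g \<in> Gens R"
    then obtain i where i: "i \<in> I" "g \<in> Gens (Q i)" unfolding Q(2)[symmetric] Gens_def by blast
    then show ?thesis using presents_gens[OF P(2)[OF i(1)] i(2)] by blast
  qed
  have "is_colimit (poset_cat I r) (Mod T) P Dm M p"
    unfolding is_colimit_def
  proof (intro conjI allI impI)
    show "is_cocone (poset_cat I r) (Mod T) P Dm M p"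
      unfolding cone
    proof (intro conjI ballI)
      fix x assume "x \<in> r"
      then obtain i j where x: "x = (i, j)" "(i, j) \<in> r" by (cases x) auto
      note i = rI(1)[OF x(2)] and j = rI(2)[OF x(2)]
      have eq: "(\<lambda>s. compose (carrier (P i) s) (b j s) (d (i, j) s)) = b i"
        by (rule presents_unique[OF P(2)[OF i] Ma(1,2) MQ[OF i] cmp_hom[OF x(2) b(1)[OF j]]
              cmp_le[OF x(2) b(2)[OF j]] b(1)[OF i] b(2)[OF i]])
      have "b j s (d (i, j) s y) = b i s y" if "y \<in> carrier (P i) s" for s y
        using fun_cong[OF fun_cong[OF eq, of s], of y] that by (simp add: compose_eq)
      then show "case x of (i, j) \<Rightarrow> \<forall>s. \<forall>y\<in>carrier (P i) s. maps (p j) s (d (i, j) s y) = maps (p i) s y"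
        by (simp add: x p_def)
    qed (use M b p_def in auto)
    fix N q assume "is_cocone (poset_cat I r) (Mod T) P Dm N q"
    note q = this[unfolded cone]
    have N: "N \<in> Obj (Mod T)" "is_model T N" using q Mod_Obj by blast+
    define c where "c i = maps (q i)" for i
    have c: "q i = (P i, c i, N)" "model_hom T (P i) N (c i)" if "i \<in> I" for i using q that unfolding c_def by blast+
    have c_d: "c j s (d (i, j) s x) = c i s x" if "(i, j) \<in> r" "x \<in> carrier (P i) s" for i j s x
      using q that unfolding c_def by blast
    \<comment> \<open>A generator may belong to several parts; the values that two legs assign to it
      are compared at an upper bound.\<close>
    have wd: "c i (snd g) x = c j (snd g) y" if ij: "i \<in> I" "j \<in> I" "a i g = Some x" "a j g = Some y" for i j g x y
    proof -
      obtain k where k: "k \<in> I" "(i, k) \<in> r" "(j, k) \<in> r" using dp ij unfolding directed_poset_def by blast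
      have "a k g = Some (d (i, k) (snd g) x)" "a k g = Some (d (j, k) (snd g) y)"
        using d(2)[OF k(2)] d(2)[OF k(3)] ij unfolding hmap_le_iff by blast+
      then have "d (i, k) (snd g) x = d (j, k) (snd g) y" by simp
      then show ?thesis using c_d[OF k(2) aP[OF ij(1,3)]] c_d[OF k(3) aP[OF ij(2,4)]] by simp
    qed
    define h where "h g = (if \<exists>i\<in>I. \<exists>x. a i g = Some x then
        (let i = SOME i. i \<in> I \<and> a i g \<noteq> None in Some (c i (snd g) (the (a i g)))) else None)" for g
    have h: "h g = Some (c i (snd g) x)" if i: "i \<in> I" "a i g = Some x" for i g x
    proof -
      define j where "j = (SOME i. i \<in> I \<and> a i g \<noteq> None)"
      have j: "j \<in> I \<and> a j g \<noteq> None" unfolding j_def by (rule someI[of _ i]) (use i in auto)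
      then obtain y where "a j g = Some y" by blast
      then show ?thesis using j i wd[OF _ i(1) _ i(2), of j y] unfolding h_def j_def[symmetric] Let_def by auto
    qed
    have h_None: "\<exists>i\<in>I. \<exists>x. a i g = Some x" if "h g \<noteq> None" for g using that unfolding h_def by presburger
    have hval: "valuation N h"
      unfolding valuation_def
    proof (intro allI impI)
      fix g y assume y: "h g = Some y"
      then obtain i x where ix: "i \<in> I" "a i g = Some x" using h_None by blast
      then show "y \<in> carrier N (snd g)" using h[OF ix] y hom_carrier[OF c(2)[OF ix(1)] aP[OF ix]] by simp
    qed
    have c_h: "hmap (c i) (a i) \<subseteq>\<^sub>m h" if "i \<in> I" for i unfolding hmap_le_iff using h that by blast
    have hQ: "\<forall>(t, u)\<in>Q i. holds N h t u" if i: "i \<in> I" for i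
    proof (clarify)
      fix t u assume tu: "(t, u) \<in> Q i"
      then have "(t, u) \<in> R" using Q(2) i by blast
      then have "wft t" "wft u" "csort t = csort u" using R unfolding wfR_def by blast+
      moreover have "holds (P i) (a i) t u" using Pm(4)[OF i] tu by blast
      ultimately have "holds N (hmap (c i) (a i)) t u" using holds_hom[OF Pm(1)[OF i] c(2)[OF i]] by blast
      then show "holds N h t u" by (rule holds_mono[OF c_h[OF i]])
    qed
    then have hR: "\<forall>(t, u)\<in>R. holds N h t u" using Q(2) by blast
    have iff: "hmap k e \<subseteq>\<^sub>m h \<longleftrightarrow> (\<forall>i\<in>I. Cmp (Mod T) (M, k, N) (p i) = q i)" if k: "model_hom T M N k" for k
    proof
      assume le: "hmap k e \<subseteq>\<^sub>m h"
      show "\<forall>i\<in>I. Cmp (Mod T) (M, k, N) (p i) = q i"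
      proof
        fix i assume i: "i \<in> I"
        have "(\<lambda>s. compose (carrier (P i) s) (k s) (b i s)) = c i"
        proof (rule presents_unique[OF P(2)[OF i] N(2) hval hQ[OF i]])
          show "hmap (\<lambda>s. compose (carrier (P i) s) (k s) (b i s)) (a i) \<subseteq>\<^sub>m h"
            using b(2)[OF i] le aP[OF i] unfolding hmap_le_iff by (simp add: compose_eq)
        qed (use hom_compose[OF Pm(1)[OF i] b(1)[OF i] k] c(2)[OF i] c_h[OF i] in auto)
        then show "Cmp (Mod T) (M, k, N) (p i) = q i" using c(1)[OF i] by (simp add: p_def)
      qed
    next
      assume *: "\<forall>i\<in>I. Cmp (Mod T) (M, k, N) (p i) = q i"
      have kb: "k s (b i s x) = c i s x" if "i \<in> I" "x \<in> carrier (P i) s" for i s x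
      proof -
        have "c i = (\<lambda>s. compose (carrier (P i) s) (k s) (b i s))" using * c(1) that(1) by (simp add: p_def)
        then show ?thesis using that(2) by (simp add: compose_eq)
      qed
      show "hmap k e \<subseteq>\<^sub>m h" unfolding hmap_le_iff
      proof (intro allI impI)
        fix g x assume x: "e g = Some x"
        then have "g \<in> Gens R" using Ma(3) by blast
        then obtain i y where iy: "i \<in> I" "a i g = Some y" using a_gens by blast
        then have "e g = Some (b i (snd g) y)" using b(2) unfolding hmap_le_iff by blast
        then show "h g = Some (k (snd g) x)" using h[OF iy] kb[OF iy(1) aP[OF iy]] x by simp
      qed
    qed
    have ex: "\<exists>!k. model_hom T M N k \<and> hmap k e \<subseteq>\<^sub>m h" using M(2) N(2) hval hR unfolding presents_def by blast
    then obtain k where k: "model_hom T M N k" "hmap k e \<subseteq>\<^sub>m h" by blast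
    show "\<exists>!h. h \<in> hom (Mod T) M N \<and> (\<forall>i\<in>Obj (poset_cat I r). Cmp (Mod T) h (p i) = q i)"
    proof (rule ex1I[of _ "(M, k, N)"])
      show "(M, k, N) \<in> hom (Mod T) M N \<and> (\<forall>i\<in>Obj (poset_cat I r). Cmp (Mod T) (M, k, N) (p i) = q i)"
        using iff[OF k(1)] k M N(1) by (simp add: Mod_hom)
    next
      fix H assume H: "H \<in> hom (Mod T) M N \<and> (\<forall>i\<in>Obj (poset_cat I r). Cmp (Mod T) H (p i) = q i)"
      then obtain k' where k': "H = (M, k', N)" "model_hom T M N k'" by (auto simp: Mod_hom)
      then have "hmap k' e \<subseteq>\<^sub>m h" using iff[OF k'(2)] H by simp
      then have "k' = k" using ex k k'(2) by blast
      then show "H = (M, k, N)" using k' by simp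
    qed
  qed
  then show ?thesis using D by blast
qed

definition finite_presentations :: "('s, 'f, 'u) partial_algebra set" where
  "finite_presentations = Pres ` {R :: (('f, nat \<times> 's) ct \<times> ('f, nat \<times> 's) ct) set. finite R \<and> wfR R}"

lemma finite_presentations_small: "small TYPE('u) finite_presentations"
proof -
  have "countable {R :: (('f, nat \<times> 's) ct \<times> ('f, nat \<times> 's) ct) set. finite R \<and> wfR R}"
    by (rule countable_subset[OF _ countable_Collect_finite]) blast
  then show ?thesis unfolding finite_presentations_def by (intro small_image small_countable)
qed

lemma small_finite: "finite A \<Longrightarrow> small TYPE('u) A"
  by (intro small_countable countable_finite)

lemma finite_presentations_fp:
  assumes "M \<in> finite_presentations"
  shows "finitely_presentable_elementwise TYPE('u) (Mod T) M"
proof -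
  obtain R :: "(('f, nat \<times> 's) ct \<times> ('f, nat \<times> 's) ct) set" where R: "finite R" "wfR R" "M = Pres R"
    using assms unfolding finite_presentations_def by blast
  obtain e where "presents M e R" "M \<in> Obj (Mod T)"
    using Pres[OF R(2) small_finite[OF finite_Gens[OF R(1)]]] unfolding R(3) by metis
  then show ?thesis using presented_finitely_presentable R by blast
qed

lemma finite_presentation_exists:
  fixes R :: "(('f, 'a \<times> 's) ct \<times> ('f, 'a \<times> 's) ct) set"
  assumes R: "finite R" "wfR R"
  shows "\<exists>M e. M \<in> finite_presentations \<and> M \<in> Obj (Mod T) \<and> presents M e R"
proof -
  \<comment> \<open>The name becomes a number while the sort is kept, so that terms stay well
    sorted.\<close>
  define \<rho> where "\<rho> = (\<lambda>g :: 'a \<times> 's. (to_nat_on (Gens R) g, snd g))"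
  define R' where "R' = map_prod (map_ct (\<lambda>x. x) \<rho>) (map_ct (\<lambda>x. x) \<rho>) ` R"
  have fin: "finite (Gens R)" by (rule finite_Gens[OF R(1)])
  have \<rho>: "inj_on \<rho> (Gens R)" "\<And>g. snd (\<rho> g) = snd g"
    using inj_on_to_nat_on[OF countable_finite[OF fin]] by (auto simp: \<rho>_def inj_on_def)
  have R': "finite R'" "wfR R'" using R wfR_rename[OF \<rho>(2)] unfolding R'_def by blast+
  obtain e where "presents (Pres R') e R'" "Pres R' \<in> Obj (Mod T)"
    using Pres[OF R'(2) small_finite[OF finite_Gens[OF R'(1)]]] by metis
  moreover have "Pres R' \<in> finite_presentations" using R' unfolding finite_presentations_def by blast
  ultimately show ?thesis using presents_rename[OF \<rho>, folded R'_def] by metis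
qed

lemma directed_colimit_of_finite_presentations:
  assumes M: "M \<in> Obj (Mod T)"
  shows "is_directed_colimit_of TYPE('u) (Mod T) finite_presentations M"
proof -
  \<comment> \<open>For a single model the tag carries no information, hence the unit type.\<close>
  define R where "R = diag () M"
  have Mm: "is_model T M" "\<And>s. small TYPE('u) (carrier M s)" using M by (auto simp: Mod_Obj)
  have R: "wfR R" unfolding R_def by (rule diag_wfR[OF Mm(1)])
  define F where "F = {S. finite S \<and> S \<subseteq> R}"
  have "Gens R = (\<Union>s. (\<lambda>x. (((), x), s)) ` carrier M s)" unfolding R_def Gens_diag[OF Mm(1)] by auto
  also have "small TYPE('u) \<dots>" by (intro small_UN small_image Mm small_countable countableI_type)
  finally have tm: "small TYPE('u) {t :: ('f, (unit \<times> 'u) \<times> 's) ct. gens t \<subseteq> Gens R}" by (rule small_terms)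
  have "R \<subseteq> {t. gens t \<subseteq> Gens R} \<times> {t. gens t \<subseteq> Gens R}" unfolding Gens_def by fastforce
  then have "small TYPE('u) R" by (rule small_subset) (intro small_Sigma tm)
  then have "small TYPE('u) (Pow R)" by (rule small_Pow)
  then have sF: "small TYPE('u) F" by (rule small_subset[rotated]) (auto simp: F_def)
  then obtain j :: "(('f, (unit \<times> 'u) \<times> 's) ct \<times> ('f, (unit \<times> 'u) \<times> 's) ct) set \<Rightarrow> 'u" where j: "inj_on j F" by (rule small_imp_inj)
  \<comment> \<open>The index set of a directed colimit must consist of elements of
    \<open>'u\<close>: a finite part of the table is represented by its code under \<open>j\<close>,
    and \<open>Q\<close> decodes it.\<close>
  define I where "I = j ` F"
  define Q where "Q = inv_into F j"
  define r where "r = {(x, y). x \<in> I \<and> y \<in> I \<and> Q x \<subseteq> Q y}"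
  have Qj: "Q (j S) = S" if "S \<in> F" for S using j that by (simp add: Q_def)
  have jQ: "j (Q x) = x" "Q x \<in> F" if "x \<in> I" for x using that j by (auto simp: I_def Qj)
  have dp: "directed_poset I r"
    unfolding directed_poset_def partial_order_on_def preorder_on_def
  proof (intro conjI ballI)
    show "antisym r" using jQ unfolding r_def antisym_def by (auto; metis subset_antisym)
    show "I \<noteq> {}" unfolding I_def F_def by auto
    fix x y assume "x \<in> I" "y \<in> I"
    then have "Q x \<union> Q y \<in> F" using jQ unfolding F_def by auto
    then show "\<exists>z\<in>I. (x, z) \<in> r \<and> (y, z) \<in> r"
      using \<open>x \<in> I\<close> \<open>y \<in> I\<close> by (intro bexI[of _ "j (Q x \<union> Q y)"]) (auto simp: r_def I_def Qj)
  qed (auto simp: r_def refl_on_def trans_def)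
  have "\<forall>i\<in>I. \<exists>P e. P \<in> finite_presentations \<and> P \<in> Obj (Mod T) \<and> presents P e (Q i)"
  proof
    fix i assume "i \<in> I"
    then have "finite (Q i)" "wfR (Q i)" using jQ R unfolding F_def wfR_def by blast+
    then show "\<exists>P e. P \<in> finite_presentations \<and> P \<in> Obj (Mod T) \<and> presents P e (Q i)"
      by (rule finite_presentation_exists)
  qed
  then obtain P a where P: "\<And>i. i \<in> I \<Longrightarrow> P i \<in> finite_presentations" "\<And>i. i \<in> I \<Longrightarrow> P i \<in> Obj (Mod T)"
    "\<And>i. i \<in> I \<Longrightarrow> presents (P i) (a i) (Q i)" by metis
  have Q_mono: "\<And>i j. (i, j) \<in> r \<Longrightarrow> Q i \<subseteq> Q j" by (simp add: r_def)
  have "(\<Union>i\<in>I. Q i) = R"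
  proof
    show "(\<Union>i\<in>I. Q i) \<subseteq> R" using jQ unfolding F_def by blast
    show "R \<subseteq> (\<Union>i\<in>I. Q i)"
    proof
      fix x assume "x \<in> R"
      then have "{x} \<in> F" unfolding F_def by simp
      then show "x \<in> (\<Union>i\<in>I. Q i)" using Qj unfolding I_def by force
    qed
  qed
  then obtain Dm p where "is_functor (poset_cat I r) (Mod T) P Dm" "is_colimit (poset_cat I r) (Mod T) P Dm M p"
    using directed_union[where P = P and a = a and Q = Q, OF M diag_presents[OF Mm(1), of "()", folded R_def] R dp
        Q_mono _ P(2,3)] by blast
  moreover have "small TYPE('u) I" unfolding I_def by (rule small_image[OF sF])
  ultimately show ?thesis using dp P(1) unfolding is_directed_colimit_of_def by blast
qed

lemma Mod_hom_small: "small TYPE('u) (hom (Mod T) M N)" for M N :: "('s, 'f, 'u) partial_algebra"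
proof (cases "M \<in> Obj (Mod T) \<and> N \<in> Obj (Mod T)")
  case True
  have "hom (Mod T) M N \<subseteq> (\<lambda>h. (M, h, N)) ` PiE UNIV (\<lambda>s. PiE (carrier M s) (\<lambda>_. carrier N s))"
    by (auto simp: Mod_hom model_hom_def PiE_UNIV_domain)
  moreover have "small TYPE('u) (PiE UNIV (\<lambda>s. PiE (carrier M s) (\<lambda>_. carrier N s)))"
  proof (intro small_PiE)
    show "small TYPE('u) (UNIV :: 's set)" by (rule small_countable) simp
  qed (use True in \<open>simp_all add: Mod_Obj\<close>)
  ultimately show ?thesis using small_subset small_image by blast
next
  case False
  then have "hom (Mod T) M N = {}" by (auto simp: Mod_hom)
  then show ?thesis by (simp add: small_countable)
qed

subsection \<open>Limits of models\<close>

text \<open>In the limit an operation is defined at a tuple exactly if it is defined at every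
  coordinate, because domain equations between total terms can be tested coordinatewise.\<close>

theorem Mod_complete: "complete_category TYPE('u) (Mod T :: (('s, 'f, 'u) partial_algebra, _) cat)"
  unfolding complete_category_def
proof (intro conjI allI impI)
  show "category (Mod T :: (('s, 'f, 'u) partial_algebra, _) cat)" by (rule Mod_category)
  fix J :: "('u, 'u) cat" and Do :: "'u \<Rightarrow> ('s, 'f, 'u) partial_algebra" and Dm
  assume sJ: "small_cat J" and D: "is_functor J (Mod T) Do Dm"
  interpret model_diagram U T J Do Dm
    by unfold_locales (use sJ D in \<open>auto simp: small_cat_def\<close>)
  \<comment> \<open>For empty \<open>J\<close> the product is a singleton for every
    \<open>s\<close>; the condition \<open>s \<in> sorts T\<close> keeps the carriers outside the
    theory empty.\<close>
  define L where "L s = {\<phi> \<in> PiE (Obj J) (\<lambda>i. carrier (Do i) s). s \<in> sorts T \<and>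
      (\<forall>u\<in>Arr J. maps (Dm u) s (\<phi> (Dom J u)) = \<phi> (Cod J u))}" for s
  have sL: "small TYPE('u) (L s)" for s
  proof (rule small_subset)
    show "L s \<subseteq> PiE (Obj J) (\<lambda>i. carrier (Do i) s)" unfolding L_def by blast
    show "small TYPE('u) (PiE (Obj J) (\<lambda>i. carrier (Do i) s))"
      by (intro small_PiE diagram_obj(3)) (use sJ small_cat_def in blast)
  qed
  have "small TYPE('u) (\<Union>s. L s)" by (intro small_UN sL) (rule small_countable, simp)
  then obtain j :: "('u \<Rightarrow> 'u) \<Rightarrow> 'u" where j: "inj_on j (\<Union>s. L s)" by (rule small_imp_inj)
  \<comment> \<open>Compatible families are functions, so the carriers hold codes of them;
    \<open>\<pi> i\<close> decodes and takes the coordinate at \<open>i\<close>.\<close>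
  define \<pi> where "\<pi> i x = inv_into (\<Union>s. L s) j x i" for i x
  have \<pi>: "\<pi> i (j \<phi>) = \<phi> i" if "\<phi> \<in> L s" for \<phi> s i
    unfolding \<pi>_def using inv_into_f_f[OF j] that by (metis UNIV_I UN_I)
  define C where "C s = j ` L s" for s
  have \<pi>C: "\<pi> i x \<in> carrier (Do i) s" if "x \<in> C s" "i \<in> Obj J" for x s i
    using that \<pi> unfolding C_def L_def by fastforce
  have \<pi>D: "maps (Dm u) s (\<pi> (Dom J u) x) = \<pi> (Cod J u) x" if "x \<in> C s" "u \<in> Arr J" for x s u
    using that \<pi> unfolding C_def by (auto simp: L_def)
  have \<pi>_ext: "x = y" if xy: "x \<in> C s" "y \<in> C s" "\<And>i. i \<in> Obj J \<Longrightarrow> \<pi> i x = \<pi> i y" for x y s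
  proof -
    obtain \<phi> \<psi> where \<phi>: "\<phi> \<in> L s" "x = j \<phi>" "\<psi> \<in> L s" "y = j \<psi>" using xy(1,2) unfolding C_def by blast
    have "\<phi> = \<psi>"
      by (rule PiE_ext[of _ "Obj J" "\<lambda>i. carrier (Do i) s"]) (use \<phi> xy(3) \<pi> in \<open>auto simp: L_def\<close>)
    then show ?thesis using \<phi> by simp
  qed
  have \<pi>_ex: "\<exists>x\<in>C s. \<forall>i\<in>Obj J. \<pi> i x = \<phi> i"
    if "s \<in> sorts T" "\<And>i. i \<in> Obj J \<Longrightarrow> \<phi> i \<in> carrier (Do i) s" "\<And>u. u \<in> Arr J \<Longrightarrow> maps (Dm u) s (\<phi> (Dom J u)) = \<phi> (Cod J u)" for \<phi> s
  proof -
    have "restrict \<phi> (Obj J) \<in> L s" unfolding L_def using that J_Arr by simp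
    then show ?thesis unfolding C_def using \<pi> by (intro bexI[of _ "j (restrict \<phi> (Obj J))"]) auto
  qed
  \<comment> \<open>The graph of the operation \<open>f\<close> in the limit; joint injectivity of
    the projections makes it single valued.\<close>
  define good where "good f xs y \<longleftrightarrow> f \<in> ops T \<and> list_all2 (\<lambda>x s. x \<in> C s) xs (arity T f) \<and> y \<in> C (result T f) \<and>
      (\<forall>i\<in>Obj J. interp (Do i) f (map (\<pi> i) xs) = Some (\<pi> i y))" for f xs y
  define K where "K = \<lparr>carrier = C, interp = (\<lambda>f xs. if \<exists>y. good f xs y then Some (SOME y. good f xs y) else None)\<rparr>"
  have good_unique: "y = z" if "good f xs y" "good f xs z" for f xs y z
    using that unfolding good_def by (intro \<pi>_ext[of y "result T f" z]) force+
  have interpK: "interp K f xs = Some y \<longleftrightarrow> good f xs y" for f xs y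
  proof
    assume "interp K f xs = Some y"
    then have "\<exists>y. good f xs y" "y = (SOME y. good f xs y)" by (auto simp: K_def split: if_splits)
    then show "good f xs y" using someI_ex by metis
  next
    assume y: "good f xs y"
    then have "(SOME y. good f xs y) = y" using good_unique by (intro some_equality) blast+
    then show "interp K f xs = Some y" using y by (auto simp: K_def)
  qed
  have tupK: "xs \<in> tuples K \<Gamma> \<longleftrightarrow> list_all2 (\<lambda>x s. x \<in> C s) xs \<Gamma>" for xs \<Gamma> by (simp add: tuples_def K_def)
  have tup\<pi>: "map (\<pi> i) xs \<in> tuples (Do i) \<Gamma>" if "xs \<in> tuples K \<Gamma>" "i \<in> Obj J" for i xs \<Gamma>
    using that(1)[unfolded tupK] that(2) \<pi>C by (auto simp: tuples_def list_all2_conv_all_nth)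
  have ex_good: "\<exists>y. good f xs y"
    if f: "f \<in> ops T" "xs \<in> tuples K (arity T f)" "\<And>i. i \<in> Obj J \<Longrightarrow> interp (Do i) f (map (\<pi> i) xs) \<noteq> None" for f xs
  proof -
    define \<phi> where "\<phi> i = the (interp (Do i) f (map (\<pi> i) xs))" for i
    have \<phi>: "interp (Do i) f (map (\<pi> i) xs) = Some (\<phi> i)" if "i \<in> Obj J" for i
      unfolding \<phi>_def using f(3)[OF that] by auto
    \<comment> \<open>The coordinatewise results form a compatible family because the transition
      maps are homomorphisms.\<close>
    obtain y where y: "y \<in> C (result T f)" "\<forall>i\<in>Obj J. \<pi> i y = \<phi> i"
    proof (rule bexE[OF \<pi>_ex[of "result T f" \<phi>]])
      show "result T f \<in> sorts T" using op_sorts(2)[OF f(1)] .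
      show "\<phi> i \<in> carrier (Do i) (result T f)" if "i \<in> Obj J" for i
        using model_interp(3)[OF diagram_obj(2)[OF that] \<phi>[OF that]] .
      fix u assume u: "u \<in> Arr J"
      note d = J_Arr(1)[OF u] and c = J_Arr(2)[OF u]
      have "map2 (maps (Dm u)) (arity T f) (map (\<pi> (Dom J u)) xs) = map (\<pi> (Cod J u)) xs"
        using f(2) \<pi>D[OF _ u] by (auto simp: tupK list_all2_conv_all_nth intro!: nth_equalityI)
      then have "interp (Do (Cod J u)) f (map (\<pi> (Cod J u)) xs) = Some (maps (Dm u) (result T f) (\<phi> (Dom J u)))"
        using hom_interp[OF diagram_obj(2)[OF d] diagram_arr(2)[OF u] \<phi>[OF d]] by simp
      then show "maps (Dm u) (result T f) (\<phi> (Dom J u)) = \<phi> (Cod J u)" using \<phi>[OF c] by simp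
    qed blast
    then have "good f xs y" using f \<phi> by (simp add: good_def tupK)
    then show ?thesis by blast
  qed
  have eval\<pi>: "eval_tm (Do i) (map (\<pi> i) xs) t = Some (\<pi> i y)"
    if "eval_tm K xs t = Some y" "i \<in> Obj J" for i xs t y
    using that(1)
  proof (induction t arbitrary: y)
    case (Var n)
    then show ?case by (auto split: if_splits)
  next
    case (Op f ts)
    then obtain ys where ys: "list_all2 (\<lambda>p y. eval_tm K xs p = Some y) ts ys" "interp K f ys = Some y"
      unfolding eval_Op by blast
    have "list_all2 (\<lambda>p y. eval_tm (Do i) (map (\<pi> i) xs) p = Some y) ts (map (\<pi> i) ys)"
      using ys(1) Op.IH by (auto simp: list_all2_conv_all_nth)
    moreover have "interp (Do i) f (map (\<pi> i) ys) = Some (\<pi> i y)"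
      using ys(2) that(2) unfolding interpK good_def by blast
    ultimately show ?case unfolding eval_Op by blast
  qed
  have evalC: "y \<in> C s" if "has_sort T \<Gamma> t s" "xs \<in> tuples K \<Gamma>" "eval_tm K xs t = Some y" for \<Gamma> t s xs y
    using that
  proof (induction arbitrary: y rule: has_sort.induct)
    case (1 n)
    then show ?case by (auto simp: tupK list_all2_conv_all_nth split: if_splits)
  next
    case (2 f ts)
    then show ?case unfolding eval_Op interpK good_def by blast
  qed
  \<comment> \<open>\<open>eval_total\<close> presupposes a model, which \<open>K\<close> is only
    about to be shown to be. Without values on both sides, equality in \<open>K\<close> could not be
    reduced to equality of all coordinates.\<close>
  have eval_total_K: "\<exists>y. eval_tm K xs t = Some y"
    if "has_sort T \<Gamma> t s" "op_symbols t \<subseteq> total_ops T" "xs \<in> tuples K \<Gamma>" for \<Gamma> t s xs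
    using that
  proof (induction rule: has_sort.induct)
    case (1 n)
    then show ?case by (auto simp: tupK list_all2_conv_all_nth)
  next
    case (2 f ts)
    have "\<forall>n<length ts. \<exists>y. eval_tm K xs (ts ! n) = Some y" using 2 by (simp add: UN_subset_iff)
    then obtain Y where Y: "\<And>n. n < length ts \<Longrightarrow> eval_tm K xs (ts ! n) = Some (Y n)" by metis
    define ys where "ys = map Y [0..<length ts]"
    have ys: "list_all2 (\<lambda>p y. eval_tm K xs p = Some y) ts ys"
      using Y by (auto simp: ys_def list_all2_conv_all_nth)
    have tys: "ys \<in> tuples K (arity T f)"
      unfolding tupK
    proof (rule list_all2_all_nthI)
      fix n assume "n < length ys"
      then have n: "n < length ts" by (simp add: ys_def)
      then have "has_sort T \<Gamma> (ts ! n) (arity T f ! n)" using 2 by blast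
      then show "ys ! n \<in> C (arity T f ! n)" using evalC 2(5) Y[OF n] n by (simp add: ys_def)
    qed (use 2(2) in \<open>simp add: ys_def\<close>)
    have f: "f \<in> total_ops T" using 2 by simp
    have "interp (Do i) f (map (\<pi> i) ys) \<noteq> None" if "i \<in> Obj J" for i
      using model_defined[OF diagram_obj(2)[OF that] 2(1) tup\<pi>[OF tys that]] total_op[OF f] by simp
    then obtain z where "good f ys z" using ex_good[OF 2(1) tys] by blast
    then have "eval_tm K xs (Op f ts) = Some z" using ys unfolding eval_Op interpK by blast
    then show ?case by blast
  qed
  have K_model: "is_model T K"
    unfolding model_iff
  proof (intro conjI allI impI ballI)
    fix s assume "s \<notin> sorts T"
    then show "carrier K s = {}" by (simp add: K_def C_def L_def)
  next
    fix f xs y assume "interp K f xs = Some y"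
    then show "f \<in> ops T" "xs \<in> tuples K (arity T f)" "y \<in> carrier K (result T f)"
      unfolding interpK good_def tupK by (simp_all add: K_def)
  next
    fix f xs assume f: "f \<in> ops T" and xs: "xs \<in> tuples K (arity T f)"
    have eq: "eval_tm K xs p = eval_tm K xs q \<longleftrightarrow>
        (\<forall>i\<in>Obj J. eval_tm (Do i) (map (\<pi> i) xs) p = eval_tm (Do i) (map (\<pi> i) xs) q)" if pq: "(p, q) \<in> dq f" for p q
    proof -
      obtain s where s: "has_sort T (arity T f) p s" "has_sort T (arity T f) q s" using dq_sort(1)[OF f pq] by blast
      obtain a where a: "eval_tm K xs p = Some a" using eval_total_K[OF s(1) dq_sort(2)[OF f pq] xs] by blast
      obtain b where b: "eval_tm K xs q = Some b" using eval_total_K[OF s(2) dq_sort(3)[OF f pq] xs] by blast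
      have "a = b \<longleftrightarrow> (\<forall>i\<in>Obj J. \<pi> i a = \<pi> i b)"
        using \<pi>_ext[OF evalC[OF s(1) xs a] evalC[OF s(2) xs b]] by blast
      then show ?thesis using a b eval\<pi>[OF a] eval\<pi>[OF b] by simp
    qed
    have "interp K f xs \<noteq> None \<longleftrightarrow> (\<exists>y. good f xs y)" using interpK by auto
    also have "\<dots> \<longleftrightarrow> (\<forall>i\<in>Obj J. interp (Do i) f (map (\<pi> i) xs) \<noteq> None)"
      using ex_good[OF f xs] unfolding good_def by auto
    also have "\<dots> \<longleftrightarrow> (\<forall>i\<in>Obj J. \<forall>p q. (p, q) \<in> dq f \<longrightarrow>
        eval_tm (Do i) (map (\<pi> i) xs) p = eval_tm (Do i) (map (\<pi> i) xs) q)"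
      using model_defined[OF diagram_obj(2) f tup\<pi>[OF xs]] by (intro ball_cong) simp_all
    finally show "interp K f xs \<noteq> None \<longleftrightarrow> (\<forall>p q. (p, q) \<in> dq f \<longrightarrow> eval_tm K xs p = eval_tm K xs q)"
      using eq by auto
  next
    fix \<Gamma> p q xs assume ax: "(\<Gamma>, p, q) \<in> axioms T" and xs: "xs \<in> tuples K \<Gamma>"
      and d: "eval_tm K xs p \<noteq> None" "eval_tm K xs q \<noteq> None"
    obtain s where s: "has_sort T \<Gamma> p s" "has_sort T \<Gamma> q s" using axiom_sort(2)[OF ax] by blast
    obtain a b where ab: "eval_tm K xs p = Some a" "eval_tm K xs q = Some b" using d by blast
    have "a = b"
    proof (rule \<pi>_ext[OF evalC[OF s(1) xs ab(1)] evalC[OF s(2) xs ab(2)]])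
      fix i assume i: "i \<in> Obj J"
      show "\<pi> i a = \<pi> i b"
        using model_axiom[OF diagram_obj(2)[OF i] ax tup\<pi>[OF xs i]] eval\<pi>[OF ab(1) i] eval\<pi>[OF ab(2) i] by simp
    qed
    then show "eval_tm K xs p = eval_tm K xs q" using ab by simp
  qed
  have CK: "carrier K = C" by (simp add: K_def)
  have K_Obj: "K \<in> Obj (Mod T)"
    unfolding Mod_Obj CK C_def using K_model small_image[OF sL] by blast
  define p where "p i = (\<lambda>s. restrict (\<pi> i) (C s))" for i
  have map_p: "map2 (p i) \<Gamma> xs = map (\<pi> i) xs" if "xs \<in> tuples K \<Gamma>" for i \<Gamma> xs
    using that by (auto simp: tupK p_def list_all2_conv_all_nth intro!: nth_equalityI)
  have p_hom: "model_hom T K (Do i) (p i)" if i: "i \<in> Obj J" for i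
    unfolding model_hom_def CK
  proof (intro conjI allI ballI impI)
    show "p i s \<in> C s \<rightarrow>\<^sub>E carrier (Do i) s" for s unfolding p_def using \<pi>C[OF _ i] by simp
    fix f xs y assume y: "interp K f xs = Some y"
    have "xs \<in> tuples K (arity T f)" by (rule model_interp(2)[OF K_model y])
    then show "interp (Do i) f (map2 (p i) (arity T f) xs) = Some (p i (result T f) y)"
      using y i unfolding interpK good_def by (simp add: map_p) (simp add: p_def)
  qed
  have "is_limit J (Mod T) Do Dm K (\<lambda>i. (K, p i, Do i))"
    unfolding is_limit_def is_cone_def
  proof (intro conjI ballI allI impI)
    show "K \<in> Obj (Mod T)" by (rule K_Obj)
    show "(K, p i, Do i) \<in> hom (Mod T) K (Do i)" if "i \<in> Obj J" for i
      using that K_Obj p_hom diagram_obj(1) by (simp add: Mod_hom)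
    show "Cmp (Mod T) (Dm u) (K, p (Dom J u), Do (Dom J u)) = (K, p (Cod J u), Do (Cod J u))" if u: "u \<in> Arr J" for u
    proof -
      obtain a where a: "Dm u = (Do (Dom J u), a, Do (Cod J u))"
        "model_hom T (Do (Dom J u)) (Do (Cod J u)) a" using diagram_arr[OF u] by metis
      have "(\<lambda>s. compose (carrier K s) (a s) (p (Dom J u) s)) = p (Cod J u)"
        by (rule model_hom_ext[OF hom_compose[OF K_model p_hom[OF J_Arr(1)[OF u]] a(2)] p_hom[OF J_Arr(2)[OF u]]])
          (use \<pi>D[OF _ u] a(1) in \<open>simp add: compose_eq CK p_def\<close>)
      then show ?thesis by (simp add: a(1))
    qed
  next
    fix N q
    assume q: "N \<in> Obj (Mod T) \<and> (\<forall>i\<in>Obj J. q i \<in> hom (Mod T) N (Do i)) \<and>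
      (\<forall>u\<in>Arr J. Cmp (Mod T) (Dm u) (q (Dom J u)) = q (Cod J u))"
    then have N: "N \<in> Obj (Mod T)" "is_model T N" by (auto simp: Mod_Obj)
    define m where "m i = maps (q i)" for i
    have m: "q i = (N, m i, Do i)" "model_hom T N (Do i) (m i)" if "i \<in> Obj J" for i
    proof -
      have "q i \<in> hom (Mod T) N (Do i)" using q that by blast
      then show "q i = (N, m i, Do i)" "model_hom T N (Do i) (m i)" by (auto simp: Mod_hom m_def)
    qed
    have m_D: "maps (Dm u) s (m (Dom J u) s x) = m (Cod J u) s x" if u: "u \<in> Arr J" "x \<in> carrier N s" for u s x
    proof -
      obtain a where a: "Dm u = (Do (Dom J u), a, Do (Cod J u))" using diagram_arr(1)[OF u(1)] by metis
      have "Cmp (Mod T) (Dm u) (q (Dom J u)) = q (Cod J u)" using q u(1) by blast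
      then have eq: "(\<lambda>s. compose (carrier N s) (a s) (m (Dom J u) s)) = m (Cod J u)"
        using a m(1)[OF J_Arr(1)[OF u(1)]] m(1)[OF J_Arr(2)[OF u(1)]] by simp
      show ?thesis using fun_cong[OF fun_cong[OF eq, of s], of x] u(2) a by (simp add: compose_eq)
    qed
    define h where "h s = (\<lambda>x\<in>carrier N s. SOME y. y \<in> C s \<and> (\<forall>i\<in>Obj J. \<pi> i y = m i s x))" for s
    have h: "h s x \<in> C s \<and> (\<forall>i\<in>Obj J. \<pi> i (h s x) = m i s x)" if x: "x \<in> carrier N s" for s x
    proof -
      have "\<exists>y\<in>C s. \<forall>i\<in>Obj J. \<pi> i y = m i s x"
        using \<pi>_ex[OF model_carrier[OF N(2) x], of "\<lambda>i. m i s x"] hom_carrier[OF m(2) x] m_D[OF _ x] by blast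
      then have "\<exists>y. y \<in> C s \<and> (\<forall>i\<in>Obj J. \<pi> i y = m i s x)" by blast
      from someI_ex[OF this] show ?thesis using x by (simp add: h_def)
    qed
    have h_hom: "model_hom T N K h"
      unfolding model_hom_def CK
    proof (intro conjI allI ballI impI)
      show "h s \<in> carrier N s \<rightarrow>\<^sub>E C s" for s
        by (rule PiE_I) (use h in \<open>auto simp: h_def\<close>)
      fix f xs y assume f: "f \<in> ops T" and y: "interp N f xs = Some y"
      note t = model_interp[OF N(2) y]
      have "list_all2 (\<lambda>x s. x \<in> C s) (map2 h (arity T f) xs) (arity T f)"
        using t(2) h by (simp add: tuples_def list_all2_conv_all_nth)
      moreover have "interp (Do i) f (map (\<pi> i) (map2 h (arity T f) xs)) = Some (\<pi> i (h (result T f) y))"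
        if i: "i \<in> Obj J" for i
      proof -
        have eq: "map (\<pi> i) (map2 h (arity T f) xs) = map2 (m i) (arity T f) xs"
          by (rule nth_equalityI) (use t(2) h i in \<open>auto simp: tuples_def list_all2_conv_all_nth\<close>)
        show ?thesis unfolding eq using hom_interp[OF N(2) m(2)[OF i] y] h[OF t(3)] i by simp
      qed
      ultimately show "interp K f (map2 h (arity T f) xs) = Some (h (result T f) y)"
        unfolding interpK good_def using f h[OF t(3)] by blast
    qed
    have iff: "(\<forall>i\<in>Obj J. Cmp (Mod T) (K, p i, Do i) (N, k, K) = q i) \<longleftrightarrow> k = h" if k: "model_hom T N K k" for k
    proof
      assume *: "\<forall>i\<in>Obj J. Cmp (Mod T) (K, p i, Do i) (N, k, K) = q i"
      show "k = h"
      proof (rule model_hom_ext[OF k h_hom])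
        fix s x assume x: "x \<in> carrier N s"
        have kC: "k s x \<in> C s" using hom_carrier[OF k x] by (simp add: CK)
        show "k s x = h s x"
        proof (rule \<pi>_ext[OF kC])
          show "h s x \<in> C s" using h[OF x] by blast
          fix i assume i: "i \<in> Obj J"
          have eq: "(\<lambda>s. compose (carrier N s) (p i s) (k s)) = m i"
            using bspec[OF * i] m(1)[OF i] by simp
          have "\<pi> i (k s x) = m i s x"
            using fun_cong[OF fun_cong[OF eq, of s], of x] x kC by (simp add: compose_eq p_def)
          then show "\<pi> i (k s x) = \<pi> i (h s x)" using h[OF x] i by simp
        qed
      qed
    next
      assume kh: "k = h"
      show "\<forall>i\<in>Obj J. Cmp (Mod T) (K, p i, Do i) (N, k, K) = q i"
      proof
        fix i assume i: "i \<in> Obj J"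
        have "(\<lambda>s. compose (carrier N s) (p i s) (h s)) = m i"
          by (rule model_hom_ext[OF hom_compose[OF N(2) h_hom p_hom[OF i]] m(2)[OF i]])
            (use h i in \<open>simp add: compose_eq p_def\<close>)
        then show "Cmp (Mod T) (K, p i, Do i) (N, k, K) = q i" using m(1)[OF i] kh by simp
      qed
    qed
    show "\<exists>!h. h \<in> hom (Mod T) N K \<and> (\<forall>i\<in>Obj J. Cmp (Mod T) (K, p i, Do i) h = q i)"
    proof (rule ex1I[of _ "(N, h, K)"])
      show "(N, h, K) \<in> hom (Mod T) N K \<and> (\<forall>i\<in>Obj J. Cmp (Mod T) (K, p i, Do i) (N, h, K) = q i)"
        using iff[OF h_hom] h_hom N(1) K_Obj by (simp add: Mod_hom del: Mod_simps)
    next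
      fix H assume H: "H \<in> hom (Mod T) N K \<and> (\<forall>i\<in>Obj J. Cmp (Mod T) (K, p i, Do i) H = q i)"
      then obtain k where k: "H = (N, k, K)" "model_hom T N K k" by (auto simp: Mod_hom)
      then show "H = (N, h, K)" using iff[OF k(2)] H by blast
    qed
  qed
  then show "\<exists>c p. is_limit J (Mod T) Do Dm c p" by blast
qed

end

section \<open>The theory of weak omega categories\<close>

text \<open>The underlying, middle and strictified magma. With the magma as a parameter, operations
  and laws common to all three are stated once.\<close>

datatype mag = Und | Mid | Str

instance mag :: countable by countable_datatype

datatype sym = Src mag nat | Tgt mag nat | Idt mag nat | Comp mag nat nat | Proj mag nat | Rho nat | Bridge nat

instance sym :: countable by countable_datatype

text \<open>Interleaving the three families of cells is a bijection onto the naturals, so every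
  natural is a sort and no carrier has to be kept empty.\<close>

fun srt :: "mag \<Rightarrow> nat \<Rightarrow> nat" where
  "srt Und i = 3 * i" | "srt Mid i = 3 * i + 1" | "srt Str i = 3 * i + 2"

definition srt_mag :: "nat \<Rightarrow> mag" where
  "srt_mag s = (if s mod 3 = 0 then Und else if s mod 3 = 1 then Mid else Str)"

definition srt_dim :: "nat \<Rightarrow> nat" where "srt_dim s = s div 3"

lemma srt_inv [simp]: "srt_mag (srt k i) = k" "srt_dim (srt k i) = i" "srt (srt_mag s) (srt_dim s) = s"
proof -
  show "srt_mag (srt k i) = k" "srt_dim (srt k i) = i" by (cases k; simp add: srt_mag_def srt_dim_def; presburger)+
  show "srt (srt_mag s) (srt_dim s) = s" unfolding srt_mag_def srt_dim_def by (auto; presburger)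
qed

text \<open>
  \<open>Proj Und\<close> is \<open>\<lambda>\<close> and \<open>Proj Str\<close> is \<open>\<kappa>\<close>; there is no operation \<open>Proj Mid\<close>.
  The bridge relation becomes a partial operation, since \<open>(a, b)\<close> determines the bridge and has
  one exactly if \<open>a\<close> and \<open>b\<close> are parallel and identified by \<open>\<kappa>\<close>.
\<close>

fun sym_ok :: "sym \<Rightarrow> bool" where
  "sym_ok (Comp k i j) \<longleftrightarrow> i < j" | "sym_ok (Proj k i) \<longleftrightarrow> k \<noteq> Mid" | "sym_ok f \<longleftrightarrow> True"

fun sym_total :: "sym \<Rightarrow> bool" where
  "sym_total (Comp k i j) \<longleftrightarrow> False" | "sym_total (Bridge i) \<longleftrightarrow> False" | "sym_total f \<longleftrightarrow> True"

fun sym_arity :: "sym \<Rightarrow> nat list" where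
  "sym_arity (Src k i) = [srt k (Suc i)]"
| "sym_arity (Tgt k i) = [srt k (Suc i)]"
| "sym_arity (Idt k i) = [srt k i]"
| "sym_arity (Comp k i j) = [srt k j, srt k j]"
| "sym_arity (Proj k i) = [srt Mid i]"
| "sym_arity (Rho i) = [srt Und i]"
| "sym_arity (Bridge i) = [srt Mid i, srt Mid i]"

fun sym_result :: "sym \<Rightarrow> nat" where
  "sym_result (Src k i) = srt k i"
| "sym_result (Tgt k i) = srt k i"
| "sym_result (Idt k i) = srt k (Suc i)"
| "sym_result (Comp k i j) = srt k j"
| "sym_result (Proj k i) = srt k i"
| "sym_result (Rho i) = srt Mid i"
| "sym_result (Bridge i) = srt Mid (Suc i)"

abbreviation op :: "sym \<Rightarrow> nat tm list \<Rightarrow> nat tm" where "op f \<equiv> Op (to_nat f)"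
abbreviation v0 :: "nat tm" where "v0 \<equiv> Var 0"
abbreviation v1 :: "nat tm" where "v1 \<equiv> Var (Suc 0)"
abbreviation v2 :: "nat tm" where "v2 \<equiv> Var (Suc (Suc 0))"
abbreviation v3 :: "nat tm" where "v3 \<equiv> Var (Suc (Suc (Suc 0)))"

text \<open>The same recursion as \<open>src_it\<close>, innermost face first, so that evaluation
  matches \<open>src_it\<close> by induction on \<open>j\<close>.\<close>

primrec srcT :: "mag \<Rightarrow> nat \<Rightarrow> nat \<Rightarrow> nat tm \<Rightarrow> nat tm" where
  "srcT k i 0 t = t" | "srcT k i (Suc j) t = (if i \<le> j then srcT k i j (op (Src k j) [t]) else t)"

primrec tgtT :: "mag \<Rightarrow> nat \<Rightarrow> nat \<Rightarrow> nat tm \<Rightarrow> nat tm" where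
  "tgtT k i 0 t = t" | "tgtT k i (Suc j) t = (if i \<le> j then tgtT k i j (op (Tgt k j) [t]) else t)"

primrec idtT :: "mag \<Rightarrow> nat \<Rightarrow> nat \<Rightarrow> nat tm \<Rightarrow> nat tm" where
  "idtT k i 0 t = t" | "idtT k i (Suc j) t = (if i \<le> j then op (Idt k j) [idtT k i j t] else t)"

text \<open>Any two 0-cells are parallel, so in dimension 0 a bridge is subject only to the
  condition on \<open>\<kappa>\<close>.\<close>

fun sym_dom :: "sym \<Rightarrow> (nat tm \<times> nat tm) set" where
  "sym_dom (Comp k i j) = {(tgtT k i j v0, srcT k i j v1)}"
| "sym_dom (Bridge i) = {(op (Proj Str i) [v0], op (Proj Str i) [v1])} \<union>
     (case i of 0 \<Rightarrow> {} | Suc m \<Rightarrow>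
        {(op (Src Mid m) [v0], op (Src Mid m) [v1]), (op (Tgt Mid m) [v0], op (Tgt Mid m) [v1])})"
| "sym_dom f = {}"

text \<open>An axiom binds only where both sides are defined; this is how the composability
  hypotheses of the definitions enter. The category laws are imposed on \<open>Str\<close> alone. No
  law makes \<open>Rho\<close> preserve composites, as \<rho> is a morphism of omega graphs only.
  That bridges are unique is implicit in \<open>Bridge\<close> being an operation.\<close>

inductive law :: "nat list \<Rightarrow> nat tm \<Rightarrow> nat tm \<Rightarrow> bool" where
  src_glob: "law [srt k (Suc (Suc i))] (op (Src k i) [op (Src k (Suc i)) [v0]]) (op (Src k i) [op (Tgt k (Suc i)) [v0]])"
| tgt_glob: "law [srt k (Suc (Suc i))] (op (Tgt k i) [op (Src k (Suc i)) [v0]]) (op (Tgt k i) [op (Tgt k (Suc i)) [v0]])"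
| src_idt: "law [srt k i] (op (Src k i) [op (Idt k i) [v0]]) v0"
| tgt_idt: "law [srt k i] (op (Tgt k i) [op (Idt k i) [v0]]) v0"
| src_comp: "law [srt k (Suc i), srt k (Suc i)] (op (Src k i) [op (Comp k i (Suc i)) [v0, v1]]) (op (Src k i) [v0])"
| tgt_comp: "law [srt k (Suc i), srt k (Suc i)] (op (Tgt k i) [op (Comp k i (Suc i)) [v0, v1]]) (op (Tgt k i) [v1])"
| src_comp': "i < j \<Longrightarrow> law [srt k (Suc j), srt k (Suc j)] (op (Src k j) [op (Comp k i (Suc j)) [v0, v1]])
    (op (Comp k i j) [op (Src k j) [v0], op (Src k j) [v1]])"
| tgt_comp': "i < j \<Longrightarrow> law [srt k (Suc j), srt k (Suc j)] (op (Tgt k j) [op (Comp k i (Suc j)) [v0, v1]])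
    (op (Comp k i j) [op (Tgt k j) [v0], op (Tgt k j) [v1]])"
| assoc: "i < j \<Longrightarrow> law [srt Str j, srt Str j, srt Str j]
    (op (Comp Str i j) [op (Comp Str i j) [v0, v1], v2]) (op (Comp Str i j) [v0, op (Comp Str i j) [v1, v2]])"
| interchange: "i < j \<Longrightarrow> j < k \<Longrightarrow> law [srt Str k, srt Str k, srt Str k, srt Str k]
    (op (Comp Str i k) [op (Comp Str j k) [v0, v1], op (Comp Str j k) [v2, v3]])
    (op (Comp Str j k) [op (Comp Str i k) [v0, v2], op (Comp Str i k) [v1, v3]])"
| unit_left: "i < j \<Longrightarrow> law [srt Str j] (op (Comp Str i j) [idtT Str i j (srcT Str i j v0), v0]) v0"
| unit_right: "i < j \<Longrightarrow> law [srt Str j] (op (Comp Str i j) [v0, idtT Str i j (tgtT Str i j v0)]) v0"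
| idt_comp: "i < j \<Longrightarrow> law [srt Str j, srt Str j]
    (op (Comp Str i (Suc j)) [op (Idt Str j) [v0], op (Idt Str j) [v1]]) (op (Idt Str j) [op (Comp Str i j) [v0, v1]])"
| proj_src: "k \<noteq> Mid \<Longrightarrow> law [srt Mid (Suc i)] (op (Proj k i) [op (Src Mid i) [v0]]) (op (Src k i) [op (Proj k (Suc i)) [v0]])"
| proj_tgt: "k \<noteq> Mid \<Longrightarrow> law [srt Mid (Suc i)] (op (Proj k i) [op (Tgt Mid i) [v0]]) (op (Tgt k i) [op (Proj k (Suc i)) [v0]])"
| proj_idt: "k \<noteq> Mid \<Longrightarrow> law [srt Mid i] (op (Proj k (Suc i)) [op (Idt Mid i) [v0]]) (op (Idt k i) [op (Proj k i) [v0]])"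
| proj_comp: "k \<noteq> Mid \<Longrightarrow> i < j \<Longrightarrow> law [srt Mid j, srt Mid j] (op (Proj k j) [op (Comp Mid i j) [v0, v1]])
    (op (Comp k i j) [op (Proj k j) [v0], op (Proj k j) [v1]])"
| rho_src: "law [srt Und (Suc i)] (op (Rho i) [op (Src Und i) [v0]]) (op (Src Mid i) [op (Rho (Suc i)) [v0]])"
| rho_tgt: "law [srt Und (Suc i)] (op (Rho i) [op (Tgt Und i) [v0]]) (op (Tgt Mid i) [op (Rho (Suc i)) [v0]])"
| rho_idt: "law [srt Und i] (op (Rho (Suc i)) [op (Idt Und i) [v0]]) (op (Idt Mid i) [op (Rho i) [v0]])"
| lam_rho: "law [srt Und i] (op (Proj Und i) [op (Rho i) [v0]]) v0"
| bridge_src: "law [srt Mid i, srt Mid i] (op (Src Mid i) [op (Bridge i) [v0, v1]]) v0"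
| bridge_tgt: "law [srt Mid i, srt Mid i] (op (Tgt Mid i) [op (Bridge i) [v0, v1]]) v1"
| bridge_idt: "law [srt Mid i] (op (Bridge i) [v0, v0]) (op (Idt Mid i) [v0])"
| bridge_kappa: "law [srt Mid i, srt Mid i] (op (Proj Str (Suc i)) [op (Bridge i) [v0, v1]]) (op (Idt Str i) [op (Proj Str i) [v0]])"

text \<open>Sorts and symbols are numbers; restricting \<open>ops\<close> to codes of admissible
  symbols leaves out those on which \<open>from_nat\<close> is arbitrary.\<close>

definition omega_theory :: "(nat, nat) ea_theory" where
  "omega_theory = \<lparr>sorts = UNIV, ops = to_nat ` {f. sym_ok f}, arity = sym_arity \<circ> from_nat,
     result = sym_result \<circ> from_nat, total_ops = to_nat ` {f. sym_ok f \<and> sym_total f},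
     dom_eqs = sym_dom \<circ> from_nat, axioms = {(\<Gamma>, t, u). law \<Gamma> t u}\<rparr>"

lemma theory_simps [simp]:
  "sorts omega_theory = UNIV" "to_nat f \<in> ops omega_theory \<longleftrightarrow> sym_ok f"
  "arity omega_theory (to_nat f) = sym_arity f" "result omega_theory (to_nat f) = sym_result f"
  "to_nat f \<in> total_ops omega_theory \<longleftrightarrow> sym_ok f \<and> sym_total f" "dom_eqs omega_theory (to_nat f) = sym_dom f"
  "(\<Gamma>, t, u) \<in> axioms omega_theory \<longleftrightarrow> law \<Gamma> t u"
  by (auto simp: omega_theory_def)

lemma theory_ops: "ops omega_theory = to_nat ` {f. sym_ok f}"
  by (simp add: omega_theory_def)

lemma sort_Op:
  assumes "sym_ok f" "list_all2 (has_sort omega_theory \<Gamma>) ts (sym_arity f)"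
  shows "has_sort omega_theory \<Gamma> (op f ts) (sym_result f)"
  using has_sort.intros(2)[of "to_nat f" omega_theory ts \<Gamma>] assms by (simp add: list_all2_conv_all_nth)

lemma sort_unary:
  "has_sort omega_theory \<Gamma> t (srt k (Suc i)) \<Longrightarrow> has_sort omega_theory \<Gamma> (op (Src k i) [t]) (srt k i)"
  "has_sort omega_theory \<Gamma> t (srt k (Suc i)) \<Longrightarrow> has_sort omega_theory \<Gamma> (op (Tgt k i) [t]) (srt k i)"
  "has_sort omega_theory \<Gamma> t (srt k i) \<Longrightarrow> has_sort omega_theory \<Gamma> (op (Idt k i) [t]) (srt k (Suc i))"
  "k \<noteq> Mid \<Longrightarrow> has_sort omega_theory \<Gamma> t (srt Mid i) \<Longrightarrow> has_sort omega_theory \<Gamma> (op (Proj k i) [t]) (srt k i)"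
  "has_sort omega_theory \<Gamma> t (srt Und i) \<Longrightarrow> has_sort omega_theory \<Gamma> (op (Rho i) [t]) (srt Mid i)"
  using sort_Op[of "Src k i" \<Gamma> "[t]"] sort_Op[of "Tgt k i" \<Gamma> "[t]"] sort_Op[of "Idt k i" \<Gamma> "[t]"]
    sort_Op[of "Proj k i" \<Gamma> "[t]"] sort_Op[of "Rho i" \<Gamma> "[t]"] by simp_all

lemma sort_binary:
  "i < j \<Longrightarrow> has_sort omega_theory \<Gamma> t (srt k j) \<Longrightarrow> has_sort omega_theory \<Gamma> u (srt k j) \<Longrightarrow>
    has_sort omega_theory \<Gamma> (op (Comp k i j) [t, u]) (srt k j)"
  "has_sort omega_theory \<Gamma> t (srt Mid i) \<Longrightarrow> has_sort omega_theory \<Gamma> u (srt Mid i) \<Longrightarrow>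
    has_sort omega_theory \<Gamma> (op (Bridge i) [t, u]) (srt Mid (Suc i))"
  using sort_Op[of "Comp k i j" \<Gamma> "[t, u]"] sort_Op[of "Bridge i" \<Gamma> "[t, u]"] by simp_all

lemma sort_Var:
  "has_sort T (s # \<Gamma>) v0 s" "has_sort T (s' # s # \<Gamma>) v1 s"
  "has_sort T (s'' # s' # s # \<Gamma>) v2 s" "has_sort T (s3 # s'' # s' # s # \<Gamma>) v3 s"
  using has_sort.intros(1)[of 0 "s # \<Gamma>" T] has_sort.intros(1)[of "Suc 0" "s' # s # \<Gamma>" T]
    has_sort.intros(1)[of "Suc (Suc 0)" "s'' # s' # s # \<Gamma>" T]
    has_sort.intros(1)[of "Suc (Suc (Suc 0))" "s3 # s'' # s' # s # \<Gamma>" T] by simp_all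

lemma sort_iterated:
  "i \<le> j \<Longrightarrow> has_sort omega_theory \<Gamma> t (srt k j) \<Longrightarrow> has_sort omega_theory \<Gamma> (srcT k i j t) (srt k i)"
  "i \<le> j \<Longrightarrow> has_sort omega_theory \<Gamma> t (srt k j) \<Longrightarrow> has_sort omega_theory \<Gamma> (tgtT k i j t) (srt k i)"
  "i \<le> j \<Longrightarrow> has_sort omega_theory \<Gamma> t (srt k i) \<Longrightarrow> has_sort omega_theory \<Gamma> (idtT k i j t) (srt k j)"
proof (induction j arbitrary: t)
  case (Suc j)
  { case 1 then show ?case using Suc(1) sort_unary(1) by (cases "i = Suc j") auto }
  { case 2 then show ?case using Suc(2) sort_unary(2) by (cases "i = Suc j") auto }
  { case 3 then show ?case using Suc(3) sort_unary(3) by (cases "i = Suc j") auto }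
qed simp_all

lemma symbols_iterated:
  "op_symbols (srcT k i j t) \<subseteq> op_symbols t \<union> total_ops omega_theory"
  "op_symbols (tgtT k i j t) \<subseteq> op_symbols t \<union> total_ops omega_theory"
proof -
  show "op_symbols (srcT k i j t) \<subseteq> op_symbols t \<union> total_ops omega_theory"
  proof (induction j arbitrary: t)
    case (Suc j)
    then show ?case using Suc[of "op (Src k j) [t]"] by auto
  qed simp
  show "op_symbols (tgtT k i j t) \<subseteq> op_symbols t \<union> total_ops omega_theory"
  proof (induction j arbitrary: t)
    case (Suc j)
    then show ?case using Suc[of "op (Tgt k j) [t]"] by auto
  qed simp
qed

lemma law_sort: "law \<Gamma> t u \<Longrightarrow> \<exists>s. has_sort omega_theory \<Gamma> t s \<and> has_sort omega_theory \<Gamma> u s"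
  by (induction rule: law.induct; rule exI; rule conjI)
    (rule sort_unary sort_binary sort_iterated sort_Var less_imp_le | assumption | simp; fail)+

lemma dom_sort:
  assumes "(t, u) \<in> sym_dom f" "sym_ok f"
  shows "(\<exists>s. has_sort omega_theory (sym_arity f) t s \<and> has_sort omega_theory (sym_arity f) u s) \<and>
    op_symbols t \<subseteq> total_ops omega_theory \<and> op_symbols u \<subseteq> total_ops omega_theory"
proof (cases f)
  case (Comp k i j)
  then have tu: "t = tgtT k i j v0" "u = srcT k i j v1" "i < j" using assms by auto
  have "has_sort omega_theory (sym_arity f) t (srt k i)" "has_sort omega_theory (sym_arity f) u (srt k i)"
    unfolding tu Comp sym_arity.simps by (intro sort_iterated sort_Var less_imp_le tu(3))+
  then show ?thesis using symbols_iterated[of k i j] unfolding tu by fastforce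
next
  case (Bridge i)
  have p: "has_sort omega_theory (sym_arity f) (op (Proj Str i) [v0]) (srt Str i)"
    "has_sort omega_theory (sym_arity f) (op (Proj Str i) [v1]) (srt Str i)"
    unfolding Bridge sym_arity.simps by (intro sort_unary sort_Var; simp)+
  have q: "has_sort omega_theory (sym_arity f) (op (Src Mid m) [v0]) (srt Mid m)"
    "has_sort omega_theory (sym_arity f) (op (Src Mid m) [v1]) (srt Mid m)"
    "has_sort omega_theory (sym_arity f) (op (Tgt Mid m) [v0]) (srt Mid m)"
    "has_sort omega_theory (sym_arity f) (op (Tgt Mid m) [v1]) (srt Mid m)" if "i = Suc m" for m
    unfolding Bridge that sym_arity.simps by (intro sort_unary sort_Var)+
  show ?thesis using assms(1) unfolding Bridge using p q unfolding Bridge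
    by (auto split: nat.splits)
qed (use assms in simp_all)

lemma omega_theory_ea: "essentially_algebraic_theory omega_theory"
  unfolding essentially_algebraic_theory_def
proof (intro conjI ballI)
  show "total_ops omega_theory \<subseteq> ops omega_theory" by (auto simp: omega_theory_def)
next
  fix n assume "n \<in> ops omega_theory - total_ops omega_theory"
  then obtain f where f: "n = to_nat f" "sym_ok f" by (auto simp: theory_ops)
  show "finite (dom_eqs omega_theory n)" unfolding f theory_simps by (cases f) (auto split: nat.splits)
  fix x assume "x \<in> dom_eqs omega_theory n"
  then show "case x of (t, u) \<Rightarrow> (\<exists>s. has_sort omega_theory (arity omega_theory n) t s \<and>
      has_sort omega_theory (arity omega_theory n) u s) \<and>
      op_symbols t \<subseteq> total_ops omega_theory \<and> op_symbols u \<subseteq> total_ops omega_theory"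
    using dom_sort f by (cases x) (simp del: op_symbols.simps)
next
  fix x assume "x \<in> axioms omega_theory"
  then show "case x of (\<Gamma>, t, u) \<Rightarrow> set \<Gamma> \<subseteq> sorts omega_theory \<and>
      (\<exists>s. has_sort omega_theory \<Gamma> t s \<and> has_sort omega_theory \<Gamma> u s)"
    using law_sort by (cases x) simp
qed simp_all

subsection \<open>Cells\<close>

fun mg :: "mag \<Rightarrow> 'u weak_omega_category \<Rightarrow> 'u omega_magma" where
  "mg Und X = underlying X" | "mg Mid X = middle X" | "mg Str X = strictified X"

fun pj :: "mag \<Rightarrow> 'u weak_omega_category \<Rightarrow> nat \<Rightarrow> 'u \<Rightarrow> 'u" where
  "pj Und X = lam X" | "pj Str X = kappa X" | "pj Mid X = (\<lambda>_ _. undefined)"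

text \<open>Everything in the definition of a weak omega category except the equations.\<close>

locale raw =
  fixes X :: "'u weak_omega_category"
  assumes src_PiE: "\<And>k i. src (mg k X) i \<in> cell (mg k X) (Suc i) \<rightarrow>\<^sub>E cell (mg k X) i"
    and tgt_PiE: "\<And>k i. tgt (mg k X) i \<in> cell (mg k X) (Suc i) \<rightarrow>\<^sub>E cell (mg k X) i"
    and idt_PiE: "\<And>k i. idt (mg k X) i \<in> cell (mg k X) i \<rightarrow>\<^sub>E cell (mg k X) (Suc i)"
    and cmp_PiE: "\<And>k i j. i < j \<Longrightarrow> cmp (mg k X) i j \<in> composable (mg k X) i j \<rightarrow>\<^sub>E cell (mg k X) j"
    and cmp_undefined: "\<And>k i j. \<not> i < j \<Longrightarrow> cmp (mg k X) i j = (\<lambda>_. undefined)"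
    and pj_PiE: "\<And>k i. k \<noteq> Mid \<Longrightarrow> pj k X i \<in> cell (middle X) i \<rightarrow>\<^sub>E cell (mg k X) i"
    and rho_PiE: "\<And>i. rho X i \<in> cell (underlying X) i \<rightarrow>\<^sub>E cell (middle X) i"
    and bridge_ex: "\<And>i a b. (\<exists>c. (a, b, c) \<in> bridges X i) \<longleftrightarrow> parallel (middle X) i a b \<and> kappa X i a = kappa X i b"
    and bridge_cell: "\<And>i a b c. (a, b, c) \<in> bridges X i \<Longrightarrow> c \<in> cell (middle X) (Suc i)"
    and bridge_unique: "\<And>i a b c d. (a, b, c) \<in> bridges X i \<Longrightarrow> (a, b, d) \<in> bridges X i \<Longrightarrow> c = d"
begin

lemma raw_mem:
  "a \<in> cell (mg k X) (Suc i) \<Longrightarrow> src (mg k X) i a \<in> cell (mg k X) i"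
  "a \<in> cell (mg k X) (Suc i) \<Longrightarrow> tgt (mg k X) i a \<in> cell (mg k X) i"
  "a \<in> cell (mg k X) i \<Longrightarrow> idt (mg k X) i a \<in> cell (mg k X) (Suc i)"
  "i < j \<Longrightarrow> (a, b) \<in> composable (mg k X) i j \<Longrightarrow> cmp (mg k X) i j (a, b) \<in> cell (mg k X) j"
  "k \<noteq> Mid \<Longrightarrow> a \<in> cell (mg Mid X) i \<Longrightarrow> pj k X i a \<in> cell (mg k X) i"
  "a \<in> cell (mg Und X) i \<Longrightarrow> rho X i a \<in> cell (mg Mid X) i"
  using PiE_mem[OF src_PiE] PiE_mem[OF tgt_PiE] PiE_mem[OF idt_PiE] PiE_mem[OF cmp_PiE]
    PiE_mem[OF pj_PiE] PiE_mem[OF rho_PiE] by simp_all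

end

text \<open>What is needed to evaluate terms in total operations: equal cells and matching unary
  operations. It applies to \<open>alg X\<close> as well as to \<open>str M\<close>, so the domains
  of composition and bridges are computed once for both directions of the correspondence.\<close>

locale rep =
  fixes M :: "(nat, nat, 'u) partial_algebra" and X :: "'u weak_omega_category"
  assumes car: "\<And>k i. carrier M (srt k i) = cell (mg k X) i"
    and int_src: "\<And>k i x. interp M (to_nat (Src k i)) [x] =
      (if x \<in> cell (mg k X) (Suc i) then Some (src (mg k X) i x) else None)"
    and int_tgt: "\<And>k i x. interp M (to_nat (Tgt k i)) [x] =
      (if x \<in> cell (mg k X) (Suc i) then Some (tgt (mg k X) i x) else None)"
    and int_idt: "\<And>k i x. interp M (to_nat (Idt k i)) [x] =
      (if x \<in> cell (mg k X) i then Some (idt (mg k X) i x) else None)"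
    and int_proj: "\<And>k i x. k \<noteq> Mid \<Longrightarrow> interp M (to_nat (Proj k i)) [x] =
      (if x \<in> cell (mg Mid X) i then Some (pj k X i x) else None)"
    and int_rho: "\<And>i x. interp M (to_nat (Rho i)) [x] =
      (if x \<in> cell (mg Und X) i then Some (rho X i x) else None)"
    and mem: "\<And>k i a. a \<in> cell (mg k X) (Suc i) \<Longrightarrow> src (mg k X) i a \<in> cell (mg k X) i"
      "\<And>k i a. a \<in> cell (mg k X) (Suc i) \<Longrightarrow> tgt (mg k X) i a \<in> cell (mg k X) i"
      "\<And>k i a. a \<in> cell (mg k X) i \<Longrightarrow> idt (mg k X) i a \<in> cell (mg k X) (Suc i)"
      "\<And>k i a. k \<noteq> Mid \<Longrightarrow> a \<in> cell (mg Mid X) i \<Longrightarrow> pj k X i a \<in> cell (mg k X) i"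
begin

lemma eval_unary: "eval_tm M xs (Op f [t]) = Option.bind (eval_tm M xs t) (\<lambda>y. interp M f [y])"
  by (cases "eval_tm M xs t") auto

lemma eval_binary: "eval_tm M xs (Op f [t, u]) =
    Option.bind (eval_tm M xs t) (\<lambda>y. Option.bind (eval_tm M xs u) (\<lambda>z. interp M f [y, z]))"
  by (cases "eval_tm M xs t"; cases "eval_tm M xs u") auto

lemma eval_iterated:
  "i \<le> j \<Longrightarrow> a \<in> cell (mg k X) j \<Longrightarrow> eval_tm M xs t = Some a \<Longrightarrow>
    eval_tm M xs (srcT k i j t) = Some (src_it (mg k X) i j a) \<and> src_it (mg k X) i j a \<in> cell (mg k X) i"
  "i \<le> j \<Longrightarrow> a \<in> cell (mg k X) j \<Longrightarrow> eval_tm M xs t = Some a \<Longrightarrow>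
    eval_tm M xs (tgtT k i j t) = Some (tgt_it (mg k X) i j a) \<and> tgt_it (mg k X) i j a \<in> cell (mg k X) i"
  "i \<le> j \<Longrightarrow> a \<in> cell (mg k X) i \<Longrightarrow> eval_tm M xs t = Some a \<Longrightarrow>
    eval_tm M xs (idtT k i j t) = Some (idt_it (mg k X) i j a) \<and> idt_it (mg k X) i j a \<in> cell (mg k X) j"
proof (induction j arbitrary: t a)
  case 0
  { case 1 then show ?case by simp }
  { case 2 then show ?case by simp }
  { case 3 then show ?case by simp }
next
  case (Suc j)
  { case 1
    then show ?case using Suc(1)[of "src (mg k X) j a" "op (Src k j) [t]"]
      by (cases "i = Suc j") (auto simp: eval_unary int_src mem simp del: eval_tm.simps(2)) }
  { case 2
    then show ?case using Suc(2)[of "tgt (mg k X) j a" "op (Tgt k j) [t]"]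
      by (cases "i = Suc j") (auto simp: eval_unary int_tgt mem simp del: eval_tm.simps(2)) }
  { case 3
    then show ?case using Suc(3)[of a t]
      by (cases "i = Suc j") (auto simp: eval_unary int_idt mem simp del: eval_tm.simps(2)) }
qed

lemma dom_Comp:
  assumes "i < j" "a \<in> cell (mg k X) j" "b \<in> cell (mg k X) j"
  shows "(\<forall>(t, u)\<in>sym_dom (Comp k i j). eval_tm M [a, b] t = eval_tm M [a, b] u) \<longleftrightarrow>
    (a, b) \<in> composable (mg k X) i j"
  using eval_iterated(2)[of i j a k "[a, b]" v0] eval_iterated(1)[of i j b k "[a, b]" v1] assms
  by (simp add: composable_def)

lemma dom_Bridge:
  assumes "a \<in> cell (mg Mid X) i" "b \<in> cell (mg Mid X) i"
  shows "(\<forall>(t, u)\<in>sym_dom (Bridge i). eval_tm M [a, b] t = eval_tm M [a, b] u) \<longleftrightarrow>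
    parallel (middle X) i a b \<and> kappa X i a = kappa X i b"
  using assms int_proj[of Str i] int_src[of Mid] int_tgt[of Mid]
  by (cases i) (auto simp: parallel_def eval_unary simp del: eval_tm.simps(2))

end

subsection \<open>Iterated faces and composability\<close>

text \<open>As \<open>i < j\<close>, the iterated face begins with a further face in dimension
  \<open>j - 1\<close>, where globularity makes the source and target of \<open>a\<close>
  indistinguishable.\<close>

lemma globular_faces:
  assumes "is_globular_set Z" "i < j" "a \<in> cell Z (Suc j)"
  shows "src_it Z i j (src Z j a) = src_it Z i j (tgt Z j a)" "tgt_it Z i j (src Z j a) = tgt_it Z i j (tgt Z j a)"
proof -
  obtain m where j: "j = Suc m" "i \<le> m" using assms(2) by (cases j) auto
  then show "src_it Z i j (src Z j a) = src_it Z i j (tgt Z j a)" "tgt_it Z i j (src Z j a) = tgt_it Z i j (tgt Z j a)"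
    using assms(1,3) unfolding is_globular_set_def by simp_all
qed

lemma globular_mem:
  assumes "is_globular_set Z"
  shows "a \<in> cell Z (Suc i) \<Longrightarrow> src Z i a \<in> cell Z i" "a \<in> cell Z (Suc i) \<Longrightarrow> tgt Z i a \<in> cell Z i"
  using assms PiE_mem[of "src Z i"] PiE_mem[of "tgt Z i"] unfolding is_globular_set_def by blast+

text \<open>This makes the right sides of the laws \<open>src_comp'\<close> and
  \<open>tgt_comp'\<close> defined whenever the left sides are.\<close>

lemma composable_faces:
  assumes "is_globular_set Z" "i < j" "(a, b) \<in> composable Z i (Suc j)"
  shows "(src Z j a, src Z j b) \<in> composable Z i j" "(tgt Z j a, tgt Z j b) \<in> composable Z i j"
  using assms globular_faces[OF assms(1,2)] globular_mem[OF assms(1)] by (auto simp: composable_def)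

lemma graph_idt:
  assumes "is_omega_graph Z" "a \<in> cell Z i"
  shows "idt Z i a \<in> cell Z (Suc i)" "src Z i (idt Z i a) = a" "tgt Z i (idt Z i a) = a"
  using assms PiE_mem[of "idt Z i"] unfolding is_omega_graph_def by blast+

lemma composable_idt:
  assumes "is_omega_graph Z" "i < j" "(a, b) \<in> composable Z i j"
  shows "(idt Z j a, idt Z j b) \<in> composable Z i (Suc j)"
  using assms graph_idt[OF assms(1)] by (auto simp: composable_def)

lemma idt_it:
  assumes "is_omega_graph Z" "a \<in> cell Z i" "i \<le> j"
  shows "idt_it Z i j a \<in> cell Z j \<and> src_it Z i j (idt_it Z i j a) = a \<and> tgt_it Z i j (idt_it Z i j a) = a"
  using assms(3)
proof (induction j)
  case 0
  then show ?case using assms(2) by simp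
next
  case (Suc j)
  show ?case
  proof (cases "i = Suc j")
    case True
    then show ?thesis using assms(2) by simp
  next
    case False
    then show ?thesis using Suc graph_idt[OF assms(1)] by simp
  qed
qed

lemma it_mem:
  assumes "is_globular_set Z" "a \<in> cell Z j" "i \<le> j"
  shows "src_it Z i j a \<in> cell Z i" "tgt_it Z i j a \<in> cell Z i"
proof -
  have "src_it Z i j a \<in> cell Z i \<and> tgt_it Z i j a \<in> cell Z i"
    using assms(2,3)
  proof (induction j arbitrary: a)
    case (Suc j)
    then show ?case using globular_mem[OF assms(1)] by (cases "i = Suc j") auto
  qed simp
  then show "src_it Z i j a \<in> cell Z i" "tgt_it Z i j a \<in> cell Z i" by simp_all
qed

lemma composable_unit:
  assumes "is_omega_graph Z" "a \<in> cell Z j" "i < j"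
  shows "(idt_it Z i j (src_it Z i j a), a) \<in> composable Z i j" "(a, idt_it Z i j (tgt_it Z i j a)) \<in> composable Z i j"
proof -
  have "is_globular_set Z" using assms(1) unfolding is_omega_graph_def by blast
  note m = it_mem[OF this assms(2) less_imp_le[OF assms(3)]]
  show "(idt_it Z i j (src_it Z i j a), a) \<in> composable Z i j" "(a, idt_it Z i j (tgt_it Z i j a)) \<in> composable Z i j"
    using idt_it[OF assms(1) m(1) less_imp_le[OF assms(3)]] idt_it[OF assms(1) m(2) less_imp_le[OF assms(3)]] assms(2)
    by (simp_all add: composable_def)
qed

lemma morphism_it:
  assumes F: "\<And>i a. a \<in> cell X (Suc i) \<Longrightarrow> F i (src X i a) = src Y i (F (Suc i) a)"
    "\<And>i a. a \<in> cell X (Suc i) \<Longrightarrow> F i (tgt X i a) = tgt Y i (F (Suc i) a)"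
    and X: "is_globular_set X"
  shows "a \<in> cell X j \<Longrightarrow> i \<le> j \<Longrightarrow>
    F i (src_it X i j a) = src_it Y i j (F j a) \<and> F i (tgt_it X i j a) = tgt_it Y i j (F j a)"
proof (induction j arbitrary: a)
  case (Suc j)
  then show ?case using F globular_mem[OF X] by (cases "i = Suc j") auto
qed simp

lemma morphism_composable:
  assumes "globular_morphism X Y F" "is_globular_set X" "(a, b) \<in> composable X i j" "i < j"
  shows "(F j a, F j b) \<in> composable Y i j"
proof -
  note F = assms(1)[unfolded globular_morphism_def]
  have ab: "a \<in> cell X j" "b \<in> cell X j" "tgt_it X i j a = src_it X i j b" using assms(3) by (auto simp: composable_def)
  have it: "a \<in> cell X j \<Longrightarrow>
      F i (src_it X i j a) = src_it Y i j (F j a) \<and> F i (tgt_it X i j a) = tgt_it Y i j (F j a)" for a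
    by (rule morphism_it) (use F assms in auto)
  have "F j a \<in> cell Y j" "F j b \<in> cell Y j" using F ab(1,2) by (blast intro: PiE_mem)+
  then show ?thesis using it[OF ab(1)] it[OF ab(2)] ab(3) by (auto simp: composable_def)
qed


subsection \<open>The partial algebra of a weak omega category\<close>

fun alg_op :: "'u weak_omega_category \<Rightarrow> sym \<Rightarrow> 'u list \<Rightarrow> 'u option" where
  "alg_op X (Src k i) [x] = (if x \<in> cell (mg k X) (Suc i) then Some (src (mg k X) i x) else None)"
| "alg_op X (Tgt k i) [x] = (if x \<in> cell (mg k X) (Suc i) then Some (tgt (mg k X) i x) else None)"
| "alg_op X (Idt k i) [x] = (if x \<in> cell (mg k X) i then Some (idt (mg k X) i x) else None)"
| "alg_op X (Comp k i j) [x, y] =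
    (if i < j \<and> (x, y) \<in> composable (mg k X) i j then Some (cmp (mg k X) i j (x, y)) else None)"
| "alg_op X (Proj k i) [x] = (if k \<noteq> Mid \<and> x \<in> cell (mg Mid X) i then Some (pj k X i x) else None)"
| "alg_op X (Rho i) [x] = (if x \<in> cell (mg Und X) i then Some (rho X i x) else None)"
| "alg_op X (Bridge i) [x, y] =
    (if \<exists>z. (x, y, z) \<in> bridges X i then Some (THE z. (x, y, z) \<in> bridges X i) else None)"
| "alg_op X _ _ = None"

text \<open>\<open>from_nat\<close> is arbitrary off the range of \<open>to_nat\<close>; the range
  test keeps numbers that code no symbol uninterpreted.\<close>

definition alg :: "'u weak_omega_category \<Rightarrow> (nat, nat, 'u) partial_algebra" where
  "alg X = \<lparr>carrier = (\<lambda>s. cell (mg (srt_mag s) X) (srt_dim s)),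
     interp = (\<lambda>n xs. if n \<in> range (to_nat :: sym \<Rightarrow> nat) then alg_op X (from_nat n) xs else None)\<rparr>"

lemma alg_simps [simp]:
  "carrier (alg X) s = cell (mg (srt_mag s) X) (srt_dim s)" "interp (alg X) (to_nat f) xs = alg_op X f xs"
  by (simp_all add: alg_def)

lemma tuples_iff:
  "xs \<in> tuples M [] \<longleftrightarrow> xs = []"
  "xs \<in> tuples M (s # \<Gamma>) \<longleftrightarrow> (\<exists>a as. xs = a # as \<and> a \<in> carrier M s \<and> as \<in> tuples M \<Gamma>)"
  by (auto simp: tuples_def list_all2_Cons2)

context raw
begin

lemma alg_Bridge: "alg_op X (Bridge i) [a, b] = Some c \<longleftrightarrow> (a, b, c) \<in> bridges X i"
proof
  assume "alg_op X (Bridge i) [a, b] = Some c"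
  then obtain z where "(a, b, z) \<in> bridges X i" "c = (THE z. (a, b, z) \<in> bridges X i)" by (auto split: if_splits)
  moreover from this have "(THE z. (a, b, z) \<in> bridges X i) = z" by (blast intro: bridge_unique)
  ultimately show "(a, b, c) \<in> bridges X i" by simp
next
  assume "(a, b, c) \<in> bridges X i"
  then show "alg_op X (Bridge i) [a, b] = Some c" using bridge_unique by (auto intro!: the_equality)
qed

lemma bridge_src_cell: "(a, b, c) \<in> bridges X i \<Longrightarrow> a \<in> cell (middle X) i \<and> b \<in> cell (middle X) i"
  using bridge_ex[of a b i] by (auto simp: parallel_def)

sublocale rep "alg X" X
  by unfold_locales (simp_all add: raw_mem del: mg.simps)

lemma alg_op_Some:
  assumes "alg_op X f xs = Some y"
  shows "sym_ok f \<and> xs \<in> tuples (alg X) (sym_arity f) \<and> y \<in> carrier (alg X) (sym_result f)"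
proof (cases "\<exists>i. f = Bridge i")
  case True
  then obtain i where f: "f = Bridge i" by blast
  then obtain a b where xs: "xs = [a, b]" using assms by (cases "(X, f, xs)" rule: alg_op.cases) auto
  have "(a, b, y) \<in> bridges X i" using assms unfolding f xs alg_Bridge .
  then show ?thesis using bridge_cell bridge_src_cell
    unfolding f xs by (auto simp: tuples_iff simp del: srt.simps)
next
  case False
  then show ?thesis using assms
    by (cases "(X, f, xs)" rule: alg_op.cases)
      (auto simp: tuples_iff composable_def raw_mem simp del: srt.simps mg.simps split: if_splits)
qed

lemma alg_defined:
  assumes "sym_ok f" "xs \<in> tuples (alg X) (sym_arity f)"
  shows "alg_op X f xs \<noteq> None \<longleftrightarrow> sym_total f \<or> (\<forall>(t, u)\<in>sym_dom f. eval_tm (alg X) xs t = eval_tm (alg X) xs u)"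
proof (cases f)
  case (Comp k i j)
  then obtain a b where xs: "xs = [a, b]" "a \<in> cell (mg k X) j" "b \<in> cell (mg k X) j"
    using assms(2) by (auto simp: tuples_iff simp del: srt.simps)
  show ?thesis using dom_Comp[of i j a k b] assms(1) xs unfolding Comp xs(1) by (simp del: sym_dom.simps)
next
  case (Bridge i)
  then obtain a b where xs: "xs = [a, b]" "a \<in> cell (mg Mid X) i" "b \<in> cell (mg Mid X) i"
    using assms(2) by (auto simp: tuples_iff simp del: srt.simps)
  show ?thesis using dom_Bridge[of a i b] bridge_ex xs unfolding Bridge xs(1) by (simp del: sym_dom.simps)
qed (use assms in \<open>auto simp: tuples_iff simp del: srt.simps\<close>)

text \<open>For raw data the typing and definedness conditions of a model hold by construction, so
  only the laws are left.\<close>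

lemma alg_model_iff:
  "is_model omega_theory (alg X) \<longleftrightarrow> (\<forall>\<Gamma> t u. law \<Gamma> t u \<longrightarrow> (\<forall>xs\<in>tuples (alg X) \<Gamma>.
     eval_tm (alg X) xs t \<noteq> None \<longrightarrow> eval_tm (alg X) xs u \<noteq> None \<longrightarrow> eval_tm (alg X) xs t = eval_tm (alg X) xs u))"
    (is "_ \<longleftrightarrow> ?L")
proof -
  have 1: "f \<in> ops omega_theory \<and> xs \<in> tuples (alg X) (arity omega_theory f) \<and>
      y \<in> carrier (alg X) (result omega_theory f)" if y: "interp (alg X) f xs = Some y" for f xs y
  proof -
    obtain g :: sym where g: "f = to_nat g" using y by (auto simp: alg_def split: if_splits)
    show ?thesis using alg_op_Some[of g xs y] y unfolding g by (simp del: alg_simps(1))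
  qed
  have 2: "interp (alg X) f xs \<noteq> None" if f: "f \<in> total_ops omega_theory" "xs \<in> tuples (alg X) (arity omega_theory f)" for f xs
  proof -
    obtain g where g: "f = to_nat g" "sym_ok g" "sym_total g" using f(1) by (auto simp: omega_theory_def)
    show ?thesis using alg_defined[OF g(2), of xs] f g by simp
  qed
  have 3: "interp (alg X) f xs \<noteq> None \<longleftrightarrow>
      (\<forall>(t, u)\<in>dom_eqs omega_theory f. eval_tm (alg X) xs t = eval_tm (alg X) xs u)"
    if f: "f \<in> ops omega_theory - total_ops omega_theory" "xs \<in> tuples (alg X) (arity omega_theory f)" for f xs
  proof -
    obtain g where g: "f = to_nat g" "sym_ok g" using f(1) by (auto simp: theory_ops)
    then have "\<not> sym_total g" using f(1) by simp
    then show ?thesis using alg_defined[OF g(2), of xs] f(2) unfolding g(1) theory_simps alg_simps by blast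
  qed
  have "(\<forall>(\<Gamma>, t, u)\<in>axioms omega_theory. \<forall>xs\<in>tuples (alg X) \<Gamma>.
     eval_tm (alg X) xs t \<noteq> None \<longrightarrow> eval_tm (alg X) xs u \<noteq> None \<longrightarrow> eval_tm (alg X) xs t = eval_tm (alg X) xs u) \<longleftrightarrow> ?L"
    by (simp add: omega_theory_def)
  then show ?thesis unfolding is_model_def using 1 2 3 by simp
qed

text \<open>\<open>evals\<close> computes terms one operation at a time; \<open>no_eval\<close>
  collects the unfoldings that would destroy the uniform shapes \<open>srt k i\<close> and
  \<open>mg k X\<close>.\<close>

lemmas evals = eval_unary eval_binary int_src int_tgt int_idt int_proj int_rho
lemmas no_eval = eval_tm.simps(2) srt.simps mg.simps

end

section \<open>From the laws to the definition of a weak omega category\<close>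

locale lawful = raw X for X :: "'u weak_omega_category" +
  assumes model: "is_model omega_theory (alg X)"
begin

text \<open>Each clause of the definition becomes one instance of a law, the work being to show that
  both sides have values.\<close>

lemma sat:
  assumes "law \<Gamma> t u" "xs \<in> tuples (alg X) \<Gamma>" "eval_tm (alg X) xs t = Some x" "eval_tm (alg X) xs u = Some y"
  shows "x = y"
  using model assms unfolding alg_model_iff by fastforce

lemma glob: "is_globular_set (mg k X)"
  unfolding is_globular_set_def
proof (intro conjI allI ballI)
  fix i a assume a: "a \<in> cell (mg k X) (Suc (Suc i))"
  show "src (mg k X) i (src (mg k X) (Suc i) a) = src (mg k X) i (tgt (mg k X) (Suc i) a)"
    by (rule sat[OF law.src_glob[of k i], of "[a]"]) (use a in \<open>simp_all add: tuples_iff evals mem del: no_eval\<close>)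
  show "tgt (mg k X) i (src (mg k X) (Suc i) a) = tgt (mg k X) i (tgt (mg k X) (Suc i) a)"
    by (rule sat[OF law.tgt_glob[of k i], of "[a]"]) (use a in \<open>simp_all add: tuples_iff evals mem del: no_eval\<close>)
qed (rule src_PiE tgt_PiE)+

lemma graph: "is_omega_graph (mg k X)"
  unfolding is_omega_graph_def
proof (intro conjI allI ballI)
  fix i a assume a: "a \<in> cell (mg k X) i"
  show "src (mg k X) i (idt (mg k X) i a) = a"
    by (rule sat[OF law.src_idt[of k i], of "[a]"]) (use a in \<open>simp_all add: tuples_iff evals mem del: no_eval\<close>)
  show "tgt (mg k X) i (idt (mg k X) i a) = a"
    by (rule sat[OF law.tgt_idt[of k i], of "[a]"]) (use a in \<open>simp_all add: tuples_iff evals mem del: no_eval\<close>)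
qed (rule glob idt_PiE)+

lemma composableD: "(a, b) \<in> composable Z i j \<Longrightarrow> a \<in> cell Z j \<and> b \<in> cell Z j"
  by (simp add: composable_def)

text \<open>For faces of codimension above one, the composite of the faces must exist before the law
  applies; this rests on globularity, established beforehand.\<close>

lemma magma: "is_omega_magma (mg k X)"
  unfolding is_omega_magma_def
proof (intro conjI allI impI ballI; (clarify, (intro conjI)?)?)
  fix i a b assume ab: "(a, b) \<in> composable (mg k X) i (Suc i)"
  show "src (mg k X) i (cmp (mg k X) i (Suc i) (a, b)) = src (mg k X) i a"
    by (rule sat[OF law.src_comp[of k i], of "[a, b]"])
      (use ab composableD[OF ab] in \<open>simp_all add: tuples_iff evals mem raw_mem del: no_eval\<close>)
  show "tgt (mg k X) i (cmp (mg k X) i (Suc i) (a, b)) = tgt (mg k X) i b"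
    by (rule sat[OF law.tgt_comp[of k i], of "[a, b]"])
      (use ab composableD[OF ab] in \<open>simp_all add: tuples_iff evals mem raw_mem del: no_eval\<close>)
next
  fix i j a b assume ij: "i < j" and ab: "(a, b) \<in> composable (mg k X) i (Suc j)"
  note f = composable_faces[OF glob ij ab]
  show "src (mg k X) j (cmp (mg k X) i (Suc j) (a, b)) = cmp (mg k X) i j (src (mg k X) j a, src (mg k X) j b)"
    by (rule sat[OF law.src_comp'[OF ij, of k], of "[a, b]"])
      (use ij ab f composableD[OF ab] in \<open>simp_all add: tuples_iff evals mem raw_mem del: no_eval\<close>)
  show "tgt (mg k X) j (cmp (mg k X) i (Suc j) (a, b)) = cmp (mg k X) i j (tgt (mg k X) j a, tgt (mg k X) j b)"
    by (rule sat[OF law.tgt_comp'[OF ij, of k], of "[a, b]"])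
      (use ij ab f composableD[OF ab] in \<open>simp_all add: tuples_iff evals mem raw_mem del: no_eval\<close>)
qed (use graph cmp_PiE cmp_undefined in auto)

lemma strict: "is_strict_omega_category (mg Str X)"
  unfolding is_strict_omega_category_def
proof (intro conjI allI impI ballI; (clarify, (intro conjI)?)?)
  show "is_omega_magma (mg Str X)" by (rule magma)
next
  fix i j a b c
  assume c: "i < j" "(a, b) \<in> composable (mg Str X) i j" "(cmp (mg Str X) i j (a, b), c) \<in> composable (mg Str X) i j"
    "(b, c) \<in> composable (mg Str X) i j" "(a, cmp (mg Str X) i j (b, c)) \<in> composable (mg Str X) i j"
  show "cmp (mg Str X) i j (cmp (mg Str X) i j (a, b), c) = cmp (mg Str X) i j (a, cmp (mg Str X) i j (b, c))"
    by (rule sat[OF law.assoc[OF c(1)], of "[a, b, c]"])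
      (use c composableD[OF c(2)] composableD[OF c(4)] in \<open>simp_all add: tuples_iff evals del: no_eval\<close>)
next
  fix i j k a b c d
  assume c: "i < j" "j < k" "(a, b) \<in> composable (mg Str X) j k" "(c, d) \<in> composable (mg Str X) j k"
    "(cmp (mg Str X) j k (a, b), cmp (mg Str X) j k (c, d)) \<in> composable (mg Str X) i k"
    "(a, c) \<in> composable (mg Str X) i k" "(b, d) \<in> composable (mg Str X) i k"
    "(cmp (mg Str X) i k (a, c), cmp (mg Str X) i k (b, d)) \<in> composable (mg Str X) j k"
  show "cmp (mg Str X) i k (cmp (mg Str X) j k (a, b), cmp (mg Str X) j k (c, d)) =
      cmp (mg Str X) j k (cmp (mg Str X) i k (a, c), cmp (mg Str X) i k (b, d))"
    by (rule sat[OF law.interchange[OF c(1,2)], of "[a, b, c, d]"])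
      (use c less_trans[OF c(1,2)] composableD[OF c(3)] composableD[OF c(4)] in
        \<open>simp_all add: tuples_iff evals del: no_eval\<close>)
next
  fix i j a assume ij: "i < j" and a: "a \<in> cell (mg Str X) j"
  note le = less_imp_le[OF ij]
  note u = composable_unit[OF graph a ij]
  have s: "eval_tm (alg X) [a] (idtT Str i j (srcT Str i j v0)) = Some (idt_it (mg Str X) i j (src_it (mg Str X) i j a))"
    using eval_iterated(1)[OF le a, of "[a]" v0] eval_iterated(3)[OF le, of _ Str "[a]"] by simp
  have t: "eval_tm (alg X) [a] (idtT Str i j (tgtT Str i j v0)) = Some (idt_it (mg Str X) i j (tgt_it (mg Str X) i j a))"
    using eval_iterated(2)[OF le a, of "[a]" v0] eval_iterated(3)[OF le, of _ Str "[a]"] by simp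
  show "cmp (mg Str X) i j (idt_it (mg Str X) i j (src_it (mg Str X) i j a), a) = a"
    by (rule sat[OF law.unit_left[OF ij], of "[a]"])
      (use ij a u in \<open>simp_all add: tuples_iff evals s del: no_eval\<close>)
  show "cmp (mg Str X) i j (a, idt_it (mg Str X) i j (tgt_it (mg Str X) i j a)) = a"
    by (rule sat[OF law.unit_right[OF ij], of "[a]"])
      (use ij a u in \<open>simp_all add: tuples_iff evals t del: no_eval\<close>)
next
  fix i j a b assume ij: "i < j" and ab: "(a, b) \<in> composable (mg Str X) i j"
  show "cmp (mg Str X) i (Suc j) (idt (mg Str X) j a, idt (mg Str X) j b) = idt (mg Str X) j (cmp (mg Str X) i j (a, b))"
    by (rule sat[OF law.idt_comp[OF ij], of "[a, b]"])
      (use ij ab composable_idt[OF graph ij ab] composableD[OF ab] in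
        \<open>simp_all add: tuples_iff evals mem raw_mem del: no_eval\<close>)
qed

text \<open>The globular part comes first: it makes images of composable cells composable, without
  which the law on composites would say nothing.\<close>

lemma proj:
  assumes k: "k \<noteq> Mid" shows "omega_magma_morphism (mg Mid X) (mg k X) (pj k X)"
proof -
  have g: "globular_morphism (mg Mid X) (mg k X) (pj k X)"
    unfolding globular_morphism_def
  proof (intro conjI allI ballI)
    show "pj k X i \<in> cell (mg Mid X) i \<rightarrow>\<^sub>E cell (mg k X) i" for i using pj_PiE[OF k] by simp
    fix i a assume a: "a \<in> cell (mg Mid X) (Suc i)"
    show "pj k X i (src (mg Mid X) i a) = src (mg k X) i (pj k X (Suc i) a)"
      by (rule sat[OF law.proj_src[OF k, of i], of "[a]"])
        (use a k in \<open>simp_all add: tuples_iff evals mem del: no_eval\<close>)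
    show "pj k X i (tgt (mg Mid X) i a) = tgt (mg k X) i (pj k X (Suc i) a)"
      by (rule sat[OF law.proj_tgt[OF k, of i], of "[a]"])
        (use a k in \<open>simp_all add: tuples_iff evals mem del: no_eval\<close>)
  qed
  show ?thesis
    unfolding omega_magma_morphism_def omega_graph_morphism_def
  proof (intro conjI allI impI ballI g; (clarify)?)
    fix i a assume a: "a \<in> cell (mg Mid X) i"
    show "pj k X (Suc i) (idt (mg Mid X) i a) = idt (mg k X) i (pj k X i a)"
      by (rule sat[OF law.proj_idt[OF k, of i], of "[a]"])
        (use a k in \<open>simp_all add: tuples_iff evals mem del: no_eval\<close>)
  next
    fix i j a b assume ij: "i < j" and ab: "(a, b) \<in> composable (mg Mid X) i j"
    show "pj k X j (cmp (mg Mid X) i j (a, b)) = cmp (mg k X) i j (pj k X j a, pj k X j b)"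
      by (rule sat[OF law.proj_comp[OF k ij], of "[a, b]"])
        (use ij ab k composableD[OF ab] morphism_composable[OF g glob ab ij] in
          \<open>simp_all add: tuples_iff evals mem raw_mem del: no_eval\<close>)
  qed
qed

lemma rho_morphism: "omega_graph_morphism (mg Und X) (mg Mid X) (rho X)"
  unfolding omega_graph_morphism_def globular_morphism_def
proof (intro conjI allI ballI)
  show "rho X i \<in> cell (mg Und X) i \<rightarrow>\<^sub>E cell (mg Mid X) i" for i using rho_PiE by simp
  fix i a assume a: "a \<in> cell (mg Und X) (Suc i)"
  show "rho X i (src (mg Und X) i a) = src (mg Mid X) i (rho X (Suc i) a)"
    by (rule sat[OF law.rho_src[of i], of "[a]"]) (use a in \<open>simp_all add: tuples_iff evals raw_mem del: no_eval\<close>)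
  show "rho X i (tgt (mg Und X) i a) = tgt (mg Mid X) i (rho X (Suc i) a)"
    by (rule sat[OF law.rho_tgt[of i], of "[a]"]) (use a in \<open>simp_all add: tuples_iff evals raw_mem del: no_eval\<close>)
next
  fix i a assume a: "a \<in> cell (mg Und X) i"
  show "rho X (Suc i) (idt (mg Und X) i a) = idt (mg Mid X) i (rho X i a)"
    by (rule sat[OF law.rho_idt[of i], of "[a]"]) (use a in \<open>simp_all add: tuples_iff evals raw_mem del: no_eval\<close>)
qed

lemma lam_rho: "a \<in> cell (mg Und X) i \<Longrightarrow> pj Und X i (rho X i a) = a"
  by (rule sat[OF law.lam_rho[of i], of "[a]"]) (simp_all add: tuples_iff evals raw_mem del: no_eval pj.simps)

lemma bridge_laws:
  assumes R: "(a, b, c) \<in> bridges X i"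
  shows "src (mg Mid X) i c = a" "tgt (mg Mid X) i c = b" "pj Str X (Suc i) c = idt (mg Str X) i (pj Str X i a)"
proof -
  have ab: "a \<in> cell (mg Mid X) i" "b \<in> cell (mg Mid X) i" "c \<in> cell (mg Mid X) (Suc i)"
    using bridge_src_cell[OF R] bridge_cell[OF R] by simp_all
  note B = R[folded alg_Bridge]
  show "src (mg Mid X) i c = a"
    by (rule sat[OF law.bridge_src[of i], of "[a, b]"])
      (use ab B in \<open>simp_all add: tuples_iff evals del: no_eval alg_op.simps(7)\<close>)
  show "tgt (mg Mid X) i c = b"
    by (rule sat[OF law.bridge_tgt[of i], of "[a, b]"])
      (use ab B in \<open>simp_all add: tuples_iff evals del: no_eval alg_op.simps(7)\<close>)
  show "pj Str X (Suc i) c = idt (mg Str X) i (pj Str X i a)"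
    by (rule sat[OF law.bridge_kappa[of i], of "[a, b]"])
      (use ab B in \<open>simp_all add: tuples_iff evals mem del: no_eval alg_op.simps(7) pj.simps\<close>)
qed

text \<open>The pair \<open>(a, a)\<close> is in the domain of the bridge operation, so it has some
  bridge, which the law identifies as the identity.\<close>

lemma bridge_idt:
  assumes a: "a \<in> cell (mg Mid X) i" shows "(a, a, idt (mg Mid X) i a) \<in> bridges X i"
proof -
  have "parallel (middle X) i a a" using a by (simp add: parallel_def)
  then obtain c where c: "(a, a, c) \<in> bridges X i" using bridge_ex by blast
  have "c = idt (mg Mid X) i a"
    by (rule sat[OF law.bridge_idt[of i], of "[a]"])
      (use a c[folded alg_Bridge] in \<open>simp_all add: tuples_iff evals mem del: no_eval alg_op.simps(7)\<close>)
  then show ?thesis using c by simp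
qed

lemma weak: "is_weak_omega_category X"
proof -
  have br: "bridge_relation (middle X) (bridges X)"
    unfolding bridge_relation_def
    using bridge_src_cell bridge_cell bridge_ex bridge_laws bridge_idt bridge_unique
    by (auto simp del: pj.simps)
  have kap: "omega_magma_morphism (middle X) (strictified X) (kappa X)" using proj[of Str] by simp
  have kap_cell: "a \<in> cell (middle X) i \<Longrightarrow> kappa X i a \<in> cell (strictified X) i" for i a
    using mem(4)[of Str a i] by simp
  have bk: "kappa X i a = kappa X i b" "kappa X (Suc i) c = idt (strictified X) i (kappa X i a)"
    if "(a, b, c) \<in> bridges X i" for i a b c
    using bridge_laws(3)[OF that] that bridge_ex[of a b i] by auto
  \<comment> \<open>The domain condition gives equal images of \<open>a\<close> and
    \<open>b\<close>, and the law on \<open>\<kappa>\<close> sends the bridge to their identity: the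
    image triple is diagonal.\<close>
  have "(kappa X i a, kappa X i b, kappa X (Suc i) c) \<in> diagonal_bridge (strictified X) i"
    if "(a, b, c) \<in> bridges X i" for i a b c
    using bk[OF that] bridge_src_cell[OF that] kap_cell unfolding diagonal_bridge_def by auto
  then have "bridge_morphism (middle X) (bridges X) (strictified X) (diagonal_bridge (strictified X)) (kappa X)"
    unfolding bridge_morphism_def using kap by blast
  then have "categorical_Penon_morphism (middle X) (bridges X) (strictified X) (diagonal_bridge (strictified X)) (kappa X)"
    unfolding categorical_Penon_morphism_def using magma[of Mid] strict br bk bridge_ex by simp
  then show ?thesis
    unfolding is_weak_omega_category_def
    using magma[of Und] magma[of Mid] proj[of Und] rho_morphism lam_rho br strict by simp
qed

end

section \<open>From a weak omega category to the laws\<close>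

lemma weakD:
  assumes "is_weak_omega_category X"
  shows "is_omega_magma (mg k X)" "is_strict_omega_category (mg Str X)"
    "k \<noteq> Mid \<Longrightarrow> omega_magma_morphism (mg Mid X) (mg k X) (pj k X)"
    "omega_graph_morphism (mg Und X) (mg Mid X) (rho X)"
    "a \<in> cell (mg Und X) i \<Longrightarrow> pj Und X i (rho X i a) = a"
    "bridge_relation (mg Mid X) (bridges X)"
    "(a, b, c) \<in> bridges X i \<Longrightarrow> kappa X i a = kappa X i b \<and> kappa X (Suc i) c = idt (mg Str X) i (kappa X i a)"
    "parallel (middle X) i a b \<Longrightarrow> kappa X i a = kappa X i b \<Longrightarrow> \<exists>c. (a, b, c) \<in> bridges X i"
proof -
  have 1: "is_omega_magma (underlying X)" "is_omega_magma (middle X)"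
    "omega_magma_morphism (middle X) (underlying X) (lam X)" "omega_graph_morphism (underlying X) (middle X) (rho X)"
    "\<forall>i. \<forall>a\<in>cell (underlying X) i. lam X i (rho X i a) = a" "bridge_relation (middle X) (bridges X)"
    "is_strict_omega_category (strictified X)"
    and P: "categorical_Penon_morphism (middle X) (bridges X) (strictified X) (diagonal_bridge (strictified X)) (kappa X)"
    using assms unfolding is_weak_omega_category_def by simp_all
  have 2: "omega_magma_morphism (middle X) (strictified X) (kappa X)"
    "\<forall>i a b c. (a, b, c) \<in> bridges X i \<longrightarrow> kappa X i a = kappa X i b \<and> kappa X (Suc i) c = idt (strictified X) i (kappa X i a)"
    "\<forall>i a b. parallel (middle X) i a b \<longrightarrow> kappa X i a = kappa X i b \<longrightarrow> (\<exists>c. (a, b, c) \<in> bridges X i)"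
    using P unfolding categorical_Penon_morphism_def bridge_morphism_def by simp_all
  show "is_omega_magma (mg k X)" using 1 by (cases k) (simp_all add: is_strict_omega_category_def)
  show "omega_magma_morphism (mg Mid X) (mg k X) (pj k X)" if "k \<noteq> Mid" using 1 2 that by (cases k) simp_all
  show "is_strict_omega_category (mg Str X)" "omega_graph_morphism (mg Und X) (mg Mid X) (rho X)"
    "a \<in> cell (mg Und X) i \<Longrightarrow> pj Und X i (rho X i a) = a" "bridge_relation (mg Mid X) (bridges X)"
    using 1 by simp_all
  show "(a, b, c) \<in> bridges X i \<Longrightarrow> kappa X i a = kappa X i b \<and> kappa X (Suc i) c = idt (mg Str X) i (kappa X i a)"
    using 2(2) by simp
  show "parallel (middle X) i a b \<Longrightarrow> kappa X i a = kappa X i b \<Longrightarrow> \<exists>c. (a, b, c) \<in> bridges X i"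
    using 2(3) by simp
qed

lemma weak_raw:
  assumes W: "is_weak_omega_category X" shows "raw X"
proof
  fix k i
  have m: "is_omega_magma (mg k X)" by (rule weakD(1)[OF W])
  then have g: "is_omega_graph (mg k X)" unfolding is_omega_magma_def by (elim conjE)
  then have gl: "is_globular_set (mg k X)" unfolding is_omega_graph_def by (elim conjE)
  show "src (mg k X) i \<in> cell (mg k X) (Suc i) \<rightarrow>\<^sub>E cell (mg k X) i"
    "tgt (mg k X) i \<in> cell (mg k X) (Suc i) \<rightarrow>\<^sub>E cell (mg k X) i"
    using gl unfolding is_globular_set_def by simp_all
  show "idt (mg k X) i \<in> cell (mg k X) i \<rightarrow>\<^sub>E cell (mg k X) (Suc i)"
    using g unfolding is_omega_graph_def by simp
  show "i < j \<Longrightarrow> cmp (mg k X) i j \<in> composable (mg k X) i j \<rightarrow>\<^sub>E cell (mg k X) j"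
    "\<not> i < j \<Longrightarrow> cmp (mg k X) i j = (\<lambda>_. undefined)" for j
    using m unfolding is_omega_magma_def by simp_all
  show "k \<noteq> Mid \<Longrightarrow> pj k X i \<in> cell (middle X) i \<rightarrow>\<^sub>E cell (mg k X) i"
    using weakD(3)[OF W, of k]
    by (simp add: omega_magma_morphism_def omega_graph_morphism_def globular_morphism_def)
  show "rho X i \<in> cell (underlying X) i \<rightarrow>\<^sub>E cell (middle X) i"
    using weakD(4)[OF W] by (simp add: omega_graph_morphism_def globular_morphism_def)
next
  fix i a b
  note b = weakD(6)[OF W, unfolded bridge_relation_def mg.simps]
  show "(\<exists>c. (a, b, c) \<in> bridges X i) \<longleftrightarrow> parallel (middle X) i a b \<and> kappa X i a = kappa X i b"
    using b weakD(7)[OF W, of a b _ i] weakD(8)[OF W, of i a b] by blast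
  show "c \<in> cell (middle X) (Suc i)" if "(a, b, c) \<in> bridges X i" for c
    using b that by blast
  show "c = d" if "(a, b, c) \<in> bridges X i" "(a, b, d) \<in> bridges X i" for c d
    using b that by blast
qed

text \<open>Once both sides are known to be defined, each law evaluates to a clause of the
  definition. Units are treated separately because of their iterated terms, interchange because its
  four arguments have to be matched explicitly.\<close>

lemma weak_laws:
  assumes W: "is_weak_omega_category X" shows "is_model omega_theory (alg X)"
proof -
  interpret raw X using W by (rule weak_raw)
  note m = weakD(1)[OF W]
  have g: "is_omega_graph (mg k X)" for k using m unfolding is_omega_magma_def by blast
  have gl: "is_globular_set (mg k X)" for k using g unfolding is_omega_graph_def by blast
  have glob: "src (mg k X) i (src (mg k X) (Suc i) a) = src (mg k X) i (tgt (mg k X) (Suc i) a)"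
    "tgt (mg k X) i (src (mg k X) (Suc i) a) = tgt (mg k X) i (tgt (mg k X) (Suc i) a)"
    if "a \<in> cell (mg k X) (Suc (Suc i))" for k i a
    using gl[of k] that unfolding is_globular_set_def by blast+
  note idts = graph_idt(2,3)[OF g]
  have comps: "src (mg k X) i (cmp (mg k X) i (Suc i) (a, b)) = src (mg k X) i a"
    "tgt (mg k X) i (cmp (mg k X) i (Suc i) (a, b)) = tgt (mg k X) i b"
    if "(a, b) \<in> composable (mg k X) i (Suc i)" for k i a b
    using m[of k] that unfolding is_omega_magma_def by blast+
  have comps': "src (mg k X) j (cmp (mg k X) i (Suc j) (a, b)) = cmp (mg k X) i j (src (mg k X) j a, src (mg k X) j b)"
    "tgt (mg k X) j (cmp (mg k X) i (Suc j) (a, b)) = cmp (mg k X) i j (tgt (mg k X) j a, tgt (mg k X) j b)"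
    if "i < j" "(a, b) \<in> composable (mg k X) i (Suc j)" for k i j a b
    using m[of k] that unfolding is_omega_magma_def by blast+
  note st = weakD(2)[OF W, unfolded is_strict_omega_category_def]
  have assoc: "cmp (mg Str X) i j (cmp (mg Str X) i j (a, b), c) = cmp (mg Str X) i j (a, cmp (mg Str X) i j (b, c))"
    if "i < j" "(a, b) \<in> composable (mg Str X) i j" "(cmp (mg Str X) i j (a, b), c) \<in> composable (mg Str X) i j"
      "(b, c) \<in> composable (mg Str X) i j" "(a, cmp (mg Str X) i j (b, c)) \<in> composable (mg Str X) i j" for i j a b c
    using conjunct1[OF conjunct2[OF st]] that by blast
  have inter: "cmp (mg Str X) i k (cmp (mg Str X) j k (a, b), cmp (mg Str X) j k (c, d)) =
        cmp (mg Str X) j k (cmp (mg Str X) i k (a, c), cmp (mg Str X) i k (b, d))"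
    if "i < j" "j < k" "(a, b) \<in> composable (mg Str X) j k" "(c, d) \<in> composable (mg Str X) j k"
      "(cmp (mg Str X) j k (a, b), cmp (mg Str X) j k (c, d)) \<in> composable (mg Str X) i k"
      "(a, c) \<in> composable (mg Str X) i k" "(b, d) \<in> composable (mg Str X) i k"
      "(cmp (mg Str X) i k (a, c), cmp (mg Str X) i k (b, d)) \<in> composable (mg Str X) j k" for i j k a b c d
    using conjunct1[OF conjunct2[OF conjunct2[OF st]]] that by blast
  have unit: "cmp (mg Str X) i j (idt_it (mg Str X) i j (src_it (mg Str X) i j a), a) = a"
    "cmp (mg Str X) i j (a, idt_it (mg Str X) i j (tgt_it (mg Str X) i j a)) = a"
    if "i < j" "a \<in> cell (mg Str X) j" for i j a
    using conjunct1[OF conjunct2[OF conjunct2[OF conjunct2[OF st]]]] that by blast+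
  have idc: "cmp (mg Str X) i (Suc j) (idt (mg Str X) j a, idt (mg Str X) j b) = idt (mg Str X) j (cmp (mg Str X) i j (a, b))"
    if "i < j" "(a, b) \<in> composable (mg Str X) i j" for i j a b
    using conjunct2[OF conjunct2[OF conjunct2[OF conjunct2[OF st]]]] that by blast
  have pr: "pj k X i (src (mg Mid X) i a) = src (mg k X) i (pj k X (Suc i) a)"
    "pj k X i (tgt (mg Mid X) i a) = tgt (mg k X) i (pj k X (Suc i) a)"
    if "k \<noteq> Mid" "a \<in> cell (mg Mid X) (Suc i)" for k i a
    using weakD(3)[OF W that(1)] that(2)
    unfolding omega_magma_morphism_def omega_graph_morphism_def globular_morphism_def by blast+
  have pri: "pj k X (Suc i) (idt (mg Mid X) i a) = idt (mg k X) i (pj k X i a)"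
    if "k \<noteq> Mid" "a \<in> cell (mg Mid X) i" for k i a
    using weakD(3)[OF W that(1)] that(2) unfolding omega_magma_morphism_def omega_graph_morphism_def by blast
  have prc: "pj k X j (cmp (mg Mid X) i j (a, b)) = cmp (mg k X) i j (pj k X j a, pj k X j b)"
    if "k \<noteq> Mid" "i < j" "(a, b) \<in> composable (mg Mid X) i j" for k i j a b
    using weakD(3)[OF W that(1)] that(2,3) unfolding omega_magma_morphism_def by blast
  have rh: "rho X i (src (mg Und X) i a) = src (mg Mid X) i (rho X (Suc i) a)"
    "rho X i (tgt (mg Und X) i a) = tgt (mg Mid X) i (rho X (Suc i) a)"
    if "a \<in> cell (mg Und X) (Suc i)" for i a
    using weakD(4)[OF W] that unfolding omega_graph_morphism_def globular_morphism_def by blast+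
  have rhi: "rho X (Suc i) (idt (mg Und X) i a) = idt (mg Mid X) i (rho X i a)" if "a \<in> cell (mg Und X) i" for i a
    using weakD(4)[OF W] that unfolding omega_graph_morphism_def by blast
  note br = weakD(6)[OF W, unfolded bridge_relation_def]
  have br1: "src (mg Mid X) i c = a" "tgt (mg Mid X) i c = b" "c \<in> cell (mg Mid X) (Suc i)"
    "pj Str X (Suc i) c = idt (mg Str X) i (pj Str X i a)"
    if "alg_op X (Bridge i) [a, b] = Some c" for i a b c
    using br that weakD(7)[OF W, of a b c i] unfolding alg_Bridge by auto
  have br2: "alg_op X (Bridge i) [a, a] = Some (idt (mg Mid X) i a)" if "a \<in> cell (mg Mid X) i" for i a
    using br that unfolding alg_Bridge by blast
  show ?thesis
    unfolding alg_model_iff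
  proof (intro allI impI ballI)
    fix \<Gamma> t u xs
    assume "law \<Gamma> t u" and xs: "xs \<in> tuples (alg X) \<Gamma>"
      and def: "eval_tm (alg X) xs t \<noteq> None" "eval_tm (alg X) xs u \<noteq> None"
    then obtain x y where xy: "eval_tm (alg X) xs t = Some x" "eval_tm (alg X) xs u = Some y" by blast
    have "x = y"
      using \<open>law \<Gamma> t u\<close>
    proof cases
      case (unit_left i j)
      then obtain a where a: "xs = [a]" "a \<in> cell (mg Str X) j" using xs by (auto simp: tuples_iff simp del: no_eval)
      have s: "eval_tm (alg X) [a] (idtT Str i j (srcT Str i j v0)) =
          Some (idt_it (mg Str X) i j (src_it (mg Str X) i j a))"
        using eval_iterated(1)[of i j a Str "[a]" v0] eval_iterated(3)[of i j _ Str "[a]"] unit_left(4) a(2) by simp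
      show ?thesis using xy unit_left a unit(1)[OF unit_left(4) a(2)]
        by (auto simp: evals s simp del: no_eval split: if_splits)
    next
      case (unit_right i j)
      then obtain a where a: "xs = [a]" "a \<in> cell (mg Str X) j" using xs by (auto simp: tuples_iff simp del: no_eval)
      have s: "eval_tm (alg X) [a] (idtT Str i j (tgtT Str i j v0)) =
          Some (idt_it (mg Str X) i j (tgt_it (mg Str X) i j a))"
        using eval_iterated(2)[of i j a Str "[a]" v0] eval_iterated(3)[of i j _ Str "[a]"] unit_right(4) a(2) by simp
      show ?thesis using xy unit_right a unit(2)[OF unit_right(4) a(2)]
        by (auto simp: evals s simp del: no_eval split: if_splits)
    next
      case (interchange i j k)
      then obtain a b c d where a: "xs = [a, b, c, d]" using xs by (auto simp: tuples_iff)
      have "i < j" "j < k" by (rule interchange)+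
      then show ?thesis using xy interchange(2,3) inter[of i j k a b c d]
        by (auto simp: a evals simp del: no_eval split: if_splits)
    qed (use xs xy in \<open>auto simp: tuples_iff evals mem raw_mem glob idts comps comps' assoc idc pr pri prc rh rhi
          weakD(5)[OF W] br1 br2 bind_eq_Some_conv simp del: no_eval pj.simps alg_op.simps(7) split: if_splits\<close>)
    then show "eval_tm (alg X) xs t = eval_tm (alg X) xs u" using xy by simp
  qed
qed

subsection \<open>The weak omega category of a model\<close>

text \<open>\<open>undefined\<close> is the value of extensional functions off their domain, so the
  structure maps read off from a model are extensional.\<close>

definition ap :: "(nat, nat, 'u) partial_algebra \<Rightarrow> sym \<Rightarrow> 'u list \<Rightarrow> 'u" where
  "ap M f xs = (case interp M (to_nat f) xs of None \<Rightarrow> undefined | Some y \<Rightarrow> y)"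

definition str_magma :: "mag \<Rightarrow> (nat, nat, 'u) partial_algebra \<Rightarrow> 'u omega_magma" where
  "str_magma k M = \<lparr>cell = (\<lambda>i. carrier M (srt k i)), src = (\<lambda>i x. ap M (Src k i) [x]), tgt = (\<lambda>i x. ap M (Tgt k i) [x]),
     idt = (\<lambda>i x. ap M (Idt k i) [x]), cmp = (\<lambda>i j (x, y). ap M (Comp k i j) [x, y])\<rparr>"

definition str :: "(nat, nat, 'u) partial_algebra \<Rightarrow> 'u weak_omega_category" where
  "str M = \<lparr>underlying = str_magma Und M, middle = str_magma Mid M, strictified = str_magma Str M,
     lam = (\<lambda>i x. ap M (Proj Und i) [x]), rho = (\<lambda>i x. ap M (Rho i) [x]),
     bridges = (\<lambda>i. {(a, b, c). interp M (to_nat (Bridge i)) [a, b] = Some c}),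
     kappa = (\<lambda>i x. ap M (Proj Str i) [x])\<rparr>"

lemma mg_str [simp]: "mg k (str M) = str_magma k M"
  by (cases k) (simp_all add: str_def)

lemma pj_str: "k \<noteq> Mid \<Longrightarrow> pj k (str M) i x = ap M (Proj k i) [x]"
  by (cases k) (simp_all add: str_def)

lemma str_simps [simp]:
  "underlying (str M) = str_magma Und M" "middle (str M) = str_magma Mid M" "strictified (str M) = str_magma Str M"
  "cell (str_magma k M) i = carrier M (srt k i)" "src (str_magma k M) i x = ap M (Src k i) [x]"
  "tgt (str_magma k M) i x = ap M (Tgt k i) [x]" "idt (str_magma k M) i x = ap M (Idt k i) [x]"
  "cmp (str_magma k M) i j (x, y) = ap M (Comp k i j) [x, y]"
  "rho (str M) i x = ap M (Rho i) [x]" "(a, b, c) \<in> bridges (str M) i \<longleftrightarrow> interp M (to_nat (Bridge i)) [a, b] = Some c"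
  by (simp_all add: str_magma_def str_def)

locale theory_model =
  fixes M :: "(nat, nat, 'u) partial_algebra"
  assumes model: "is_model omega_theory M"
begin

lemma interp_typed:
  assumes "interp M n xs = Some y"
  shows "\<exists>f. n = to_nat f \<and> sym_ok f \<and> xs \<in> tuples M (sym_arity f) \<and> y \<in> carrier M (sym_result f)"
proof -
  have "n \<in> ops omega_theory \<and> xs \<in> tuples M (arity omega_theory n) \<and> y \<in> carrier M (result omega_theory n)"
    using model assms unfolding is_model_def by blast
  then show ?thesis by (auto simp: theory_ops)
qed

lemma interp_typed_sym:
  assumes "interp M (to_nat f) xs = Some y"
  shows "sym_ok f" "xs \<in> tuples M (sym_arity f)" "y \<in> carrier M (sym_result f)"
  using interp_typed[OF assms] by auto

lemma interp_total:
  assumes "sym_ok f" "sym_total f"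
  shows "interp M (to_nat f) xs = (if xs \<in> tuples M (sym_arity f) then Some (ap M f xs) else None)"
    "xs \<in> tuples M (sym_arity f) \<Longrightarrow> ap M f xs \<in> carrier M (sym_result f)"
proof -
  have "to_nat f \<in> total_ops omega_theory" using assms by simp
  then have d: "interp M (to_nat f) xs \<noteq> None" if "xs \<in> tuples M (sym_arity f)"
    using model that unfolding is_model_def by fastforce
  then show "interp M (to_nat f) xs = (if xs \<in> tuples M (sym_arity f) then Some (ap M f xs) else None)"
    using interp_typed_sym(2)[of f xs] by (cases "interp M (to_nat f) xs") (auto simp: ap_def)
  show "xs \<in> tuples M (sym_arity f) \<Longrightarrow> ap M f xs \<in> carrier M (sym_result f)"
    using d interp_typed_sym(3)[of f xs] by (cases "interp M (to_nat f) xs") (auto simp: ap_def)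
qed

lemma interp_partial:
  assumes "sym_ok f" "\<not> sym_total f" "xs \<in> tuples M (sym_arity f)"
  shows "interp M (to_nat f) xs \<noteq> None \<longleftrightarrow> (\<forall>(t, u)\<in>sym_dom f. eval_tm M xs t = eval_tm M xs u)"
proof -
  have "to_nat f \<in> ops omega_theory - total_ops omega_theory" using assms by simp
  then have "interp M (to_nat f) xs \<noteq> None \<longleftrightarrow>
      (\<forall>(t, u)\<in>dom_eqs omega_theory (to_nat f). eval_tm M xs t = eval_tm M xs u)"
    using model assms(3) unfolding is_model_def by simp
  then show ?thesis by simp
qed

lemma unary:
  "interp M (to_nat (Src k i)) [x] = (if x \<in> carrier M (srt k (Suc i)) then Some (ap M (Src k i) [x]) else None)"
  "interp M (to_nat (Tgt k i)) [x] = (if x \<in> carrier M (srt k (Suc i)) then Some (ap M (Tgt k i) [x]) else None)"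
  "interp M (to_nat (Idt k i)) [x] = (if x \<in> carrier M (srt k i) then Some (ap M (Idt k i) [x]) else None)"
  "k \<noteq> Mid \<Longrightarrow> interp M (to_nat (Proj k i)) [x] = (if x \<in> carrier M (srt Mid i) then Some (ap M (Proj k i) [x]) else None)"
  "interp M (to_nat (Rho i)) [x] = (if x \<in> carrier M (srt Und i) then Some (ap M (Rho i) [x]) else None)"
  using interp_total(1)[of "Src k i" "[x]"] interp_total(1)[of "Tgt k i" "[x]"] interp_total(1)[of "Idt k i" "[x]"]
    interp_total(1)[of "Proj k i" "[x]"] interp_total(1)[of "Rho i" "[x]"]
  by (simp_all add: tuples_iff del: srt.simps)

lemma unary_cell:
  "x \<in> carrier M (srt k (Suc i)) \<Longrightarrow> ap M (Src k i) [x] \<in> carrier M (srt k i)"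
  "x \<in> carrier M (srt k (Suc i)) \<Longrightarrow> ap M (Tgt k i) [x] \<in> carrier M (srt k i)"
  "x \<in> carrier M (srt k i) \<Longrightarrow> ap M (Idt k i) [x] \<in> carrier M (srt k (Suc i))"
  "k \<noteq> Mid \<Longrightarrow> x \<in> carrier M (srt Mid i) \<Longrightarrow> ap M (Proj k i) [x] \<in> carrier M (srt k i)"
  "x \<in> carrier M (srt Und i) \<Longrightarrow> ap M (Rho i) [x] \<in> carrier M (srt Mid i)"
  using interp_total(2)[of "Src k i" "[x]"] interp_total(2)[of "Tgt k i" "[x]"] interp_total(2)[of "Idt k i" "[x]"]
    interp_total(2)[of "Proj k i" "[x]"] interp_total(2)[of "Rho i" "[x]"]
  by (simp_all add: tuples_iff del: srt.simps)

sublocale rep M "str M"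
  by unfold_locales (simp_all add: unary unary_cell pj_str del: srt.simps mg.simps)

lemma Comp_defined:
  assumes "i < j"
  shows "interp M (to_nat (Comp k i j)) [a, b] \<noteq> None \<longleftrightarrow> (a, b) \<in> composable (str_magma k M) i j"
proof (cases "a \<in> carrier M (srt k j) \<and> b \<in> carrier M (srt k j)")
  case True
  then have "[a, b] \<in> tuples M (sym_arity (Comp k i j))" by (simp add: tuples_iff del: srt.simps)
  then show ?thesis using interp_partial[of "Comp k i j" "[a, b]"] dom_Comp[OF assms, of a k b] assms True
    by (simp del: srt.simps sym_dom.simps sym_arity.simps)
next
  case False
  then have "(a, b) \<notin> composable (str_magma k M) i j" by (auto simp: composable_def)
  moreover have "interp M (to_nat (Comp k i j)) [a, b] = None"
    using interp_typed_sym(2)[of "Comp k i j" "[a, b]"] False by (fastforce simp: tuples_iff simp del: srt.simps)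
  ultimately show ?thesis by simp
qed

lemma Bridge_defined:
  "interp M (to_nat (Bridge i)) [a, b] \<noteq> None \<longleftrightarrow>
    parallel (str_magma Mid M) i a b \<and> kappa (str M) i a = kappa (str M) i b"
proof (cases "a \<in> carrier M (srt Mid i) \<and> b \<in> carrier M (srt Mid i)")
  case True
  then have "[a, b] \<in> tuples M (sym_arity (Bridge i))" by (simp add: tuples_iff del: srt.simps)
  moreover have "middle (str M) = str_magma Mid M" by (simp add: str_def)
  ultimately show ?thesis using interp_partial[of "Bridge i" "[a, b]"] dom_Bridge[of a i b] True
    by (simp del: srt.simps sym_dom.simps sym_arity.simps)
next
  case False
  then have "\<not> parallel (str_magma Mid M) i a b" by (auto simp: parallel_def)
  moreover have "interp M (to_nat (Bridge i)) [a, b] = None"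
    using interp_typed_sym(2)[of "Bridge i" "[a, b]"] False by (fastforce simp: tuples_iff simp del: srt.simps)
  ultimately show ?thesis by simp
qed

lemma raw_str: "raw (str M)"
proof
  fix k i
  show "src (mg k (str M)) i \<in> cell (mg k (str M)) (Suc i) \<rightarrow>\<^sub>E cell (mg k (str M)) i"
    by (rule PiE_I) (simp_all add: unary_cell, simp add: ap_def unary)
  show "tgt (mg k (str M)) i \<in> cell (mg k (str M)) (Suc i) \<rightarrow>\<^sub>E cell (mg k (str M)) i"
    by (rule PiE_I) (simp_all add: unary_cell, simp add: ap_def unary)
  show "idt (mg k (str M)) i \<in> cell (mg k (str M)) i \<rightarrow>\<^sub>E cell (mg k (str M)) (Suc i)"
    by (rule PiE_I) (simp_all add: unary_cell, simp add: ap_def unary)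
  show "k \<noteq> Mid \<Longrightarrow> pj k (str M) i \<in> cell (middle (str M)) i \<rightarrow>\<^sub>E cell (mg k (str M)) i"
    by (rule PiE_I) (simp_all add: pj_str unary_cell del: srt.simps, simp add: ap_def unary del: srt.simps)
  show "rho (str M) i \<in> cell (underlying (str M)) i \<rightarrow>\<^sub>E cell (middle (str M)) i"
    by (rule PiE_I) (simp_all add: unary_cell del: srt.simps, simp add: ap_def unary del: srt.simps)
  show "cmp (mg k (str M)) i j \<in> composable (mg k (str M)) i j \<rightarrow>\<^sub>E cell (mg k (str M)) j" if ij: "i < j" for j
  proof (rule PiE_I; clarify)
    fix a b
    show "cmp (mg k (str M)) i j (a, b) \<in> cell (mg k (str M)) j" if ab: "(a, b) \<in> composable (mg k (str M)) i j"
    proof -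
      obtain y where "interp M (to_nat (Comp k i j)) [a, b] = Some y" using Comp_defined[OF ij, of k a b] ab by auto
      then show ?thesis using interp_typed_sym(3)[of "Comp k i j"] by (fastforce simp: ap_def simp del: srt.simps)
    qed
    show "cmp (mg k (str M)) i j (a, b) = undefined" if "(a, b) \<notin> composable (mg k (str M)) i j"
      using Comp_defined[OF ij, of k a b] that by (simp add: ap_def)
  qed
  \<comment> \<open>Unless \<open>i < j\<close> the symbol is not an operation of the theory, so the
    model leaves it uninterpreted.\<close>
  show "cmp (mg k (str M)) i j = (\<lambda>_. undefined)" if ij: "\<not> i < j" for j
  proof -
    have "interp M (to_nat (Comp k i j)) xs = None" for xs
      using interp_typed_sym(1)[of "Comp k i j" xs] ij by (cases "interp M (to_nat (Comp k i j)) xs") auto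
    then show ?thesis by (simp add: fun_eq_iff ap_def)
  qed
next
  fix i a b
  show "(\<exists>c. (a, b, c) \<in> bridges (str M) i) \<longleftrightarrow>
      parallel (middle (str M)) i a b \<and> kappa (str M) i a = kappa (str M) i b"
    using Bridge_defined[of i a b] by (simp add: str_def)
  show "c \<in> cell (middle (str M)) (Suc i)" if "(a, b, c) \<in> bridges (str M) i" for c
    using interp_typed_sym(3)[of "Bridge i" "[a, b]" c] that by (simp add: str_def)
  show "c = d" if "(a, b, c) \<in> bridges (str M) i" "(a, b, d) \<in> bridges (str M) i" for c d
    using that by simp
qed

text \<open>On arguments of the right sorts both interpretations agree symbol by symbol; on all
  others both are undefined, as models interpret nothing outside the typing.\<close>

lemma alg_str: "alg (str M) = M"
proof -
  interpret R: raw "str M" by (rule raw_str)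
  have 1: "alg_op (str M) f xs = Some y \<longleftrightarrow> interp M (to_nat f) xs = Some y" if xs: "xs \<in> tuples M (sym_arity f)" "sym_ok f" for f xs y
  proof (cases f)
    case (Comp k i j)
    then obtain a b where ab: "xs = [a, b]" using xs by (auto simp: tuples_iff)
    have "i < j" using xs Comp by simp
    then show ?thesis using Comp_defined[of i j k a b] unfolding Comp ab by (auto simp: ap_def)
  next
    case (Bridge i)
    then obtain a b where ab: "xs = [a, b]" using xs by (auto simp: tuples_iff)
    show ?thesis unfolding Bridge ab R.alg_Bridge by simp
  qed (use xs in \<open>auto simp: tuples_iff unary pj_str simp del: srt.simps mg.simps\<close>)
  have 2: "interp (alg (str M)) n xs = Some y \<longleftrightarrow> interp M n xs = Some y" for n xs y
  proof
    assume a: "interp (alg (str M)) n xs = Some y"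
    then obtain f :: sym where f: "n = to_nat f" by (auto simp: alg_def split: if_splits)
    have "alg_op (str M) f xs = Some y" using a unfolding f by simp
    moreover from R.alg_op_Some[OF this] have "sym_ok f" "xs \<in> tuples M (sym_arity f)"
      by (simp_all add: tuples_def)
    ultimately show "interp M n xs = Some y" using 1 f by blast
  next
    assume a: "interp M n xs = Some y"
    then obtain f where "n = to_nat f" "sym_ok f" "xs \<in> tuples M (sym_arity f)" using interp_typed by blast
    then show "interp (alg (str M)) n xs = Some y" using 1 a by simp
  qed
  show ?thesis
  proof (rule partial_algebra.equality)
    show "carrier (alg (str M)) = carrier M" by (simp add: fun_eq_iff)
    show "interp (alg (str M)) = interp M"
    proof (intro ext)
      fix n xs show "interp (alg (str M)) n xs = interp M n xs"
      proof (cases "interp M n xs")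
        case None
        then have "\<not> (\<exists>y. interp (alg (str M)) n xs = Some y)" using 2[of n xs] by simp
        then show ?thesis using None by simp
      next
        case (Some y)
        then show ?thesis using 2[of n xs y] by simp
      qed
    qed
  qed simp
qed

lemma str_weak: "is_weak_omega_category (str M)"
proof -
  interpret lawful "str M" by (intro lawful.intro raw_str lawful_axioms.intro) (simp add: alg_str model)
  show ?thesis by (rule weak)
qed

end

text \<open>Extensionality turns the round trip into an equality: off the domains both sides are
  \<open>undefined\<close>. This is what yields an isomorphism of categories.\<close>

lemma (in raw) str_alg: "str (alg X) = X"
proof -
  have m: "str_magma k (alg X) = mg k X" for k
  proof (rule omega_magma.equality)
    show "cell (str_magma k (alg X)) = cell (mg k X)" by (simp add: fun_eq_iff)
    show "src (str_magma k (alg X)) = src (mg k X)"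
      using PiE_arb[OF src_PiE] by (simp add: fun_eq_iff ap_def del: mg.simps)
    show "tgt (str_magma k (alg X)) = tgt (mg k X)"
      using PiE_arb[OF tgt_PiE] by (simp add: fun_eq_iff ap_def del: mg.simps)
    show "idt (str_magma k (alg X)) = idt (mg k X)"
      using PiE_arb[OF idt_PiE] by (simp add: fun_eq_iff ap_def del: mg.simps)
    have "cmp (str_magma k (alg X)) i j (a, b) = cmp (mg k X) i j (a, b)" for i j a b
      using PiE_arb[OF cmp_PiE, of i j "(a, b)" k] cmp_undefined[of i j k] by (cases "i < j") (auto simp: ap_def)
    then show "cmp (str_magma k (alg X)) = cmp (mg k X)" by (simp add: fun_eq_iff)
  qed simp
  have p: "ap (alg X) (Proj k i) [x] = pj k X i x" if "k \<noteq> Mid" for k i x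
    using PiE_arb[OF pj_PiE[OF that], of x i] that by (simp add: ap_def)
  show ?thesis
  proof (rule weak_omega_category.equality)
    show "underlying (str (alg X)) = underlying X" "middle (str (alg X)) = middle X"
      "strictified (str (alg X)) = strictified X" using m[of Und] m[of Mid] m[of Str] by (simp_all add: str_def)
    show "lam (str (alg X)) = lam X" "kappa (str (alg X)) = kappa X"
      using p[of Und] p[of Str] by (simp_all add: str_def fun_eq_iff)
    show "rho (str (alg X)) = rho X" using PiE_arb[OF rho_PiE] by (simp add: fun_eq_iff ap_def)
    have "(a, b, c) \<in> bridges (str (alg X)) i \<longleftrightarrow> (a, b, c) \<in> bridges X i" for i a b c
      using alg_Bridge by (simp del: alg_op.simps)
    then show "bridges (str (alg X)) = bridges X" by (auto simp: fun_eq_iff)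
  qed simp
qed

subsection \<open>Omega functors as homomorphisms\<close>

fun fm :: "mag \<Rightarrow> 'u functor_data \<Rightarrow> nat \<Rightarrow> 'u \<Rightarrow> 'u" where
  "fm Und (F1, F2, F3) = F1" | "fm Mid (F1, F2, F3) = F2" | "fm Str (F1, F2, F3) = F3"

definition fam :: "'u functor_data \<Rightarrow> nat \<Rightarrow> 'u \<Rightarrow> 'u" where
  "fam F s = fm (srt_mag s) F (srt_dim s)"

definition unfam :: "(nat \<Rightarrow> 'u \<Rightarrow> 'u) \<Rightarrow> 'u functor_data" where
  "unfam h = (\<lambda>i. h (srt Und i), \<lambda>i. h (srt Mid i), \<lambda>i. h (srt Str i))"

lemma fam_srt [simp]: "fam F (srt k i) = fm k F i"
  by (simp add: fam_def del: srt.simps)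

lemma fm_unfam: "fm k (unfam h) i = h (srt k i)"
  by (cases k) (simp_all add: unfam_def)

lemma fam_unfam: "fam (unfam h) = h"
  by (rule ext) (simp add: fam_def fm_unfam)

lemma unfam_fam: "unfam (fam F) = F"
  by (cases F) (simp add: unfam_def del: srt.simps)

lemma all_mag: "(\<forall>k. P k) \<longleftrightarrow> P Und \<and> P Mid \<and> P Str"
  by (metis mag.exhaust)

lemma omega_functor_iff:
  "omega_functor X Y F \<longleftrightarrow> (\<forall>k. omega_magma_morphism (mg k X) (mg k Y) (fm k F)) \<and>
     (\<forall>i a b c. (a, b, c) \<in> bridges X i \<longrightarrow> (fm Mid F i a, fm Mid F i b, fm Mid F (Suc i) c) \<in> bridges Y i) \<and>
     (\<forall>k. k \<noteq> Mid \<longrightarrow> (\<forall>i. \<forall>a\<in>cell (mg Mid X) i. fm k F i (pj k X i a) = pj k Y i (fm Mid F i a))) \<and>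
     (\<forall>i. \<forall>a\<in>cell (mg Und X) i. fm Mid F i (rho X i a) = rho Y i (fm Und F i a))"
  by (cases F) (auto simp: all_mag bridge_morphism_def)

text \<open>Symbol by symbol, being a homomorphism is preserving one piece of structure. A
  homomorphism preserves the definedness of composites outright, whereas for an omega functor it
  follows from preservation of iterated faces. Preserving the bridge operation is the same as
  preserving the bridge relation.\<close>

lemma hom_iff:
  assumes X: "is_weak_omega_category X" and Y: "is_weak_omega_category Y"
  shows "model_hom omega_theory (alg X) (alg Y) (fam F) \<longleftrightarrow> omega_functor X Y F"
proof -
  interpret X: raw X using X by (rule weak_raw)
  interpret Y: raw Y using Y by (rule weak_raw)
  have gX: "is_globular_set (mg k X)" for k
    using weakD(1)[OF X, of k] unfolding is_omega_magma_def is_omega_graph_def by blast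
  have carr: "(\<forall>s. fam F s \<in> carrier (alg X) s \<rightarrow>\<^sub>E carrier (alg Y) s) \<longleftrightarrow>
      (\<forall>k i. fm k F i \<in> cell (mg k X) i \<rightarrow>\<^sub>E cell (mg k Y) i)"
  proof -
    show ?thesis
    proof (intro iffI allI)
      fix k i assume "\<forall>s. fam F s \<in> carrier (alg X) s \<rightarrow>\<^sub>E carrier (alg Y) s"
      then have "fam F (srt k i) \<in> carrier (alg X) (srt k i) \<rightarrow>\<^sub>E carrier (alg Y) (srt k i)" by blast
      then show "fm k F i \<in> cell (mg k X) i \<rightarrow>\<^sub>E cell (mg k Y) i" by (simp del: srt.simps)
    qed (simp add: fam_def)
  qed
  have hom: "model_hom omega_theory (alg X) (alg Y) (fam F) \<longleftrightarrow>
      (\<forall>k i. fm k F i \<in> cell (mg k X) i \<rightarrow>\<^sub>E cell (mg k Y) i) \<and>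
      (\<forall>f xs y. sym_ok f \<longrightarrow> alg_op X f xs = Some y \<longrightarrow>
         alg_op Y f (map2 (fam F) (sym_arity f) xs) = Some (fam F (sym_result f) y))"
    unfolding model_hom_def carr theory_ops by (auto simp del: alg_simps(1))
  show ?thesis
  proof
    assume "model_hom omega_theory (alg X) (alg Y) (fam F)"
    then have c: "\<And>k i. fm k F i \<in> cell (mg k X) i \<rightarrow>\<^sub>E cell (mg k Y) i"
      and o: "\<And>f xs y. sym_ok f \<Longrightarrow> alg_op X f xs = Some y \<Longrightarrow>
         alg_op Y f (map2 (fam F) (sym_arity f) xs) = Some (fam F (sym_result f) y)"
      unfolding hom by blast+
    note cm = PiE_mem[OF c]
    have g: "globular_morphism (mg k X) (mg k Y) (fm k F)" for k
      unfolding globular_morphism_def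
    proof (intro conjI allI ballI c)
      fix i a assume a: "a \<in> cell (mg k X) (Suc i)"
      show "fm k F i (src (mg k X) i a) = src (mg k Y) i (fm k F (Suc i) a)"
        using o[of "Src k i" "[a]"] a cm by (simp del: srt.simps mg.simps)
      show "fm k F i (tgt (mg k X) i a) = tgt (mg k Y) i (fm k F (Suc i) a)"
        using o[of "Tgt k i" "[a]"] a cm by (simp del: srt.simps mg.simps)
    qed
    have "omega_magma_morphism (mg k X) (mg k Y) (fm k F)" for k
      unfolding omega_magma_morphism_def omega_graph_morphism_def
    proof (intro conjI allI ballI impI g; (clarify)?)
      show "fm k F (Suc i) (idt (mg k X) i a) = idt (mg k Y) i (fm k F i a)" if "a \<in> cell (mg k X) i" for i a
        using o[of "Idt k i" "[a]"] that cm by (simp del: srt.simps mg.simps)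
      show "fm k F j (cmp (mg k X) i j (a, b)) = cmp (mg k Y) i j (fm k F j a, fm k F j b)"
        if "i < j" "(a, b) \<in> composable (mg k X) i j" for i j a b
        using o[of "Comp k i j" "[a, b]"] that by (simp del: srt.simps mg.simps split: if_splits)
    qed
    moreover have "(fm Mid F i a, fm Mid F i b, fm Mid F (Suc i) c) \<in> bridges Y i" if "(a, b, c) \<in> bridges X i" for i a b c
      using o[of "Bridge i" "[a, b]" c] that
      by (simp add: X.alg_Bridge Y.alg_Bridge del: srt.simps mg.simps alg_op.simps)
    moreover have "fm k F i (pj k X i a) = pj k Y i (fm Mid F i a)" if "k \<noteq> Mid" "a \<in> cell (mg Mid X) i" for k i a
      using o[of "Proj k i" "[a]"] that by (simp del: srt.simps mg.simps split: if_splits)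
    moreover have "fm Mid F i (rho X i a) = rho Y i (fm Und F i a)" if "a \<in> cell (mg Und X) i" for i a
      using o[of "Rho i" "[a]"] that by (simp del: srt.simps mg.simps split: if_splits)
    ultimately show "omega_functor X Y F" unfolding omega_functor_iff by blast
  next
    assume "omega_functor X Y F"
    note F = this[unfolded omega_functor_iff]
    have mm: "omega_magma_morphism (mg k X) (mg k Y) (fm k F)" for k using F by blast
    then have g: "globular_morphism (mg k X) (mg k Y) (fm k F)" for k
      unfolding omega_magma_morphism_def omega_graph_morphism_def by blast
    then have c: "fm k F i \<in> cell (mg k X) i \<rightarrow>\<^sub>E cell (mg k Y) i" for k i
      unfolding globular_morphism_def by blast
    note cm = PiE_mem[OF c]
    have st: "fm k F i (src (mg k X) i a) = src (mg k Y) i (fm k F (Suc i) a)"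
      "fm k F i (tgt (mg k X) i a) = tgt (mg k Y) i (fm k F (Suc i) a)" if "a \<in> cell (mg k X) (Suc i)" for k i a
      using g[of k] that unfolding globular_morphism_def by blast+
    have it: "fm k F (Suc i) (idt (mg k X) i a) = idt (mg k Y) i (fm k F i a)" if "a \<in> cell (mg k X) i" for k i a
      using mm[of k] that unfolding omega_magma_morphism_def omega_graph_morphism_def by blast
    have cp: "fm k F j (cmp (mg k X) i j (a, b)) = cmp (mg k Y) i j (fm k F j a, fm k F j b)"
      "(fm k F j a, fm k F j b) \<in> composable (mg k Y) i j"
      if "i < j" "(a, b) \<in> composable (mg k X) i j" for k i j a b
      using mm[of k] that morphism_composable[OF g gX that(2,1)] unfolding omega_magma_morphism_def by blast+
    have "alg_op Y f (map2 (fam F) (sym_arity f) xs) = Some (fam F (sym_result f) y)"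
      if f: "sym_ok f" "alg_op X f xs = Some y" for f xs y
    proof (cases "\<exists>i. f = Bridge i")
      case True
      then obtain i where i: "f = Bridge i" by blast
      obtain a b where xs: "xs = [a, b]" using f(2) unfolding i by (cases "(X, f, xs)" rule: alg_op.cases) (auto simp: i)
      show ?thesis using f(2) F unfolding i xs
        by (simp add: X.alg_Bridge Y.alg_Bridge del: srt.simps mg.simps alg_op.simps)
    next
      case False
      then show ?thesis using f
        by (cases "(X, f, xs)" rule: alg_op.cases)
          (use F in \<open>auto simp: cm st it cp simp del: srt.simps mg.simps split: if_splits\<close>)
    qed
    then show "model_hom omega_theory (alg X) (alg Y) (fam F)" unfolding hom using c by blast
  qed
qed

text \<open>Identities and composition of \<open>C\<close> are those of \<open>D\<close> read
  through the bijections, so the category laws of \<open>C\<close> are inherited instead of being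
  verified for omega functors.\<close>

lemma category_isoI:
  assumes D: "category D"
    and obj: "\<And>x. x \<in> Obj C \<Longrightarrow> Fo x \<in> Obj D" "\<And>x. x \<in> Obj C \<Longrightarrow> Go (Fo x) = x"
      "\<And>y. y \<in> Obj D \<Longrightarrow> Go y \<in> Obj C" "\<And>y. y \<in> Obj D \<Longrightarrow> Fo (Go y) = y"
    and arr: "\<And>f. f \<in> Arr C \<Longrightarrow> Fm f \<in> Arr D" "\<And>f. f \<in> Arr C \<Longrightarrow> Gm (Fm f) = f"
      "\<And>g. g \<in> Arr D \<Longrightarrow> Gm g \<in> Arr C" "\<And>g. g \<in> Arr D \<Longrightarrow> Fm (Gm g) = g"
    and dom: "\<And>f. f \<in> Arr C \<Longrightarrow> Dom C f \<in> Obj C \<and> Cod C f \<in> Obj C"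
      "\<And>f. f \<in> Arr C \<Longrightarrow> Dom D (Fm f) = Fo (Dom C f) \<and> Cod D (Fm f) = Fo (Cod C f)"
    and ident: "\<And>x. x \<in> Obj C \<Longrightarrow> Id C x = Gm (Id D (Fo x))"
    and comp: "\<And>f g. f \<in> Arr C \<Longrightarrow> g \<in> Arr C \<Longrightarrow> Dom C g = Cod C f \<Longrightarrow> Cmp C g f = Gm (Cmp D (Fm g) (Fm f))"
  shows "category_iso C D Fo Fm Go Gm"
proof -
  have domG: "Dom C (Gm g) = Go (Dom D g)" "Cod C (Gm g) = Go (Cod D g)" if "g \<in> Arr D" for g
    using dom[OF arr(3)[OF that]] arr(4)[OF that] obj(2) by metis+
  have FId: "Fm (Id C x) = Id D (Fo x)" "Id D (Fo x) \<in> hom D (Fo x) (Fo x)" if "x \<in> Obj C" for x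
    using category_id(1)[OF D obj(1)[OF that]] ident[OF that] arr(4) by (auto simp: in_hom)
  have FCmp: "Fm (Cmp C g f) = Cmp D (Fm g) (Fm f)"
    "Cmp D (Fm g) (Fm f) \<in> hom D (Fo (Dom C f)) (Fo (Cod C g))"
    if fg: "f \<in> Arr C" "g \<in> Arr C" "Dom C g = Cod C f" for f g
  proof -
    show h: "Cmp D (Fm g) (Fm f) \<in> hom D (Fo (Dom C f)) (Fo (Cod C g))"
      by (rule category_cmp[OF D, where y = "Fo (Cod C f)"]) (use fg arr(1) dom in \<open>auto simp: in_hom\<close>)
    then show "Fm (Cmp C g f) = Cmp D (Fm g) (Fm f)" using comp[OF fg] arr(4) by (simp add: in_hom)
  qed
  have CmpC: "Cmp C g f \<in> hom C (Dom C f) (Cod C g)" if fg: "f \<in> Arr C" "g \<in> Arr C" "Dom C g = Cod C f" for f g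
    using FCmp(2)[OF fg] arr(3) domG obj(2) dom(1) fg unfolding comp[OF fg] by (auto simp: in_hom)
  have IdC: "Id C x \<in> hom C x x" if "x \<in> Obj C" for x
    using FId(2)[OF that] arr(3) domG obj(2)[OF that] unfolding ident[OF that] by (auto simp: in_hom)
  have inj: "f = g" if "f \<in> Arr C" "g \<in> Arr C" "Fm f = Fm g" for f g using arr(2) that by metis
  have C: "category C"
    unfolding category_def
  proof (intro conjI ballI impI)
    fix f assume f: "f \<in> Arr C"
    show "Dom C f \<in> Obj C" "Cod C f \<in> Obj C" using dom(1)[OF f] by blast+
    have i: "Id C (Dom C f) \<in> Arr C" "Cod C (Id C (Dom C f)) = Dom C f"
      "Id C (Cod C f) \<in> Arr C" "Dom C (Id C (Cod C f)) = Cod C f"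
      using IdC dom(1)[OF f] by (auto simp: in_hom)
    have F: "Fm f \<in> hom D (Fo (Dom C f)) (Fo (Cod C f))" using arr(1)[OF f] dom(2)[OF f] by (simp add: in_hom)
    show "Cmp C f (Id C (Dom C f)) = f"
      using CmpC[OF i(1) f] i FCmp(1)[OF i(1) f] FId(1) dom(1)[OF f] category_id(2)[OF D F] f by (intro inj) (auto simp: in_hom)
    show "Cmp C (Id C (Cod C f)) f = f"
      using CmpC[OF f i(3)] i FCmp(1)[OF f i(3)] FId(1) dom(1)[OF f] category_id(3)[OF D F] f by (intro inj) (auto simp: in_hom)
  next
    show "Id C x \<in> hom C x x" if "x \<in> Obj C" for x by (rule IdC[OF that])
    show "Cmp C g f \<in> hom C (Dom C f) (Cod C g)" if "f \<in> Arr C" "g \<in> Arr C" "Dom C g = Cod C f" for f g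
      by (rule CmpC[OF that])
    fix f g h assume f: "f \<in> Arr C" and g: "g \<in> Arr C" and h: "h \<in> Arr C" and fg: "Dom C g = Cod C f" and gh: "Dom C h = Cod C g"
    note gf = CmpC[OF f g fg] and hg = CmpC[OF g h gh]
    have gf': "Cmp C g f \<in> Arr C" "Dom C h = Cod C (Cmp C g f)" and hg': "Cmp C h g \<in> Arr C" "Dom C (Cmp C h g) = Cod C f"
      using gf hg fg gh by (auto simp: in_hom)
    have F: "Fm x \<in> hom D (Fo (Dom C x)) (Fo (Cod C x))" if "x \<in> Arr C" for x
      using arr(1)[OF that] dom(2)[OF that] by (simp add: in_hom)
    have "Cmp D (Fm h) (Cmp D (Fm g) (Fm f)) = Cmp D (Cmp D (Fm h) (Fm g)) (Fm f)"
      using category_assoc[OF D F[OF f] F[OF g, unfolded fg] F[OF h, unfolded gh]] .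
    then have "Fm (Cmp C h (Cmp C g f)) = Fm (Cmp C (Cmp C h g) f)"
      using FCmp(1)[OF gf'(1) h gf'(2)] FCmp(1)[OF f hg'(1) hg'(2)] FCmp(1)[OF f g fg] FCmp(1)[OF g h gh] by simp
    then show "Cmp C h (Cmp C g f) = Cmp C (Cmp C h g) f"
      using CmpC[OF gf'(1) h gf'(2)] CmpC[OF f hg'(1) hg'(2)] by (intro inj) (auto simp: in_hom)
  qed
  have F: "is_functor C D Fo Fm"
    unfolding is_functor_def using obj(1) arr(1) dom(2) FId(1) FCmp(1) by (auto simp: in_hom)
  have G: "is_functor D C Go Gm"
    unfolding is_functor_def
  proof (intro conjI ballI impI)
    show "Gm f \<in> hom C (Go (Dom D f)) (Go (Cod D f))" if "f \<in> Arr D" for f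
      using arr(3) domG that by (simp add: in_hom)
    show "Gm (Id D x) = Id C (Go x)" if "x \<in> Obj D" for x using ident[OF obj(3)[OF that]] obj(4)[OF that] by simp
    fix f g assume fg: "f \<in> Arr D" "g \<in> Arr D" "Dom D g = Cod D f"
    then show "Gm (Cmp D g f) = Cmp C (Gm g) (Gm f)"
      using comp[OF arr(3)[OF fg(1)] arr(3)[OF fg(2)]] domG arr(4) by simp
  qed (use obj in blast)
  show ?thesis using C D F G obj(2,4) arr(2,4) by unfold_locales
qed

lemma Omega_Cat_simps [simp]:
  "X \<in> Obj Omega_Cat \<longleftrightarrow> small_weak_omega_category X"
  "(X, F, Y) \<in> Arr Omega_Cat \<longleftrightarrow> small_weak_omega_category X \<and> small_weak_omega_category Y \<and> omega_functor X Y F"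
  "Dom Omega_Cat f = fst f" "Cod Omega_Cat f = snd (snd f)"
  by (simp_all add: Omega_Cat_def)

lemma Mod_Obj_Arr:
  "M \<in> Obj (Mod T) \<longleftrightarrow> is_model T M \<and> (\<forall>s. small TYPE('u) (carrier M s))"
  "(M, h, N) \<in> Arr (Mod T) \<longleftrightarrow> M \<in> Obj (Mod T) \<and> N \<in> Obj (Mod T) \<and> model_hom T M N h"
  for M :: "('s, 'f, 'u) partial_algebra"
  by (simp_all add: Mod_def Let_def)

lemma small_weak_iff:
  "small_weak_omega_category X \<longleftrightarrow> is_weak_omega_category X \<and> (\<forall>k i. small TYPE('u) (cell (mg k X) i))"
  for X :: "'u weak_omega_category"
  unfolding small_weak_omega_category_def all_mag by auto

lemma alg_Obj:
  fixes X :: "'u weak_omega_category"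
  assumes "small_weak_omega_category X" shows "alg X \<in> Obj (Mod omega_theory)" "str (alg X) = X"
  using assms weak_laws raw.str_alg[OF weak_raw] unfolding small_weak_iff Mod_Obj_Arr by auto

lemma str_Obj:
  fixes M :: "(nat, nat, 'u) partial_algebra"
  assumes "M \<in> Obj (Mod omega_theory)" shows "small_weak_omega_category (str M)" "alg (str M) = M"
proof -
  interpret theory_model M by unfold_locales (use assms Mod_Obj_Arr in blast)
  show "small_weak_omega_category (str M)" using str_weak assms unfolding small_weak_iff Mod_Obj_Arr by simp
  show "alg (str M) = M" by (rule alg_str)
qed

lemma Omega_Cat_iso:
  "category_iso (Omega_Cat :: ('u weak_omega_category, _) cat) (Mod omega_theory)
     alg (\<lambda>(X, F, Y). (alg X, fam F, alg Y)) str (\<lambda>(M, h, N). (str M, unfam h, str N))"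
proof (rule category_isoI)
  interpret ea omega_theory by unfold_locales (rule omega_theory_ea)
  show "category (Mod omega_theory :: ((nat, nat, 'u) partial_algebra, _) cat)" by (rule Mod_category)
  have weak: "small_weak_omega_category X \<Longrightarrow> is_weak_omega_category X" for X :: "'u weak_omega_category"
    unfolding small_weak_omega_category_def by blast
  fix f g :: "'u weak_omega_category \<times> 'u functor_data \<times> 'u weak_omega_category"
  obtain X F Y where f: "f = (X, F, Y)" by (cases f)
  show "(case f of (X, F, Y) \<Rightarrow> (alg X, fam F, alg Y)) \<in> Arr (Mod omega_theory)" if "f \<in> Arr Omega_Cat"
    using that hom_iff[of X Y F] weak[of X] weak[of Y] alg_Obj(1)[of X] alg_Obj(1)[of Y] unfolding f
    by (simp add: Mod_Obj_Arr(2))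
  show "(case case f of (X, F, Y) \<Rightarrow> (alg X, fam F, alg Y) of (M, h, N) \<Rightarrow> (str M, unfam h, str N)) = f"
    if "f \<in> Arr Omega_Cat"
    using that alg_Obj(2)[of X] alg_Obj(2)[of Y] unfolding f by (simp add: unfam_fam)
  assume fg: "f \<in> Arr Omega_Cat" "g \<in> Arr Omega_Cat" "Dom Omega_Cat g = Cod Omega_Cat f"
  then obtain G Z where g: "g = (Y, G, Z)" unfolding f by (cases g) auto
  have XZ: "small_weak_omega_category X" "small_weak_omega_category Z" using fg unfolding f g by auto
  obtain F1 F2 F3 where F: "F = (F1, F2, F3)" by (cases F)
  obtain G1 G2 G3 where G: "G = (G1, G2, G3)" by (cases G)
  have "unfam (\<lambda>s. compose (carrier (alg X) s) (fam G s) (fam F s)) =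
      (compose_maps (underlying X) G1 F1, compose_maps (middle X) G2 F2, compose_maps (strictified X) G3 F3)"
    by (simp add: unfam_def compose_maps_def F G fun_eq_iff del: srt.simps)
  then show "Cmp Omega_Cat g f = (case Cmp (Mod omega_theory) (case g of (X, F, Y) \<Rightarrow> (alg X, fam F, alg Y))
      (case f of (X, F, Y) \<Rightarrow> (alg X, fam F, alg Y)) of (M, h, N) \<Rightarrow> (str M, unfam h, str N))"
    using alg_Obj(2)[OF XZ(1)] alg_Obj(2)[OF XZ(2)] unfolding f g by (simp add: Omega_Cat_def F G del: alg_simps)
next
  fix f :: "(nat, nat, 'u) partial_algebra \<times> (nat \<Rightarrow> 'u \<Rightarrow> 'u) \<times> (nat, nat, 'u) partial_algebra"
  assume f: "f \<in> Arr (Mod omega_theory)"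
  obtain M h N where F: "f = (M, h, N)" by (cases f)
  have MN: "M \<in> Obj (Mod omega_theory)" "N \<in> Obj (Mod omega_theory)" "model_hom omega_theory M N h"
    using f unfolding F by (simp_all add: Mod_Obj_Arr(2))
  have w: "is_weak_omega_category (str M)" "is_weak_omega_category (str N)"
    using str_Obj(1)[OF MN(1)] str_Obj(1)[OF MN(2)] unfolding small_weak_omega_category_def by blast+
  have "omega_functor (str M) (str N) (unfam h)"
    using hom_iff[OF w, of "unfam h"] MN(3) str_Obj(2)[OF MN(1)] str_Obj(2)[OF MN(2)] by (simp add: fam_unfam)
  then show "(case f of (M, h, N) \<Rightarrow> (str M, unfam h, str N)) \<in> Arr Omega_Cat"
    using str_Obj(1)[OF MN(1)] str_Obj(1)[OF MN(2)] unfolding F by simp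
  show "(case case f of (M, h, N) \<Rightarrow> (str M, unfam h, str N) of (X, F, Y) \<Rightarrow> (alg X, fam F, alg Y)) = f"
    using str_Obj(2)[OF MN(1)] str_Obj(2)[OF MN(2)] unfolding F by (simp add: fam_unfam)
next
  interpret ea omega_theory by unfold_locales (rule omega_theory_ea)
  fix X :: "'u weak_omega_category"
  assume X: "X \<in> Obj Omega_Cat"
  have "unfam (\<lambda>s. restrict id (carrier (alg X) s)) =
      (identity_map (underlying X), identity_map (middle X), identity_map (strictified X))"
    by (simp add: unfam_def identity_map_def fun_eq_iff del: srt.simps)
  then show "Id Omega_Cat X = (case Id (Mod omega_theory) (alg X) of (M, h, N) \<Rightarrow> (str M, unfam h, str N))"
    using alg_Obj(2)[of X] X by (simp add: Omega_Cat_def del: alg_simps)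
next
  fix M :: "(nat, nat, 'u) partial_algebra" assume M: "M \<in> Obj (Mod omega_theory)"
  show "str M \<in> Obj Omega_Cat" "alg (str M) = M" using str_Obj[OF M] by simp_all
qed (use alg_Obj in \<open>auto simp: Mod_def Let_def\<close>)

lemma category_iso_isomorphic: "category_iso C D Fo Fm Go Gm \<Longrightarrow> isomorphic_categories C D"
  unfolding category_iso_def isomorphic_categories_def by blast

theorem theorem16:
  assumes "grothendieck_universe TYPE('u)"
  shows "(\<exists>T :: (nat, nat) ea_theory. essentially_algebraic_theory T \<and>
            isomorphic_categories (Omega_Cat :: ('u weak_omega_category, _) cat)
              (Mod T :: ((nat, nat, 'u) partial_algebra, _) cat)) \<and>
         locally_finitely_presentable TYPE('u) (Omega_Cat :: ('u weak_omega_category, _) cat) \<and>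
         complete_category TYPE('u) (Omega_Cat :: ('u weak_omega_category, _) cat) \<and>
         cocomplete_category TYPE('u) (Omega_Cat :: ('u weak_omega_category, _) cat)"
proof -
  interpret small_ea "TYPE('u)" omega_theory
    by unfold_locales (rule assms, rule omega_theory_ea)
  interpret category_iso "Omega_Cat :: ('u weak_omega_category, _) cat" "Mod omega_theory"
    alg "\<lambda>(X, F, Y). (alg X, fam F, alg Y)" str "\<lambda>(M, h, N). (str M, unfam h, str N)"
    by (rule Omega_Cat_iso)
  have "finite_presentations \<subseteq> Obj (Mod omega_theory)"
    using finite_presentations_fp unfolding finitely_presentable_elementwise_def by blast
  then have "locally_finitely_presentable TYPE('u) (Omega_Cat :: ('u weak_omega_category, _) cat)"
    using Mod_hom_small Mod_cocomplete finite_presentations_small finite_presentations_fp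
      directed_colimit_of_finite_presentations by (intro lfp_transfer)
  moreover have "complete_category TYPE('u) (Omega_Cat :: ('u weak_omega_category, _) cat)"
    by (rule complete_transfer[OF Mod_complete])
  moreover have "cocomplete_category TYPE('u) (Omega_Cat :: ('u weak_omega_category, _) cat)"
    by (rule cocomplete_transfer[OF Mod_cocomplete])
  ultimately show ?thesis using omega_theory_ea category_iso_isomorphic[OF Omega_Cat_iso] by blast
qed

end
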